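(* Let $c+1>0$, $0\le V\in L^1_{loc}(\mathbb{R}^+,y^c\,dy)$. The semigroup $\{e^{z(B^n-V)}:\ z\in\mathbb{C}_+\}$ consists of integral operators $$e^{z(B^n-V)}f(y)=\int_0^\infty p_V(z,y,\rho)f(\rho)\,\rho^c\,d\rho,\qquad f\in L^2_c,\quad y>0.$$ Furthermore, for every $\epsilon>0$ there exist $\kappa_\epsilon,C_\epsilon>0$ such that, for every $z\in\Sigma_{\frac\pi2-\epsilon}$ and $y,\rho>0$, $$|p_V(z,y,\rho)|\le C_\epsilon|z|^{-\frac12}\rho^{-c}\left(\frac{\rho}{|z|^{\frac12}}\wedge1\right)^{c}\exp\left(-\frac{|y-\rho|^2}{\kappa_\epsilon|z|}\right).$$
   Context: $\mathbb{R}_+=(0,\infty)$; $L^2_c=L^2(\mathbb{R}_+,y^c\,dy)$; $\mathbb{C}_+=\{z\in\mathbb{C}:\mathrm{Re}\,z>0\}$; $\Sigma_\theta=\{z\in\mathbb{C}\setminus\{0\}:|\mathrm{Arg}\,z|<\theta\}$. $V\in L^1_{loc}(\mathbb{R}^+,y^c\,dy)$ means $V\in L^1([0,b],y^c\,dy)$ for every $0<b<\infty$. Integral kernels are determined up to null sets, and pointwise bounds for them are understood almost everywhere. $B^n-V$ (formally $D_{yy}+\frac cyD_y-V$ with Neumann condition at $0$) is the operator in $L^2_c$ associated with the non-negative, symmetric, closed form $$\mathfrak{a}_V(u,v)=\int_0^\infty\left(D_yu\,D_y\overline v+Vu\overline v\right)y^c\,dy,\qquad D(\mathfrak{a}_V)=\{u\in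 L^2_c:u'\in L^2_c,\ V^{1/2}u\in L^2_c\},$$ i.e. $u\in D(B^n-V)$ and $B^nu-Vu=-f$ iff $u\in D(\mathfrak a_V)$, $f\in L^2_c$ and $\mathfrak{a}_V(u,v)=\int_0^\infty f\overline v\,y^cdy$ for all $v\in D(\mathfrak{a}_V)$. It generates a contractive analytic semigroup $\{e^{z(B^n-V)}:z\in\mathbb{C}_+\}$ in $L^2_c$. *)

theory Defs
  imports "HOL-Analysis.Analysis"
begin

section \<open>The weighted space \<open>L\<^sup>2\<^sub>c = L\<^sup>2((0,\<infinity>), y\<^sup>c dy)\<close>\<close>

definition weighted_measure :: "real \<Rightarrow> real measure" where
  "weighted_measure c = density (restrict_space lborel {0<..}) (\<lambda>y. ennreal (y powr c))"

text \<open>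
  Elements of \<open>L\<^sup>2\<^sub>c\<close> are represented by functions. All identities between them are
  understood almost everywhere, and the values on \<open>(-\<infinity>,0]\<close> play no role.
\<close>

definition L2 :: "real \<Rightarrow> (real \<Rightarrow> complex) set" where
  "L2 c = {f \<in> borel_measurable (weighted_measure c).
             integrable (weighted_measure c) (\<lambda>y. (cmod (f y))\<^sup>2)}"

definition L2_norm :: "real \<Rightarrow> (real \<Rightarrow> complex) \<Rightarrow> real" where
  "L2_norm c f = sqrt (LINT y|weighted_measure c. (cmod (f y))\<^sup>2)"

definition L2_inner :: "real \<Rightarrow> (real \<Rightarrow> complex) \<Rightarrow> (real \<Rightarrow> complex) \<Rightarrow> complex" where
  "L2_inner c f g = (LINT y|weighted_measure c. f y * cnj (g y))"

text \<open>Local integrability up to the endpoint \<open>0\<close>, with respect to the weighted measure.\<close>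

definition L1_loc :: "real \<Rightarrow> (real \<Rightarrow> real) \<Rightarrow> bool" where
  "L1_loc c V \<longleftrightarrow> (\<forall>b>0. set_integrable (weighted_measure c) {0<..b} V)"


section \<open>Weak derivatives on \<open>(0,\<infinity>)\<close>\<close>

text \<open>\<open>C\<^sup>\<infinity>\<close> functions with compact support in the open half-line.\<close>

definition test_function :: "(real \<Rightarrow> real) \<Rightarrow> bool" where
  "test_function \<phi> \<longleftrightarrow>
     (\<forall>k x. (deriv ^^ k) \<phi> differentiable (at x)) \<and>
     compact (closure {x. \<phi> x \<noteq> 0}) \<and> closure {x. \<phi> x \<noteq> 0} \<subseteq> {0<..}"

definition loc_integrable :: "(real \<Rightarrow> complex) \<Rightarrow> bool" where
  "loc_integrable u \<longleftrightarrow> (\<forall>a b. 0 < a \<longrightarrow> a < b \<longrightarrow> set_integrable lborel {a..b} u)"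

definition has_weak_deriv :: "(real \<Rightarrow> complex) \<Rightarrow> (real \<Rightarrow> complex) \<Rightarrow> bool" where
  "has_weak_deriv u g \<longleftrightarrow> loc_integrable u \<and> loc_integrable g \<and>
     (\<forall>\<phi>. test_function \<phi> \<longrightarrow>
        (LINT y:{0<..}|lborel. u y * of_real (deriv \<phi> y)) =
        - (LINT y:{0<..}|lborel. g y * of_real (\<phi> y)))"

text \<open>The weak derivative is unique up to null sets, so the choice is immaterial below.\<close>

definition weak_deriv :: "(real \<Rightarrow> complex) \<Rightarrow> real \<Rightarrow> complex" where
  "weak_deriv u = (SOME g. has_weak_deriv u g)"


section \<open>The form \<open>\<aa>\<^sub>V\<close> and the operator \<open>B\<^sup>n - V\<close>\<close>

definition form_domain :: "real \<Rightarrow> (real \<Rightarrow> real) \<Rightarrow> (real \<Rightarrow> complex) set" where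
  "form_domain c V = {u \<in> L2 c. (\<exists>g. has_weak_deriv u g) \<and> weak_deriv u \<in> L2 c \<and>
                        (\<lambda>y. of_real (sqrt (V y)) * u y) \<in> L2 c}"

definition form_V ::
    "real \<Rightarrow> (real \<Rightarrow> real) \<Rightarrow> (real \<Rightarrow> complex) \<Rightarrow> (real \<Rightarrow> complex) \<Rightarrow> complex" where
  "form_V c V u v = (LINT y|weighted_measure c.
      weak_deriv u y * cnj (weak_deriv v y) + of_real (V y) * u y * cnj (v y))"

text \<open>
  The graph of \<open>B\<^sup>n - V\<close>: a pair \<open>(u, -f)\<close> belongs to it iff \<open>\<aa>\<^sub>V(u,v) = \<langle>f,v\<rangle>\<close> for all
  \<open>v\<close> in the form domain. The Neumann condition is encoded in the form domain.
\<close>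

definition Bn_minus :: "real \<Rightarrow> (real \<Rightarrow> real) \<Rightarrow> ((real \<Rightarrow> complex) \<times> (real \<Rightarrow> complex)) set" where
  "Bn_minus c V = {(u, w). u \<in> form_domain c V \<and> w \<in> L2 c \<and>
     (\<forall>v\<in>form_domain c V. form_V c V u v = L2_inner c (\<lambda>y. - w y) v)}"


section \<open>Analytic semigroups on \<open>L\<^sup>2\<^sub>c\<close>\<close>

definition Cplus :: "complex set" where
  "Cplus = {z. 0 < Re z}"

definition sector :: "real \<Rightarrow> complex set" where
  "sector \<theta> = {z. z \<noteq> 0 \<and> \<bar>Arg z\<bar> < \<theta>}"

definition bounded_operator :: "real \<Rightarrow> ((real \<Rightarrow> complex) \<Rightarrow> (real \<Rightarrow> complex)) \<Rightarrow> bool" where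
  "bounded_operator c S \<longleftrightarrow>
     (\<forall>f\<in>L2 c. S f \<in> L2 c) \<and>
     (\<forall>f\<in>L2 c. \<forall>g\<in>L2 c. \<forall>a b.
        AE y in weighted_measure c. S (\<lambda>x. a * f x + b * g x) y = a * S f y + b * S g y) \<and>
     (\<exists>K. \<forall>f\<in>L2 c. L2_norm c (S f) \<le> K * L2_norm c f)"

text \<open>
  Contractive analytic semigroups on the open right half-plane: analyticity is complex
  differentiability in operator norm, and strong continuity at \<open>0\<close> holds in every proper subsector.
\<close>

definition contractive_analytic_semigroup ::
    "real \<Rightarrow> (complex \<Rightarrow> (real \<Rightarrow> complex) \<Rightarrow> (real \<Rightarrow> complex)) \<Rightarrow> bool" where
  "contractive_analytic_semigroup c T \<longleftrightarrow>
     (\<forall>z\<in>Cplus. bounded_operator c (T z)) \<and>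
     (\<forall>z\<in>Cplus. \<forall>f\<in>L2 c. L2_norm c (T z f) \<le> L2_norm c f) \<and>
     (\<forall>z\<in>Cplus. \<forall>w\<in>Cplus. \<forall>f\<in>L2 c.
        AE y in weighted_measure c. T (z + w) f y = T z (T w f) y) \<and>
     (\<forall>z\<in>Cplus. \<exists>S. bounded_operator c S \<and>
        (\<forall>e>0. \<forall>\<^sub>F h in at 0. \<forall>f\<in>L2 c.
           L2_norm c (\<lambda>y. (T (z + h) f y - T z f y) / h - S f y) \<le> e * L2_norm c f)) \<and>
     (\<forall>\<theta>. 0 < \<theta> \<longrightarrow> \<theta> < pi / 2 \<longrightarrow>
        (\<forall>f\<in>L2 c. ((\<lambda>z. L2_norm c (\<lambda>y. T z f y - f y)) \<longlongrightarrow> 0) (at 0 within sector \<theta>)))"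

text \<open>The graph of the infinitesimal generator.\<close>

definition generator ::
    "real \<Rightarrow> (complex \<Rightarrow> (real \<Rightarrow> complex) \<Rightarrow> (real \<Rightarrow> complex)) \<Rightarrow>
     ((real \<Rightarrow> complex) \<times> (real \<Rightarrow> complex)) set" where
  "generator c T = {(u, w). u \<in> L2 c \<and> w \<in> L2 c \<and>
     ((\<lambda>t. L2_norm c (\<lambda>y. (T (of_real t) u y - u y) / of_real t - w y)) \<longlongrightarrow> 0) (at_right 0)}"

text \<open>
  \<open>T z\<close> is \<open>e\<^bsup>zA\<^esup>\<close>, where \<open>A\<close> is the operator with the given graph. A generator determines
  its semigroup uniquely (up to null sets).
\<close>

definition generates ::
    "real \<Rightarrow> ((real \<Rightarrow> complex) \<times> (real \<Rightarrow> complex)) set \<Rightarrow>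
     (complex \<Rightarrow> (real \<Rightarrow> complex) \<Rightarrow> (real \<Rightarrow> complex)) \<Rightarrow> bool" where
  "generates c A T \<longleftrightarrow> contractive_analytic_semigroup c T \<and> generator c T = A"


section \<open>Integral operators\<close>

definition is_integral_kernel ::
    "real \<Rightarrow> ((real \<Rightarrow> complex) \<Rightarrow> (real \<Rightarrow> complex)) \<Rightarrow> (real \<Rightarrow> real \<Rightarrow> complex) \<Rightarrow> bool" where
  "is_integral_kernel c S k \<longleftrightarrow>
     (\<lambda>(y, \<rho>). k y \<rho>) \<in> borel_measurable (weighted_measure c \<Otimes>\<^sub>M weighted_measure c) \<and>
     (\<forall>f\<in>L2 c. AE y in weighted_measure c.
        integrable (weighted_measure c) (\<lambda>\<rho>. k y \<rho> * f \<rho>) \<and>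
        S f y = (LINT \<rho>|weighted_measure c. k y \<rho> * f \<rho>))"

end

theory Submission
  imports Defs "HOL-Complex_Analysis.Cauchy_Integral_Formula"
begin

text \<open>
  The semigroup is symmetric for the bilinear pairing and, by a Davies perturbation, satisfies
  \<open>\<parallel>e\<^sup>-\<^sup>\<phi> T z f\<parallel> \<le> exp (C \<alpha>\<^sup>2 \<bar>z\<bar>) \<parallel>e\<^sup>-\<^sup>\<phi> f\<parallel>\<close> for every nonnegative \<open>\<phi>\<close> with \<open>\<bar>\<phi>'\<bar> \<le> \<alpha>\<close>, uniformly
  on sectors; Cauchy's formula then bounds the derivative in \<open>z\<close>, hence the form energy of \<open>T z f\<close>.
  Pointwise bounds follow: for \<open>y \<ge> \<surd>\<bar>z\<bar>\<close> from the one-dimensional Sobolev inequality, and for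
  \<open>y < \<surd>\<bar>z\<bar>\<close> by integrating the equation from the origin. No Sobolev inequality of the right
  dimension is needed there, since a crude rate of blow-up at the origin improves itself when it is
  inserted into the equation a bounded number of times. The kernel arises by applying \<open>T z\<close> to
  mollifiers, since \<open>T z = T (z/2) T (z/2)\<close> and each factor maps \<open>L\<^sup>2\<close> to pointwise bounded
  functions by duality. Its bound \<open>exp (C \<alpha>\<^sup>2 \<bar>z\<bar> - \<alpha> \<bar>y - \<rho>\<bar>)\<close> is finally optimised in \<open>\<alpha>\<close>.
\<close>

section \<open>Smooth functions and test functions\<close>

text \<open>Only decaying weights \<open>exp (- \<phi>)\<close> with \<phi> >= 0 are used: they are
  at most 1 and so preserve \<open>L2 c\<close> and the form domain. The growing weight of a
  conjugated semigroup is replaced by duality between two such weights, centred at the two arguments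
  of the kernel. Estimates run at a length scale r with |z| and r^2 comparable up to a factor
  \<Lambda>, so that z and z/2 can share the same r. The obstacle is the origin, where for c > 0 the
  first estimate only bounds |u(s)|^2 by a multiple of s^(-c). The equation bounds |u(s)|^2 by
  |u(r)|^2 plus an integral of |u| |w|, with w the z-derivative of u = T z f. Both u and w are
  \<open>T (z/2)\<close> of functions in \<open>L2 c\<close>, so a rate \<gamma> valid for all
  orbits bounds both factors, and the integral then has the rate max (\<gamma> - 1/2) 0. The
  potential enters only through a nonnegative term that is dropped. The kernel bound first carries
  the geometric mean of the profiles \<open>max y r powr (- c)\<close> and
  \<open>max \<rho> r powr (- c)\<close>; half of the Gaussian pays for keeping the one at \<rho>
  alone.\<close>

fun times_differentiable :: "nat \<Rightarrow> (real \<Rightarrow> real) \<Rightarrow> bool" where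
  "times_differentiable 0 f \<longleftrightarrow> True"
| "times_differentiable (Suc n) f \<longleftrightarrow> (\<forall>x. f differentiable (at x)) \<and> times_differentiable n (deriv f)"

text \<open>The recursion peels off the innermost derivative, so closure under sums and products is
  a plain induction over all functions. This equivalence carries the results over to the iterates
  \<open>deriv ^^ k\<close> in which \<open>test_function\<close> is phrased.\<close>

lemma times_differentiable_iff:
  "times_differentiable n f \<longleftrightarrow> (\<forall>k<n. \<forall>x. (deriv ^^ k) f differentiable (at x))"
proof (induction n arbitrary: f)
  case (Suc n)
  have "(\<forall>k<Suc n. \<forall>x. (deriv ^^ k) f differentiable (at x)) \<longleftrightarrow>
     (\<forall>x. f differentiable (at x)) \<and> (\<forall>k<n. \<forall>x. (deriv ^^ Suc k) f differentiable (at x))"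
    by (subst All_less_Suc2) (simp)
  then show ?case
    using Suc by (simp add: funpow_swap1)
qed simp

lemma times_differentiable_Suc:
  assumes "\<And>x. (f has_real_derivative g x) (at x)" "times_differentiable n g"
  shows "times_differentiable (Suc n) f"
proof -
  have "deriv f = g" using assms(1) by (intro ext DERIV_imp_deriv)
  then show ?thesis using assms by (auto simp: real_differentiable_def)
qed

lemma times_differentiable_SucD:
  assumes "times_differentiable (Suc n) f"
  shows "(f has_real_derivative deriv f x) (at x)" "times_differentiable n (deriv f)"
  using assms by (auto simp: DERIV_deriv_iff_real_differentiable)

lemma times_differentiable_mono: "times_differentiable n f \<Longrightarrow> m \<le> n \<Longrightarrow> times_differentiable m f"
  by (auto simp: times_differentiable_iff)

lemma times_differentiable_const: "times_differentiable n (\<lambda>x. c)"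
proof (induction n arbitrary: c)
  case (Suc n) show ?case
    by (rule times_differentiable_Suc[where g="\<lambda>x. 0"]) (auto intro: Suc)
qed simp

lemma times_differentiable_add:
  "times_differentiable n f \<Longrightarrow> times_differentiable n g \<Longrightarrow> times_differentiable n (\<lambda>x. f x + g x)"
proof (induction n arbitrary: f g)
  case (Suc n)
  show ?case
    by (rule times_differentiable_Suc[where g="\<lambda>x. deriv f x + deriv g x"])
       (use Suc times_differentiable_SucD in \<open>blast intro: DERIV_add\<close>)+
qed simp

text \<open>Both Leibniz summands are again products, of other functions, so the induction ranges
  over f and g; the undifferentiated factor is lowered from \<open>Suc n\<close> to
  \<open>n\<close>.\<close>

lemma times_differentiable_mult:
  "times_differentiable n f \<Longrightarrow> times_differentiable n g \<Longrightarrow> times_differentiable n (\<lambda>x. f x * g x)"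
proof (induction n arbitrary: f g)
  case (Suc n)
  show ?case
  proof (rule times_differentiable_Suc[where g="\<lambda>x. deriv f x * g x + f x * deriv g x"])
    show "((\<lambda>x. f x * g x) has_real_derivative deriv f x * g x + f x * deriv g x) (at x)" for x
      using Suc.prems by (auto intro!: derivative_eq_intros times_differentiable_SucD(1))
    show "times_differentiable n (\<lambda>x. deriv f x * g x + f x * deriv g x)"
      using Suc.prems times_differentiable_mono[of "Suc n" f n] times_differentiable_mono[of "Suc n" g n]
      by (intro times_differentiable_add Suc.IH) auto
  qed
qed simp

lemma times_differentiable_affine:
  "times_differentiable n f \<Longrightarrow> times_differentiable n (\<lambda>x. f (a * x + b))"
proof (induction n arbitrary: f)
  case (Suc n)
  show ?case
  proof (rule times_differentiable_Suc[where g="\<lambda>x. a * deriv f (a * x + b)"])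
    show "((\<lambda>x. f (a * x + b)) has_real_derivative a * deriv f (a * x + b)) (at x)" for x
      using Suc.prems
    proof -
      have "((\<lambda>x. a * x + b) has_real_derivative a) (at x)"
        by (auto intro!: derivative_eq_intros)
      from DERIV_chain2[OF times_differentiable_SucD(1)[OF Suc.prems] this] show ?thesis
        by (simp add: mult.commute)
    qed
    show "times_differentiable n (\<lambda>x. a * deriv f (a * x + b))"
      using Suc.prems
      by (intro times_differentiable_mult times_differentiable_const Suc.IH times_differentiable_SucD(2))
  qed
qed simp

section \<open>Smooth cut-off functions built from exp (- 1/x)\<close>

definition flat_exp :: "nat \<Rightarrow> real \<Rightarrow> real" where
  "flat_exp k x = (if x > 0 then (1 / x) ^ k * exp (- (1 / x)) else 0)"

lemma flat_exp_tendsto_0: "(flat_exp k \<longlongrightarrow> 0) (at 0)"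
proof -
  have "((\<lambda>x. (1 / x) ^ k / exp (1 / x)) \<longlongrightarrow> 0) (at_right (0::real))"
    using filterlim_compose[OF tendsto_power_div_exp_0[of k] filterlim_inverse_at_top_right]
    by (simp add: inverse_eq_divide)
  then have "(flat_exp k \<longlongrightarrow> 0) (at_right 0)"
    by (rule Lim_transform_eventually)
      (auto simp: flat_exp_def eventually_at_right_field exp_minus field_simps intro!: exI[of _ 1])
  moreover have "(flat_exp k \<longlongrightarrow> 0) (at_left 0)"
    by (rule Lim_transform_eventually[OF tendsto_const])
      (auto simp: flat_exp_def eventually_at_left_field intro!: exI[of _ "-1"])
  ultimately show ?thesis by (simp add: filterlim_split_at)
qed

text \<open>The powers of 1/x are carried along because the resulting family is closed under
  differentiation: a derivative is a combination of the next two members. Smoothness is then an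
  induction over all k at once.\<close>

lemma flat_exp_deriv:
  "(flat_exp k has_real_derivative - real k * flat_exp (Suc k) x + flat_exp (Suc (Suc k)) x) (at x)"
proof (cases x "0::real" rule: linorder_cases)
  case less
  have "(flat_exp k has_real_derivative 0) (at x) \<longleftrightarrow> ((\<lambda>x. 0::real) has_real_derivative 0) (at x)"
    by (rule DERIV_cong_ev)
       (use less eventually_nhds_in_open[of "{..<0}" x] in \<open>auto elim!: eventually_mono simp: flat_exp_def\<close>)
  then show ?thesis using less by (simp add: flat_exp_def)
next
  case equal
  \<comment> \<open>The difference quotient at 0 is the next member of the family, whose limit at 0
    is known.\<close>
  have "((\<lambda>h. flat_exp k h / h) \<longlongrightarrow> 0) (at 0)"
  proof (rule Lim_transform_eventually[OF flat_exp_tendsto_0[of "Suc k"]])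
    show "\<forall>\<^sub>F x in at 0. flat_exp (Suc k) x = flat_exp k x / x"
      by (rule always_eventually) (auto simp: flat_exp_def field_simps)
  qed
  then show ?thesis using equal by (simp add: has_field_derivative_iff flat_exp_def)
next
  case greater
  have inv: "((\<lambda>x. 1 / x) has_real_derivative - (1 / x)\<^sup>2) (at x)"
    using greater by (auto intro!: derivative_eq_intros simp: field_simps power2_eq_square)
  have "((\<lambda>x. (1 / x) ^ k) has_real_derivative - real k * (1 / x) ^ Suc k) (at x)"
  proof (cases k)
    case (Suc j)
    have "(1 + real j) * (- q\<^sup>2 * q ^ j) = - real (Suc j) * q ^ Suc (Suc j)" for q :: real
      by (simp add: power2_eq_square algebra_simps)
    then show ?thesis unfolding Suc
      by (intro DERIV_cong[OF DERIV_power_Suc[OF inv]])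
  qed simp
  from DERIV_mult'[OF this DERIV_chain2[OF DERIV_exp DERIV_minus[OF inv]]]
  have *: "((\<lambda>x. (1 / x) ^ k * exp (- (1 / x))) has_real_derivative
    - real k * flat_exp (Suc k) x + flat_exp (Suc (Suc k)) x) (at x)"
    using greater by (simp add: flat_exp_def power2_eq_square algebra_simps)
  have "(flat_exp k has_real_derivative D) (at x) \<longleftrightarrow>
      ((\<lambda>x. (1 / x) ^ k * exp (- (1 / x))) has_real_derivative D) (at x)" for D
    by (rule DERIV_cong_ev)
       (use greater eventually_nhds_in_open[of "{0<..}" x] in \<open>auto elim!: eventually_mono simp: flat_exp_def\<close>)
  with * show ?thesis by simp
qed

lemma times_differentiable_flat_exp: "times_differentiable n (flat_exp k)"
proof (induction n arbitrary: k)
  case (Suc n)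
  show ?case
    by (rule times_differentiable_Suc[OF flat_exp_deriv])
      (intro times_differentiable_add times_differentiable_mult times_differentiable_const Suc)
qed simp

lemma test_functionI:
  assumes "\<And>n. times_differentiable n \<phi>" "0 < a" "\<And>x. x \<notin> {a..b} \<Longrightarrow> \<phi> x = 0"
  shows "test_function \<phi>"
proof -
  have sub: "closure {x. \<phi> x \<noteq> 0} \<subseteq> {a..b}"
    using assms(3) by (intro closure_minimal subsetI) (fastforce, simp)
  then have "compact (closure {x. \<phi> x \<noteq> 0})"
    by (meson compact_Icc closed_closure bounded_subset compact_eq_bounded_closed)
  moreover have "closure {x. \<phi> x \<noteq> 0} \<subseteq> {0<..}"
    using assms(2) by (intro order_trans[OF sub]) auto
  ultimately show ?thesis
    using assms(1) unfolding test_function_def times_differentiable_iff by blast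
qed

lemma test_functionE:
  assumes "test_function \<phi>"
  obtains a b where "0 < a" "a < b" "\<And>x. x \<notin> {a..b} \<Longrightarrow> \<phi> x = 0" "\<And>n. times_differentiable n \<phi>"
proof -
  let ?K = "closure {x. \<phi> x \<noteq> 0}"
  have K: "compact ?K" "?K \<subseteq> {0<..}" using assms by (auto simp: test_function_def)
  have sm: "times_differentiable n \<phi>" for n
    using assms by (auto simp: test_function_def times_differentiable_iff)
  have sub: "{x. \<phi> x \<noteq> 0} \<subseteq> ?K" by (rule closure_subset)
  show ?thesis
  proof (cases "?K = {}")
    case True
    then show ?thesis using sub sm by (intro that[of 1 2]) auto
  next
    case False
    obtain a where a: "a \<in> ?K" "\<And>x. x \<in> ?K \<Longrightarrow> a \<le> x"
      using compact_attains_inf[OF K(1) False] by auto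
    obtain b where b: "b \<in> ?K" "\<And>x. x \<in> ?K \<Longrightarrow> x \<le> b"
      using compact_attains_sup[OF K(1) False] by auto
    show ?thesis
    \<comment> \<open>Passing to \<open>b + 1\<close> gives a strict inequality without arguing that
      the support has more than one point.\<close>
    proof (rule that[of a "b + 1"])
      show "0 < a" using a K by auto
      show "a < b + 1" using a(2)[OF b(1)] by simp
      show "\<phi> x = 0" if "x \<notin> {a..b + 1}" for x
      proof (rule ccontr)
        assume "\<phi> x \<noteq> 0"
        then have "x \<in> ?K" using sub by auto
        then show False using a(2)[of x] b(2)[of x] that by auto
      qed
    qed (rule sm)
  qed
qed

lemma test_function_DERIV:
  assumes "test_function \<phi>"
  shows "(\<phi> has_real_derivative deriv \<phi> x) (at x)" "continuous_on A \<phi>" "continuous_on A (deriv \<phi>)"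
proof -
  have "times_differentiable n \<phi>" for n using test_functionE[OF assms] by metis
  then have *: "times_differentiable (Suc (Suc 0)) \<phi>" by blast
  show 1: "(\<phi> has_real_derivative deriv \<phi> x) (at x)" for x
    using times_differentiable_SucD(1)[OF *] .
  show "continuous_on A \<phi>"
    by (meson 1 DERIV_isCont continuous_at_imp_continuous_on)
  show "continuous_on A (deriv \<phi>)"
    by (meson times_differentiable_SucD(1)[OF times_differentiable_SucD(2)[OF *]]
        DERIV_isCont continuous_at_imp_continuous_on)
qed

text \<open>The factor \<open>Suc n\<close> steepens both flanks: exp (- 1 / (n t)) tends to 1 for
  every t > 0. The bumps converge to the indicator of the open interval and stay below it, which is
  what dominated convergence asks for.\<close>

definition bump :: "real \<Rightarrow> real \<Rightarrow> nat \<Rightarrow> real \<Rightarrow> real" where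
  "bump a b n x = flat_exp 0 (real (Suc n) * (x - a)) * flat_exp 0 (real (Suc n) * (b - x))"

lemma test_function_bump: "0 < a \<Longrightarrow> test_function (bump a b n)"
proof (rule test_functionI[of _ a b])
  fix m
  have "times_differentiable m (\<lambda>x. flat_exp 0 (real (Suc n) * x + - real (Suc n) * a) * flat_exp 0 (- real (Suc n) * x + real (Suc n) * b))"
    by (intro times_differentiable_mult times_differentiable_affine times_differentiable_flat_exp)
  then show "times_differentiable m (bump a b n)"
    by (simp add: bump_def[abs_def] algebra_simps)
next
  fix x assume "x \<notin> {a..b}"
  then show "bump a b n x = 0" by (auto simp: bump_def flat_exp_def zero_less_mult_iff)
qed

lemma flat_exp_0_bounds: "0 \<le> flat_exp 0 x" "flat_exp 0 x \<le> 1"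
  by (auto simp: flat_exp_def)

lemma bump_bounds: "0 \<le> bump a b n x" "bump a b n x \<le> indicator {a<..<b} x"
proof -
  show "0 \<le> bump a b n x" by (simp add: bump_def flat_exp_0_bounds)
  have "bump a b n x \<le> 1"
    unfolding bump_def using flat_exp_0_bounds by (intro mult_le_one) auto
  moreover have "bump a b n x = 0" if "x \<notin> {a<..<b}"
    using that by (auto simp: bump_def flat_exp_def zero_less_mult_iff)
  ultimately show "bump a b n x \<le> indicator {a<..<b} x"
    by (auto simp: indicator_def)
qed

lemma bump_tendsto: "(\<lambda>n. bump a b n x) \<longlonglongrightarrow> indicator {a<..<b} x"
proof (cases "x \<in> {a<..<b}")
  case True
  have *: "(\<lambda>n. flat_exp 0 (real (Suc n) * y)) \<longlonglongrightarrow> 1" if "y > 0" for y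
  proof -
    have "(\<lambda>n. exp (- ((1 / y) * inverse (real (Suc n))))) \<longlonglongrightarrow> exp (- ((1/y) * 0))"
      by (intro tendsto_intros LIMSEQ_inverse_real_of_nat)
    then show ?thesis using that by (simp add: flat_exp_def inverse_eq_divide zero_less_mult_iff mult.commute)
  qed
  have "(\<lambda>n. bump a b n x) \<longlonglongrightarrow> 1 * 1"
    unfolding bump_def using True by (intro tendsto_mult *) auto
  then show ?thesis using True by simp
next
  case False
  then have "bump a b n x = 0" for n using bump_bounds[of a b n x] by simp
  then show ?thesis using False by simp
qed

lemma bump_pos: "a < x \<Longrightarrow> x < b \<Longrightarrow> 0 < bump a b n x"
  by (simp add: bump_def flat_exp_def zero_less_mult_iff)

section \<open>Locally absolutely continuous functions on the half-line\<close>

lemma continuous_on_pos_iff: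
  fixes u :: "real \<Rightarrow> 'a::topological_space"
  assumes "\<And>a b. 0 < a \<Longrightarrow> a < b \<Longrightarrow> continuous_on {a..b} u"
  shows "continuous_on {0<..} u"
proof (rule continuous_at_imp_continuous_on, rule ballI)
  fix x :: real assume "x \<in> {0<..}"
  then have "0 < x / 2" "x / 2 < 2 * x" "x \<in> interior {x / 2..2 * x}" by auto
  then show "isCont u x" using assms continuous_on_interior by blast
qed

text \<open>Fubini on the square over {a..b}, cut along the diagonal: on one side t is integrated
  first, on the other side s. This is integration by parts for two indefinite integrals of merely
  integrable functions.\<close>

lemma set_integral_by_parts:
  fixes g h :: "real \<Rightarrow> complex"
  assumes g: "set_integrable lborel {a..b} g" and h: "set_integrable lborel {a..b} h"
  shows "set_integrable lborel {a..b} (\<lambda>s. g s * (LINT t:{a..s}|lborel. h t))"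
    and "set_integrable lborel {a..b} (\<lambda>s. (LINT t:{a..s}|lborel. g t) * h s)"
    and "(LINT s:{a..b}|lborel. g s * (LINT t:{a..s}|lborel. h t))
      + (LINT s:{a..b}|lborel. (LINT t:{a..s}|lborel. g t) * h s)
      = (LINT s:{a..b}|lborel. g s) * (LINT s:{a..b}|lborel. h s)"
proof -
  define g' where "g' = (\<lambda>s. indicator {a..b} s *\<^sub>R g s)"
  define h' where "h' = (\<lambda>s. indicator {a..b} s *\<^sub>R h s)"
  have g'[simp]: "integrable lborel g'" and h'[simp]: "integrable lborel h'"
    using g h by (auto simp: g'_def h'_def set_integrable_def)
  have m[measurable]: "g' \<in> borel_measurable borel" "h' \<in> borel_measurable borel"
    using borel_measurable_integrable[OF g'] borel_measurable_integrable[OF h'] by simp_all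
  have prod: "integrable (lborel \<Otimes>\<^sub>M lborel) (\<lambda>(s, t). g' s * h' t)"
    by (rule lborel_pair.Fubini_integrable) (auto simp: norm_mult)
  let ?A = "{(s, t). t \<le> s} :: (real \<times> real) set" and ?B = "{(s, t). s < t} :: (real \<times> real) set"
  have AB: "?A \<in> sets (lborel \<Otimes>\<^sub>M lborel)" "?B \<in> sets (lborel \<Otimes>\<^sub>M lborel)"
  proof -
    have "closed ?A \<and> open ?B"
      unfolding case_prod_beta by (intro conjI closed_Collect_le open_Collect_less continuous_intros)
    then have "?A \<in> sets borel" "?B \<in> sets borel" by (auto intro: borel_closed borel_open)
    moreover have "sets (lborel \<Otimes>\<^sub>M lborel) = sets (borel :: (real \<times> real) measure)"
      by (metis lborel_prod sets_lborel)
    ultimately show "?A \<in> sets (lborel \<Otimes>\<^sub>M lborel)" "?B \<in> sets (lborel \<Otimes>\<^sub>M lborel)"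
      by blast+
  qed
  have A: "integrable (lborel \<Otimes>\<^sub>M lborel) (\<lambda>(s, t). indicator ?A (s, t) *\<^sub>R (g' s * h' t))"
    using integrable_mult_indicator[OF AB(1) prod] by (simp add: case_prod_beta')
  have B: "integrable (lborel \<Otimes>\<^sub>M lborel) (\<lambda>(s, t). indicator ?B (s, t) *\<^sub>R (g' s * h' t))"
    using integrable_mult_indicator[OF AB(2) prod] by (simp add: case_prod_beta')
  have inA: "(\<integral>t. indicator ?A (s, t) *\<^sub>R (g' s * h' t) \<partial>lborel) =
      indicator {a..b} s *\<^sub>R (g s * (LINT t:{a..s}|lborel. h t))" for s
  proof (cases "s \<in> {a..b}")
    case True
    have "(\<integral>t. indicator ?A (s, t) *\<^sub>R (g' s * h' t) \<partial>lborel) = (\<integral>t. g s * (indicator {a..s} t *\<^sub>R h t) \<partial>lborel)"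
      using True by (intro Bochner_Integration.integral_cong) (auto simp: g'_def h'_def indicator_def)
    also have "\<dots> = g s * (\<integral>t. indicator {a..s} t *\<^sub>R h t \<partial>lborel)"
      by (rule Bochner_Integration.integral_mult_right_zero)
    finally show ?thesis using True by (simp add: set_lebesgue_integral_def)
  qed (simp add: g'_def)
  have inB: "(\<integral>s. indicator ?B (s, t) *\<^sub>R (g' s * h' t) \<partial>lborel) =
      indicator {a..b} t *\<^sub>R ((LINT s:{a..t}|lborel. g s) * h t)" for t
  proof (cases "t \<in> {a..b}")
    case True
    have "(\<integral>s. indicator ?B (s, t) *\<^sub>R (g' s * h' t) \<partial>lborel) = (\<integral>s. (indicator {a..t} s *\<^sub>R g s) * h t \<partial>lborel)"
    proof (rule integral_cong_AE)
      \<comment> \<open>The cut is strict while the interval is closed; the two differ in the single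
        point s = t.\<close>
      show "AE s in lborel. indicator ?B (s, t) *\<^sub>R (g' s * h' t) = (indicator {a..t} s *\<^sub>R g s) * h t"
        by (rule AE_mp[OF AE_lborel_singleton[of t]], rule AE_I2)
           (use True in \<open>auto simp: g'_def h'_def indicator_def\<close>)
      have "(\<lambda>s. indicator {a..t} s *\<^sub>R g s) = (\<lambda>s. indicator {a..t} s *\<^sub>R g' s)"
        using True by (auto simp: g'_def indicator_def)
      then have "(\<lambda>s. indicator {a..t} s *\<^sub>R g s) \<in> borel_measurable lborel" by simp
      then show "(\<lambda>s. indicator {a..t} s *\<^sub>R g s * h t) \<in> borel_measurable lborel"
        by (intro borel_measurable_times) auto
    qed simp
    also have "\<dots> = (\<integral>s. indicator {a..t} s *\<^sub>R g s \<partial>lborel) * h t"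
      by (rule Bochner_Integration.integral_mult_left_zero)
    finally show ?thesis using True by (simp add: set_lebesgue_integral_def)
  qed (simp add: h'_def)
  show "set_integrable lborel {a..b} (\<lambda>s. g s * (LINT t:{a..s}|lborel. h t))"
    using lborel_pair.integrable_fst[OF A] unfolding inA set_integrable_def .
  show "set_integrable lborel {a..b} (\<lambda>s. (LINT t:{a..s}|lborel. g t) * h s)"
    using lborel_pair.integrable_snd[OF B] unfolding inB set_integrable_def .
  have "(LINT s:{a..b}|lborel. g s) * (LINT s:{a..b}|lborel. h s) = (\<integral>s. \<integral>t. g' s * h' t \<partial>lborel \<partial>lborel)"
    by (simp add: g'_def[symmetric] h'_def[symmetric] set_lebesgue_integral_def)
  also have "\<dots> = (\<integral>p. (case p of (s, t) \<Rightarrow> g' s * h' t) \<partial>(lborel \<Otimes>\<^sub>M lborel))"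
    by (rule lborel_pair.integral_fst[OF prod])
  also have "\<dots> = (\<integral>p. (case p of (s, t) \<Rightarrow> indicator ?A (s, t) *\<^sub>R (g' s * h' t))
      + (case p of (s, t) \<Rightarrow> indicator ?B (s, t) *\<^sub>R (g' s * h' t)) \<partial>(lborel \<Otimes>\<^sub>M lborel))"
    by (intro Bochner_Integration.integral_cong) (auto simp: indicator_def)
  also have "\<dots> = (LINT s:{a..b}|lborel. g s * (LINT t:{a..s}|lborel. h t))
      + (LINT s:{a..b}|lborel. (LINT t:{a..s}|lborel. g t) * h s)"
    by (subst Bochner_Integration.integral_add[OF A B])
       (simp add: lborel_pair.integral_fst[OF A, symmetric] lborel_pair.integral_snd[OF B, symmetric]
          inA inB set_lebesgue_integral_def)
  finally show "(LINT s:{a..b}|lborel. g s * (LINT t:{a..s}|lborel. h t))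
      + (LINT s:{a..b}|lborel. (LINT t:{a..s}|lborel. g t) * h s)
      = (LINT s:{a..b}|lborel. g s) * (LINT s:{a..b}|lborel. h s)" by simp
qed

text \<open>Local absolute continuity is encoded as being an indefinite integral. The identity holds
  at every pair of points, not almost everywhere, and it names the derivative; products and
  pointwise bounds rely on both.\<close>

definition locally_ac :: "(real \<Rightarrow> complex) \<Rightarrow> (real \<Rightarrow> complex) \<Rightarrow> bool" where
  "locally_ac u g \<longleftrightarrow> loc_integrable g \<and>
     (\<forall>a b. 0 < a \<longrightarrow> a \<le> b \<longrightarrow> u b - u a = (LINT x:{a..b}|lborel. g x))"

lemma loc_integrableD:
  assumes "loc_integrable g" "0 < a" shows "set_integrable lborel {a..b} g"
proof -
  have "set_integrable lborel {a..max b (a + 1)} g" using assms by (auto simp: loc_integrable_def)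
  then show ?thesis by (rule set_integrable_subset) auto
qed

lemma loc_integrableI:
  assumes "\<And>a b. 0 < a \<Longrightarrow> a < b \<Longrightarrow> set_integrable lborel {a..b} g"
  shows "loc_integrable g"
  using assms by (auto simp: loc_integrable_def)

lemma locally_acD:
  assumes "locally_ac u g"
  shows "loc_integrable g" "0 < a \<Longrightarrow> a \<le> b \<Longrightarrow> u b = u a + (LINT x:{a..b}|lborel. g x)"
    "0 < a \<Longrightarrow> set_integrable lborel {a..b} g"
proof -
  show l: "loc_integrable g" using assms by (simp add: locally_ac_def)
  show "set_integrable lborel {a..b} g" if "0 < a" using loc_integrableD[OF l that] .
  show "u b = u a + (LINT x:{a..b}|lborel. g x)" if "0 < a" "a \<le> b"
  proof -
    have "u b - u a = (LINT x:{a..b}|lborel. g x)" using assms that by (simp add: locally_ac_def)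
    then show ?thesis by (simp add: algebra_simps)
  qed
qed

lemma continuous_on_set_integral:
  fixes g :: "real \<Rightarrow> complex"
  assumes "set_integrable lborel {a..b} g"
  shows "continuous_on {a..b} (\<lambda>x. LINT t:{a..x}|lborel. g t)"
proof -
  have "continuous_on {a..b} (\<lambda>x. integral {a..x} g)"
    by (rule indefinite_integral_continuous_1) (rule set_borel_integral_eq_integral(1)[OF assms])
  then show ?thesis
  proof (rule continuous_on_eq)
    fix x assume "x \<in> {a..b}"
    then show "integral {a..x} g = (LINT t:{a..x}|lborel. g t)"
      by (intro set_borel_integral_eq_integral(2)[symmetric] set_integrable_subset[OF assms]) auto
  qed
qed

lemma locally_ac_continuous:
  assumes "locally_ac u g" shows "continuous_on {0<..} u"
proof (rule continuous_on_pos_iff)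
  fix a b :: real assume ab: "0 < a" "a < b"
  have "continuous_on {a..b} (\<lambda>x. u a + (LINT t:{a..x}|lborel. g t))"
    by (intro continuous_intros continuous_on_set_integral locally_acD(3)[OF assms] ab)
  then show "continuous_on {a..b} u"
    by (rule continuous_on_eq) (rule locally_acD(2)[OF assms ab(1), symmetric], simp)
qed

lemma set_integrable_mult_continuous:
  fixes g v :: "real \<Rightarrow> complex"
  assumes "set_integrable lborel {a..b} g" "continuous_on {a..b} v"
  shows "set_integrable lborel {a..b} (\<lambda>x. g x * v x)"
proof -
  have bd: "bounded (v ` {a..b})"
    by (intro compact_imp_bounded compact_continuous_image assms compact_Icc)
  obtain B where B: "\<And>x. x \<in> {a..b} \<Longrightarrow> cmod (v x) \<le> B"
    using bd unfolding bounded_iff by blast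
  have mv: "(\<lambda>x. indicator {a..b} x *\<^sub>R v x) \<in> borel_measurable lborel"
    using borel_measurable_continuous_on_indicator[OF _ assms(2)] by simp
  have mg: "(\<lambda>x. indicator {a..b} x *\<^sub>R g x) \<in> borel_measurable lborel"
    using assms(1) by (auto simp: set_integrable_def)
  show ?thesis unfolding set_integrable_def
  proof (rule Bochner_Integration.integrable_bound)
    show "integrable lborel (\<lambda>x. B *\<^sub>R norm (indicator {a..b} x *\<^sub>R g x))"
      using assms(1) by (intro integrable_scaleR_right integrable_norm) (simp add: set_integrable_def)
    have "(\<lambda>x. indicator {a..b} x *\<^sub>R (g x * v x)) = (\<lambda>x. (indicator {a..b} x *\<^sub>R g x) * (indicator {a..b} x *\<^sub>R v x))"
      by (auto simp: indicator_def)
    then show "(\<lambda>x. indicator {a..b} x *\<^sub>R (g x * v x)) \<in> borel_measurable lborel"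
      using borel_measurable_times[OF mg mv] by metis
    show "AE x in lborel. norm (indicator {a..b} x *\<^sub>R (g x * v x)) \<le> norm (B *\<^sub>R norm (indicator {a..b} x *\<^sub>R g x))"
    proof (rule AE_I2)
      fix x
      show "norm (indicator {a..b} x *\<^sub>R (g x * v x)) \<le> norm (B *\<^sub>R norm (indicator {a..b} x *\<^sub>R g x))"
      proof (cases "x \<in> {a..b}")
        case True
        then have "0 \<le> B" using B[OF True] norm_ge_zero[of "v x"] by linarith
        then show ?thesis using B[OF True] True
          by (auto simp: norm_mult mult.commute[of B] intro!: mult_left_mono)
      qed simp
    qed
  qed
qed

lemma loc_integrable_mult_continuous:
  assumes "loc_integrable g" "continuous_on {0<..} v"
  shows "loc_integrable (\<lambda>x. g x * v x)"
proof (rule loc_integrableI)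
  fix a b :: real assume "0 < a" "a < b"
  then show "set_integrable lborel {a..b} (\<lambda>x. g x * v x)"
    by (intro set_integrable_mult_continuous loc_integrableD[OF assms(1)] continuous_on_subset[OF assms(2)]) auto
qed

lemma loc_integrable_add:
  "loc_integrable f \<Longrightarrow> loc_integrable g \<Longrightarrow> loc_integrable (\<lambda>x. f x + g x)"
  by (auto simp: loc_integrable_def)

lemma loc_integrable_continuous:
  assumes "continuous_on {0<..} u" shows "loc_integrable u"
proof (rule loc_integrableI)
  fix a b :: real assume "0 < a" "a < b"
  then have "continuous_on {a..b} u" by (intro continuous_on_subset[OF assms]) auto
  then show "set_integrable lborel {a..b} u"
    unfolding set_integrable_def by (intro borel_integrable_compact compact_Icc)
qed

text \<open>On {a..b} each factor is its value at a plus an indefinite integral. After expanding,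
  the two mixed terms are exactly those of \<open>set_integral_by_parts\<close>.\<close>

lemma locally_ac_mult:
  assumes u: "locally_ac u g" and v: "locally_ac v h"
  shows "locally_ac (\<lambda>x. u x * v x) (\<lambda>x. g x * v x + u x * h x)"
  unfolding locally_ac_def
proof (intro conjI allI impI)
  have "loc_integrable (\<lambda>x. g x * v x)" "loc_integrable (\<lambda>x. h x * u x)"
    by (rule loc_integrable_mult_continuous locally_acD(1)[OF u] locally_ac_continuous[OF v]
        locally_acD(1)[OF v] locally_ac_continuous[OF u])+
  then show "loc_integrable (\<lambda>x. g x * v x + u x * h x)"
    by (simp add: mult.commute loc_integrable_add)
  fix a b :: real assume ab: "0 < a" "a \<le> b"
  let ?G = "\<lambda>s. LINT t:{a..s}|lborel. g t" and ?H = "\<lambda>s. LINT t:{a..s}|lborel. h t"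
  note i = locally_acD(3)[OF u ab(1), of b] locally_acD(3)[OF v ab(1), of b]
  note parts = set_integral_by_parts[OF i]
  have "(LINT x:{a..b}|lborel. g x * v x + u x * h x)
      = (LINT x:{a..b}|lborel. (g x * v a + u a * h x) + (g x * ?H x + ?G x * h x))"
  proof (rule set_lebesgue_integral_cong)
    show "\<forall>x. x \<in> {a..b} \<longrightarrow> g x * v x + u x * h x = g x * v a + u a * h x + (g x * ?H x + ?G x * h x)"
    proof (intro allI impI)
      fix x assume "x \<in> {a..b}"
      then have "v x = v a + ?H x" "u x = u a + ?G x"
        by (intro locally_acD(2)[OF v ab(1)] locally_acD(2)[OF u ab(1)], simp)+
      then show "g x * v x + u x * h x = g x * v a + u a * h x + (g x * ?H x + ?G x * h x)"
        by (simp only:) (simp add: algebra_simps)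
    qed
  qed simp
  also have "\<dots> = ?G b * v a + u a * ?H b + ?G b * ?H b"
    using i parts by (simp add: set_integral_add)
  also have "\<dots> = u b * v b - u a * v a"
    unfolding locally_acD(2)[OF u ab] locally_acD(2)[OF v ab] by (simp add: algebra_simps)
  finally show "u b * v b - u a * v a = (LINT x:{a..b}|lborel. g x * v x + u x * h x)" ..
qed

lemma loc_integrable_cnj: "loc_integrable g \<Longrightarrow> loc_integrable (\<lambda>x. cnj (g x))"
proof -
  have "(\<lambda>x. indicator A x *\<^sub>R cnj (g x)) = (\<lambda>x. cnj (indicator A x *\<^sub>R g x))" for A :: "real set"
    by simp
  then show "loc_integrable g \<Longrightarrow> loc_integrable (\<lambda>x. cnj (g x))"
    unfolding loc_integrable_def set_integrable_def by (metis complex_integrable_cnj)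
qed

lemma set_integral_cnj:
  "(LINT x:A|M. cnj (g x)) = cnj (LINT x:A|M. g x)" for g :: "_ \<Rightarrow> complex"
proof -
  have "(\<lambda>x. indicator A x *\<^sub>R cnj (g x)) = (\<lambda>x. cnj (indicator A x *\<^sub>R g x))" by simp
  then show ?thesis unfolding set_lebesgue_integral_def by (simp only: Bochner_Integration.integral_cnj)
qed

lemma locally_ac_cnj:
  "locally_ac u g \<Longrightarrow> locally_ac (\<lambda>x. cnj (u x)) (\<lambda>x. cnj (g x))"
  unfolding locally_ac_def set_integral_cnj complex_cnj_diff[symmetric]
  by (simp add: loc_integrable_cnj)

lemma locally_ac_DERIV:
  fixes f :: "real \<Rightarrow> real"
  assumes "\<And>x. 0 < x \<Longrightarrow> (f has_real_derivative f' x) (at x)" "continuous_on {0<..} f'"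
  shows "locally_ac (\<lambda>x. of_real (f x)) (\<lambda>x. of_real (f' x))"
  unfolding locally_ac_def
proof (intro conjI allI impI)
  show "loc_integrable (\<lambda>x. complex_of_real (f' x))"
    by (intro loc_integrable_continuous continuous_intros assms)
  fix a b :: real assume ab: "0 < a" "a \<le> b"
  have "(\<integral>x. indicator {a..b} x *\<^sub>R complex_of_real (f' x) \<partial>lborel) = of_real (f b) - of_real (f a)"
  proof (rule integral_FTC_atLeastAtMost[OF ab(2), where F="\<lambda>x. complex_of_real (f x)"])
    show "((\<lambda>x. complex_of_real (f x)) has_vector_derivative complex_of_real (f' x)) (at x within {a..b})"
      if "a \<le> x" "x \<le> b" for x
    proof -
      have "(f has_real_derivative f' x) (at x)" using assms(1)[of x] ab(1) that by linarith
      then show ?thesis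
        by (rule has_vector_derivative_at_within[OF has_vector_derivative_of_real])
    qed
    show "continuous_on {a..b} (\<lambda>x. complex_of_real (f' x))"
      using ab by (intro continuous_on_of_real continuous_on_subset[OF assms(2)]) auto
  qed
  then show "complex_of_real (f b) - complex_of_real (f a) = (LINT x:{a..b}|lborel. complex_of_real (f' x))"
    by (simp add: set_lebesgue_integral_def)
qed

section \<open>Weak derivatives and absolute continuity\<close>

lemma test_set_integral:
  fixes k :: "real \<Rightarrow> complex" and \<phi> :: "real \<Rightarrow> real"
  assumes k: "loc_integrable k" and \<phi>: "continuous_on UNIV \<phi>" "\<And>x. x \<notin> {a..b} \<Longrightarrow> \<phi> x = 0" and a: "0 < a"
  shows "set_integrable lborel {0<..} (\<lambda>x. k x * of_real (\<phi> x))"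
    and "(LINT x:{0<..}|lborel. k x * of_real (\<phi> x)) = (LINT x:{a..b}|lborel. k x * of_real (\<phi> x))"
proof -
  have eq: "(\<lambda>x. indicator {0<..} x *\<^sub>R (k x * of_real (\<phi> x))) = (\<lambda>x. indicator {a..b} x *\<^sub>R (k x * of_real (\<phi> x)))"
  proof
    fix x
    show "indicator {0<..} x *\<^sub>R (k x * of_real (\<phi> x)) = indicator {a..b} x *\<^sub>R (k x * of_real (\<phi> x))"
      using \<phi>(2)[of x] a by (cases "x \<in> {a..b}") (auto simp: indicator_def)
  qed
  have "set_integrable lborel {a..b} (\<lambda>x. k x * of_real (\<phi> x))"
    by (intro set_integrable_mult_continuous loc_integrableD[OF k a] continuous_on_of_real
        continuous_on_subset[OF \<phi>(1)]) auto
  then show "set_integrable lborel {0<..} (\<lambda>x. k x * of_real (\<phi> x))"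
    unfolding set_integrable_def eq .
  show "(LINT x:{0<..}|lborel. k x * of_real (\<phi> x)) = (LINT x:{a..b}|lborel. k x * of_real (\<phi> x))"
    unfolding set_lebesgue_integral_def eq ..
qed

lemma test_function_deriv_0:
  assumes "\<And>x. x \<notin> {a..b} \<Longrightarrow> \<phi> x = (0::real)" "x \<notin> {a..b}"
  shows "deriv \<phi> x = 0"
proof -
  have "open (- {a..b})" "x \<in> - {a..b}" using assms(2) by auto
  then have "\<forall>\<^sub>F y in nhds x. \<phi> y = 0"
    using assms(1) by (auto simp: eventually_nhds)
  then have "(\<phi> has_real_derivative 0) (at x) \<longleftrightarrow> ((\<lambda>_. 0) has_real_derivative 0) (at x)"
    by (intro DERIV_cong_ev) auto
  then show ?thesis by (auto intro: DERIV_imp_deriv)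
qed

lemma test_function_integrals:
  assumes "test_function \<phi>" "loc_integrable k"
  shows "set_integrable lborel {0<..} (\<lambda>x. k x * of_real (\<phi> x))"
    "set_integrable lborel {0<..} (\<lambda>x. k x * of_real (deriv \<phi> x))"
proof -
  obtain a b where ab: "0 < a" "\<And>x. x \<notin> {a..b} \<Longrightarrow> \<phi> x = 0"
    using test_functionE[OF assms(1)] by metis
  show "set_integrable lborel {0<..} (\<lambda>x. k x * of_real (\<phi> x))"
    by (rule test_set_integral(1)[OF assms(2) test_function_DERIV(2)[OF assms(1)] ab(2,1)])
  show "set_integrable lborel {0<..} (\<lambda>x. k x * of_real (deriv \<phi> x))"
    by (rule test_set_integral(1)[OF assms(2) test_function_DERIV(3)[OF assms(1)]
          test_function_deriv_0[OF ab(2)] ab(1)])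
qed

lemma locally_ac_imp_has_weak_deriv:
  assumes "locally_ac u g" shows "has_weak_deriv u g"
  unfolding has_weak_deriv_def
proof (intro conjI allI impI)
  show g: "loc_integrable g" using locally_acD(1)[OF assms] .
  show u: "loc_integrable u" by (rule loc_integrable_continuous[OF locally_ac_continuous[OF assms]])
  fix \<phi> assume \<phi>: "test_function \<phi>"
  obtain a b where ab: "0 < a" "a < b" "\<And>x. x \<notin> {a..b} \<Longrightarrow> \<phi> x = 0"
    using test_functionE[OF \<phi>] by metis
  \<comment> \<open>The interval is widened so that \<phi> vanishes at its end points too; the
    boundary terms of the product u \<phi> then disappear.\<close>
  let ?a = "a / 2" and ?b = "b + 1"
  have z: "\<phi> x = 0" "deriv \<phi> x = 0" if "x \<notin> {?a..?b}" for x
  proof -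
    have x: "x \<notin> {a..b}" using that ab(1) by auto
    show "\<phi> x = 0" by (rule ab(3)[OF x])
    show "deriv \<phi> x = 0" by (rule test_function_deriv_0[OF ab(3) x])
  qed
  have ac: "locally_ac (\<lambda>x. u x * of_real (\<phi> x)) (\<lambda>x. g x * of_real (\<phi> x) + u x * of_real (deriv \<phi> x))"
    by (intro locally_ac_mult[OF assms] locally_ac_DERIV test_function_DERIV[OF \<phi>])
  have a2: "0 < ?a" using ab by simp
  have "0 = (LINT x:{?a..?b}|lborel. g x * of_real (\<phi> x) + u x * of_real (deriv \<phi> x))"
    using locally_acD(2)[OF ac, of ?a ?b] ab(3)[of ?a] ab(3)[of ?b] ab(1,2) by simp
  also have "\<dots> = (LINT x:{?a..?b}|lborel. g x * of_real (\<phi> x)) + (LINT x:{?a..?b}|lborel. u x * of_real (deriv \<phi> x))"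
    by (intro set_integral_add set_integrable_mult_continuous loc_integrableD[OF g a2] loc_integrableD[OF u a2]
        continuous_on_of_real test_function_DERIV[OF \<phi>])
  also have "(LINT x:{?a..?b}|lborel. g x * of_real (\<phi> x)) = (LINT x:{0<..}|lborel. g x * of_real (\<phi> x))"
    by (rule test_set_integral(2)[OF g test_function_DERIV(2)[OF \<phi>] z(1) a2, symmetric])
  also have "(LINT x:{?a..?b}|lborel. u x * of_real (deriv \<phi> x)) = (LINT x:{0<..}|lborel. u x * of_real (deriv \<phi> x))"
    by (rule test_set_integral(2)[OF u test_function_DERIV(3)[OF \<phi>] z(2) a2, symmetric])
  finally show "(LINT y:{0<..}|lborel. u y * of_real (deriv \<phi> y)) = - (LINT y:{0<..}|lborel. g y * of_real (\<phi> y))"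
    by (simp add: eq_neg_iff_add_eq_0 add.commute)
qed

text \<open>Dynkin's argument: the half-lines are stable under intersection and generate the Borel
  sets, so the integral vanishes over every Borel set. The total integral is assumed to vanish
  because complements need it.\<close>

lemma integrable_zero_on_initial_AE_zero:
  fixes f :: "real \<Rightarrow> complex"
  assumes f: "integrable lborel f" and z: "\<And>x. (LINT t:{..<x}|lborel. f t) = 0"
    and tot: "(\<integral>t. f t \<partial>lborel) = 0"
  shows "AE x in lborel. f x = 0"
proof (rule sigma_finite_measure.density_zero[OF sigma_finite_lborel f])
  fix A :: "real set" assume "A \<in> sets lborel"
  then have A: "A \<in> sigma_sets UNIV (range lessThan)"
    by (simp add: borel_Iio)
  have si: "set_integrable lborel S f" if "S \<in> sets borel" for S
    using f that by (simp add: set_integrable_def integrable_mult_indicator)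
  have "Int_stable (range (lessThan :: real \<Rightarrow> real set))"
  proof (rule Int_stableI)
    fix X Y :: "real set" assume "X \<in> range lessThan" "Y \<in> range lessThan"
    then obtain x y where "X = {..<x}" "Y = {..<y}" by auto
    then have "X \<inter> Y = {..<min x y}" by auto
    then show "X \<inter> Y \<in> range lessThan" by blast
  qed
  moreover have "range (lessThan :: real \<Rightarrow> real set) \<subseteq> Pow UNIV" by simp
  ultimately show "(LINT t:A|lborel. f t) = 0"
    using A
  proof (induction rule: sigma_sets_induct_disjoint)
    case (compl S)
    then have S: "S \<in> sets borel" by (simp add: borel_Iio)
    have "(LINT t:(UNIV - S) \<union> S|lborel. f t) = (LINT t:UNIV - S|lborel. f t) + (LINT t:S|lborel. f t)"
      using S by (intro set_integral_Un si) auto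
    then show ?case using compl tot by (simp add: set_lebesgue_integral_def)
  next
    case (union S)
    then have S: "S i \<in> sets borel" for i by (auto simp: borel_Iio)
    have "(LINT t:(\<Union>i. S i)|lborel. f t) = (\<Sum>i. (LINT t:S i|lborel. f t))"
      using union(1) S by (intro lebesgue_integral_countable_add si) (auto simp: disjoint_family_on_def)
    then show ?case using union by simp
  qed (use z in \<open>auto simp: set_lebesgue_integral_def\<close>)
qed

lemma loc_integrable_AE_zero:
  assumes k: "loc_integrable k" and z: "\<And>a b. 0 < a \<Longrightarrow> a < b \<Longrightarrow> (LINT t:{a<..<b}|lborel. k t) = 0"
  shows "AE x in lborel. 0 < x \<longrightarrow> k x = 0"
proof -
  have *: "AE x in lborel. indicator {a<..<b} x *\<^sub>R k x = 0" if "0 < a" "a < b" for a b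
  proof (rule integrable_zero_on_initial_AE_zero)
    show "integrable lborel (\<lambda>x. indicator {a<..<b} x *\<^sub>R k x)"
      using set_integrable_subset[OF loc_integrableD[OF k that(1), of b], of "{a<..<b}"]
      by (auto simp: set_integrable_def greaterThanLessThan_subseteq_atLeastAtMost_iff)
    show "(\<integral>t. indicator {a<..<b} t *\<^sub>R k t \<partial>lborel) = 0"
      using z[OF that] by (simp add: set_lebesgue_integral_def)
    fix x
    have "(\<lambda>t. indicator {..<x} t *\<^sub>R indicator {a<..<b} t *\<^sub>R k t) = (\<lambda>t. indicator {a<..<min x b} t *\<^sub>R k t)"
      by (auto simp: indicator_def)
    then show "(LINT t:{..<x}|lborel. indicator {a<..<b} t *\<^sub>R k t) = 0"
      using z[OF that(1), of "min x b"] that by (cases "a < x") (auto simp: set_lebesgue_integral_def)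
  qed
  have "AE x in lborel. \<forall>n::nat. indicator {1 / real (Suc n)<..<real (Suc n)} x *\<^sub>R k x = 0"
  proof (subst AE_all_countable, rule allI)
    fix n :: nat
    show "AE x in lborel. indicator {1 / real (Suc n)<..<real (Suc n)} x *\<^sub>R k x = 0"
    \<comment> \<open>For n = 0 the exhausting interval is the empty one from 1 to 1, so it is
      treated apart.\<close>
    proof (cases n)
      case (Suc m)
      then show ?thesis by (intro *) (auto simp: field_simps intro: less_le_trans[of _ "1 + real m"])
    qed (simp add: indicator_def)
  qed
  then show ?thesis
  proof (rule AE_mp, intro AE_I2 impI)
    fix x :: real assume a: "\<forall>n::nat. indicator {1 / real (Suc n)<..<real (Suc n)} x *\<^sub>R k x = 0" and x: "0 < x"
    obtain n :: nat where n: "max x (1 / x) < real (Suc n)"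
      using reals_Archimedean2[of "max x (1 / x)"] by (metis less_trans of_nat_less_iff lessI)
    then have "1 / real (Suc n) < x" using x by (auto simp: field_simps)
    then show "k x = 0" using a[rule_format, of n] n by simp
  qed
qed

text \<open>On a fixed interval the bumps tend to the indicator under an integrable majorant, so the
  vanishing integrals pass from test functions to open intervals.\<close>

lemma fundamental_lemma:
  assumes k: "loc_integrable k"
    and z: "\<And>\<phi>. test_function \<phi> \<Longrightarrow> (LINT x:{0<..}|lborel. k x * of_real (\<phi> x)) = 0"
  shows "AE x in lborel. 0 < x \<longrightarrow> k x = 0"
proof (rule loc_integrable_AE_zero[OF k])
  fix a b :: real assume ab: "0 < a" "a < b"
  let ?f = "\<lambda>x. indicator {a<..<b} x *\<^sub>R k x"
  have i: "integrable lborel (\<lambda>x. indicator {a..b} x *\<^sub>R k x)"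
    using loc_integrableD[OF k ab(1)] by (simp add: set_integrable_def)
  have mi: "(\<lambda>x. indicator {0<..} x *\<^sub>R (k x * of_real (bump a b n x))) \<in> borel_measurable lborel" for n
    using test_function_integrals(1)[OF test_function_bump[OF ab(1)] k]
    by (auto simp: set_integrable_def)
  have "set_integrable lborel {a<..<b} k"
    by (rule set_integrable_subset[OF loc_integrableD[OF k ab(1), of b]]) auto
  then have mf: "?f \<in> borel_measurable lborel" by (auto simp: set_integrable_def)
  have "(\<lambda>n. \<integral>x. indicator {0<..} x *\<^sub>R (k x * of_real (bump a b n x)) \<partial>lborel) \<longlonglongrightarrow> (\<integral>x. ?f x \<partial>lborel)"
  proof (rule integral_dominated_convergence[OF mf mi integrable_norm[OF i]])
    show "AE x in lborel. (\<lambda>n. indicator {0<..} x *\<^sub>R (k x * of_real (bump a b n x))) \<longlonglongrightarrow> ?f x"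
    proof (rule AE_I2)
      fix x
      have "(\<lambda>n. indicator {0<..} x *\<^sub>R (k x * of_real (bump a b n x))) \<longlonglongrightarrow>
         indicator {0<..} x *\<^sub>R (k x * of_real (indicator {a<..<b} x))"
        by (intro tendsto_intros bump_tendsto)
      also have "indicator {0<..} x *\<^sub>R (k x * of_real (indicator {a<..<b} x)) = ?f x"
        using ab by (auto simp: indicator_def)
      finally show "(\<lambda>n. indicator {0<..} x *\<^sub>R (k x * of_real (bump a b n x))) \<longlonglongrightarrow> ?f x" .
    qed
    fix n
    show "AE x in lborel. norm (indicator {0<..} x *\<^sub>R (k x * of_real (bump a b n x))) \<le> norm (indicator {a..b} x *\<^sub>R k x)"
    proof (rule AE_I2)
      fix x
      show "norm (indicator {0<..} x *\<^sub>R (k x * of_real (bump a b n x))) \<le> norm (indicator {a..b} x *\<^sub>R k x)"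
        using bump_bounds[of a b n x]
        by (cases "x \<in> {a<..<b}") (auto simp: indicator_def norm_mult intro: mult_left_le)
    qed
  qed
  moreover have "(\<integral>x. indicator {0<..} x *\<^sub>R (k x * of_real (bump a b n x)) \<partial>lborel) = 0" for n
    using z[OF test_function_bump[OF ab(1)]] by (simp add: set_lebesgue_integral_def)
  ultimately show "(LINT t:{a<..<b}|lborel. k t) = 0"
    by (simp add: set_lebesgue_integral_def LIMSEQ_const_iff)
qed

text \<open>Integration starts left of the support, hence the primitive vanishes before A; the zero
  integral makes it vanish after B. The lower limit A / 2 rather than A makes every point x >= A
  interior to the interval on which the primitive is differentiated.\<close>

lemma test_function_antideriv:
  assumes sm: "\<And>n. times_differentiable n \<theta>" and A: "0 < A" "A < B"
    and z: "\<And>x. x \<notin> {A..B} \<Longrightarrow> \<theta> x = 0" and int0: "integral {A / 2..B} \<theta> = 0"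
  obtains \<psi> where "test_function \<psi>" "deriv \<psi> = \<theta>"
proof
  define \<psi> where "\<psi> = (\<lambda>x. integral {A / 2..x} \<theta>)"
  have cont: "continuous_on S \<theta>" for S
    using times_differentiable_SucD(1)[OF sm] by (meson DERIV_isCont continuous_at_imp_continuous_on)
  have \<psi>0: "\<psi> x = 0" if "x < A" for x
  proof -
    have "\<psi> x = integral {A / 2..x} (\<lambda>_. 0)"
      unfolding \<psi>_def by (rule integral_cong) (use z that in auto)
    then show ?thesis by simp
  qed
  have D: "(\<psi> has_real_derivative \<theta> x) (at x)" for x
  proof (cases "x < A")
    case True
    then have "(\<psi> has_real_derivative 0) (at x) \<longleftrightarrow> ((\<lambda>_. 0) has_real_derivative 0) (at x)"
      using eventually_nhds_in_open[of "{..<A}" x] \<psi>0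
      by (intro DERIV_cong_ev) (auto elim!: eventually_mono)
    then show ?thesis using z[of x] True by auto
  next
    case False
    have "(\<psi> has_real_derivative \<theta> x) (at x within {A / 2..x + 1})"
      unfolding \<psi>_def using False A by (intro integral_has_real_derivative cont) auto
    moreover have "x \<in> interior {A / 2..x + 1}" using False A by auto
    ultimately show ?thesis by (metis at_within_interior)
  qed
  show "deriv \<psi> = \<theta>" using D by (intro ext DERIV_imp_deriv)
  show "test_function \<psi>"
  proof (rule test_functionI[OF _ A(1)])
    show "times_differentiable n \<psi>" for n
      using times_differentiable_Suc[OF D sm] times_differentiable_mono[of "Suc n" \<psi> n] by simp
    fix x assume x: "x \<notin> {A..B}"
    show "\<psi> x = 0"
    proof (cases "x < A")
      case False
      then have "B < x" using x by auto
      have "integral {A / 2..B} \<theta> + integral {B..x} \<theta> = \<psi> x"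
        unfolding \<psi>_def using A \<open>B < x\<close>
        by (intro Henstock_Kurzweil_Integration.integral_combine integrable_continuous_real cont) auto
      moreover have "integral {B..x} \<theta> = integral {B..x} (\<lambda>_. 0)"
        by (rule integral_spike[of "{B}"]) (use z in auto)
      ultimately show ?thesis using int0 by simp
    qed (rule \<psi>0)
  qed
qed

text \<open>A test function with integral 0 is the derivative of a test function. Any test function
  acquires integral 0 after subtracting a multiple of one fixed bump, and that multiple produces the
  constant.\<close>

lemma weak_deriv_zero_const:
  assumes k: "loc_integrable k"
    and z: "\<And>\<phi>. test_function \<phi> \<Longrightarrow> (LINT x:{0<..}|lborel. k x * of_real (deriv \<phi> x)) = 0"
  obtains \<kappa> where "AE x in lborel. 0 < x \<longrightarrow> k x = \<kappa>"
proof -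
  let ?\<omega> = "bump 1 2 0"
  have \<omega>: "test_function ?\<omega>" by (rule test_function_bump) simp
  have \<omega>0: "?\<omega> x = 0" if "x \<notin> {1..2}" for x
    using bump_bounds[of 1 2 0 x] that by (auto simp: indicator_def)
  \<comment> \<open>Here \<open>c\<close> is the mass of the fixed bump, not the exponent of the
    weight.\<close>
  define c where "c = integral {1..2} ?\<omega>"
  have c: "c > 0"
  proof -
    have "c \<noteq> 0"
    proof
      assume "c = 0"
      then have "(?\<omega> has_integral 0) (cbox 1 2)"
        using integrable_integral[OF integrable_continuous_real[OF test_function_DERIV(2)[OF \<omega>], of 1 2]]
        by (simp add: c_def)
      from has_integral_0_cbox_imp_0[OF _ _ this, of "3 / 2"]
      have "?\<omega> (3 / 2) = 0" using bump_bounds test_function_DERIV(2)[OF \<omega>] by auto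
      then show False using bump_pos[of 1 "3 / 2" 2 0] by simp
    qed
    moreover have "c \<ge> 0" unfolding c_def
      by (intro integral_nonneg integrable_continuous_real test_function_DERIV(2)[OF \<omega>]) (simp add: bump_bounds)
    ultimately show ?thesis by simp
  qed
  \<comment> \<open>If k is a constant, testing with the bump determines it as this
    quotient.\<close>
  define \<kappa> where "\<kappa> = (LINT x:{0<..}|lborel. k x * of_real (?\<omega> x)) / of_real c"
  have one: "loc_integrable (\<lambda>_. 1)" by (rule loc_integrable_continuous) simp
  have "AE x in lborel. 0 < x \<longrightarrow> k x + - \<kappa> * 1 = 0"
  proof (rule fundamental_lemma)
    have c1: "loc_integrable (\<lambda>x. - \<kappa> * 1)" by (rule loc_integrable_continuous) simp
    show "loc_integrable (\<lambda>x. k x + - \<kappa> * 1)"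
      by (rule loc_integrable_add[OF k c1])
    fix \<phi> assume \<phi>: "test_function \<phi>"
    obtain a b where ab: "0 < a" "a < b" "\<And>x. x \<notin> {a..b} \<Longrightarrow> \<phi> x = 0" "\<And>n. times_differentiable n \<phi>"
      using test_functionE[OF \<phi>] by metis
    define A where "A = min a 1"
    define B where "B = max b 2"
    have AB: "0 < A" "A < B" using ab by (auto simp: A_def B_def)
    define I where "I = integral {A / 2..B} \<phi>"
    define \<theta> where "\<theta> = (\<lambda>x. \<phi> x + (- I / c) * ?\<omega> x)"
    have \<phi>z: "\<phi> x = 0" and \<omega>z: "?\<omega> x = 0" if "x \<notin> {A..B}" for x
    proof -
      have "x \<notin> {a..b}" "x \<notin> {1..2}" using that by (auto simp: A_def B_def)
      then show "\<phi> x = 0" "?\<omega> x = 0" using ab(3) \<omega>0 by blast+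
    qed
    have sm: "times_differentiable n \<theta>" for n
      unfolding \<theta>_def using ab(4) test_functionE[OF \<omega>]
      by (intro times_differentiable_add times_differentiable_mult times_differentiable_const) metis+
    have int\<omega>: "integral {A / 2..B} ?\<omega> = c"
    proof -
      have "{1..2} \<subseteq> {A / 2..B}" using ab(1) by (auto simp: A_def B_def)
      then have "c = integral {A / 2..B} (\<lambda>x. if x \<in> {1..2} then ?\<omega> x else 0)"
        unfolding c_def Henstock_Kurzweil_Integration.integral_restrict_Int by (simp add: Int_absorb2)
      also have "(\<lambda>x. if x \<in> {1..2} then ?\<omega> x else 0) = ?\<omega>"
        using \<omega>0 by fastforce
      finally show ?thesis ..
    qed
    have "integral {A / 2..B} \<theta> = I + (- I / c) * integral {A / 2..B} ?\<omega>"
      unfolding \<theta>_def I_def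
      by (subst Henstock_Kurzweil_Integration.integral_add)
        (intro integrable_continuous_real continuous_on_mult continuous_on_const
          test_function_DERIV(2)[OF \<phi>] test_function_DERIV(2)[OF \<omega>] refl | simp)+
    also have "\<dots> = 0" using c int\<omega> by simp
    finally have int0: "integral {A / 2..B} \<theta> = 0" .
    obtain \<psi> where \<psi>: "test_function \<psi>" "deriv \<psi> = \<theta>"
      using test_function_antideriv[OF sm AB _ int0] \<phi>z \<omega>z by (auto simp: \<theta>_def)
    define q :: complex where "q = - of_real (I / c)"
    have "0 = (LINT x:{0<..}|lborel. k x * of_real (\<theta> x))"
      using z[OF \<psi>(1)] \<psi>(2) by simp
    also have "\<dots> = (LINT x:{0<..}|lborel. k x * of_real (\<phi> x) + q * (k x * of_real (?\<omega> x)))"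
      by (simp add: \<theta>_def q_def algebra_simps)
    also have "\<dots> = (LINT x:{0<..}|lborel. k x * of_real (\<phi> x)) + q * (LINT x:{0<..}|lborel. k x * of_real (?\<omega> x))"
      by (subst set_integral_add) (auto intro!: test_function_integrals \<phi> \<omega> k)
    also have "\<dots> = (LINT x:{0<..}|lborel. k x * of_real (\<phi> x)) - \<kappa> * of_real I"
      using c by (simp add: \<kappa>_def q_def)
    also have "complex_of_real I = (LINT x:{0<..}|lborel. 1 * complex_of_real (\<phi> x))"
    proof -
      have A2: "0 < A / 2" "A / 2 \<le> B" using AB by auto
      have "(LINT x:{0<..}|lborel. 1 * complex_of_real (\<phi> x)) = (LINT x:{A / 2..B}|lborel. 1 * complex_of_real (\<phi> x))"
        by (rule test_set_integral(2)[OF one test_function_DERIV(2)[OF \<phi>] _ A2(1)]) (use \<phi>z AB in auto)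
      also have "\<dots> = of_real (LINT x:{A / 2..B}|lborel. \<phi> x)"
        by (simp add: set_integral_complex_of_real)
      also have "(LINT x:{A / 2..B}|lborel. \<phi> x) = I"
        unfolding I_def
        by (intro set_borel_integral_eq_integral(2))
           (unfold set_integrable_def, intro borel_integrable_compact compact_Icc test_function_DERIV(2)[OF \<phi>])
      finally show ?thesis ..
    qed
    also have "(LINT x:{0<..}|lborel. k x * of_real (\<phi> x)) - \<kappa> * (LINT x:{0<..}|lborel. 1 * of_real (\<phi> x))
        = (LINT x:{0<..}|lborel. k x * of_real (\<phi> x) - \<kappa> * (1 * of_real (\<phi> x)))"
      by (subst set_integral_diff) (auto intro!: test_function_integrals(1)[OF \<phi> k] test_function_integrals(1)[OF \<phi> one, simplified])
    finally show "(LINT x:{0<..}|lborel. (k x + - \<kappa> * 1) * of_real (\<phi> x)) = 0"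
      by (simp add: algebra_simps)
  qed
  then show ?thesis using that[of \<kappa>] by (simp add: algebra_simps)
qed

lemma set_integral_split:
  assumes "loc_integrable g" "0 < a" "a \<le> b" "b \<le> c"
  shows "(LINT x:{a..c}|lborel. g x) = (LINT x:{a..b}|lborel. g x) + (LINT x:{b..c}|lborel. g x)"
proof -
  note i = loc_integrableD[OF assms(1)]
  have "0 < b" using assms by simp
  then show ?thesis
    using Henstock_Kurzweil_Integration.integral_combine[OF assms(3,4) set_borel_integral_eq_integral(1)[OF i[OF assms(2)]]]
    by (simp add: set_borel_integral_eq_integral(2)[OF i] assms(2))
qed

text \<open>The base point is 1, with a change of sign to its left, because g need not be integrable
  up to the origin.\<close>

lemma locally_ac_antideriv:
  assumes g: "loc_integrable g"
  shows "locally_ac (\<lambda>x. if 1 \<le> x then LINT t:{1..x}|lborel. g t else - (LINT t:{x..1}|lborel. g t)) g"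
  unfolding locally_ac_def
proof (intro conjI allI impI g)
  fix a b :: real assume ab: "0 < a" "a \<le> b"
  consider "1 \<le> a" | "a < 1" "1 \<le> b" | "b < 1" by linarith
  then show "(if 1 \<le> b then LINT t:{1..b}|lborel. g t else - (LINT t:{b..1}|lborel. g t)) -
      (if 1 \<le> a then LINT t:{1..a}|lborel. g t else - (LINT t:{a..1}|lborel. g t)) = (LINT x:{a..b}|lborel. g x)"
  proof cases
    case 1 then show ?thesis using set_integral_split[OF g, of 1 a b] ab by simp
  next
    case 2 then show ?thesis using set_integral_split[OF g, of a 1 b] ab by simp
  next
    case 3 then show ?thesis using set_integral_split[OF g, of a b 1] ab by simp
  qed
qed

lemma locally_ac_add_const: "locally_ac u g \<Longrightarrow> locally_ac (\<lambda>x. \<kappa> + u x) g"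
  by (simp add: locally_ac_def)

text \<open>The difference between u and a primitive of g has weak derivative 0, so it is almost
  everywhere a constant; adding that constant to the primitive gives the representative.\<close>

lemma has_weak_deriv_imp_locally_ac:
  assumes "has_weak_deriv u g"
  obtains v where "locally_ac v g" "AE x in lborel. 0 < x \<longrightarrow> u x = v x"
proof -
  have u: "loc_integrable u" and g: "loc_integrable g"
    and ug: "\<And>\<phi>. test_function \<phi> \<Longrightarrow> (LINT y:{0<..}|lborel. u y * of_real (deriv \<phi> y)) =
        - (LINT y:{0<..}|lborel. g y * of_real (\<phi> y))"
    using assms by (auto simp: has_weak_deriv_def)
  obtain G where G: "locally_ac G g" using locally_ac_antideriv[OF g] by blast
  have Gi: "loc_integrable G" by (rule loc_integrable_continuous[OF locally_ac_continuous[OF G]])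
  have mG: "loc_integrable (\<lambda>x. G x * (-1))"
    by (rule loc_integrable_mult_continuous[OF Gi]) simp
  have ki: "loc_integrable (\<lambda>x. u x + G x * (-1))" by (rule loc_integrable_add[OF u mG])
  obtain \<kappa> where \<kappa>: "AE x in lborel. 0 < x \<longrightarrow> u x + G x * (-1) = \<kappa>"
  proof (rule weak_deriv_zero_const[OF ki])
    fix \<phi> assume \<phi>: "test_function \<phi>"
    have "(LINT x:{0<..}|lborel. (u x + G x * (-1)) * of_real (deriv \<phi> x)) =
      (LINT x:{0<..}|lborel. u x * of_real (deriv \<phi> x) - G x * of_real (deriv \<phi> x))"
      by (simp add: algebra_simps)
    also have "\<dots> = (LINT x:{0<..}|lborel. u x * of_real (deriv \<phi> x)) - (LINT x:{0<..}|lborel. G x * of_real (deriv \<phi> x))"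
      by (intro set_integral_diff test_function_integrals \<phi> u Gi)
    also have "\<dots> = 0"
      using ug[OF \<phi>] locally_ac_imp_has_weak_deriv[OF G] \<phi> by (auto simp: has_weak_deriv_def)
    finally show "(LINT x:{0<..}|lborel. (u x + G x * (-1)) * of_real (deriv \<phi> x)) = 0" .
  qed
  show ?thesis
  proof
    show "locally_ac (\<lambda>x. \<kappa> + G x) g" by (rule locally_ac_add_const[OF G])
    show "AE x in lborel. 0 < x \<longrightarrow> u x = \<kappa> + G x"
      using \<kappa> by (rule AE_mp) (auto intro!: AE_I2 simp: algebra_simps)
  qed
qed

lemma has_weak_deriv_cong_AE:
  assumes "has_weak_deriv v g" "loc_integrable u" "AE x in lborel. 0 < x \<longrightarrow> u x = v x"
  shows "has_weak_deriv u g"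
  unfolding has_weak_deriv_def
proof (intro conjI allI impI assms(2))
  have v: "loc_integrable v" using assms(1) by (simp add: has_weak_deriv_def)
  show "loc_integrable g" using assms(1) by (simp add: has_weak_deriv_def)
  fix \<phi> assume \<phi>: "test_function \<phi>"
  have "(LINT y:{0<..}|lborel. u y * of_real (deriv \<phi> y)) = (LINT y:{0<..}|lborel. v y * of_real (deriv \<phi> y))"
    unfolding set_lebesgue_integral_def
  proof (rule integral_cong_AE)
    show "(\<lambda>x. indicat_real {0<..} x *\<^sub>R (u x * complex_of_real (deriv \<phi> x))) \<in> borel_measurable lborel"
      "(\<lambda>x. indicat_real {0<..} x *\<^sub>R (v x * complex_of_real (deriv \<phi> x))) \<in> borel_measurable lborel"
      using test_function_integrals(2)[OF \<phi> assms(2)] test_function_integrals(2)[OF \<phi> v]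
      by (auto simp: set_integrable_def)
    show "AE x in lborel. indicat_real {0<..} x *\<^sub>R (u x * complex_of_real (deriv \<phi> x)) =
        indicat_real {0<..} x *\<^sub>R (v x * complex_of_real (deriv \<phi> x))"
      using assms(3) by (rule AE_mp) (auto intro!: AE_I2 simp: indicator_def)
  qed
  also have "\<dots> = - (LINT y:{0<..}|lborel. g y * of_real (\<phi> y))"
    using assms(1) \<phi> by (simp add: has_weak_deriv_def)
  finally show "(LINT y:{0<..}|lborel. u y * of_real (deriv \<phi> y)) = - (LINT y:{0<..}|lborel. g y * of_real (\<phi> y))" .
qed

text \<open>This makes the choice inside \<open>weak_deriv\<close> harmless: every concrete formula
  for a weak derivative agrees with the chosen one almost everywhere.\<close>

lemma has_weak_deriv_unique:
  assumes "has_weak_deriv u g" "has_weak_deriv u h"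
  shows "AE x in lborel. 0 < x \<longrightarrow> g x = h x"
proof -
  have g: "loc_integrable g" and h: "loc_integrable h" using assms by (auto simp: has_weak_deriv_def)
  have "AE x in lborel. 0 < x \<longrightarrow> g x + h x * (-1) = 0"
  proof (rule fundamental_lemma)
    show "loc_integrable (\<lambda>x. g x + h x * (-1))"
      by (intro loc_integrable_add g loc_integrable_mult_continuous h) simp
    fix \<phi> assume \<phi>: "test_function \<phi>"
    have "(LINT x:{0<..}|lborel. (g x + h x * (-1)) * of_real (\<phi> x)) =
      (LINT x:{0<..}|lborel. g x * of_real (\<phi> x) - h x * of_real (\<phi> x))"
      by (simp add: algebra_simps)
    also have "\<dots> = (LINT x:{0<..}|lborel. g x * of_real (\<phi> x)) - (LINT x:{0<..}|lborel. h x * of_real (\<phi> x))"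
      by (intro set_integral_diff test_function_integrals \<phi> g h)
    also have "\<dots> = 0"
      using assms \<phi> by (auto simp: has_weak_deriv_def)
    finally show "(LINT x:{0<..}|lborel. (g x + h x * (-1)) * of_real (\<phi> x)) = 0" .
  qed
  then show ?thesis by (rule AE_mp) (auto intro!: AE_I2)
qed

section \<open>The space of square-integrable functions\<close>

lemma space_weighted_measure [simp]: "space (weighted_measure c) = {0<..}"
  by (simp add: weighted_measure_def space_restrict_space)

lemma sets_weighted_measure: "sets (weighted_measure c) = sets (restrict_space borel {0<..})"
  unfolding weighted_measure_def by (simp add: sets_restrict_space)

lemma measurable_weighted_measure:
  "borel_measurable (weighted_measure c) = borel_measurable (restrict_space borel {0<..})"
  by (rule measurable_cong_sets) (simp_all add: sets_weighted_measure)

lemma measurable_weighted_measure_iff: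
  fixes f :: "real \<Rightarrow> 'a::real_normed_vector"
  shows "f \<in> borel_measurable (weighted_measure c) \<longleftrightarrow> (\<lambda>x. indicator {0<..} x *\<^sub>R f x) \<in> borel_measurable lborel"
  unfolding measurable_weighted_measure by (subst borel_measurable_restrict_space_iff) auto

lemma measurable_weighted_measureI:
  "f \<in> borel_measurable borel \<Longrightarrow> f \<in> borel_measurable (weighted_measure c)"
  unfolding measurable_weighted_measure by (rule measurable_restrict_space1)

lemma continuous_on_measurable_weighted:
  fixes f :: "real \<Rightarrow> 'a::real_normed_vector"
  assumes "continuous_on {0<..} f" shows "f \<in> borel_measurable (weighted_measure c)"
  unfolding measurable_weighted_measure by (rule borel_measurable_continuous_on_restrict[OF assms])

lemma powr_measurable_restrict: "(\<lambda>y::real. y powr c) \<in> borel_measurable (restrict_space lborel {0<..})"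
  by (intro measurable_restrict_space1 powr_real_measurable) simp_all

text \<open>The density is strictly positive on the half-line, so the weighted null sets are the
  Lebesgue null sets for every c. Weak derivatives live over \<open>lborel\<close> and norms over
  the weighted measure; statements travel between them through this equivalence.\<close>

lemma AE_weighted_measure:
  "(AE x in weighted_measure c. P x) \<longleftrightarrow> (AE x in lborel. 0 < x \<longrightarrow> P x)"
proof -
  have "(AE x in weighted_measure c. P x) \<longleftrightarrow> (AE x in restrict_space lborel {0<..}. 0 < ennreal (x powr c) \<longrightarrow> P x)"
    unfolding weighted_measure_def
    by (rule AE_density) (intro measurable_compose[OF powr_measurable_restrict] measurable_ennreal)
  also have "\<dots> \<longleftrightarrow> (AE x in lborel. x \<in> {0<..} \<longrightarrow> (0 < ennreal (x powr c) \<longrightarrow> P x))"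
    by (rule AE_restrict_space_iff) simp
  also have "\<dots> \<longleftrightarrow> (AE x in lborel. 0 < x \<longrightarrow> P x)"
    by (rule AE_cong) auto
  finally show ?thesis .
qed

lemma AE_weighted_I: "(\<And>x. 0 < x \<Longrightarrow> P x) \<Longrightarrow> AE x in weighted_measure c. P x"
  by (rule AE_I2) simp

lemma integrable_weighted_iff:
  fixes f :: "real \<Rightarrow> 'a::{banach, second_countable_topology}"
  assumes "f \<in> borel_measurable (weighted_measure c)"
  shows "integrable (weighted_measure c) f \<longleftrightarrow> set_integrable lborel {0<..} (\<lambda>x. x powr c *\<^sub>R f x)"
proof -
  have "f \<in> borel_measurable (restrict_space lborel {0<..})"
    using assms by (simp add: measurable_weighted_measure_iff borel_measurable_restrict_space_iff)
  then show ?thesis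
    unfolding weighted_measure_def set_integrable_def
    by (subst integrable_density[OF _ powr_measurable_restrict])
       (auto simp: integrable_restrict_space)
qed

lemma integral_weighted:
  fixes f :: "real \<Rightarrow> 'a::{banach, second_countable_topology}"
  assumes "f \<in> borel_measurable (weighted_measure c)"
  shows "(LINT x|weighted_measure c. f x) = (LINT x:{0<..}|lborel. x powr c *\<^sub>R f x)"
proof -
  have "f \<in> borel_measurable (restrict_space lborel {0<..})"
    using assms by (simp add: measurable_weighted_measure_iff borel_measurable_restrict_space_iff)
  then show ?thesis
    unfolding weighted_measure_def set_lebesgue_integral_def
    by (subst integral_density[OF _ powr_measurable_restrict])
       (auto simp: integral_restrict_space)
qed

text \<open>Bilinear, without conjugation: since the coefficients are real, \<open>T z\<close> is
  symmetric for this pairing at every complex z, whereas for the inner product its adjoint belongs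
  to the conjugate of z.\<close>

definition L2_pair :: "real \<Rightarrow> (real \<Rightarrow> complex) \<Rightarrow> (real \<Rightarrow> complex) \<Rightarrow> complex" where
  "L2_pair c f g = (LINT y|weighted_measure c. f y * g y)"

lemma L2_measurable [dest]: "f \<in> L2 c \<Longrightarrow> f \<in> borel_measurable (weighted_measure c)"
  by (simp add: L2_def)

lemma L2_integrable: "f \<in> L2 c \<Longrightarrow> integrable (weighted_measure c) (\<lambda>y. (cmod (f y))\<^sup>2)"
  by (simp add: L2_def)

lemma L2_I_bound:
  assumes "f \<in> borel_measurable (weighted_measure c)" "integrable (weighted_measure c) g"
    "AE y in weighted_measure c. (cmod (f y))\<^sup>2 \<le> g y"
  shows "f \<in> L2 c"
  unfolding L2_def
proof (intro CollectI conjI assms(1))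
  show "integrable (weighted_measure c) (\<lambda>y. (cmod (f y))\<^sup>2)"
  proof (rule Bochner_Integration.integrable_bound[OF assms(2)])
    show "(\<lambda>y. (cmod (f y))\<^sup>2) \<in> borel_measurable (weighted_measure c)"
      using assms(1) by measurable
    show "AE y in weighted_measure c. norm ((cmod (f y))\<^sup>2) \<le> norm (g y)"
      using assms(3) by eventually_elim auto
  qed
qed

lemma L2_norm_square: "f \<in> L2 c \<Longrightarrow> (L2_norm c f)\<^sup>2 = (LINT y|weighted_measure c. (cmod (f y))\<^sup>2)"
  by (simp add: L2_norm_def)

lemma L2_norm_nonneg [simp]: "0 \<le> L2_norm c f"
  by (simp add: L2_norm_def)

lemma L2_add: "f \<in> L2 c \<Longrightarrow> g \<in> L2 c \<Longrightarrow> (\<lambda>y. f y + g y) \<in> L2 c"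
proof -
  assume f: "f \<in> L2 c" and g: "g \<in> L2 c"
  show ?thesis
  proof (rule L2_I_bound)
    show "(\<lambda>y. f y + g y) \<in> borel_measurable (weighted_measure c)"
      using f g by (intro borel_measurable_add) auto
    show "integrable (weighted_measure c) (\<lambda>y. 2 * (cmod (f y))\<^sup>2 + 2 * (cmod (g y))\<^sup>2)"
      using L2_integrable[OF f] L2_integrable[OF g] by auto
    have "(cmod (f y + g y))\<^sup>2 \<le> 2 * (cmod (f y))\<^sup>2 + 2 * (cmod (g y))\<^sup>2" for y
    proof -
      have "(cmod (f y + g y))\<^sup>2 \<le> (cmod (f y) + cmod (g y))\<^sup>2"
        by (intro power_mono norm_triangle_ineq) auto
      also have "\<dots> \<le> 2 * (cmod (f y))\<^sup>2 + 2 * (cmod (g y))\<^sup>2"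
        using sum_squares_bound[of "cmod (f y)" "cmod (g y)"] by (simp add: power2_sum)
      finally show ?thesis .
    qed
    then show "AE y in weighted_measure c. (cmod (f y + g y))\<^sup>2 \<le> 2 * (cmod (f y))\<^sup>2 + 2 * (cmod (g y))\<^sup>2"
      by simp
  qed
qed

lemma L2_bounded_mult:
  assumes f: "f \<in> L2 c" and m: "m \<in> borel_measurable (weighted_measure c)"
    and B: "\<And>y. 0 < y \<Longrightarrow> cmod (m y) \<le> B"
  shows "(\<lambda>y. m y * f y) \<in> L2 c"
proof (rule L2_I_bound)
  show "(\<lambda>y. m y * f y) \<in> borel_measurable (weighted_measure c)" using f m by (intro borel_measurable_times) auto
  show "integrable (weighted_measure c) (\<lambda>y. B\<^sup>2 * (cmod (f y))\<^sup>2)"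
    using L2_integrable[OF f] by simp
  show "AE y in weighted_measure c. (cmod (m y * f y))\<^sup>2 \<le> B\<^sup>2 * (cmod (f y))\<^sup>2"
    by (rule AE_weighted_I) (auto simp: norm_mult power_mult_distrib intro!: mult_right_mono power_mono B)
qed

lemma L2_scale: "f \<in> L2 c \<Longrightarrow> (\<lambda>y. a * f y) \<in> L2 c"
  by (rule L2_bounded_mult[where B="cmod a"]) auto

lemma L2_diff: "f \<in> L2 c \<Longrightarrow> g \<in> L2 c \<Longrightarrow> (\<lambda>y. f y - g y) \<in> L2 c"
  using L2_add[of f c "\<lambda>y. (-1) * g y"] L2_scale[of g c "-1"] by simp

lemma L2_cnj: "f \<in> L2 c \<Longrightarrow> (\<lambda>y. cnj (f y)) \<in> L2 c"
proof -
  assume f: "f \<in> L2 c"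
  have "(cnj :: complex \<Rightarrow> complex) \<in> borel_measurable borel"
    by (intro borel_measurable_continuous_onI continuous_intros)
  from measurable_compose[OF L2_measurable[OF f] this] show ?thesis
    using f by (simp add: L2_def)
qed

lemma L2_mult_integrable:
  assumes "f \<in> L2 c" "g \<in> L2 c"
  shows "integrable (weighted_measure c) (\<lambda>y. f y * g y)"
    "integrable (weighted_measure c) (\<lambda>y. cmod (f y) * cmod (g y))"
proof -
  have m[measurable]: "f \<in> borel_measurable (weighted_measure c)" "g \<in> borel_measurable (weighted_measure c)"
    using assms by auto
  have i: "integrable (weighted_measure c) (\<lambda>y. (cmod (f y))\<^sup>2 + (cmod (g y))\<^sup>2)"
    using assms L2_integrable by auto
  have b: "cmod (f y) * cmod (g y) \<le> (cmod (f y))\<^sup>2 + (cmod (g y))\<^sup>2" for y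
    using sum_squares_bound[of "cmod (f y)" "cmod (g y)"] zero_le_power2[of "cmod (f y)"] zero_le_power2[of "cmod (g y)"]
      mult_nonneg_nonneg[OF norm_ge_zero[of "f y"] norm_ge_zero[of "g y"]] by linarith
  show "integrable (weighted_measure c) (\<lambda>y. f y * g y)"
    by (rule Bochner_Integration.integrable_bound[OF i]) (use b in \<open>auto simp: norm_mult\<close>)
  show "integrable (weighted_measure c) (\<lambda>y. cmod (f y) * cmod (g y))"
    by (rule Bochner_Integration.integrable_bound[OF i]) (use b in \<open>auto simp: norm_mult\<close>)
qed

lemma L2_Cauchy_Schwarz:
  assumes "f \<in> L2 c" "g \<in> L2 c"
  shows "(LINT y|weighted_measure c. cmod (f y) * cmod (g y)) \<le> L2_norm c f * L2_norm c g"
proof -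
  let ?M = "weighted_measure c"
  have m[measurable]: "f \<in> borel_measurable ?M" "g \<in> borel_measurable ?M" using assms by auto
  let ?I = "LINT y|?M. cmod (f y) * cmod (g y)"
  let ?A = "LINT y|?M. (cmod (f y))\<^sup>2" and ?B = "LINT y|?M. (cmod (g y))\<^sup>2"
  have nn: "(\<integral>\<^sup>+y. ennreal (cmod (f y)) * ennreal (cmod (g y)) \<partial>?M) = ennreal ?I"
    using nn_integral_eq_integral[OF L2_mult_integrable(2)[OF assms]] by (simp add: ennreal_mult)
  have nA: "(\<integral>\<^sup>+y. ennreal (cmod (f y)) ^ 2 \<partial>?M) = ennreal ?A"
    using nn_integral_eq_integral[OF L2_integrable[OF assms(1)]] by (simp add: ennreal_power)
  have nB: "(\<integral>\<^sup>+y. ennreal (cmod (g y)) ^ 2 \<partial>?M) = ennreal ?B"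
    using nn_integral_eq_integral[OF L2_integrable[OF assms(2)]] by (simp add: ennreal_power)
  have pos: "0 \<le> ?I" "0 \<le> ?A" "0 \<le> ?B" by (auto intro!: integral_nonneg)
  have "(ennreal ?I)\<^sup>2 \<le> ennreal ?A * ennreal ?B"
    using Cauchy_Schwarz_nn_integral[of "\<lambda>y. ennreal (cmod (f y))" ?M "\<lambda>y. ennreal (cmod (g y))"]
    by (simp add: nn nA nB)
  then have "?I\<^sup>2 \<le> ?A * ?B"
    using pos by (simp add: ennreal_power ennreal_mult[symmetric])
  then have "?I \<le> sqrt (?A * ?B)" by (rule real_le_rsqrt)
  then show ?thesis by (simp add: L2_norm_def real_sqrt_mult)
qed

lemma L2_pair_bound:
  assumes "f \<in> L2 c" "g \<in> L2 c" shows "cmod (L2_pair c f g) \<le> L2_norm c f * L2_norm c g"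
proof -
  have "cmod (L2_pair c f g) \<le> (LINT y|weighted_measure c. cmod (f y * g y))"
    unfolding L2_pair_def by (rule integral_norm_bound)
  also have "\<dots> \<le> L2_norm c f * L2_norm c g"
    using L2_Cauchy_Schwarz[OF assms] by (simp add: norm_mult)
  finally show ?thesis .
qed

lemma L2_pair_commute: "L2_pair c f g = L2_pair c g f"
  by (simp add: L2_pair_def mult.commute)

lemma L2_pair_lincomb:
  assumes "f \<in> L2 c" "g \<in> L2 c" "h \<in> L2 c"
  shows "L2_pair c (\<lambda>y. a * f y + b * g y) h = a * L2_pair c f h + b * L2_pair c g h"
proof -
  have "L2_pair c (\<lambda>y. a * f y + b * g y) h = (LINT y|weighted_measure c. a * (f y * h y) + b * (g y * h y))"
    by (simp add: L2_pair_def algebra_simps)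
  also have "\<dots> = a * L2_pair c f h + b * L2_pair c g h"
    unfolding L2_pair_def using L2_mult_integrable(1)[OF assms(1,3)] L2_mult_integrable(1)[OF assms(2,3)]
    by (subst Bochner_Integration.integral_add) auto
  finally show ?thesis .
qed

lemma L2_pair_diff:
  assumes "f \<in> L2 c" "g \<in> L2 c" "h \<in> L2 c"
  shows "L2_pair c (\<lambda>y. f y - g y) h = L2_pair c f h - L2_pair c g h"
  using L2_pair_lincomb[OF assms, of 1 "-1"] by simp

lemma L2_pair_cnj: "f \<in> L2 c \<Longrightarrow> L2_pair c f (\<lambda>y. cnj (f y)) = of_real ((L2_norm c f)\<^sup>2)"
proof -
  assume f: "f \<in> L2 c"
  have "f y * cnj (f y) = of_real ((cmod (f y))\<^sup>2)" for y
    using complex_norm_square[of "f y"] by simp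
  then show ?thesis
    unfolding L2_pair_def L2_norm_square[OF f] by (simp only: integral_complex_of_real)
qed

lemma L2_norm_cong_AE:
  assumes "AE y in weighted_measure c. f y = g y" "f \<in> L2 c" "g \<in> L2 c"
  shows "L2_norm c f = L2_norm c g"
proof -
  have [measurable]: "f \<in> borel_measurable (weighted_measure c)" "g \<in> borel_measurable (weighted_measure c)"
    using assms by auto
  have "(LINT y|weighted_measure c. (cmod (f y))\<^sup>2) = (LINT y|weighted_measure c. (cmod (g y))\<^sup>2)"
    by (rule integral_cong_AE) (measurable, use assms(1) in eventually_elim, simp)
  then show ?thesis by (simp add: L2_norm_def)
qed

lemma L2_norm_mono_AE:
  assumes "f \<in> L2 c" "g \<in> L2 c" "AE y in weighted_measure c. cmod (f y) \<le> cmod (g y)"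
  shows "L2_norm c f \<le> L2_norm c g"
proof -
  have "(LINT y|weighted_measure c. (cmod (f y))\<^sup>2) \<le> (LINT y|weighted_measure c. (cmod (g y))\<^sup>2)"
    by (rule integral_mono_AE[OF L2_integrable[OF assms(1)] L2_integrable[OF assms(2)]])
       (use assms(3) in eventually_elim, auto intro: power_mono)
  then show ?thesis by (simp add: L2_norm_def)
qed

lemma L2_norm_scale: "L2_norm c (\<lambda>y. a * f y) = cmod a * L2_norm c f"
  by (simp add: L2_norm_def norm_mult power_mult_distrib real_sqrt_mult)

lemma L2_norm_cnj: "L2_norm c (\<lambda>y. cnj (f y)) = L2_norm c f"
  by (simp add: L2_norm_def)

text \<open>The choice g = cnj f turns the bilinear pairing into the squared norm. All norm bounds
  on images of mollifiers are obtained in this dual form, where the semigroup can be moved to the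
  other factor.\<close>

lemma L2_norm_dual:
  assumes f: "f \<in> L2 c" and B: "\<And>g. g \<in> L2 c \<Longrightarrow> cmod (L2_pair c f g) \<le> B * L2_norm c g" "0 \<le> B"
  shows "L2_norm c f \<le> B"
proof (cases "L2_norm c f = 0")
  case False
  have "(L2_norm c f)\<^sup>2 \<le> B * L2_norm c f"
    using B(1)[OF L2_cnj[OF f]] unfolding L2_pair_cnj[OF f] norm_of_real by (simp add: L2_norm_cnj)
  then show ?thesis using False L2_norm_nonneg[of c f]
    by (simp add: power2_eq_square)
qed (simp add: B(2))

text \<open>Read off from linearity of the pairing through \<open>L2_norm_dual\<close>.\<close>

lemma L2_norm_triangle:
  assumes f: "f \<in> L2 c" and g: "g \<in> L2 c"
  shows "L2_norm c (\<lambda>y. f y + g y) \<le> L2_norm c f + L2_norm c g"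
proof (rule L2_norm_dual[OF L2_add[OF f g]])
  fix h assume h: "h \<in> L2 c"
  have "L2_pair c (\<lambda>y. f y + g y) h = L2_pair c f h + L2_pair c g h"
    using L2_pair_lincomb[OF f g h, of 1 1] by simp
  then have "cmod (L2_pair c (\<lambda>y. f y + g y) h) \<le> cmod (L2_pair c f h) + cmod (L2_pair c g h)"
    by (simp add: norm_triangle_ineq)
  also have "\<dots> \<le> L2_norm c f * L2_norm c h + L2_norm c g * L2_norm c h"
    by (intro add_mono L2_pair_bound f g h)
  finally show "cmod (L2_pair c (\<lambda>y. f y + g y) h) \<le> (L2_norm c f + L2_norm c g) * L2_norm c h"
    by (simp add: algebra_simps)
qed simp

lemma L2_norm_diff_triangle:
  assumes "f \<in> L2 c" "g \<in> L2 c" "h \<in> L2 c"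
  shows "L2_norm c (\<lambda>y. f y - h y) \<le> L2_norm c (\<lambda>y. f y - g y) + L2_norm c (\<lambda>y. g y - h y)"
  using L2_norm_triangle[OF L2_diff[OF assms(1,2)] L2_diff[OF assms(2,3)]] by simp

lemma L2_norm_zero_AE:
  assumes "f \<in> L2 c" "L2_norm c f = 0" shows "AE y in weighted_measure c. f y = 0"
proof -
  have "(LINT y|weighted_measure c. (cmod (f y))\<^sup>2) = 0" using assms by (simp add: L2_norm_def)
  then have "AE y in weighted_measure c. (cmod (f y))\<^sup>2 = 0"
    by (subst (asm) integral_nonneg_eq_0_iff_AE[OF L2_integrable[OF assms(1)]]) auto
  then show ?thesis by eventually_elim simp
qed

lemma L2_pair_tendsto:
  assumes f: "\<forall>\<^sub>F x in F. f x \<in> L2 c" "l \<in> L2 c" "g \<in> L2 c"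
    and lim: "((\<lambda>x. L2_norm c (\<lambda>y. f x y - l y)) \<longlongrightarrow> 0) F"
  shows "((\<lambda>x. L2_pair c (f x) g) \<longlongrightarrow> L2_pair c l g) F"
proof (rule Lim_transform_eventually)
  have "((\<lambda>x. L2_pair c (f x) g - L2_pair c l g) \<longlongrightarrow> 0) F"
  proof (rule Lim_null_comparison)
    show "\<forall>\<^sub>F x in F. norm (L2_pair c (f x) g - L2_pair c l g) \<le> L2_norm c (\<lambda>y. f x y - l y) * L2_norm c g"
      using f(1) by eventually_elim
        (use L2_pair_bound[OF L2_diff[OF _ f(2)] f(3)] L2_pair_diff[OF _ f(2,3)] in simp)
    show "((\<lambda>x. L2_norm c (\<lambda>y. f x y - l y) * L2_norm c g) \<longlongrightarrow> 0) F"
      using tendsto_mult_left_zero[OF lim] by simp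
  qed
  from tendsto_add[OF this tendsto_const[of "L2_pair c l g"]]
  show "((\<lambda>x. L2_pair c (f x) g - L2_pair c l g + L2_pair c l g) \<longlongrightarrow> L2_pair c l g) F" by simp
qed simp

section \<open>The form domain\<close>

lemma loc_integrable_measurable_weighted:
  assumes "loc_integrable g" shows "g \<in> borel_measurable (weighted_measure c)"
  unfolding measurable_weighted_measure_iff
proof (rule borel_measurable_LIMSEQ_metric)
  fix n :: nat
  show "(\<lambda>x. indicator {1 / real (Suc n)..real (Suc n)} x *\<^sub>R g x) \<in> borel_measurable lborel"
    using loc_integrableD[OF assms, of "1 / real (Suc n)" "real (Suc n)"] by (auto simp: set_integrable_def)
next
  fix x :: real
  show "(\<lambda>n. indicator {1 / real (Suc n)..real (Suc n)} x *\<^sub>R g x) \<longlonglongrightarrow> indicator {0<..} x *\<^sub>R g x"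
  proof (cases "0 < x")
    case True
    obtain N :: nat where N: "max x (1 / x) < real N" using reals_Archimedean2 by blast
    have "indicator {1 / real (Suc n)..real (Suc n)} x = (1::real)" if "n \<ge> N" for n
    proof -
      have "max x (1 / x) < real (Suc n)" using N that by simp
      then show ?thesis using True by (auto simp: field_simps)
    qed
    then have "\<forall>\<^sub>F n in sequentially. indicator {1 / real (Suc n)..real (Suc n)} x *\<^sub>R g x = indicator {0<..} x *\<^sub>R g x"
      using True by (auto simp: eventually_sequentially intro!: exI[of _ N])
    then show ?thesis by (rule tendsto_eventually)
  next
    case False
    have "0 < 1 / real (Suc n)" for n by simp
    then have "x \<notin> {1 / real (Suc n)..real (Suc n)}" for n
      using False by (metis atLeastAtMost_iff less_le_trans)
    then show ?thesis using False by simp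
  qed
qed

lemma L1_loc_measurable:
  assumes "L1_loc c V" shows "V \<in> borel_measurable (weighted_measure c)"
proof (rule borel_measurable_LIMSEQ_metric)
  fix n :: nat
  have "0 < real (Suc n)" by simp
  then have "set_integrable (weighted_measure c) {0<..real (Suc n)} V"
    using assms by (simp only: L1_loc_def)
  then show "(\<lambda>x. indicator {0<..real (Suc n)} x *\<^sub>R V x) \<in> borel_measurable (weighted_measure c)"
    by (auto simp: set_integrable_def)
next
  fix x assume "x \<in> space (weighted_measure c)"
  then have x: "0 < x" by simp
  obtain N :: nat where N: "x < real N" using reals_Archimedean2 by blast
  have "\<forall>\<^sub>F n in sequentially. indicator {0<..real (Suc n)} x *\<^sub>R V x = V x"
    using N x by (auto simp: eventually_sequentially intro!: exI[of _ N])
  then show "(\<lambda>n. indicator {0<..real (Suc n)} x *\<^sub>R V x) \<longlonglongrightarrow> V x"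
    by (rule tendsto_eventually)
qed

lemma L2_cong_AE:
  assumes "f \<in> L2 c" "g \<in> borel_measurable (weighted_measure c)" "AE y in weighted_measure c. g y = f y"
  shows "g \<in> L2 c"
  by (rule L2_I_bound[OF assms(2) L2_integrable[OF assms(1)]]) (use assms(3) in eventually_elim, simp)

text \<open>The admissible factors for testing the equation with \<psi> u. The bounds keep \<psi> u
  in the form domain, and the sign makes the gradient and potential terms nonnegative. Absolute
  continuity instead of continuous differentiability admits the cut-off of
  \<open>inner_bound\<close>, whose derivative jumps.\<close>

definition multiplier :: "(real \<Rightarrow> real) \<Rightarrow> (real \<Rightarrow> real) \<Rightarrow> real \<Rightarrow> bool" where
  "multiplier \<psi> h B \<longleftrightarrow> locally_ac (\<lambda>x. of_real (\<psi> x)) (\<lambda>x. of_real (h x)) \<and>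
     (\<forall>x>0. 0 \<le> \<psi> x \<and> \<psi> x \<le> B \<and> \<bar>h x\<bar> \<le> B)"

lemma multiplier_measurable:
  assumes "multiplier \<psi> h B"
  shows "(\<lambda>x. complex_of_real (\<psi> x)) \<in> borel_measurable (weighted_measure c)"
    "(\<lambda>x. complex_of_real (h x)) \<in> borel_measurable (weighted_measure c)"
  using assms unfolding multiplier_def
  by (auto intro: continuous_on_measurable_weighted locally_ac_continuous
      loc_integrable_measurable_weighted locally_acD(1))

lemma form_domainD:
  assumes "u \<in> form_domain c V"
  shows "u \<in> L2 c" "has_weak_deriv u (weak_deriv u)" "weak_deriv u \<in> L2 c"
    "(\<lambda>y. of_real (sqrt (V y)) * u y) \<in> L2 c"
proof -
  have "\<exists>g. has_weak_deriv u g" using assms by (simp add: form_domain_def)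
  then show "has_weak_deriv u (weak_deriv u)" unfolding weak_deriv_def by (rule someI_ex)
qed (use assms in \<open>simp_all add: form_domain_def\<close>)

text \<open>The product rule is applied to the absolutely continuous representative of u and then
  transferred along a null set; the bounds on \<psi> and h give the square integrability.\<close>

lemma form_domain_mult:
  assumes u: "u \<in> form_domain c V" and m: "multiplier \<psi> h B"
  shows "(\<lambda>x. of_real (\<psi> x) * u x) \<in> form_domain c V"
    "AE x in weighted_measure c. weak_deriv (\<lambda>x. of_real (\<psi> x) * u x) x = of_real (h x) * u x + of_real (\<psi> x) * weak_deriv u x"
proof -
  let ?\<psi> = "\<lambda>x. complex_of_real (\<psi> x)" and ?h = "\<lambda>x. complex_of_real (h x)"
  let ?g = "weak_deriv u"
  have ac: "locally_ac ?\<psi> ?h" and bd: "\<And>x. 0 < x \<Longrightarrow> cmod (?\<psi> x) \<le> B" "\<And>x. 0 < x \<Longrightarrow> cmod (?h x) \<le> B"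
    using m by (auto simp: multiplier_def)
  note u' = form_domainD[OF u]
  obtain v where v: "locally_ac v ?g" "AE x in lborel. 0 < x \<longrightarrow> u x = v x"
    using has_weak_deriv_imp_locally_ac[OF u'(2)] by blast
  have ul: "loc_integrable u" using u'(2) by (simp add: has_weak_deriv_def)
  have w: "has_weak_deriv (\<lambda>x. ?\<psi> x * u x) (\<lambda>x. ?h x * v x + ?\<psi> x * ?g x)"
  proof (rule has_weak_deriv_cong_AE[OF locally_ac_imp_has_weak_deriv[OF locally_ac_mult[OF ac v(1)]]])
    show "loc_integrable (\<lambda>x. ?\<psi> x * u x)"
      using loc_integrable_mult_continuous[OF ul locally_ac_continuous[OF ac]] by (simp add: mult.commute)
    show "AE x in lborel. 0 < x \<longrightarrow> ?\<psi> x * u x = ?\<psi> x * v x"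
      using v(2) by eventually_elim simp
  qed
  have w2: "has_weak_deriv (\<lambda>x. ?\<psi> x * u x) (weak_deriv (\<lambda>x. ?\<psi> x * u x))"
    using someI[of "has_weak_deriv (\<lambda>x. ?\<psi> x * u x)", OF w] by (simp only: weak_deriv_def)
  show AE: "AE x in weighted_measure c. weak_deriv (\<lambda>x. ?\<psi> x * u x) x = ?h x * u x + ?\<psi> x * ?g x"
    unfolding AE_weighted_measure using has_weak_deriv_unique[OF w2 w] v(2)
    by eventually_elim simp
  have L: "(\<lambda>x. ?h x * u x + ?\<psi> x * ?g x) \<in> L2 c" "(\<lambda>x. ?\<psi> x * u x) \<in> L2 c"
    by (intro L2_add L2_bounded_mult[where B=B] u' multiplier_measurable[OF m] bd; assumption)+
  have "weak_deriv (\<lambda>x. ?\<psi> x * u x) \<in> L2 c"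
    by (rule L2_cong_AE[OF L(1) loc_integrable_measurable_weighted AE])
       (use w2 in \<open>simp add: has_weak_deriv_def\<close>)
  moreover have "(\<lambda>y. of_real (sqrt (V y)) * (?\<psi> y * u y)) \<in> L2 c"
    using L2_bounded_mult[OF u'(4) multiplier_measurable(1)[OF m] bd(1)]
    by (simp add: mult.left_commute)
  ultimately show "(\<lambda>x. ?\<psi> x * u x) \<in> form_domain c V"
    unfolding form_domain_def using L(2) w by blast
qed

lemma Bn_minusD:
  assumes "(u, w) \<in> Bn_minus c V"
  shows "u \<in> form_domain c V" "w \<in> L2 c"
    "v \<in> form_domain c V \<Longrightarrow> form_V c V u v = L2_inner c (\<lambda>y. - w y) v"
  using assms by (auto simp: Bn_minus_def)

text \<open>The equation is tested with \<psi> u. Of the potential term, Q, only the sign is handed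
  on, so later estimates never see the size of V.\<close>

lemma form_identity:
  assumes uw: "(u, w) \<in> Bn_minus c V" and m: "multiplier \<psi> h B"
    and V: "AE y in weighted_measure c. 0 \<le> V y" "V \<in> borel_measurable (weighted_measure c)"
  obtains Q :: real where "0 \<le> Q"
    "- L2_pair c w (\<lambda>y. of_real (\<psi> y) * cnj (u y)) =
       of_real (LINT y|weighted_measure c. \<psi> y * (cmod (weak_deriv u y))\<^sup>2) + of_real Q
       + (LINT y|weighted_measure c. of_real (h y) * (weak_deriv u y * cnj (u y)))"
proof -
  let ?M = "weighted_measure c"
  let ?\<psi> = "\<lambda>x. complex_of_real (\<psi> x)" and ?h = "\<lambda>x. complex_of_real (h x)"
  let ?g = "weak_deriv u" and ?s = "\<lambda>y. complex_of_real (sqrt (V y)) * u y"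
  note u = Bn_minusD(1)[OF uw] and w = Bn_minusD(2)[OF uw]
  note u' = form_domainD[OF u]
  note mult = form_domain_mult[OF u m]
  have bd: "\<And>x. 0 < x \<Longrightarrow> cmod (?\<psi> x) \<le> B" "\<And>x. 0 < x \<Longrightarrow> cmod (?h x) \<le> B" "\<And>x. 0 < x \<Longrightarrow> 0 \<le> \<psi> x"
    using m by (auto simp: multiplier_def)
  have \<psi>L: "(\<lambda>y. ?\<psi> y * f y) \<in> L2 c" and hL: "(\<lambda>y. ?h y * f y) \<in> L2 c" if "f \<in> L2 c" for f
    by (intro L2_bounded_mult[OF that _ bd(1)] L2_bounded_mult[OF that _ bd(2)] multiplier_measurable[OF m]; assumption)+
  define Q where "Q = (LINT y|?M. \<psi> y * (cmod (?s y))\<^sup>2)"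
  have sq: "?\<psi> y * f y * cnj (f y) = of_real (\<psi> y * (cmod (f y))\<^sup>2)" for f y
    using complex_norm_square[of "f y"] by (simp add: mult.assoc)
  have ig: "integrable ?M (\<lambda>y. ?\<psi> y * ?g y * cnj (?g y))"
    by (intro L2_mult_integrable(1) \<psi>L L2_cnj u')
  have iv: "integrable ?M (\<lambda>y. ?\<psi> y * ?s y * cnj (?s y))"
    by (intro L2_mult_integrable(1) \<psi>L L2_cnj u')
  have ih: "integrable ?M (\<lambda>y. ?h y * (?g y * cnj (u y)))"
    using L2_mult_integrable(1)[OF hL[OF u'(3)] L2_cnj[OF u'(1)]] by (simp add: mult.assoc)
  have [measurable]: "u \<in> borel_measurable ?M" "?g \<in> borel_measurable ?M" "?\<psi> \<in> borel_measurable ?M"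
      "?h \<in> borel_measurable ?M" "V \<in> borel_measurable ?M" "weak_deriv (\<lambda>x. ?\<psi> x * u x) \<in> borel_measurable ?M"
      "(\<lambda>y. cnj (u y)) \<in> borel_measurable ?M" "(\<lambda>y. cnj (?g y)) \<in> borel_measurable ?M"
      "(\<lambda>y. cnj (weak_deriv (\<lambda>x. ?\<psi> x * u x) y)) \<in> borel_measurable ?M"
    using u' V(2) form_domainD(3)[OF mult(1)] L2_cnj multiplier_measurable[OF m] by blast+
  have "form_V c V u (\<lambda>y. ?\<psi> y * u y) =
     (LINT y|?M. ?\<psi> y * ?g y * cnj (?g y) + ?\<psi> y * ?s y * cnj (?s y) + ?h y * (?g y * cnj (u y)))"
    unfolding form_V_def
  proof (rule integral_cong_AE)
    show "AE y in ?M. ?g y * cnj (weak_deriv (\<lambda>y. ?\<psi> y * u y) y) + complex_of_real (V y) * u y * cnj (?\<psi> y * u y)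
       = ?\<psi> y * ?g y * cnj (?g y) + ?\<psi> y * ?s y * cnj (?s y) + ?h y * (?g y * cnj (u y))"
      using V(1) mult(2)
    proof eventually_elim
      fix y assume "0 \<le> V y" and d: "weak_deriv (\<lambda>x. ?\<psi> x * u x) y = ?h y * u y + ?\<psi> y * ?g y"
      then have "complex_of_real (V y) = complex_of_real (sqrt (V y)) * complex_of_real (sqrt (V y))"
        by (simp flip: of_real_mult)
      then show "?g y * cnj (weak_deriv (\<lambda>y. ?\<psi> y * u y) y) + complex_of_real (V y) * u y * cnj (?\<psi> y * u y)
       = ?\<psi> y * ?g y * cnj (?g y) + ?\<psi> y * ?s y * cnj (?s y) + ?h y * (?g y * cnj (u y))"
        unfolding d by (simp add: algebra_simps)
    qed
  next
    have "(\<lambda>y. cnj (?\<psi> y * u y)) \<in> borel_measurable ?M" by simp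
    then show "(\<lambda>y. ?g y * cnj (weak_deriv (\<lambda>y. ?\<psi> y * u y) y) + complex_of_real (V y) * u y * cnj (?\<psi> y * u y)) \<in> borel_measurable ?M"
      by measurable
    show "(\<lambda>y. ?\<psi> y * ?g y * cnj (?g y) + ?\<psi> y * ?s y * cnj (?s y) + ?h y * (?g y * cnj (u y))) \<in> borel_measurable ?M"
      by (intro borel_measurable_add borel_measurable_integrable ig iv ih)
  qed
  also have "\<dots> = (LINT y|?M. ?\<psi> y * ?g y * cnj (?g y)) + (LINT y|?M. ?\<psi> y * ?s y * cnj (?s y)) + (LINT y|?M. ?h y * (?g y * cnj (u y)))"
    using ig iv ih by (simp add: Bochner_Integration.integral_add)
  also have "(LINT y|?M. ?\<psi> y * ?g y * cnj (?g y)) = of_real (LINT y|?M. \<psi> y * (cmod (?g y))\<^sup>2)"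
    by (simp only: sq integral_complex_of_real)
  also have "(LINT y|?M. ?\<psi> y * ?s y * cnj (?s y)) = of_real Q"
    unfolding Q_def integral_complex_of_real[symmetric]
    by (rule Bochner_Integration.integral_cong[OF refl sq])
  finally have 1: "form_V c V u (\<lambda>y. ?\<psi> y * u y) = of_real (LINT y|?M. \<psi> y * (cmod (?g y))\<^sup>2) + of_real Q
     + (LINT y|?M. ?h y * (?g y * cnj (u y)))" .
  have 2: "form_V c V u (\<lambda>y. ?\<psi> y * u y) = - L2_pair c w (\<lambda>y. ?\<psi> y * cnj (u y))"
    unfolding Bn_minusD(3)[OF uw mult(1)] L2_inner_def L2_pair_def
    by (simp flip: Bochner_Integration.integral_minus)
  have "0 \<le> Q" unfolding Q_def by (intro integral_nonneg_AE AE_weighted_I) (use bd(3) in auto)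
  then show ?thesis by (rule that) (rule trans[OF 2[symmetric] 1])
qed

section \<open>Pointwise bounds for absolutely continuous functions\<close>

lemma locally_ac_square:
  assumes u: "locally_ac u g" and ab: "0 < a" "a \<le> b"
  shows "set_integrable lborel {a..b} (\<lambda>x. Re (g x * cnj (u x)))"
    "(cmod (u b))\<^sup>2 = (cmod (u a))\<^sup>2 + 2 * (LINT x:{a..b}|lborel. Re (g x * cnj (u x)))"
    "set_integrable lborel {a..b} (\<lambda>x. cmod (u x) * cmod (g x))"
proof -
  note ac = locally_ac_mult[OF u locally_ac_cnj[OF u]]
  have cont: "continuous_on {a..b} (\<lambda>x. cnj (u x))"
    by (intro continuous_intros continuous_on_subset[OF locally_ac_continuous[OF u]]) (use ab in auto)
  have i: "set_integrable lborel {a..b} (\<lambda>x. g x * cnj (u x))"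
    by (rule set_integrable_mult_continuous[OF locally_acD(3)[OF u ab(1)] cont])
  have iR: "integrable lborel (\<lambda>x. Re (indicator {a..b} x *\<^sub>R (g x * cnj (u x))))"
    using i unfolding set_integrable_def by (rule integrable_Re)
  then show si: "set_integrable lborel {a..b} (\<lambda>x. Re (g x * cnj (u x)))"
    unfolding set_integrable_def by simp
  have "integrable lborel (\<lambda>x. cmod (indicator {a..b} x *\<^sub>R (g x * cnj (u x))))"
    using i unfolding set_integrable_def by (rule integrable_norm)
  moreover have "(\<lambda>x. cmod (indicator {a..b} x *\<^sub>R (g x * cnj (u x)))) = (\<lambda>x. indicator {a..b} x *\<^sub>R (cmod (u x) * cmod (g x)))"
    by (auto simp: norm_mult mult_ac indicator_def)
  ultimately show "set_integrable lborel {a..b} (\<lambda>x. cmod (u x) * cmod (g x))"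
    unfolding set_integrable_def by simp
  have e: "g x * cnj (u x) + u x * cnj (g x) = complex_of_real (2 * Re (g x * cnj (u x)))" for x
    by (simp add: complex_eq_iff algebra_simps)
  have "complex_of_real ((cmod (u b))\<^sup>2) = complex_of_real ((cmod (u a))\<^sup>2) + (LINT x:{a..b}|lborel. complex_of_real (2 * Re (g x * cnj (u x))))"
    using locally_acD(2)[OF ac ab] unfolding e complex_norm_square .
  also have "\<dots> = complex_of_real ((cmod (u a))\<^sup>2 + (LINT x:{a..b}|lborel. 2 * Re (g x * cnj (u x))))"
    by (simp only: set_integral_complex_of_real of_real_add)
  finally have "(cmod (u b))\<^sup>2 = (cmod (u a))\<^sup>2 + (LINT x:{a..b}|lborel. 2 * Re (g x * cnj (u x)))"
    by (simp only: of_real_eq_iff)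
  then show "(cmod (u b))\<^sup>2 = (cmod (u a))\<^sup>2 + 2 * (LINT x:{a..b}|lborel. Re (g x * cnj (u x)))"
    by (simp only: set_integral_mult_right)
qed

text \<open>For x in the window, |u(y)|^2 exceeds |u(x)|^2 by at most twice the integral of |u|
  |u'|; this is integrated over x. The window lies to the right of y, away from the origin.\<close>

lemma locally_ac_average_bound:
  assumes u: "locally_ac u g" and yr: "0 < y" "0 < r"
  shows "r * (cmod (u y))\<^sup>2 \<le> (LINT x:{y..y + r}|lborel. (cmod (u x))\<^sup>2)
    + 2 * r * (LINT x:{y..y + r}|lborel. cmod (u x) * cmod (g x))"
proof -
  let ?I = "{y..y + r}" and ?J = "LINT x:{y..y + r}|lborel. cmod (u x) * cmod (g x)"
  have sq: "set_integrable lborel ?I (\<lambda>x. (cmod (u x))\<^sup>2)"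
    unfolding set_integrable_def
    by (intro borel_integrable_compact compact_Icc continuous_intros
        continuous_on_subset[OF locally_ac_continuous[OF u]]) (use yr in auto)
  have pt: "(cmod (u y))\<^sup>2 - 2 * ?J \<le> (cmod (u x))\<^sup>2" if "x \<in> ?I" for x
  proof -
    have yx: "y \<le> x" using that by simp
    have le: "- (cmod (u t) * cmod (g t)) \<le> Re (g t * cnj (u t))" for t
      using abs_Re_le_cmod[of "g t * cnj (u t)"] by (simp add: norm_mult mult.commute)
    have i1: "set_integrable lborel {y..x} (\<lambda>t. cmod (u t) * cmod (g t))"
      by (rule locally_ac_square(3)[OF u yr(1) yx])
    have i2: "set_integrable lborel ?I (\<lambda>t. cmod (u t) * cmod (g t))"
      by (rule locally_ac_square(3)[OF u yr(1)]) (use yr in auto)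
    have "(LINT t:{y..x}|lborel. cmod (u t) * cmod (g t)) \<le> ?J"
      unfolding set_lebesgue_integral_def
      by (rule integral_mono) (use i1 i2 that in \<open>auto simp: set_integrable_def indicator_def\<close>)
    moreover have "(LINT t:{y..x}|lborel. - (cmod (u t) * cmod (g t))) \<le> (LINT t:{y..x}|lborel. Re (g t * cnj (u t)))"
      by (rule set_integral_mono) (use i1 locally_ac_square(1)[OF u yr(1) yx] le in \<open>auto simp: set_integrable_def\<close>)
    moreover have "(LINT t:{y..x}|lborel. - (cmod (u t) * cmod (g t))) = - (LINT t:{y..x}|lborel. cmod (u t) * cmod (g t))"
      by (rule set_integral_uminus[OF i1])
    ultimately show ?thesis using locally_ac_square(2)[OF u yr(1) yx] by linarith
  qed
  have "(LINT x:?I|lborel. (cmod (u y))\<^sup>2 - 2 * ?J) \<le> (LINT x:?I|lborel. (cmod (u x))\<^sup>2)"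
  proof (rule set_integral_mono[OF _ sq pt])
    show "set_integrable lborel ?I (\<lambda>_. (cmod (u y))\<^sup>2 - 2 * ?J)"
      unfolding set_integrable_def by (intro borel_integrable_compact compact_Icc continuous_on_const)
  qed
  moreover have "(LINT x:?I|lborel. (cmod (u y))\<^sup>2 - 2 * ?J) = r * ((cmod (u y))\<^sup>2 - 2 * ?J)"
    using yr by (simp add: set_lebesgue_integral_def)
  ultimately show ?thesis by (simp add: algebra_simps)
qed

text \<open>On {a..b} the density is bounded below by 1 / K, so Lebesgue measure is at most K times
  the weighted measure there.\<close>

lemma lborel_le_weighted:
  fixes F :: "real \<Rightarrow> real"
  assumes F: "integrable (weighted_measure c) F" "\<And>x. 0 < x \<Longrightarrow> 0 \<le> F x"
    and a: "0 < a" and K: "\<And>x. a \<le> x \<Longrightarrow> x \<le> b \<Longrightarrow> x powr (- c) \<le> K" "0 \<le> K"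
  shows "(LINT x:{a..b}|lborel. F x) \<le> K * (LINT x|weighted_measure c. indicator {a..b} x * F x)"
    "set_integrable lborel {a..b} F"
proof -
  let ?M = "weighted_measure c"
  have m: "F \<in> borel_measurable ?M" using F by auto
  have S: "{a..b} \<in> sets ?M" using a by (auto simp: sets_weighted_measure sets_restrict_space_iff)
  have iM: "integrable ?M (\<lambda>x. indicator {a..b} x * F x)"
    using integrable_mult_indicator[OF S F(1)] by simp
  have mM: "(\<lambda>x. indicator {a..b} x * F x) \<in> borel_measurable ?M" using iM by auto
  have "set_integrable lborel {0<..} (\<lambda>x. x powr c *\<^sub>R (indicator {a..b} x * F x))"
    using iM integrable_weighted_iff[OF mM] by simp
  then have i: "integrable lborel (\<lambda>x. K * (indicator {0<..} x *\<^sub>R (x powr c *\<^sub>R (indicator {a..b} x * F x))))"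
    by (intro integrable_mult_right) (simp add: set_integrable_def)
  have le: "norm (indicator {a..b} x *\<^sub>R F x) \<le> K * (indicator {0<..} x *\<^sub>R (x powr c *\<^sub>R (indicator {a..b} x * F x)))" for x
  proof (cases "x \<in> {a..b}")
    case True
    then have x: "0 < x" using a by auto
    have "1 = x powr (- c) * x powr c" using x by (simp add: powr_minus)
    also have "\<dots> \<le> K * x powr c" using True K(1)[of x] by (intro mult_right_mono) auto
    finally have "1 * F x \<le> (K * x powr c) * F x" using F(2)[OF x] by (intro mult_right_mono) auto
    then show ?thesis using True x F(2)[OF x] by (simp add: mult.assoc)
  qed simp
  have me: "(\<lambda>x. indicator {a..b} x *\<^sub>R F x) \<in> borel_measurable lborel"
  proof -
    have "(\<lambda>x. indicator {0<..} x *\<^sub>R (indicator {a..b} x * F x)) = (\<lambda>x. indicator {a..b} x *\<^sub>R F x)"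
      using a by (auto simp: indicator_def)
    then show ?thesis using mM unfolding measurable_weighted_measure_iff by simp
  qed
  show "set_integrable lborel {a..b} F"
    unfolding set_integrable_def by (rule Bochner_Integration.integrable_bound[OF i me]) (intro AE_I2 order_trans[OF le], simp)
  then have i0: "integrable lborel (\<lambda>x. indicator {a..b} x *\<^sub>R F x)" by (simp add: set_integrable_def)
  have "(LINT x:{a..b}|lborel. F x) \<le> (\<integral>x. K * (indicator {0<..} x *\<^sub>R (x powr c *\<^sub>R (indicator {a..b} x * F x))) \<partial>lborel)"
    unfolding set_lebesgue_integral_def
    by (rule integral_mono[OF i0 i]) (use le in \<open>metis norm_ge_zero abs_ge_self order_trans real_norm_def\<close>)
  also have "\<dots> = K * (LINT x|?M. indicator {a..b} x * F x)"
    unfolding integral_weighted[OF mM] set_lebesgue_integral_def by (rule Bochner_Integration.integral_mult_right_zero)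
  finally show "(LINT x:{a..b}|lborel. F x) \<le> K * (LINT x|?M. indicator {a..b} x * F x)" .
qed

lemma continuous_AE_eq:
  fixes v w :: "real \<Rightarrow> complex"
  assumes "continuous_on {0<..} v" "continuous_on {0<..} w" "AE x in lborel. 0 < x \<longrightarrow> v x = w x" "0 < x"
  shows "v x = w x"
proof (rule ccontr)
  assume ne: "v x \<noteq> w x"
  have "continuous_on {0<..} (\<lambda>x. v x - w x)" by (intro continuous_intros assms)
  then have "open ({0<..} \<inter> (\<lambda>x. v x - w x) -` (- {0}))"
    by (intro continuous_open_preimage) auto
  moreover have "x \<in> {0<..} \<inter> (\<lambda>x. v x - w x) -` (- {0})" using ne assms(4) by auto
  ultimately obtain e where e: "0 < e" "ball x e \<subseteq> {0<..} \<inter> (\<lambda>x. v x - w x) -` (- {0})"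
    unfolding open_contains_ball by blast
  have "AE y in lborel. y \<notin> ball x e"
    using assms(3) by eventually_elim (use e(2) in auto)
  then have "emeasure lborel (ball x e) = 0"
    by (subst (asm) AE_iff_measurable[of "ball x e"]) auto
  then show False using e(1) by (simp add: ball_eq_greaterThanLessThan)
qed

section \<open>Continuous representatives and local Hoelder continuity\<close>

definition has_rep :: "(real \<Rightarrow> complex) \<Rightarrow> bool" where
  "has_rep u \<longleftrightarrow> (\<exists>v. continuous_on {0<..} v \<and> (AE x in lborel. 0 < x \<longrightarrow> u x = v x))"

text \<open>The continuous representative; outside the half-line its values are junk.\<close>
definition rep :: "(real \<Rightarrow> complex) \<Rightarrow> real \<Rightarrow> complex" where
  "rep u = (SOME v. continuous_on {0<..} v \<and> (AE x in lborel. 0 < x \<longrightarrow> u x = v x))"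

lemma rep:
  assumes "has_rep u"
  shows "continuous_on {0<..} (rep u)" "AE x in weighted_measure c. u x = rep u x"
  using someI_ex[OF assms[unfolded has_rep_def]] unfolding rep_def[symmetric] AE_weighted_measure by auto

lemma rep_eqI:
  assumes "continuous_on {0<..} v" "AE x in weighted_measure c. u x = v x"
  shows "has_rep u" "0 < x \<Longrightarrow> rep u x = v x"
proof -
  show h: "has_rep u" using assms by (auto simp: has_rep_def AE_weighted_measure)
  have "AE x in lborel. 0 < x \<longrightarrow> rep u x = v x"
    using rep(2)[OF h, of c] assms(2) unfolding AE_weighted_measure by eventually_elim auto
  then show "rep u x = v x" if "0 < x" using continuous_AE_eq[OF rep(1)[OF h] assms(1) _ that] by simp
qed

lemma rep_diff:
  assumes "has_rep u" "has_rep v" "AE x in weighted_measure c. w x = u x - v x" "0 < x"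
  shows "rep w x = rep u x - rep v x"
proof (rule rep_eqI(2)[OF _ _ assms(4)])
  show "continuous_on {0<..} (\<lambda>x. rep u x - rep v x)"
    by (intro continuous_intros rep assms)
  show "AE x in weighted_measure c. w x = rep u x - rep v x"
    using assms(3) rep(2)[OF assms(1), of c] rep(2)[OF assms(2), of c] by eventually_elim simp
qed

lemma locally_ac_cong:
  assumes "locally_ac v g" "\<And>x. 0 < x \<Longrightarrow> u x = v x" shows "locally_ac u g"
  using assms unfolding locally_ac_def by (metis less_le_trans)

lemma form_domain_rep:
  assumes "u \<in> form_domain c V"
  shows "has_rep u" "locally_ac (rep u) (weak_deriv u)" "rep u \<in> L2 c"
proof -
  obtain v where v: "locally_ac v (weak_deriv u)" "AE x in lborel. 0 < x \<longrightarrow> u x = v x"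
    using has_weak_deriv_imp_locally_ac[OF form_domainD(2)[OF assms]] by blast
  have AE: "AE x in weighted_measure c. u x = v x" using v(2) by (simp add: AE_weighted_measure)
  show h: "has_rep u" by (rule rep_eqI(1)[OF locally_ac_continuous[OF v(1)] AE])
  show "locally_ac (rep u) (weak_deriv u)"
    by (rule locally_ac_cong[OF v(1) rep_eqI(2)[OF locally_ac_continuous[OF v(1)] AE]])
  show "rep u \<in> L2 c"
    by (rule L2_cong_AE[OF form_domainD(1)[OF assms] continuous_on_measurable_weighted[OF rep(1)[OF h]]])
       (use rep(2)[OF h, of c] in eventually_elim, simp)
qed

lemma powr_bound_interval:
  fixes p :: real
  assumes "0 < a" "a \<le> x" "x \<le> b"
  shows "x powr p \<le> max (a powr p) (b powr p)"
proof (cases "0 \<le> p")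
  case True
  then have "x powr p \<le> b powr p" using assms by (intro powr_mono2) auto
  then show ?thesis by simp
next
  case False
  then have "x powr p \<le> a powr p" using assms by (intro powr_mono2') auto
  then show ?thesis by simp
qed

lemma Icc_sets_weighted: "0 < a \<Longrightarrow> {a..b} \<in> sets (weighted_measure c)"
  by (auto simp: sets_weighted_measure sets_restrict_space_iff)

text \<open>The norm bound is the Cauchy-Schwarz partner in the Hoelder estimate; positivity of the
  measure allows the mollifiers to be normalised.\<close>

lemma indicator_L2:
  assumes ab: "0 < a" "a \<le> b"
  shows "(\<lambda>x. complex_of_real (indicator {a..b} x)) \<in> L2 c"
    "(L2_norm c (\<lambda>x. complex_of_real (indicator {a..b} x)))\<^sup>2 \<le> max (a powr c) (b powr c) * (b - a)"
    "integrable (weighted_measure c) (indicator {a..b} :: real \<Rightarrow> real)"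
    "a < b \<Longrightarrow> 0 < measure (weighted_measure c) {a..b}"
proof -
  let ?M = "weighted_measure c" and ?K = "max (a powr c) (b powr c)"
  have mi: "(indicator {a..b} :: real \<Rightarrow> real) \<in> borel_measurable ?M"
    by (rule measurable_weighted_measureI) simp
  have e: "(\<lambda>x. indicator {0<..} x *\<^sub>R (x powr c *\<^sub>R indicator {a..b} x :: real)) = (\<lambda>x. indicator {a..b} x *\<^sub>R x powr c)"
    using ab by (auto simp: indicator_def)
  have ip: "integrable lborel (\<lambda>x. indicator {a..b} x *\<^sub>R x powr c)"
    by (intro borel_integrable_compact compact_Icc continuous_on_powr continuous_on_id continuous_on_const) (use ab in auto)
  then show im: "integrable ?M (indicator {a..b} :: real \<Rightarrow> real)"
    unfolding integrable_weighted_iff[OF mi] set_integrable_def e .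
  have int: "(LINT x|?M. indicator {a..b} x :: real) = (\<integral>x. indicator {a..b} x *\<^sub>R x powr c \<partial>lborel)"
    unfolding integral_weighted[OF mi] set_lebesgue_integral_def e ..
  have ii: "integrable lborel (\<lambda>x. indicator {a..b} x *\<^sub>R k)" for k :: real
    by (intro borel_integrable_compact compact_Icc continuous_on_const)
  have sq: "(cmod (complex_of_real (indicator {a..b} x)))\<^sup>2 = indicator {a..b} x" for x
    by (simp add: indicator_def)
  show L: "(\<lambda>x. complex_of_real (indicator {a..b} x)) \<in> L2 c"
    unfolding L2_def mem_Collect_eq sq by (intro conjI im measurable_weighted_measureI) simp
  have "(L2_norm c (\<lambda>x. complex_of_real (indicator {a..b} x)))\<^sup>2 = (\<integral>x. indicator {a..b} x *\<^sub>R x powr c \<partial>lborel)"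
    unfolding L2_norm_square[OF L] sq int ..
  also have "\<dots> \<le> (\<integral>x. indicator {a..b} x *\<^sub>R ?K \<partial>lborel)"
    by (intro integral_mono ip ii) (use ab powr_bound_interval in \<open>auto simp: indicator_def\<close>)
  also have "\<dots> = ?K * (b - a)" using ab by simp
  finally show "(L2_norm c (\<lambda>x. complex_of_real (indicator {a..b} x)))\<^sup>2 \<le> ?K * (b - a)" .
  show "0 < measure ?M {a..b}" if "a < b"
  proof -
    \<comment> \<open>The lower bound for the density is the reciprocal of the upper bound that
      \<open>powr_bound_interval\<close> gives for the exponent - c.\<close>
    define k where "k = min (a powr c) (b powr c)"
    have k: "0 < k" "\<And>x. x \<in> {a..b} \<Longrightarrow> k \<le> x powr c"
    proof -
      show "0 < k" using ab by (simp add: k_def)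
      fix x assume x: "x \<in> {a..b}"
      have "x powr (- c) \<le> max (a powr - c) (b powr - c)" using powr_bound_interval[of a x b "-c"] x ab by auto
      then have "inverse (x powr c) \<le> max (inverse (a powr c)) (inverse (b powr c))" by (simp add: powr_minus)
      moreover have "max (inverse (a powr c)) (inverse (b powr c)) = inverse k"
        using ab by (auto simp: k_def max_def min_def le_imp_inverse_le intro!: antisym)
      ultimately have "inverse (x powr c) \<le> inverse k" by simp
      then show "k \<le> x powr c" using x ab \<open>0 < k\<close> by simp
    qed
    have "0 < (b - a) * k" using k that by simp
    also have "(b - a) * k = (\<integral>x. indicator {a..b} x *\<^sub>R k \<partial>lborel)" using ab by simp
    also have "\<dots> \<le> (\<integral>x. indicator {a..b} x *\<^sub>R x powr c \<partial>lborel)"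
      by (intro integral_mono ip ii) (use k in \<open>auto simp: indicator_def\<close>)
    also have "\<dots> = measure ?M {a..b}"
    proof -
      have "{a..b} \<inter> {0<..} = {a..b}" using ab by auto
      then show ?thesis unfolding int[symmetric] using Icc_sets_weighted[OF ab(1), of b c] by simp
    qed
    finally show ?thesis .
  qed
qed

text \<open>The increment is the integral of the derivative; Cauchy-Schwarz against the indicator of
  the interval yields the exponent 1/2. The constant depends on a and b only through the extreme
  values of the density, which suffices for limits at a fixed point.\<close>

lemma form_domain_Hoelder:
  assumes u: "u \<in> form_domain c V" and ab: "0 < a" "a \<le> x" "a \<le> y" "x \<le> b" "y \<le> b"
  shows "cmod (rep u y - rep u x) \<le> max (a powr (- c)) (b powr (- c)) * sqrt (max (a powr c) (b powr c)) * sqrt \<bar>y - x\<bar>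
     * L2_norm c (weak_deriv u)"
  using ab
proof (induction x y rule: linorder_wlog)
  case (sym x y)
  then show ?case by (simp add: norm_minus_commute abs_minus_commute)
next
  case (le x y)
  let ?K = "max (a powr (- c)) (b powr (- c))" and ?g = "weak_deriv u" and ?M = "weighted_measure c"
  let ?i = "\<lambda>s. complex_of_real (indicator {x..y} s)"
  have x: "0 < x" using le by simp
  note g = form_domainD(3)[OF u] and ac = form_domain_rep(2)[OF u]
  note iL = indicator_L2(1)[OF x le(1), of c]
  have K: "0 \<le> ?K" by (simp add: le_max_iff_disj)
  have "integrable ?M (\<lambda>s. cmod (?i s) * cmod (?g s))" by (rule L2_mult_integrable(2)[OF iL g])
  moreover have "(\<lambda>s. cmod (?i s) * cmod (?g s)) = (\<lambda>s. indicator {x..y} s * cmod (?g s))" by (auto simp: indicator_def)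
  ultimately have Fi: "integrable ?M (\<lambda>s. indicator {x..y} s * cmod (?g s))" by simp
  have i: "set_integrable lborel {x..y} ?g" using locally_acD(3)[OF ac x] .
  have "cmod (rep u y - rep u x) = cmod (LINT s:{x..y}|lborel. ?g s)"
    using locally_acD(2)[OF ac x le(1)] by simp
  also have "\<dots> \<le> (LINT s:{x..y}|lborel. cmod (?g s))"
    using set_integral_norm_bound[OF i] by simp
  also have "\<dots> = (LINT s:{x..y}|lborel. indicator {x..y} s * cmod (?g s))"
    by (rule set_lebesgue_integral_cong) auto
  also have "\<dots> \<le> ?K * (LINT s|?M. indicator {x..y} s * (indicator {x..y} s * cmod (?g s)))"
    by (rule lborel_le_weighted(1)[OF Fi _ x _ K]) (use le powr_bound_interval[of a _ b "-c"] ab(1) in auto)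
  also have "(LINT s|?M. indicator {x..y} s * (indicator {x..y} s * cmod (?g s))) = (LINT s|?M. cmod (?i s) * cmod (?g s))"
    by (rule Bochner_Integration.integral_cong) (auto simp: indicator_def)
  also have "?K * \<dots> \<le> ?K * (L2_norm c ?i * L2_norm c ?g)"
    by (intro mult_left_mono K L2_Cauchy_Schwarz iL g)
  also have "\<dots> \<le> ?K * (sqrt (max (a powr c) (b powr c) * (y - x)) * L2_norm c ?g)"
  proof (intro mult_left_mono mult_right_mono K L2_norm_nonneg real_le_rsqrt)
    have "max (x powr c) (y powr c) \<le> max (a powr c) (b powr c)"
      using powr_bound_interval[of a x b c] powr_bound_interval[of a y b c] le ab(1) by auto
    then have "max (x powr c) (y powr c) * (y - x) \<le> max (a powr c) (b powr c) * (y - x)"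
      using le by (intro mult_right_mono) auto
    then show "(L2_norm c ?i)\<^sup>2 \<le> max (a powr c) (b powr c) * (y - x)"
      using indicator_L2(2)[OF x le(1), of c] by linarith
  qed
  finally show ?case using le by (simp add: real_sqrt_mult mult.assoc)
qed

section \<open>Exponential weights\<close>

text \<open>Nonnegativity of \<phi> makes \<open>exp (- \<phi>)\<close> a bounded multiplier, so
  weighted norms are finite on all of \<open>L2 c\<close>; the slope bound \<alpha> is the only
  other quantity that enters the estimates.\<close>

definition weight :: "real \<Rightarrow> (real \<Rightarrow> real) \<Rightarrow> bool" where
  "weight \<alpha> \<phi> \<longleftrightarrow> 0 \<le> \<alpha> \<and> (\<forall>x. 0 \<le> \<phi> x) \<and>
     (\<exists>\<phi>'. (\<forall>x. (\<phi> has_real_derivative \<phi>' x) (at x) \<and> \<bar>\<phi>' x\<bar> \<le> \<alpha>) \<and> continuous_on UNIV \<phi>')"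

definition wnorm :: "real \<Rightarrow> (real \<Rightarrow> real) \<Rightarrow> (real \<Rightarrow> complex) \<Rightarrow> real" where
  "wnorm c \<phi> f = L2_norm c (\<lambda>y. of_real (exp (- \<phi> y)) * f y)"

lemma weight_nonneg: "weight \<alpha> \<phi> \<Longrightarrow> 0 \<le> \<alpha>" "weight \<alpha> \<phi> \<Longrightarrow> 0 \<le> \<phi> x"
  by (auto simp: weight_def)

lemma weight_Lipschitz:
  assumes "weight \<alpha> \<phi>" shows "\<bar>\<phi> x - \<phi> y\<bar> \<le> \<alpha> * \<bar>x - y\<bar>"
proof -
  obtain \<phi>' where "\<And>x. (\<phi> has_real_derivative \<phi>' x) (at x)" "\<And>x. \<bar>\<phi>' x\<bar> \<le> \<alpha>"
    using assms by (auto simp: weight_def)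
  then show ?thesis
    using field_differentiable_bound[of UNIV \<phi> \<phi>' \<alpha> x y] by simp
qed

lemma weight_measurable:
  assumes "weight \<alpha> \<phi>"
  shows "(\<lambda>y. complex_of_real (exp (- \<phi> y))) \<in> borel_measurable (weighted_measure c)"
proof (rule continuous_on_measurable_weighted)
  have "continuous_on {0<..} \<phi>"
    using assms unfolding weight_def by (meson DERIV_isCont continuous_at_imp_continuous_on)
  then show "continuous_on {0<..} (\<lambda>y. complex_of_real (exp (- \<phi> y)))"
    by (intro continuous_intros)
qed

lemma weight_L2:
  assumes "weight \<alpha> \<phi>" "f \<in> L2 c" shows "(\<lambda>y. of_real (exp (- \<phi> y)) * f y) \<in> L2 c"
  by (rule L2_bounded_mult[OF assms(2) weight_measurable[OF assms(1)], where B=1])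
     (use weight_nonneg(2)[OF assms(1)] in auto)

lemma wnorm_nonneg [simp]: "0 \<le> wnorm c \<phi> f"
  by (simp add: wnorm_def)

text \<open>The second conclusion is the essential one: the derivative of
  \<open>exp (- 2 * \<phi>)\<close> is bounded by 2 \<alpha> times the function itself, so the
  commutator term is again measured in weighted norms.\<close>

lemma weight_multiplier:
  assumes "weight \<alpha> \<phi>"
  obtains h where "multiplier (\<lambda>x. exp (- \<phi> x) * exp (- \<phi> x)) h (max 1 (2 * \<alpha>))"
    "\<And>x. \<bar>h x\<bar> \<le> 2 * \<alpha> * (exp (- \<phi> x) * exp (- \<phi> x))"
proof -
  obtain \<phi>' where d: "\<And>x. (\<phi> has_real_derivative \<phi>' x) (at x)" "\<And>x. \<bar>\<phi>' x\<bar> \<le> \<alpha>" "continuous_on UNIV \<phi>'"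
    using assms by (auto simp: weight_def)
  have c: "continuous_on A \<phi>" "continuous_on A \<phi>'" for A
    using d by (meson DERIV_isCont continuous_at_imp_continuous_on, meson continuous_on_subset subset_UNIV)
  let ?\<psi> = "\<lambda>x. exp (- \<phi> x) * exp (- \<phi> x)"
  let ?h = "\<lambda>x. - 2 * \<phi>' x * (exp (- \<phi> x) * exp (- \<phi> x))"
  have b: "\<bar>?h x\<bar> \<le> 2 * \<alpha> * ?\<psi> x" for x
    using d(2)[of x] by (simp add: abs_mult)
  have p: "?\<psi> x \<le> 1" for x using weight_nonneg(2)[OF assms, of x] by (simp add: mult_le_one)
  have bb: "\<bar>?h x\<bar> \<le> max 1 (2 * \<alpha>)" for x
  proof -
    have "2 * \<alpha> * ?\<psi> x \<le> 2 * \<alpha> * 1" using weight_nonneg(1)[OF assms] p[of x] by (intro mult_left_mono) auto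
    then show ?thesis using b[of x] by simp
  qed
  have ac: "locally_ac (\<lambda>x. of_real (?\<psi> x)) (\<lambda>x. of_real (?h x))"
  proof (rule locally_ac_DERIV)
    show "(?\<psi> has_real_derivative ?h x) (at x)" for x
      by (rule derivative_eq_intros d(1) refl | simp add: algebra_simps)+
    show "continuous_on {0<..} ?h" by (intro continuous_intros c)
  qed
  show ?thesis
    by (rule that[of ?h]) (use ac p bb b in \<open>auto simp: multiplier_def max.coboundedI1\<close>)
qed

text \<open>Both parts come from the equation tested with \<open>exp (- 2 * \<phi>)\<close> times u,
  whose commutator term H is at most 2 \<alpha> times the product of the weighted norms of u' and u.
  The first part is its real part. In the second the equation is rotated by z, so H costs |z| while
  the gradient term only helps with Re z; the quotient |z|^2 / Re z is what confines uniform bounds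
  to sectors.\<close>

lemma energy_estimate:
  assumes uw: "(u, w) \<in> Bn_minus c V" and wt: "weight \<alpha> \<phi>"
    and V: "AE y in weighted_measure c. 0 \<le> V y" "V \<in> borel_measurable (weighted_measure c)"
  shows "(wnorm c \<phi> (weak_deriv u))\<^sup>2 \<le> wnorm c \<phi> w * wnorm c \<phi> u
      + 2 * \<alpha> * wnorm c \<phi> (weak_deriv u) * wnorm c \<phi> u"
    and "0 < Re z \<Longrightarrow> Re (z * L2_pair c (\<lambda>y. of_real (exp (- \<phi> y)) * w y) (\<lambda>y. cnj (of_real (exp (- \<phi> y)) * u y)))
      \<le> \<alpha>\<^sup>2 * (cmod z)\<^sup>2 / Re z * (wnorm c \<phi> u)\<^sup>2"
proof -
  let ?M = "weighted_measure c" and ?g = "weak_deriv u" and ?e = "\<lambda>y. exp (- \<phi> y)"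
  define X where "X = wnorm c \<phi> ?g"
  define Y where "Y = wnorm c \<phi> u"
  define W where "W = wnorm c \<phi> w"
  obtain h where h: "multiplier (\<lambda>x. ?e x * ?e x) h (max 1 (2 * \<alpha>))" "\<And>x. \<bar>h x\<bar> \<le> 2 * \<alpha> * (?e x * ?e x)"
    using weight_multiplier[OF wt] by blast
  obtain Q where Q: "0 \<le> Q" "- L2_pair c w (\<lambda>y. of_real (?e y * ?e y) * cnj (u y)) =
       of_real (LINT y|?M. ?e y * ?e y * (cmod (?g y))\<^sup>2) + of_real Q
       + (LINT y|?M. of_real (h y) * (?g y * cnj (u y)))"
    using form_identity[OF uw h(1) V] by blast
  define H where "H = (LINT y|?M. complex_of_real (h y) * (?g y * cnj (u y)))"
  define P where "P = L2_pair c (\<lambda>y. of_real (?e y) * w y) (\<lambda>y. cnj (of_real (?e y) * u y))"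
  note u = form_domainD[OF Bn_minusD(1)[OF uw]] and w = Bn_minusD(2)[OF uw]
  have eL: "(\<lambda>y. of_real (?e y) * f y) \<in> L2 c" if "f \<in> L2 c" for f by (rule weight_L2[OF wt that])
  have nonneg: "0 \<le> X" "0 \<le> Y" "0 \<le> W" by (simp_all add: X_def Y_def W_def)
  have X2: "(LINT y|?M. ?e y * ?e y * (cmod (?g y))\<^sup>2) = X\<^sup>2"
    unfolding X_def wnorm_def L2_norm_square[OF eL[OF u(3)]]
    by (rule Bochner_Integration.integral_cong) (auto simp: norm_mult power2_eq_square)
  have PP: "L2_pair c w (\<lambda>y. of_real (?e y * ?e y) * cnj (u y)) = P"
    unfolding P_def L2_pair_def by (rule Bochner_Integration.integral_cong) auto
  have eq: "- P = of_real (X\<^sup>2 + Q) + H"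
    using Q(2) unfolding X2 PP H_def by simp
  have iXY: "integrable ?M (\<lambda>y. cmod (of_real (?e y) * ?g y) * cmod (of_real (?e y) * u y))"
    by (rule L2_mult_integrable(2)[OF eL eL]) (use u in auto)
  have "cmod H \<le> (LINT y|?M. cmod (complex_of_real (h y) * (?g y * cnj (u y))))"
    unfolding H_def by (rule integral_norm_bound)
  also have "\<dots> \<le> (LINT y|?M. 2 * \<alpha> * (cmod (of_real (?e y) * ?g y) * cmod (of_real (?e y) * u y)))"
  proof (rule integral_mono_AE')
    show "integrable ?M (\<lambda>y. 2 * \<alpha> * (cmod (of_real (?e y) * ?g y) * cmod (of_real (?e y) * u y)))"
      using iXY by simp
    show "AE y in ?M. cmod (complex_of_real (h y) * (?g y * cnj (u y))) \<le> 2 * \<alpha> * (cmod (of_real (?e y) * ?g y) * cmod (of_real (?e y) * u y))"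
    proof (rule AE_I2)
      fix y
      have "\<bar>h y\<bar> * (cmod (?g y) * cmod (u y)) \<le> 2 * \<alpha> * (?e y * ?e y) * (cmod (?g y) * cmod (u y))"
        by (intro mult_right_mono h) auto
      then show "cmod (complex_of_real (h y) * (?g y * cnj (u y))) \<le> 2 * \<alpha> * (cmod (of_real (?e y) * ?g y) * cmod (of_real (?e y) * u y))"
        by (simp add: norm_mult mult_ac)
    qed
    show "AE y in ?M. 0 \<le> 2 * \<alpha> * (cmod (of_real (?e y) * ?g y) * cmod (of_real (?e y) * u y))"
      using weight_nonneg(1)[OF wt] by (intro AE_I2) (metis mult_nonneg_nonneg norm_ge_zero zero_le_numeral)
  qed
  also have "\<dots> \<le> 2 * \<alpha> * (X * Y)"
    unfolding Bochner_Integration.integral_mult_right_zero X_def Y_def wnorm_def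
    by (intro mult_left_mono L2_Cauchy_Schwarz eL u) (use weight_nonneg(1)[OF wt] in auto)
  finally have HB: "cmod H \<le> 2 * \<alpha> * (X * Y)" .
  have PB: "cmod P \<le> W * Y"
    unfolding P_def W_def Y_def wnorm_def
    using L2_pair_bound[OF eL[OF w] L2_cnj[OF eL[OF u(1)]]] by (simp only: L2_norm_cnj)
  have "X\<^sup>2 + Q = Re (- P - H)" using eq by simp
  also have "\<dots> \<le> cmod P + cmod H"
    using complex_Re_le_cmod[of "- P - H"] norm_triangle_ineq4[of "- P" H] by simp
  finally have "X\<^sup>2 \<le> W * Y + 2 * \<alpha> * X * Y" using PB HB Q(1) by (simp add: mult.assoc)
  then show "(wnorm c \<phi> ?g)\<^sup>2 \<le> wnorm c \<phi> w * wnorm c \<phi> u + 2 * \<alpha> * wnorm c \<phi> ?g * wnorm c \<phi> u"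
    by (simp add: X_def Y_def W_def)
  show "Re (z * P) \<le> \<alpha>\<^sup>2 * (cmod z)\<^sup>2 / Re z * (wnorm c \<phi> u)\<^sup>2" if z: "0 < Re z"
  proof -
    have "z * P = - (of_real (X\<^sup>2 + Q) * z) - z * H"
    proof -
      have "P = - (of_real (X\<^sup>2 + Q) + H)" using eq by (metis add.inverse_inverse)
      then show ?thesis by (simp only:) (simp add: algebra_simps)
    qed
    then have "Re (z * P) = - ((X\<^sup>2 + Q) * Re z) + - Re (z * H)"
      by simp
    also have "- Re (z * H) \<le> cmod z * cmod H"
      using abs_Re_le_cmod[of "z * H"] by (simp add: norm_mult)
    also have "cmod z * cmod H \<le> cmod z * (2 * \<alpha> * (X * Y))" by (intro mult_left_mono HB) auto
    also have "- ((X\<^sup>2 + Q) * Re z) + cmod z * (2 * \<alpha> * (X * Y)) \<le> - (X\<^sup>2 * Re z) + cmod z * (2 * \<alpha> * (X * Y))"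
      using z Q(1) by (simp add: algebra_simps)
    also have "\<dots> \<le> (\<alpha> * cmod z * Y)\<^sup>2 / Re z"
    proof -
      \<comment> \<open>Completing the square removes the gradient norm X.\<close>
      have "0 \<le> (X * Re z - \<alpha> * cmod z * Y)\<^sup>2" by simp
      then have "(2 * \<alpha> * cmod z * X * Y) * Re z - X\<^sup>2 * Re z * Re z \<le> (\<alpha> * cmod z * Y)\<^sup>2"
        by (simp add: power2_eq_square algebra_simps)
      then show ?thesis using z by (simp add: field_simps power2_eq_square)
    qed
    finally show ?thesis by (simp add: Y_def power_mult_distrib)
  qed
qed

section \<open>Local bounds for solutions\<close>

lemma powr_double_bound:
  fixes c :: real
  assumes "0 < y" "y \<le> x" "x \<le> 2 * y" shows "x powr (- c) \<le> 2 powr \<bar>c\<bar> * y powr (- c)"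
proof -
  have q: "1 \<le> x / y" "x / y \<le> 2" using assms by (auto simp: field_simps)
  have "x powr (- c) = (x / y) powr (- c) * y powr (- c)"
    using assms by (simp add: powr_mult[symmetric])
  also have "(x / y) powr (- c) \<le> (x / y) powr \<bar>c\<bar>" using q by (intro powr_mono) auto
  also have "\<dots> \<le> 2 powr \<bar>c\<bar>" using q by (intro powr_mono2) auto
  finally show ?thesis by (simp add: mult_right_mono)
qed

text \<open>Since r <= y, the averaging window from y to y + r lies inside {y..2*y}, where the
  density is comparable with its value at y. Moving the weight across the window costs the factor
  exp (2 \<alpha> r).\<close>

lemma bulk_bound:
  assumes u: "u \<in> form_domain c V" and wt: "weight \<alpha> \<phi>" and r: "0 < r" "r \<le> y"
  shows "(cmod (rep u y))\<^sup>2 * exp (- 2 * \<phi> y) \<le> exp (2 * \<alpha> * r) * 2 powr \<bar>c\<bar> * y powr (- c)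
     * ((wnorm c \<phi> u)\<^sup>2 / r + 2 * wnorm c \<phi> (weak_deriv u) * wnorm c \<phi> u)"
proof -
  let ?M = "weighted_measure c" and ?g = "weak_deriv u" and ?I = "{y..y + r}"
  define v where "v = rep u"
  define e where "e = (\<lambda>y. exp (- \<phi> y))"
  define K where "K = 2 powr \<bar>c\<bar> * y powr (- c)"
  \<comment> \<open>By the Lipschitz bound, D compensates the squared weight everywhere on the
    window, so unweighted integrals there are at most D times weighted ones.\<close>
  define D where "D = exp (2 * (\<phi> y + \<alpha> * r))"
  define X where "X = wnorm c \<phi> ?g"
  define Y where "Y = wnorm c \<phi> u"
  note u' = form_domainD[OF u] and fr = form_domain_rep[OF u]
  have y: "0 < y" using r by simp
  have KD: "0 \<le> K" "0 \<le> D" by (auto simp: K_def D_def)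
  have eL: "(\<lambda>y. of_real (e y) * f y) \<in> L2 c" if "f \<in> L2 c" for f
    unfolding e_def by (rule weight_L2[OF wt that])
  have K: "x powr (- c) \<le> K" if "y \<le> x" "x \<le> y + r" for x
    unfolding K_def using that r by (intro powr_double_bound) auto
  have D: "1 \<le> D * (e x * e x)" if "x \<in> ?I" for x
  proof -
    have "\<phi> x - \<phi> y \<le> \<alpha> * \<bar>x - y\<bar>" using weight_Lipschitz[OF wt, of x y] by simp
    also have "\<dots> \<le> \<alpha> * r" using that weight_nonneg(1)[OF wt] by (intro mult_left_mono) auto
    finally have "0 \<le> 2 * (\<phi> y + \<alpha> * r) + (- \<phi> x + - \<phi> x)" by simp
    then show ?thesis unfolding D_def e_def by (simp only: exp_add[symmetric] one_le_exp_iff)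
  qed
  have AEv: "AE x in ?M. u x = v x" unfolding v_def by (rule rep(2)[OF fr(1)])
  have bound: "(LINT x:?I|lborel. cmod (v x) * cmod (f' x)) \<le> K * (D * (wnorm c \<phi> u * wnorm c \<phi> f))"
    if f: "f \<in> L2 c" "f' \<in> L2 c" "AE x in ?M. f x = f' x" for f f'
  proof -
    have vL: "v \<in> L2 c" using fr(3) by (simp add: v_def)
    have F: "integrable ?M (\<lambda>x. cmod (v x) * cmod (f' x))" by (rule L2_mult_integrable(2)[OF vL f(2)])
    have "(LINT x:?I|lborel. cmod (v x) * cmod (f' x)) \<le> K * (LINT x|?M. indicator ?I x * (cmod (v x) * cmod (f' x)))"
      by (rule lborel_le_weighted(1)[OF F _ y K KD(1)]) auto
    also have "\<dots> \<le> K * (LINT x|?M. D * (cmod (of_real (e x) * u x) * cmod (of_real (e x) * f x)))"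
    proof (intro mult_left_mono KD integral_mono_AE')
      show "integrable ?M (\<lambda>x. D * (cmod (of_real (e x) * u x) * cmod (of_real (e x) * f x)))"
        by (intro integrable_mult_right L2_mult_integrable(2) eL u' f)
      show "AE x in ?M. indicator ?I x * (cmod (v x) * cmod (f' x)) \<le> D * (cmod (of_real (e x) * u x) * cmod (of_real (e x) * f x))"
        using AEv f(3)
      proof eventually_elim
        fix x assume eq: "u x = v x" "f x = f' x"
        show "indicator ?I x * (cmod (v x) * cmod (f' x)) \<le> D * (cmod (of_real (e x) * u x) * cmod (of_real (e x) * f x))"
        proof (cases "x \<in> ?I")
          case True
          have "1 * (cmod (v x) * cmod (f' x)) \<le> (D * (e x * e x)) * (cmod (v x) * cmod (f' x))"
            by (intro mult_right_mono D True) auto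
          then show ?thesis using True by (simp add: eq norm_mult e_def mult_ac)
        qed (use KD in auto)
      qed
      show "AE x in ?M. 0 \<le> D * (cmod (of_real (e x) * u x) * cmod (of_real (e x) * f x))"
        using KD by (intro AE_I2) (metis mult_nonneg_nonneg norm_ge_zero)
    qed
    also have "\<dots> \<le> K * (D * (wnorm c \<phi> u * wnorm c \<phi> f))"
      unfolding Bochner_Integration.integral_mult_right_zero wnorm_def e_def[symmetric]
      using L2_Cauchy_Schwarz[OF eL[OF u'(1)] eL[OF f(1)]]
      by (intro mult_left_mono KD) (simp add: e_def)
    finally show ?thesis .
  qed
  have "r * (cmod (v y))\<^sup>2 \<le> (LINT x:?I|lborel. cmod (v x) * cmod (v x)) + 2 * r * (LINT x:?I|lborel. cmod (v x) * cmod (?g x))"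
    using locally_ac_average_bound[OF fr(2) y r(1)] by (simp add: v_def power2_eq_square)
  also have "\<dots> \<le> K * (D * (Y * Y)) + 2 * r * (K * (D * (Y * X)))"
    unfolding X_def Y_def
  proof (intro add_mono mult_left_mono bound)
    show "v \<in> L2 c" using fr(3) by (simp add: v_def)
  qed (use u' AEv r in auto)
  finally have "(cmod (v y))\<^sup>2 \<le> K * D * (Y\<^sup>2 / r + 2 * X * Y)"
    using r by (simp add: field_simps power2_eq_square)
  then have "(cmod (v y))\<^sup>2 * exp (- 2 * \<phi> y) \<le> K * D * (Y\<^sup>2 / r + 2 * X * Y) * exp (- 2 * \<phi> y)"
    by (intro mult_right_mono) auto
  also have "\<dots> = (D * exp (- 2 * \<phi> y)) * K * (Y\<^sup>2 / r + 2 * X * Y)"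
    by (simp only: mult_ac)
  also have "D * exp (- 2 * \<phi> y) = exp (2 * \<alpha> * r)"
    unfolding D_def by (simp add: exp_add[symmetric] algebra_simps)
  finally show ?thesis unfolding v_def K_def X_def Y_def by (simp add: mult.assoc)
qed

text \<open>Testing the equation with \<open>\<eta> u\<close>, where \<open>\<eta>' y\<^sup>c = - 1\<close> on \<open>[y, r]\<close> and \<open>\<eta> = 0\<close> on
  \<open>[r, \<infinity>)\<close>: the potential only helps, and the boundary terms are the values of \<open>|u|\<^sup>2\<close> at \<open>y\<close> and \<open>r\<close>.\<close>
lemma inner_bound:
  assumes uw: "(u, w) \<in> Bn_minus c V"
    and V: "AE y in weighted_measure c. 0 \<le> V y" "V \<in> borel_measurable (weighted_measure c)"
    and y: "0 < y" "y \<le> r"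
    and S: "\<And>t s. 0 < t \<Longrightarrow> t \<le> s \<Longrightarrow> y \<le> s \<Longrightarrow> s \<le> r \<Longrightarrow> s powr (- c) \<le> S t" "\<And>t. 0 < t \<Longrightarrow> 0 \<le> S t"
    and i: "integrable (weighted_measure c) (\<lambda>t. indicator {0<..r} t * (S t * (cmod (w t) * cmod (u t))))"
  shows "(cmod (rep u y))\<^sup>2 \<le> (cmod (rep u r))\<^sup>2
     + 2 * r * (LINT t|weighted_measure c. indicator {0<..r} t * (S t * (cmod (w t) * cmod (u t))))"
proof -
  let ?M = "weighted_measure c" and ?g = "weak_deriv u"
  note u = form_domainD[OF Bn_minusD(1)[OF uw]] and w = Bn_minusD(2)[OF uw]
  note fr = form_domain_rep[OF Bn_minusD(1)[OF uw]]
  \<comment> \<open>The power cancels the density, so that the commutator term becomes an unweighted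
    integral over {y..r}.\<close>
  define k where "k = (\<lambda>s. indicator {y..r} s * s powr (- c))"
  define \<eta> where "\<eta> = (\<lambda>t. LINT s:{t..}|lborel. k s)"
  have r: "0 < r" using y by simp
  have kint: "integrable lborel k"
  proof -
    have "integrable lborel (\<lambda>s. indicator {y..r} s *\<^sub>R s powr (- c))"
      by (intro borel_integrable_compact compact_Icc continuous_on_powr continuous_on_id continuous_on_const) (use y in auto)
    then show ?thesis by (simp add: k_def)
  qed
  have ks: "set_integrable lborel A k" if "A \<in> sets borel" for A
    unfolding set_integrable_def by (rule integrable_mult_indicator[OF _ kint]) (use that in simp)
  have k0: "0 \<le> k s" for s by (simp add: k_def)
  have ac: "locally_ac (\<lambda>x. of_real (\<eta> x)) (\<lambda>x. of_real (- k x))"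
    unfolding locally_ac_def
  proof (intro conjI allI impI)
    show "loc_integrable (\<lambda>x. complex_of_real (- k x))"
      unfolding loc_integrable_def set_integrable_def
    proof (intro allI impI)
      fix a b :: real
      have "integrable lborel (\<lambda>x. complex_of_real (indicator {a..b} x *\<^sub>R (- k x)))"
        using ks[of "{a..b}"] unfolding set_integrable_def by (intro integrable_of_real) simp
      then show "integrable lborel (\<lambda>x. indicator {a..b} x *\<^sub>R complex_of_real (- k x))"
        by (simp add: scaleR_conv_of_real)
    qed
    fix a b :: real assume ab: "0 < a" "a \<le> b"
    have "{a..} = {a..b} \<union> {b..}" using ab by auto
    then have "\<eta> a = (LINT s:{a..b} \<union> {b..}|lborel. k s)" by (simp add: \<eta>_def)
    also have "\<dots> = (LINT s:{a..b}|lborel. k s) + \<eta> b"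
      unfolding \<eta>_def
    proof (rule set_integral_Un_AE)
      show "AE x in lborel. \<not> (x \<in> {a..b} \<and> x \<in> {b..})"
        by (rule AE_mp[OF AE_lborel_singleton[of b]]) auto
    qed (auto intro: ks)
    finally have e: "\<eta> b - \<eta> a = (LINT s:{a..b}|lborel. - k s)"
      using set_integral_uminus[OF ks[of "{a..b}"]] by simp
    show "complex_of_real (\<eta> b) - complex_of_real (\<eta> a) = (LINT x:{a..b}|lborel. complex_of_real (- k x))"
      unfolding set_integral_complex_of_real e[symmetric] by simp
  qed
  have \<eta>0: "0 \<le> \<eta> t" for t
    unfolding \<eta>_def set_lebesgue_integral_def by (intro integral_nonneg_AE AE_I2) (simp add: k0)
  \<comment> \<open>The integrand of \<eta> t lives on s >= t within {y..r}, where S t is a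
    majorant, over a length of at most r. Leaving the majorant S free lets it be constant in the
    first estimate and depend on t in the improvement.\<close>
  have \<eta>S: "\<eta> t \<le> r * (indicator {0<..r} t * S t)" if t: "0 < t" for t
  proof (cases "t \<le> r")
    case True
    have "\<eta> t \<le> (\<integral>s. indicator {0..r} s *\<^sub>R S t \<partial>lborel)"
      unfolding \<eta>_def set_lebesgue_integral_def
    proof (rule integral_mono)
      show "integrable lborel (\<lambda>s. indicator {t..} s *\<^sub>R k s)" using ks[of "{t..}"] by (simp add: set_integrable_def)
      show "integrable lborel (\<lambda>s. indicator {0..r} s *\<^sub>R S t)"
        by (intro borel_integrable_compact compact_Icc continuous_on_const)
      show "indicator {t..} s *\<^sub>R k s \<le> indicator {0..r} s *\<^sub>R S t" for s
        using S(1)[OF t, of s] S(2)[OF t] t y by (auto simp: k_def indicator_def)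
    qed
    also have "\<dots> = r * S t" using r by simp
    finally show ?thesis using True t by simp
  next
    case False
    then have "(\<lambda>s. indicator {t..} s *\<^sub>R k s) = (\<lambda>_. 0)" by (auto simp: k_def indicator_def)
    then show ?thesis using False by (simp add: \<eta>_def set_lebesgue_integral_def)
  qed
  define B where "B = max (integral\<^sup>L lborel k) (max (y powr (- c)) (r powr (- c)))"
  have m: "multiplier \<eta> (\<lambda>s. - k s) B"
    unfolding multiplier_def
  proof (intro conjI ac allI impI \<eta>0)
    fix x :: real assume "0 < x"
    have "\<eta> x \<le> integral\<^sup>L lborel k"
      unfolding \<eta>_def set_lebesgue_integral_def
      by (rule integral_mono[OF _ kint]) (use ks[of "{x..}"] k0 in \<open>auto simp: set_integrable_def indicator_def\<close>)
    then show "\<eta> x \<le> B" by (simp add: B_def)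
    have "k x \<le> max (y powr (- c)) (r powr (- c))"
      using powr_bound_interval[of y x r "-c"] y by (auto simp: k_def indicator_def le_max_iff_disj)
    then show "\<bar>- k x\<bar> \<le> B" using k0[of x] by (simp add: B_def)
  qed
  obtain Q where Q: "0 \<le> Q" "- L2_pair c w (\<lambda>y. of_real (\<eta> y) * cnj (u y)) =
       of_real (LINT y|?M. \<eta> y * (cmod (?g y))\<^sup>2) + of_real Q
       + (LINT y|?M. of_real (- k y) * (?g y * cnj (u y)))"
    using form_identity[OF uw m V] by blast
  define H where "H = (LINT y|?M. complex_of_real (- k y) * (?g y * cnj (u y)))"
  have kL: "(\<lambda>y. of_real (- k y) * ?g y) \<in> L2 c"
    by (rule L2_bounded_mult[OF u(3) multiplier_measurable(2)[OF m], where B=B])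
       (use m in \<open>simp add: multiplier_def\<close>)
  have mk: "(\<lambda>y. complex_of_real (- k y) * (?g y * cnj (u y))) \<in> borel_measurable ?M"
    using borel_measurable_integrable[OF L2_mult_integrable(1)[OF kL L2_cnj[OF u(1)]]] by (simp only: mult.assoc)
  \<comment> \<open>Once the densities cancel, H is minus the integral of u' cnj u, and its real
    part is half of |u(y)|^2 - |u(r)|^2.\<close>
  have "H = (LINT s:{0<..}|lborel. s powr c *\<^sub>R (of_real (- k s) * (?g s * cnj (u s))))"
    unfolding H_def by (rule integral_weighted[OF mk])
  also have "\<dots> = (LINT s:{y..r}|lborel. - (?g s * cnj (rep u s)))"
    unfolding set_lebesgue_integral_def
  proof (rule integral_cong_AE)
    have "(\<lambda>y. y powr c *\<^sub>R (complex_of_real (- k y) * (?g y * cnj (u y)))) \<in> borel_measurable ?M"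
      by (intro borel_measurable_scaleR mk measurable_weighted_measureI powr_real_measurable) auto
    then show "(\<lambda>s. indicator {0<..} s *\<^sub>R s powr c *\<^sub>R (of_real (- k s) * (?g s * cnj (u s)))) \<in> borel_measurable lborel"
      by (simp add: measurable_weighted_measure_iff)
    have "set_integrable lborel {y..r} (\<lambda>s. ?g s * cnj (rep u s))"
      by (intro set_integrable_mult_continuous locally_acD(3)[OF fr(2) y(1)] continuous_intros
          continuous_on_subset[OF rep(1)[OF fr(1)]]) (use y in auto)
    then have "(\<lambda>s. - (indicator {y..r} s *\<^sub>R (?g s * cnj (rep u s)))) \<in> borel_measurable lborel"
      by (intro borel_measurable_uminus) (auto simp: set_integrable_def)
    then show "(\<lambda>s. indicator {y..r} s *\<^sub>R - (?g s * cnj (rep u s))) \<in> borel_measurable lborel"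
      by (simp add: scaleR_minus_right)
    show "AE s in lborel. indicator {0<..} s *\<^sub>R s powr c *\<^sub>R (of_real (- k s) * (?g s * cnj (u s)))
        = indicator {y..r} s *\<^sub>R - (?g s * cnj (rep u s))"
      using rep(2)[OF fr(1), of c] unfolding AE_weighted_measure
    proof eventually_elim
      fix s assume s: "0 < s \<longrightarrow> u s = rep u s"
      show "indicator {0<..} s *\<^sub>R s powr c *\<^sub>R (of_real (- k s) * (?g s * cnj (u s)))
        = indicator {y..r} s *\<^sub>R - (?g s * cnj (rep u s))"
      proof (cases "s \<in> {y..r}")
        case True
        then have "0 < s" using y by simp
        then have "s powr c * s powr (- c) = 1" by (simp add: powr_minus)
        then have "complex_of_real (s powr c) * complex_of_real (s powr (- c)) = 1" by (metis of_real_1 of_real_mult)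
        then show ?thesis using True \<open>0 < s\<close> s
          by (simp add: k_def scaleR_conv_of_real mult.assoc[symmetric])
      qed (simp add: k_def)
    qed
  qed
  also have "\<dots> = - (LINT s:{y..r}|lborel. ?g s * cnj (rep u s))"
    by (rule set_integral_uminus)
       (intro set_integrable_mult_continuous locally_acD(3)[OF fr(2) y(1)] continuous_intros
          continuous_on_subset[OF rep(1)[OF fr(1)]], use y in auto)
  finally have H: "H = - (LINT s:{y..r}|lborel. ?g s * cnj (rep u s))" .
  have "Re (LINT s:{y..r}|lborel. ?g s * cnj (rep u s)) = (LINT s:{y..r}|lborel. Re (?g s * cnj (rep u s)))"
  proof -
    have "set_integrable lborel {y..r} (\<lambda>s. ?g s * cnj (rep u s))"
      by (intro set_integrable_mult_continuous locally_acD(3)[OF fr(2) y(1)] continuous_intros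
          continuous_on_subset[OF rep(1)[OF fr(1)]]) (use y in auto)
    then show ?thesis unfolding set_lebesgue_integral_def set_integrable_def
      by (subst integral_Re[symmetric]) auto
  qed
  then have Hv: "(cmod (rep u y))\<^sup>2 = (cmod (rep u r))\<^sup>2 + 2 * Re H"
    using locally_ac_square(2)[OF fr(2) y] unfolding H by simp
  have g0: "0 \<le> (LINT y|?M. \<eta> y * (cmod (?g y))\<^sup>2)"
    by (intro integral_nonneg_AE AE_I2) (simp add: \<eta>0)
  have "Re H \<le> Re (- L2_pair c w (\<lambda>y. of_real (\<eta> y) * cnj (u y)))"
    unfolding Q(2) H_def using g0 Q(1) by simp
  also have "\<dots> \<le> cmod (L2_pair c w (\<lambda>y. of_real (\<eta> y) * cnj (u y)))"
    using complex_Re_le_cmod[of "- L2_pair c w (\<lambda>y. of_real (\<eta> y) * cnj (u y))"] by simp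
  also have "\<dots> \<le> (LINT y|?M. cmod (w y * (of_real (\<eta> y) * cnj (u y))))"
    unfolding L2_pair_def by (rule integral_norm_bound)
  also have "\<dots> \<le> (LINT t|?M. r * (indicator {0<..r} t * (S t * (cmod (w t) * cmod (u t)))))"
  proof (rule integral_mono_AE')
    show "integrable ?M (\<lambda>t. r * (indicator {0<..r} t * (S t * (cmod (w t) * cmod (u t)))))"
      using i by simp
    show "AE t in ?M. cmod (w t * (of_real (\<eta> t) * cnj (u t))) \<le> r * (indicator {0<..r} t * (S t * (cmod (w t) * cmod (u t))))"
    proof (rule AE_weighted_I)
      fix t :: real assume t: "0 < t"
      have "\<eta> t * (cmod (w t) * cmod (u t)) \<le> (r * (indicator {0<..r} t * S t)) * (cmod (w t) * cmod (u t))"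
        by (intro mult_right_mono \<eta>S t) auto
      then show "cmod (w t * (of_real (\<eta> t) * cnj (u t))) \<le> r * (indicator {0<..r} t * (S t * (cmod (w t) * cmod (u t))))"
        using \<eta>0[of t] by (simp add: norm_mult mult_ac)
    qed
    show "AE t in ?M. 0 \<le> r * (indicator {0<..r} t * (S t * (cmod (w t) * cmod (u t))))"
      by (rule AE_weighted_I) (use S(2) r in \<open>auto intro!: mult_nonneg_nonneg\<close>)
  qed
  also have "\<dots> = r * (LINT t|?M. indicator {0<..r} t * (S t * (cmod (w t) * cmod (u t))))"
    by (rule Bochner_Integration.integral_mult_right_zero)
  finally show ?thesis using Hv by simp
qed

section \<open>Differentiation of curves of square-integrable functions\<close>

text \<open>Differentiability in norm at one time. Membership in \<open>L2 c\<close> is required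
  only near t because the paths to be differentiated lie in the right half-plane only for part of
  the real line.\<close>

definition L2_deriv :: "real \<Rightarrow> (real \<Rightarrow> real \<Rightarrow> complex) \<Rightarrow> (real \<Rightarrow> complex) \<Rightarrow> real \<Rightarrow> bool" where
  "L2_deriv c F F' t \<longleftrightarrow> F' \<in> L2 c \<and> (\<forall>\<^sub>F s in nhds t. F s \<in> L2 c) \<and>
     ((\<lambda>h. L2_norm c (\<lambda>y. (F (t + h) y - F t y) / of_real h - F' y)) \<longlongrightarrow> 0) (at 0)"

lemma L2_divide: "f \<in> L2 c \<Longrightarrow> (\<lambda>y. f y / a) \<in> L2 c"
  using L2_scale[of f c "inverse a"] by (simp add: divide_inverse mult.commute)

lemma L2_norm_divide: "L2_norm c (\<lambda>y. f y / a) = L2_norm c f / cmod a"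
  using L2_norm_scale[of c "inverse a" f] by (simp add: divide_inverse mult.commute norm_inverse)

lemma L2_derivD:
  assumes "L2_deriv c F F' t"
  shows "F' \<in> L2 c" "F t \<in> L2 c" "\<forall>\<^sub>F h in at 0. F (t + h) \<in> L2 c"
    "((\<lambda>h. L2_norm c (\<lambda>y. (F (t + h) y - F t y) / of_real h - F' y)) \<longlongrightarrow> 0) (at 0)"
    "((\<lambda>h. L2_norm c (\<lambda>y. F (t + h) y - F t y)) \<longlongrightarrow> 0) (at 0)"
proof -
  show F': "F' \<in> L2 c" and Ft: "F t \<in> L2 c"
    and lim: "((\<lambda>h. L2_norm c (\<lambda>y. (F (t + h) y - F t y) / of_real h - F' y)) \<longlongrightarrow> 0) (at 0)"
    using assms by (auto simp: L2_deriv_def dest: eventually_nhds_x_imp_x)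
  have "((\<lambda>h. t + h) \<longlongrightarrow> t + 0) (at 0)" by (intro tendsto_intros)
  then have lt: "filterlim (\<lambda>h. t + h) (nhds t) (at 0)" by simp
  have "\<forall>\<^sub>F s in nhds t. F s \<in> L2 c" using assms by (simp add: L2_deriv_def)
  from eventually_compose_filterlim[OF this lt] show ev: "\<forall>\<^sub>F h in at 0. F (t + h) \<in> L2 c" .
  have "((\<lambda>h. \<bar>h\<bar> * (L2_norm c (\<lambda>y. (F (t + h) y - F t y) / of_real h - F' y) + L2_norm c F')) \<longlongrightarrow> \<bar>0\<bar> * (0 + L2_norm c F')) (at 0)"
    by (intro tendsto_intros lim)
  then have z: "((\<lambda>h. \<bar>h\<bar> * (L2_norm c (\<lambda>y. (F (t + h) y - F t y) / of_real h - F' y) + L2_norm c F')) \<longlongrightarrow> 0) (at 0)"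
    by simp
  show "((\<lambda>h. L2_norm c (\<lambda>y. F (t + h) y - F t y)) \<longlongrightarrow> 0) (at 0)"
  proof (rule Lim_null_comparison[OF _ z])
    show "\<forall>\<^sub>F h in at 0. norm (L2_norm c (\<lambda>y. F (t + h) y - F t y)) \<le>
        \<bar>h\<bar> * (L2_norm c (\<lambda>y. (F (t + h) y - F t y) / of_real h - F' y) + L2_norm c F')"
      using ev eventually_at_ball[OF zero_less_one, of 0]
    proof eventually_elim
      fix h :: real assume h: "F (t + h) \<in> L2 c"
      have q: "(\<lambda>y. (F (t + h) y - F t y) / of_real h) \<in> L2 c" by (intro L2_divide L2_diff h Ft)
      have "L2_norm c (\<lambda>y. (F (t + h) y - F t y) / of_real h) \<le>
          L2_norm c (\<lambda>y. (F (t + h) y - F t y) / of_real h - F' y) + L2_norm c F'"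
        using L2_norm_triangle[OF L2_diff[OF q F'] F'] by simp
      then have "\<bar>h\<bar> * (L2_norm c (\<lambda>y. F (t + h) y - F t y) / \<bar>h\<bar>) \<le>
          \<bar>h\<bar> * (L2_norm c (\<lambda>y. (F (t + h) y - F t y) / of_real h - F' y) + L2_norm c F')"
        unfolding L2_norm_divide by (intro mult_left_mono) auto
      then show "norm (L2_norm c (\<lambda>y. F (t + h) y - F t y)) \<le>
          \<bar>h\<bar> * (L2_norm c (\<lambda>y. (F (t + h) y - F t y) / of_real h - F' y) + L2_norm c F')"
        by (cases "h = 0") (auto simp: L2_norm_def)
    qed
  qed
qed

lemma L2_pair_tendsto2:
  assumes F: "\<forall>\<^sub>F x in A. F x \<in> L2 c" "f \<in> L2 c" "((\<lambda>x. L2_norm c (\<lambda>y. F x y - f y)) \<longlongrightarrow> 0) A"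
    and G: "\<forall>\<^sub>F x in A. G x \<in> L2 c" "g \<in> L2 c" "((\<lambda>x. L2_norm c (\<lambda>y. G x y - g y)) \<longlongrightarrow> 0) A"
  shows "((\<lambda>x. L2_pair c (F x) (G x)) \<longlongrightarrow> L2_pair c f g) A"
proof -
  have "((\<lambda>x. L2_norm c (\<lambda>y. F x y - f y) * (L2_norm c (\<lambda>y. G x y - g y) + L2_norm c g)
       + L2_norm c f * L2_norm c (\<lambda>y. G x y - g y)) \<longlongrightarrow> 0 * (0 + L2_norm c g) + L2_norm c f * 0) A"
    by (intro tendsto_intros F G)
  then have z: "((\<lambda>x. L2_norm c (\<lambda>y. F x y - f y) * (L2_norm c (\<lambda>y. G x y - g y) + L2_norm c g)
       + L2_norm c f * L2_norm c (\<lambda>y. G x y - g y)) \<longlongrightarrow> 0) A" by simp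
  have "((\<lambda>x. L2_pair c (F x) (G x) - L2_pair c f g) \<longlongrightarrow> 0) A"
  proof (rule Lim_null_comparison[OF _ z])
    show "\<forall>\<^sub>F x in A. norm (L2_pair c (F x) (G x) - L2_pair c f g) \<le>
       L2_norm c (\<lambda>y. F x y - f y) * (L2_norm c (\<lambda>y. G x y - g y) + L2_norm c g)
       + L2_norm c f * L2_norm c (\<lambda>y. G x y - g y)"
      using F(1) G(1)
    proof eventually_elim
      fix x assume Fx: "F x \<in> L2 c" and Gx: "G x \<in> L2 c"
      have "L2_pair c (F x) (G x) - L2_pair c f g = L2_pair c (\<lambda>y. F x y - f y) (G x) + L2_pair c (\<lambda>y. G x y - g y) f"
        unfolding L2_pair_diff[OF Fx F(2) Gx] L2_pair_diff[OF Gx G(2) F(2)]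
        by (simp add: L2_pair_commute)
      also have "cmod \<dots> \<le> cmod (L2_pair c (\<lambda>y. F x y - f y) (G x)) + cmod (L2_pair c (\<lambda>y. G x y - g y) f)"
        by (rule norm_triangle_ineq)
      also have "\<dots> \<le> L2_norm c (\<lambda>y. F x y - f y) * L2_norm c (G x) + L2_norm c (\<lambda>y. G x y - g y) * L2_norm c f"
        by (intro add_mono L2_pair_bound L2_diff Fx Gx F G)
      also have "\<dots> \<le> L2_norm c (\<lambda>y. F x y - f y) * (L2_norm c (\<lambda>y. G x y - g y) + L2_norm c g)
          + L2_norm c (\<lambda>y. G x y - g y) * L2_norm c f"
        using L2_norm_triangle[OF L2_diff[OF Gx G(2)] G(2)] by (intro add_mono mult_left_mono) simp_all
      finally show "norm (L2_pair c (F x) (G x) - L2_pair c f g) \<le>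
       L2_norm c (\<lambda>y. F x y - f y) * (L2_norm c (\<lambda>y. G x y - g y) + L2_norm c g)
       + L2_norm c f * L2_norm c (\<lambda>y. G x y - g y)"
        by (simp add: mult.commute)
    qed
  qed
  then show ?thesis using Lim_null by blast
qed

lemma has_vector_derivative_quotient:
  fixes f :: "real \<Rightarrow> complex"
  assumes "((\<lambda>h. (f (t + h) - f t) / of_real h) \<longlongrightarrow> D) (at 0)"
  shows "(f has_vector_derivative D) (at t)"
proof -
  have "((\<lambda>h. norm ((f (t + h) - f t) / of_real h - D)) \<longlongrightarrow> 0) (at 0)"
    using assms by (simp add: LIM_zero tendsto_norm_zero)
  then have "((\<lambda>h. norm (f (t + h) - f t - h *\<^sub>R D) / norm h) \<longlongrightarrow> 0) (at 0)"
  proof (rule Lim_transform_eventually)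
    show "\<forall>\<^sub>F h in at 0. norm ((f (t + h) - f t) / of_real h - D) = norm (f (t + h) - f t - h *\<^sub>R D) / norm h"
      unfolding eventually_at_filter
    proof (rule always_eventually, intro allI impI)
      fix h :: real assume "h \<noteq> 0"
      then have "(f (t + h) - f t) / of_real h - D = (f (t + h) - f t - h *\<^sub>R D) / of_real h"
        by (simp add: field_simps scaleR_conv_of_real)
      then show "norm ((f (t + h) - f t) / of_real h - D) = norm (f (t + h) - f t - h *\<^sub>R D) / norm h"
        by (simp add: norm_divide)
    qed
  qed
  then show ?thesis
    unfolding has_vector_derivative_def has_derivative_at by (simp add: bounded_linear_scaleR_left)
qed

text \<open>The increment is split through the pairing of F(t) with G(t + h). One quotient is
  therefore paired with the moving factor G(t + h), so norm continuity of G enters as well.\<close>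

lemma L2_deriv_pair:
  assumes F: "L2_deriv c F F' t" and G: "L2_deriv c G G' t"
  shows "((\<lambda>s. L2_pair c (F s) (G s)) has_vector_derivative L2_pair c F' (G t) + L2_pair c (F t) G') (at t)"
proof (rule has_vector_derivative_quotient)
  note F = L2_derivD[OF F] and G = L2_derivD[OF G]
  let ?q = "\<lambda>h y. (F (t + h) y - F t y) / complex_of_real h" and ?r = "\<lambda>h y. (G (t + h) y - G t y) / complex_of_real h"
  have q: "\<forall>\<^sub>F h in at 0. ?q h \<in> L2 c"
    using F(3) by eventually_elim (intro L2_divide L2_diff F(2))
  have r: "\<forall>\<^sub>F h in at 0. ?r h \<in> L2 c"
    using G(3) by eventually_elim (intro L2_divide L2_diff G(2))
  have "((\<lambda>h. L2_pair c (?q h) (G (t + h)) + L2_pair c (?r h) (F t)) \<longlongrightarrow> L2_pair c F' (G t) + L2_pair c G' (F t)) (at 0)"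
    by (intro tendsto_add L2_pair_tendsto2[OF q F(1) F(4) G(3) G(2) G(5)] L2_pair_tendsto[OF r G(1) F(2) G(4)])
  moreover have "\<forall>\<^sub>F h in at 0. L2_pair c (?q h) (G (t + h)) + L2_pair c (?r h) (F t) =
      (L2_pair c (F (t + h)) (G (t + h)) - L2_pair c (F t) (G t)) / of_real h"
    using F(3) G(3)
  proof eventually_elim
    fix h assume Fh: "F (t + h) \<in> L2 c" and Gh: "G (t + h) \<in> L2 c"
    have "L2_pair c (?q h) (G (t + h)) = (L2_pair c (F (t + h)) (G (t + h)) - L2_pair c (F t) (G (t + h))) / of_real h"
      using L2_pair_lincomb[OF Fh F(2) Gh, of "1 / of_real h" "- 1 / of_real h"]
      by (simp add: diff_divide_distrib)
    moreover have "L2_pair c (?r h) (F t) = (L2_pair c (G (t + h)) (F t) - L2_pair c (G t) (F t)) / of_real h"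
      using L2_pair_lincomb[OF Gh G(2) F(2), of "1 / of_real h" "- 1 / of_real h"]
      by (simp add: diff_divide_distrib)
    ultimately show "L2_pair c (?q h) (G (t + h)) + L2_pair c (?r h) (F t) =
      (L2_pair c (F (t + h)) (G (t + h)) - L2_pair c (F t) (G t)) / of_real h"
      by (simp add: L2_pair_commute add_divide_distrib[symmetric])
  qed
  ultimately have "((\<lambda>h. (L2_pair c (F (t + h)) (G (t + h)) - L2_pair c (F t) (G t)) / of_real h) \<longlongrightarrow>
      L2_pair c F' (G t) + L2_pair c G' (F t)) (at 0)"
    by (rule Lim_transform_eventually)
  then show "((\<lambda>h. (L2_pair c (F (t + h)) (G (t + h)) - L2_pair c (F t) (G t)) / of_real h) \<longlongrightarrow>
      L2_pair c F' (G t) + L2_pair c (F t) G') (at 0)"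
    by (simp only: L2_pair_commute[of c "F t" G'])
qed

lemma L2_deriv_bounded_mult:
  assumes F: "L2_deriv c F F' t" and m: "m \<in> borel_measurable (weighted_measure c)"
    and B: "\<And>y. 0 < y \<Longrightarrow> cmod (m y) \<le> 1"
  shows "L2_deriv c (\<lambda>s y. m y * F s y) (\<lambda>y. m y * F' y) t"
  unfolding L2_deriv_def
proof (intro conjI)
  note F' = L2_derivD[OF F]
  note mL = L2_bounded_mult[OF _ m B]
  show "(\<lambda>y. m y * F' y) \<in> L2 c" by (rule mL[OF F'(1)])
  have "\<forall>\<^sub>F s in nhds t. F s \<in> L2 c" using F by (simp add: L2_deriv_def)
  then show "\<forall>\<^sub>F s in nhds t. (\<lambda>y. m y * F s y) \<in> L2 c" by eventually_elim (rule mL)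
  show "((\<lambda>h. L2_norm c (\<lambda>y. (m y * F (t + h) y - m y * F t y) / of_real h - m y * F' y)) \<longlongrightarrow> 0) (at 0)"
  proof (rule Lim_null_comparison[OF _ F'(4)])
    show "\<forall>\<^sub>F h in at 0. norm (L2_norm c (\<lambda>y. (m y * F (t + h) y - m y * F t y) / of_real h - m y * F' y))
       \<le> L2_norm c (\<lambda>y. (F (t + h) y - F t y) / of_real h - F' y)"
      using F'(3)
    proof eventually_elim
      fix h assume h: "F (t + h) \<in> L2 c"
      have q: "(\<lambda>y. (F (t + h) y - F t y) / of_real h - F' y) \<in> L2 c" by (intro L2_diff L2_divide h F')
      have e: "(m y * F (t + h) y - m y * F t y) / of_real h - m y * F' y = m y * ((F (t + h) y - F t y) / of_real h - F' y)" for y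
        by (simp add: algebra_simps diff_divide_distrib)
      define g where "g = (\<lambda>y. (F (t + h) y - F t y) / of_real h - F' y)"
      have g: "g \<in> L2 c" using q by (simp add: g_def)
      have "AE y in weighted_measure c. cmod (m y * g y) \<le> cmod (g y)"
        by (rule AE_weighted_I) (use B in \<open>auto simp: norm_mult intro: mult_left_le_one_le\<close>)
      from L2_norm_mono_AE[OF mL[OF g] g this]
      have "L2_norm c (\<lambda>y. m y * ((F (t + h) y - F t y) / of_real h - F' y)) \<le> L2_norm c (\<lambda>y. (F (t + h) y - F t y) / of_real h - F' y)"
        by (simp add: g_def)
      then show "norm (L2_norm c (\<lambda>y. (m y * F (t + h) y - m y * F t y) / of_real h - m y * F' y))
       \<le> L2_norm c (\<lambda>y. (F (t + h) y - F t y) / of_real h - F' y)"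
        unfolding e by simp
    qed
  qed
qed

lemma L2_deriv_cnj:
  assumes F: "L2_deriv c F F' t" shows "L2_deriv c (\<lambda>s y. cnj (F s y)) (\<lambda>y. cnj (F' y)) t"
  unfolding L2_deriv_def
proof (intro conjI)
  note F' = L2_derivD[OF F]
  show "(\<lambda>y. cnj (F' y)) \<in> L2 c" by (rule L2_cnj[OF F'(1)])
  have "\<forall>\<^sub>F s in nhds t. F s \<in> L2 c" using F by (simp add: L2_deriv_def)
  then show "\<forall>\<^sub>F s in nhds t. (\<lambda>y. cnj (F s y)) \<in> L2 c" by eventually_elim (rule L2_cnj)
  have "(\<lambda>y. (cnj (F (t + h) y) - cnj (F t y)) / of_real h - cnj (F' y)) = (\<lambda>y. cnj ((F (t + h) y - F t y) / of_real h - F' y))" for h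
    by simp
  then show "((\<lambda>h. L2_norm c (\<lambda>y. (cnj (F (t + h) y) - cnj (F t y)) / of_real h - cnj (F' y))) \<longlongrightarrow> 0) (at 0)"
    using F'(4) by (simp only: L2_norm_cnj)
qed

section \<open>The semigroup\<close>

lemma form_domain_cnj:
  assumes u: "u \<in> form_domain c V"
  shows "(\<lambda>y. cnj (u y)) \<in> form_domain c V"
    "AE y in weighted_measure c. weak_deriv (\<lambda>y. cnj (u y)) y = cnj (weak_deriv u y)"
proof -
  note u' = form_domainD[OF u] and fr = form_domain_rep[OF u]
  have ul: "loc_integrable u" using u'(2) by (simp add: has_weak_deriv_def)
  have w: "has_weak_deriv (\<lambda>y. cnj (u y)) (\<lambda>y. cnj (weak_deriv u y))"
    by (rule has_weak_deriv_cong_AE[OF locally_ac_imp_has_weak_deriv[OF locally_ac_cnj[OF fr(2)]] loc_integrable_cnj[OF ul]])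
       (use rep(2)[OF fr(1), of c] in \<open>simp add: AE_weighted_measure\<close>)
  have w2: "has_weak_deriv (\<lambda>y. cnj (u y)) (weak_deriv (\<lambda>y. cnj (u y)))"
    using someI[of "has_weak_deriv (\<lambda>y. cnj (u y))", OF w] by (simp only: weak_deriv_def)
  show AE: "AE y in weighted_measure c. weak_deriv (\<lambda>y. cnj (u y)) y = cnj (weak_deriv u y)"
    unfolding AE_weighted_measure by (rule has_weak_deriv_unique[OF w2 w])
  have "weak_deriv (\<lambda>y. cnj (u y)) \<in> L2 c"
    by (rule L2_cong_AE[OF L2_cnj[OF u'(3)] loc_integrable_measurable_weighted AE])
       (use w2 in \<open>simp add: has_weak_deriv_def\<close>)
  moreover have "(\<lambda>y. of_real (sqrt (V y)) * cnj (u y)) \<in> L2 c"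
    using L2_cnj[OF u'(4)] by simp
  ultimately show "(\<lambda>y. cnj (u y)) \<in> form_domain c V"
    unfolding form_domain_def using L2_cnj[OF u'(1)] w by blast
qed

lemma form_V_cnj:
  assumes "u \<in> form_domain c V" "v \<in> form_domain c V" "V \<in> borel_measurable (weighted_measure c)"
  shows "form_V c V u (\<lambda>y. cnj (v y)) = (LINT y|weighted_measure c. weak_deriv u y * weak_deriv v y + of_real (V y) * u y * v y)"
proof -
  let ?M = "weighted_measure c"
  have m: "weak_deriv u \<in> borel_measurable ?M" "weak_deriv v \<in> borel_measurable ?M" "u \<in> borel_measurable ?M"
    "v \<in> borel_measurable ?M" "(\<lambda>y. cnj (weak_deriv (\<lambda>y. cnj (v y)) y)) \<in> borel_measurable ?M"
    using form_domainD[OF assms(1)] form_domainD[OF assms(2)]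
      L2_cnj[OF form_domainD(3)[OF form_domain_cnj(1)[OF assms(2)]]] by auto
  have V: "(\<lambda>y. complex_of_real (V y)) \<in> borel_measurable ?M" using assms(3) by measurable
  show ?thesis
    unfolding form_V_def
  proof (rule integral_cong_AE)
    show "(\<lambda>y. weak_deriv u y * cnj (weak_deriv (\<lambda>y. cnj (v y)) y) + complex_of_real (V y) * u y * cnj (cnj (v y))) \<in> borel_measurable ?M"
      "(\<lambda>y. weak_deriv u y * weak_deriv v y + complex_of_real (V y) * u y * v y) \<in> borel_measurable ?M"
      unfolding complex_cnj_cnj by (intro borel_measurable_add borel_measurable_times m V)+
    show "AE y in ?M. weak_deriv u y * cnj (weak_deriv (\<lambda>y. cnj (v y)) y) + complex_of_real (V y) * u y * cnj (cnj (v y)) =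
        weak_deriv u y * weak_deriv v y + complex_of_real (V y) * u y * v y"
      using form_domain_cnj(2)[OF assms(2)] by eventually_elim simp
  qed
qed

text \<open>Testing one equation with the conjugate of the other solution removes the conjugation
  from the form; as V is real, what remains is symmetric in u and v.\<close>

lemma Bn_minus_symmetric:
  assumes "(u, w) \<in> Bn_minus c V" "(v, x) \<in> Bn_minus c V" "V \<in> borel_measurable (weighted_measure c)"
  shows "L2_pair c w v = L2_pair c u x"
proof -
  note u = Bn_minusD(1)[OF assms(1)] and v = Bn_minusD(1)[OF assms(2)]
  have "- L2_pair c w v = form_V c V u (\<lambda>y. cnj (v y))"
    unfolding Bn_minusD(3)[OF assms(1) form_domain_cnj(1)[OF v]] L2_inner_def L2_pair_def
    by simp
  moreover have "- L2_pair c x u = form_V c V v (\<lambda>y. cnj (u y))"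
    unfolding Bn_minusD(3)[OF assms(2) form_domain_cnj(1)[OF u]] L2_inner_def L2_pair_def
    by simp
  moreover have "form_V c V u (\<lambda>y. cnj (v y)) = form_V c V v (\<lambda>y. cnj (u y))"
    unfolding form_V_cnj[OF u v assms(3)] form_V_cnj[OF v u assms(3)] by (simp add: mult_ac)
  ultimately show ?thesis using L2_pair_commute[of c x u] by (metis add.inverse_inverse)
qed

lemma Cplus_scale: "z \<in> Cplus \<Longrightarrow> 0 < t \<Longrightarrow> of_real t * z \<in> Cplus"
  by (simp add: Cplus_def)

lemma Cplus_half: "z \<in> Cplus \<Longrightarrow> z / 2 \<in> Cplus"
  by (simp add: Cplus_def)

lemma open_Cplus: "open Cplus"
  unfolding Cplus_def by (rule open_halfspace_Re_gt)

locale schroedinger =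
  fixes c :: real and V :: "real \<Rightarrow> real" and T :: "complex \<Rightarrow> (real \<Rightarrow> complex) \<Rightarrow> (real \<Rightarrow> complex)"
  assumes V_nonneg: "AE y in weighted_measure c. 0 \<le> V y"
    and V_loc: "L1_loc c V"
    and gen: "generates c (Bn_minus c V) T"
begin

lemma V_measurable: "V \<in> borel_measurable (weighted_measure c)"
  by (rule L1_loc_measurable[OF V_loc])

lemma T_L2: "z \<in> Cplus \<Longrightarrow> f \<in> L2 c \<Longrightarrow> T z f \<in> L2 c"
  using gen by (auto simp: generates_def contractive_analytic_semigroup_def bounded_operator_def)

lemma T_contr: "z \<in> Cplus \<Longrightarrow> f \<in> L2 c \<Longrightarrow> L2_norm c (T z f) \<le> L2_norm c f"
  using gen by (auto simp: generates_def contractive_analytic_semigroup_def)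

lemma T_add: "z \<in> Cplus \<Longrightarrow> w \<in> Cplus \<Longrightarrow> f \<in> L2 c \<Longrightarrow> AE y in weighted_measure c. T (z + w) f y = T z (T w f) y"
  using gen by (auto simp: generates_def contractive_analytic_semigroup_def)

lemma T_half: "z \<in> Cplus \<Longrightarrow> f \<in> L2 c \<Longrightarrow> AE y in weighted_measure c. T z f y = T (z / 2) (T (z / 2) f) y"
  using T_add[of "z / 2" "z / 2" f] Cplus_half by simp

lemma T_lin:
  "z \<in> Cplus \<Longrightarrow> f \<in> L2 c \<Longrightarrow> g \<in> L2 c \<Longrightarrow>
    AE y in weighted_measure c. T z (\<lambda>x. a * f x + b * g x) y = a * T z f y + b * T z g y"
  using gen by (simp add: generates_def contractive_analytic_semigroup_def bounded_operator_def)

lemma T_diff: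
  assumes "z \<in> Cplus" "f \<in> L2 c" "g \<in> L2 c"
  shows "AE y in weighted_measure c. T z (\<lambda>x. f x - g x) y = T z f y - T z g y"
  using T_lin[OF assms, of 1 "-1"] by simp

text \<open>The complex derivative of the semigroup at z. On \<open>L2 c\<close> it is the generator
  applied to \<open>T z f\<close>, as \<open>T_generator\<close> shows, and so plays the part of the
  right-hand side w in the estimates for solutions.\<close>

definition Td :: "complex \<Rightarrow> (real \<Rightarrow> complex) \<Rightarrow> (real \<Rightarrow> complex)" where
  "Td z = (SOME S. bounded_operator c S \<and>
        (\<forall>e>0. \<forall>\<^sub>F h in at 0. \<forall>f\<in>L2 c.
           L2_norm c (\<lambda>y. (T (z + h) f y - T z f y) / h - S f y) \<le> e * L2_norm c f))"

lemma Td: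
  assumes "z \<in> Cplus"
  shows "bounded_operator c (Td z)" "f \<in> L2 c \<Longrightarrow> Td z f \<in> L2 c"
    "f \<in> L2 c \<Longrightarrow> ((\<lambda>h. L2_norm c (\<lambda>y. (T (z + h) f y - T z f y) / h - Td z f y)) \<longlongrightarrow> 0) (at 0)"
proof -
  have "\<exists>S. bounded_operator c S \<and> (\<forall>e>0. \<forall>\<^sub>F h in at 0. \<forall>f\<in>L2 c.
           L2_norm c (\<lambda>y. (T (z + h) f y - T z f y) / h - S f y) \<le> e * L2_norm c f)"
    using gen assms unfolding generates_def contractive_analytic_semigroup_def by blast
  from someI_ex[OF this]
  have S: "bounded_operator c (Td z)" "\<forall>e>0. \<forall>\<^sub>F h in at 0. \<forall>f\<in>L2 c.
           L2_norm c (\<lambda>y. (T (z + h) f y - T z f y) / h - Td z f y) \<le> e * L2_norm c f"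
    unfolding Td_def[symmetric] by auto
  show "bounded_operator c (Td z)" by (rule S)
  show "Td z f \<in> L2 c" if "f \<in> L2 c" using S(1) that by (simp add: bounded_operator_def)
  show "((\<lambda>h. L2_norm c (\<lambda>y. (T (z + h) f y - T z f y) / h - Td z f y)) \<longlongrightarrow> 0) (at 0)" if f: "f \<in> L2 c"
  proof (rule tendstoI)
    fix e :: real assume e: "0 < e"
    have p: "0 < L2_norm c f + 1" using L2_norm_nonneg[of c f] by linarith
    then have "0 < e / (L2_norm c f + 1)" using e by simp
    then have "\<forall>\<^sub>F h in at 0. \<forall>f'\<in>L2 c. L2_norm c (\<lambda>y. (T (z + h) f' y - T z f' y) / h - Td z f' y) \<le> e / (L2_norm c f + 1) * L2_norm c f'"
      using S(2) by blast
    then show "\<forall>\<^sub>F h in at 0. dist (L2_norm c (\<lambda>y. (T (z + h) f y - T z f y) / h - Td z f y)) 0 < e"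
    proof eventually_elim
      fix h assume "\<forall>f'\<in>L2 c. L2_norm c (\<lambda>y. (T (z + h) f' y - T z f' y) / h - Td z f' y) \<le> e / (L2_norm c f + 1) * L2_norm c f'"
      then have "L2_norm c (\<lambda>y. (T (z + h) f y - T z f y) / h - Td z f y) \<le> e / (L2_norm c f + 1) * L2_norm c f"
        using f by blast
      also have "\<dots> < e" using p e by (simp add: field_simps)
      finally show "dist (L2_norm c (\<lambda>y. (T (z + h) f y - T z f y) / h - Td z f y)) 0 < e" by simp
    qed
  qed
qed

text \<open>The complex difference quotient is restricted to positive real increments t, where the
  semigroup law rewrites T (z + t) f as T t applied to T z f; this is the limit that defines the
  generator.\<close>

lemma T_generator:
  assumes z: "z \<in> Cplus" and f: "f \<in> L2 c" shows "(T z f, Td z f) \<in> Bn_minus c V"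
proof -
  have "filterlim complex_of_real (at 0) (at_right 0)"
    unfolding filterlim_at by (auto intro!: tendsto_eq_intros simp: eventually_at_filter)
  from filterlim_compose[OF Td(3)[OF z f] this]
  have "((\<lambda>t. L2_norm c (\<lambda>y. (T (z + of_real t) f y - T z f y) / of_real t - Td z f y)) \<longlongrightarrow> 0) (at_right 0)" .
  then have "((\<lambda>t. L2_norm c (\<lambda>y. (T (of_real t) (T z f) y - T z f y) / of_real t - Td z f y)) \<longlongrightarrow> 0) (at_right 0)"
  proof (rule Lim_transform_eventually)
    show "\<forall>\<^sub>F t in at_right 0. L2_norm c (\<lambda>y. (T (z + of_real t) f y - T z f y) / of_real t - Td z f y)
       = L2_norm c (\<lambda>y. (T (of_real t) (T z f) y - T z f y) / of_real t - Td z f y)"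
      unfolding eventually_at_filter
    proof (rule always_eventually, intro allI impI)
      fix t :: real assume "t \<in> {0<..}"
      then have t: "complex_of_real t \<in> Cplus" "z + of_real t \<in> Cplus" using z by (auto simp: Cplus_def)
      show "L2_norm c (\<lambda>y. (T (z + of_real t) f y - T z f y) / of_real t - Td z f y)
       = L2_norm c (\<lambda>y. (T (of_real t) (T z f) y - T z f y) / of_real t - Td z f y)"
      proof (rule L2_norm_cong_AE)
        show "AE y in weighted_measure c. (T (z + of_real t) f y - T z f y) / of_real t - Td z f y =
            (T (of_real t) (T z f) y - T z f y) / of_real t - Td z f y"
          using T_add[OF t(1) z f] by eventually_elim (simp add: add.commute)
      qed (intro L2_diff L2_divide T_L2 t z f Td(2)[OF z])+
    qed
  qed
  then have "(T z f, Td z f) \<in> generator c T"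
    unfolding generator_def using T_L2[OF z f] Td(2)[OF z f] by simp
  then show ?thesis using gen by (simp add: generates_def)
qed

lemma T_form_domain: "z \<in> Cplus \<Longrightarrow> f \<in> L2 c \<Longrightarrow> T z f \<in> form_domain c V"
  using Bn_minusD(1)[OF T_generator] .

lemma T_has_rep: "z \<in> Cplus \<Longrightarrow> f \<in> L2 c \<Longrightarrow> has_rep (T z f)"
  using form_domain_rep(1)[OF T_form_domain] .

text \<open>The derivative thereby has the form \<open>T (z/2)\<close> of an \<open>L2 c\<close>
  function, just like T z f, and inherits every pointwise bound known for the semigroup. The
  difference quotients at z are \<open>T (z/2)\<close> of those at z/2, and contractivity passes to
  the limit.\<close>

lemma Td_half:
  assumes z: "z \<in> Cplus" and f: "f \<in> L2 c"
  shows "AE y in weighted_measure c. Td z f y = T (z / 2) (Td (z / 2) f) y"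
proof -
  let ?z = "z / 2" and ?d = "\<lambda>y. Td z f y - T (z / 2) (Td (z / 2) f) y"
  have z2: "?z \<in> Cplus" by (rule Cplus_half[OF z])
  let ?q = "\<lambda>h y. (T (z + h) f y - T z f y) / h" and ?r = "\<lambda>h y. (T (?z + h) f y - T ?z f y) / h"
  have dL: "?d \<in> L2 c" by (intro L2_diff T_L2 Td(2) z z2 f)
  have "((\<lambda>h. L2_norm c (\<lambda>y. ?q h y - Td z f y) + L2_norm c (\<lambda>y. ?r h y - Td ?z f y)) \<longlongrightarrow> 0 + 0) (at 0)"
    by (intro tendsto_add Td(3) z z2 f)
  moreover have "\<forall>\<^sub>F h in at 0. L2_norm c ?d \<le> L2_norm c (\<lambda>y. ?q h y - Td z f y) + L2_norm c (\<lambda>y. ?r h y - Td ?z f y)"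
  proof -
    have "((\<lambda>h. ?z + h) \<longlongrightarrow> ?z + 0) (at 0)" by (intro tendsto_intros)
    then have lim: "filterlim (\<lambda>h. ?z + h) (nhds ?z) (at 0)" by simp
    have "\<forall>\<^sub>F w in nhds ?z. w \<in> Cplus" using open_Cplus z2 by (rule eventually_nhds_in_open)
    from eventually_compose_filterlim[OF this lim] have "\<forall>\<^sub>F h in at 0. ?z + h \<in> Cplus" .
    then show ?thesis
    proof eventually_elim
      fix h assume h: "?z + h \<in> Cplus"
      have zh: "z + h \<in> Cplus"
      proof -
        have "?z + (?z + h) \<in> Cplus" using h z2 by (simp add: Cplus_def)
        then show ?thesis by simp
      qed
      have qL: "?q h \<in> L2 c" by (intro L2_divide L2_diff T_L2 zh z f)
      have rL: "?r h \<in> L2 c" by (intro L2_divide L2_diff T_L2 h z2 f)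
      have e: "(\<lambda>x. 1 / h * T (?z + h) f x + - (1 / h) * T ?z f x) = ?r h" by (auto simp: diff_divide_distrib)
      have AE: "AE y in weighted_measure c. ?q h y = T ?z (?r h) y"
        using T_add[OF z2 h f] T_half[OF z f] T_lin[OF z2 T_L2[OF h f] T_L2[OF z2 f], of "1 / h" "- (1 / h)"]
        unfolding e by eventually_elim (simp add: diff_divide_distrib)
      have "L2_norm c (\<lambda>y. ?q h y - T ?z (Td ?z f) y) = L2_norm c (T ?z (\<lambda>y. ?r h y - Td ?z f y))"
      proof (rule L2_norm_cong_AE)
        show "AE y in weighted_measure c. ?q h y - T ?z (Td ?z f) y = T ?z (\<lambda>y. ?r h y - Td ?z f y) y"
          using AE T_diff[OF z2 rL Td(2)[OF z2 f]] by eventually_elim simp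
      qed (intro L2_diff qL T_L2 z2 rL Td(2)[OF z2 f])+
      also have "\<dots> \<le> L2_norm c (\<lambda>y. ?r h y - Td ?z f y)"
        by (intro T_contr L2_diff rL Td(2)[OF z2 f] z2)
      finally have 1: "L2_norm c (\<lambda>y. ?q h y - T ?z (Td ?z f) y) \<le> L2_norm c (\<lambda>y. ?r h y - Td ?z f y)" .
      have "L2_norm c ?d \<le> L2_norm c (\<lambda>y. Td z f y - ?q h y) + L2_norm c (\<lambda>y. ?q h y - T ?z (Td ?z f) y)"
        by (rule L2_norm_diff_triangle) (intro Td(2) z f qL T_L2 z2)+
      also have "L2_norm c (\<lambda>y. Td z f y - ?q h y) = L2_norm c (\<lambda>y. ?q h y - Td z f y)"
        by (simp add: L2_norm_def norm_minus_commute)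
      finally show "L2_norm c ?d \<le> L2_norm c (\<lambda>y. ?q h y - Td z f y) + L2_norm c (\<lambda>y. ?r h y - Td ?z f y)"
        using 1 by simp
    qed
  qed
  ultimately have "L2_norm c ?d \<le> 0"
    by (intro tendsto_lowerbound[where F="at 0"]) auto
  then have "L2_norm c ?d = 0" using L2_norm_nonneg[of c ?d] by linarith
  from L2_norm_zero_AE[OF dL this] show ?thesis by eventually_elim simp
qed

text \<open>General affine paths are allowed because the symmetry proof follows s z and z - s z
  simultaneously, while the weighted estimate only follows the ray s z.\<close>

lemma T_line_deriv:
  assumes ab: "a + of_real t * b \<in> Cplus" "b \<noteq> 0" and f: "f \<in> L2 c"
  shows "L2_deriv c (\<lambda>s. T (a + of_real s * b) f) (\<lambda>y. b * Td (a + of_real t * b) f y) t"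
  unfolding L2_deriv_def
proof (intro conjI)
  let ?z = "a + of_real t * b"
  show "(\<lambda>y. b * Td ?z f y) \<in> L2 c" by (intro L2_scale Td(2) ab f)
  have "((\<lambda>s. a + of_real s * b) \<longlongrightarrow> ?z) (nhds t)"
    by (intro tendsto_intros filterlim_ident)
  moreover have "\<forall>\<^sub>F w in nhds ?z. w \<in> Cplus" using open_Cplus ab(1) by (rule eventually_nhds_in_open)
  ultimately have "\<forall>\<^sub>F s in nhds t. a + of_real s * b \<in> Cplus" by (rule eventually_compose_filterlim[rotated])
  then show "\<forall>\<^sub>F s in nhds t. T (a + of_real s * b) f \<in> L2 c" by eventually_elim (intro T_L2 f)
  have "((\<lambda>h. complex_of_real h * b) \<longlongrightarrow> of_real 0 * b) (at 0)" by (intro tendsto_intros)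
  then have "filterlim (\<lambda>h. complex_of_real h * b) (at 0) (at 0)"
    unfolding filterlim_at using ab(2) by (auto simp: eventually_at_filter)
  from filterlim_compose[OF Td(3)[OF ab(1) f] this]
  have "((\<lambda>h. cmod b * L2_norm c (\<lambda>y. (T (?z + of_real h * b) f y - T ?z f y) / (of_real h * b) - Td ?z f y)) \<longlongrightarrow> cmod b * 0) (at 0)"
    by (intro tendsto_mult tendsto_const)
  moreover have "L2_norm c (\<lambda>y. (T (a + of_real (t + h) * b) f y - T ?z f y) / of_real h - b * Td ?z f y) =
      cmod b * L2_norm c (\<lambda>y. (T (?z + of_real h * b) f y - T ?z f y) / (of_real h * b) - Td ?z f y)" for h
  proof -
    have 1: "a + of_real (t + h) * b = ?z + of_real h * b" by (simp add: algebra_simps)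
    have 2: "(X - Y) / of_real h - b * D = b * ((X - Y) / (of_real h * b) - D)" for X Y D
      using ab(2) by (cases "h = 0") (simp_all add: field_simps)
    show ?thesis unfolding L2_norm_scale[symmetric] 1 2 ..
  qed
  ultimately show "((\<lambda>h. L2_norm c (\<lambda>y. (T (a + of_real (t + h) * b) f y - T ?z f y) / of_real h - b * Td ?z f y)) \<longlongrightarrow> 0) (at 0)"
    by simp
qed

lemma T_ray_0:
  assumes z: "z \<in> Cplus" and f: "f \<in> L2 c"
  shows "((\<lambda>s. L2_norm c (\<lambda>y. T (of_real s * z) f y - f y)) \<longlongrightarrow> 0) (at_right 0)"
proof -
  have z0: "z \<noteq> 0" using z by (auto simp: Cplus_def)
  then have a: "\<bar>Arg z\<bar> < pi / 2"
    using z Re_Ln_pos_lt[of z] Arg_eq_Im_Ln[OF z0] by (simp add: Cplus_def)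
  \<comment> \<open>Any angle strictly between |Arg z| and pi / 2 works: the whole ray through z
    then stays in one proper subsector.\<close>
  define \<theta> where "\<theta> = (\<bar>Arg z\<bar> + pi / 2) / 2"
  have \<theta>: "0 < \<theta>" "\<theta> < pi / 2" "\<bar>Arg z\<bar> < \<theta>" using a by (auto simp: \<theta>_def)
  have "((\<lambda>s. complex_of_real s * z) \<longlongrightarrow> of_real 0 * z) (at_right 0)" by (intro tendsto_intros)
  then have "filterlim (\<lambda>s. complex_of_real s * z) (at 0 within sector \<theta>) (at_right 0)"
    unfolding filterlim_at using z0 \<theta> by (auto simp: eventually_at_filter sector_def)
  moreover have "((\<lambda>w. L2_norm c (\<lambda>y. T w f y - f y)) \<longlongrightarrow> 0) (at 0 within sector \<theta>)"
    using gen \<theta> f unfolding generates_def contractive_analytic_semigroup_def by blast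
  ultimately show ?thesis by (rule filterlim_compose[rotated])
qed

text \<open>The pairing of T (s z) f with T ((1 - s) z) g has derivative 0 for 0 < s < 1, because
  the generator is symmetric. Its limits at the two ends are the two sides of the claim.\<close>

lemma T_symmetric:
  assumes z: "z \<in> Cplus" and f: "f \<in> L2 c" and g: "g \<in> L2 c"
  shows "L2_pair c (T z f) g = L2_pair c f (T z g)"
proof -
  have z0: "z \<noteq> 0" using z by (auto simp: Cplus_def)
  define B where "B = (\<lambda>s. L2_pair c (T (0 + of_real s * z) f) (T (z + of_real s * (- z)) g))"
  have in1: "0 + of_real s * z \<in> Cplus" if "0 < s" for s using Cplus_scale[OF z that] by simp
  have in2: "z + of_real s * (- z) \<in> Cplus" if "s < 1" for s
    using Cplus_scale[OF z, of "1 - s"] that by (simp add: algebra_simps)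
  have D: "(B has_vector_derivative 0) (at s)" if s: "0 < s" "s < 1" for s
  proof -
    let ?z1 = "0 + of_real s * z" and ?z2 = "z + of_real s * (- z)"
    have "(B has_vector_derivative L2_pair c (\<lambda>y. z * Td ?z1 f y) (T ?z2 g) + L2_pair c (T ?z1 f) (\<lambda>y. - z * Td ?z2 g y)) (at s)"
      unfolding B_def by (intro L2_deriv_pair T_line_deriv in1 in2 s f g) (use z0 in auto)
    moreover have "L2_pair c (\<lambda>y. z * Td ?z1 f y) (T ?z2 g) = z * L2_pair c (Td ?z1 f) (T ?z2 g)"
      by (simp add: L2_pair_def mult.assoc)
    moreover have "L2_pair c (T ?z1 f) (\<lambda>y. - z * Td ?z2 g y) = - z * L2_pair c (T ?z1 f) (Td ?z2 g)"
      by (simp add: L2_pair_def mult.left_commute)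
    ultimately show ?thesis
      using Bn_minus_symmetric[OF T_generator[OF in1[OF s(1)] f] T_generator[OF in2[OF s(2)] g] V_measurable] by simp
  qed
  obtain k where k: "\<And>s. s \<in> {0<..<1} \<Longrightarrow> B s = k"
  proof -
    have d: "(B has_derivative (\<lambda>h. 0)) (at s within {0<..<1})" if "s \<in> {0<..<1}" for s
      using D[of s] that by (auto intro: has_derivative_at_withinI[of B "\<lambda>h. 0" s] simp: has_vector_derivative_def)
    have "B s = B (1 / 2)" if "s \<in> {0<..<1}" for s
      by (rule has_derivative_zero_unique[OF _ d that]) simp_all
    then show ?thesis using that by blast
  qed
  have "(B \<longlongrightarrow> L2_pair c f (T z g)) (at_right 0)"
    unfolding B_def
  proof (rule L2_pair_tendsto2)
    show "((\<lambda>s. L2_norm c (\<lambda>y. T (0 + of_real s * z) f y - f y)) \<longlongrightarrow> 0) (at_right 0)"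
      using T_ray_0[OF z f] by simp
    show "\<forall>\<^sub>F s in at_right 0. T (0 + of_real s * z) f \<in> L2 c"
      unfolding eventually_at_filter by (rule always_eventually) (auto intro!: T_L2 Cplus_scale z f)
    show "\<forall>\<^sub>F s in at_right 0. T (z + of_real s * (- z)) g \<in> L2 c"
      unfolding eventually_at_right_field using in2 T_L2 g by (intro exI[of _ 1]) auto
    \<comment> \<open>Here the argument tends to z, an interior point, so continuity follows from
      differentiability; the other factor approaches 0 along a ray and needs
      \<open>T_ray_0\<close>.\<close>
    have "((\<lambda>h. L2_norm c (\<lambda>y. T (z + of_real (0 + h) * (- z)) g y - T (z + of_real 0 * (- z)) g y)) \<longlongrightarrow> 0) (at 0)"
      by (rule L2_derivD(5)[OF T_line_deriv]) (use z z0 g in auto)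
    then show "((\<lambda>s. L2_norm c (\<lambda>y. T (z + of_real s * (- z)) g y - T z g y)) \<longlongrightarrow> 0) (at_right 0)"
      by (simp add: filterlim_at_split)
  qed (auto intro: T_L2 z f g)
  moreover have "(B \<longlongrightarrow> k) (at_right 0)"
    by (rule Lim_transform_eventually[OF tendsto_const])
       (use k in \<open>auto simp: eventually_at_right_field intro!: exI[of _ 1]\<close>)
  ultimately have 1: "L2_pair c f (T z g) = k" by (intro tendsto_unique[of "at_right 0" B]) auto
  have "((\<lambda>s. B (1 - s)) \<longlongrightarrow> L2_pair c (T z f) g) (at_right 0)"
    unfolding B_def
  proof (rule L2_pair_tendsto2)
    have e: "z + complex_of_real (1 - s) * (- z) = of_real s * z" for s by (simp add: algebra_simps)
    show "((\<lambda>s. L2_norm c (\<lambda>y. T (z + complex_of_real (1 - s) * (- z)) g y - g y)) \<longlongrightarrow> 0) (at_right 0)"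
      unfolding e by (rule T_ray_0[OF z g])
    show "\<forall>\<^sub>F s in at_right 0. T (z + complex_of_real (1 - s) * (- z)) g \<in> L2 c"
      unfolding e eventually_at_filter by (rule always_eventually) (auto intro!: T_L2 Cplus_scale z g)
    have e2: "0 + complex_of_real (1 - s) * z = z + of_real s * (- z)" for s by (simp add: algebra_simps)
    show "\<forall>\<^sub>F s in at_right 0. T (0 + complex_of_real (1 - s) * z) f \<in> L2 c"
      unfolding e2 eventually_at_right_field using in2 T_L2 f by (intro exI[of _ 1]) auto
    have "((\<lambda>h. L2_norm c (\<lambda>y. T (z + of_real (0 + h) * (- z)) f y - T (z + of_real 0 * (- z)) f y)) \<longlongrightarrow> 0) (at 0)"
      by (rule L2_derivD(5)[OF T_line_deriv]) (use z z0 f in auto)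
    then show "((\<lambda>s. L2_norm c (\<lambda>y. T (0 + complex_of_real (1 - s) * z) f y - T z f y)) \<longlongrightarrow> 0) (at_right 0)"
      unfolding e2 by (simp add: filterlim_at_split)
  qed (auto intro: T_L2 z f g)
  moreover have "((\<lambda>s. B (1 - s)) \<longlongrightarrow> k) (at_right 0)"
    by (rule Lim_transform_eventually[OF tendsto_const])
       (use k in \<open>auto simp: eventually_at_right_field intro!: exI[of _ 1]\<close>)
  ultimately have "L2_pair c (T z f) g = k" by (intro tendsto_unique[of "at_right 0" "\<lambda>s. B (1 - s)"]) auto
  with 1 show ?thesis by simp
qed

end

section \<open>Weighted estimates for the semigroup\<close>

text \<open>For 0 < \<delta> <= 1 this is the closed sector, without 0, whose half-angle has cosine
  \<delta>. The inequality is homogeneous, hence inherited by z/2, and it feeds directly into |z|^2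
  / Re z.\<close>

definition psector :: "real \<Rightarrow> complex set" where
  "psector \<delta> = {z. 0 < Re z \<and> \<delta> * cmod z \<le> Re z}"

lemma psector_Cplus: "z \<in> psector \<delta> \<Longrightarrow> z \<in> Cplus"
  by (simp add: psector_def Cplus_def)

lemma psector_half: "z \<in> psector \<delta> \<Longrightarrow> z / 2 \<in> psector \<delta>"
  by (simp add: psector_def norm_divide)

lemma psector_norm_pos: "z \<in> psector \<delta> \<Longrightarrow> 0 < cmod z"
  by (auto simp: psector_def)

context schroedinger
begin

text \<open>Davies' method along the ray s z: the squared weighted norm N of T (s z) f satisfies N'
  <= 2 \<kappa> N by the rotated energy estimate, and Gronwall's argument finishes.\<close>

lemma T_wnorm:
  assumes z: "z \<in> Cplus" and wt: "weight \<alpha> \<phi>" and f: "f \<in> L2 c"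
  shows "wnorm c \<phi> (T z f) \<le> exp (\<alpha>\<^sup>2 * (cmod z)\<^sup>2 / Re z) * wnorm c \<phi> f"
proof -
  have z0: "z \<noteq> 0" and Rz: "0 < Re z" using z by (auto simp: Cplus_def)
  define \<kappa> where "\<kappa> = \<alpha>\<^sup>2 * (cmod z)\<^sup>2 / Re z"
  define e where "e = (\<lambda>y. complex_of_real (exp (- \<phi> y)))"
  have em: "e \<in> borel_measurable (weighted_measure c)" unfolding e_def by (rule weight_measurable[OF wt])
  have eb: "cmod (e y) \<le> 1" for y using weight_nonneg(2)[OF wt, of y] by (simp add: e_def)
  have eL: "(\<lambda>y. e y * g y) \<in> L2 c" if "g \<in> L2 c" for g unfolding e_def by (rule weight_L2[OF wt that])
  define u where "u = (\<lambda>s. T (0 + of_real s * z) f)"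
  have sz: "0 + of_real s * z \<in> Cplus" if "0 < s" for s using Cplus_scale[OF z that] by simp
  \<comment> \<open>Writing the squared norm as a pairing makes it differentiable by
    \<open>L2_deriv_pair\<close>.\<close>
  define N where "N = (\<lambda>s. Re (L2_pair c (\<lambda>y. e y * u s y) (\<lambda>y. cnj (e y * u s y))))"
  have N: "N s = (wnorm c \<phi> (u s))\<^sup>2" if "0 < s" for s
    unfolding N_def wnorm_def u_def e_def
    using L2_pair_cnj[OF weight_L2[OF wt T_L2[OF sz[OF that] f]]] by simp
  have D: "\<exists>y. (N has_real_derivative y) (at s) \<and> y \<le> 2 * \<kappa> * N s" if s: "0 < s" for s
  proof -
    let ?w = "Td (0 + of_real s * z) f"
    let ?P = "L2_pair c (\<lambda>y. e y * ?w y) (\<lambda>y. cnj (e y * u s y))"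
    have d: "L2_deriv c (\<lambda>s y. e y * u s y) (\<lambda>y. e y * (z * ?w y)) s"
      unfolding u_def by (intro L2_deriv_bounded_mult T_line_deriv sz s z0 f em eb)
    have 1: "L2_pair c (\<lambda>y. e y * (z * ?w y)) (\<lambda>y. cnj (e y * u s y)) = z * ?P"
      by (simp add: L2_pair_def mult_ac)
    have 2: "L2_pair c (\<lambda>y. e y * u s y) (\<lambda>y. cnj (e y * (z * ?w y))) = cnj (z * ?P)"
      unfolding 1[symmetric] by (simp add: L2_pair_def mult_ac flip: Bochner_Integration.integral_cnj)
    have "((\<lambda>s. L2_pair c (\<lambda>y. e y * u s y) (\<lambda>y. cnj (e y * u s y))) has_vector_derivative (z * ?P + cnj (z * ?P))) (at s)"
      using L2_deriv_pair[OF d L2_deriv_cnj[OF d]] unfolding 1 2 .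
    then have "(N has_vector_derivative Re (z * ?P + cnj (z * ?P))) (at s)"
      unfolding N_def by (rule bounded_linear.has_vector_derivative[OF bounded_linear_Re])
    moreover have "Re (z * ?P + cnj (z * ?P)) = 2 * Re (z * ?P)" by simp
    ultimately have "(N has_real_derivative (2 * Re (z * ?P))) (at s)"
      by (simp only: has_real_derivative_iff_has_vector_derivative)
    moreover have "Re (z * ?P) \<le> \<kappa> * (wnorm c \<phi> (u s))\<^sup>2"
      using energy_estimate(2)[OF T_generator[OF sz[OF s] f] wt V_nonneg V_measurable Rz]
      unfolding \<kappa>_def e_def u_def .
    ultimately show ?thesis unfolding N[OF s] by (intro exI[of _ "2 * Re (z * ?P)"]) simp
  qed
  \<comment> \<open>The differential inequality is available only for s > 0, so the comparison
    starts at s and s tends to 0 afterwards.\<close>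
  have mono: "N 1 * exp (- 2 * \<kappa> * 1) \<le> N s * exp (- 2 * \<kappa> * s)" if s: "0 < s" "s \<le> 1" for s
  proof (rule DERIV_nonpos_imp_nonincreasing[OF s(2)])
    fix x assume x: "s \<le> x" "x \<le> 1"
    then have "0 < x" using s by simp
    from D[OF this] obtain y where y: "(N has_real_derivative y) (at x)" "y \<le> 2 * \<kappa> * N x" by blast
    have "((\<lambda>s. N s * exp (- 2 * \<kappa> * s)) has_real_derivative (y - 2 * \<kappa> * N x) * exp (- 2 * \<kappa> * x)) (at x)"
      by (rule derivative_eq_intros y(1) refl | simp add: algebra_simps)+
    moreover have "(y - 2 * \<kappa> * N x) * exp (- 2 * \<kappa> * x) \<le> 0" using y(2) by (simp add: mult_le_0_iff)
    ultimately show "\<exists>y. ((\<lambda>s. N s * exp (- 2 * \<kappa> * s)) has_real_derivative y) (at x) \<and> y \<le> 0" by blast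
  qed
  have evL: "\<forall>\<^sub>F s in at_right 0. (\<lambda>y. e y * u s y) \<in> L2 c"
    unfolding eventually_at_filter u_def by (rule always_eventually) (auto intro!: eL T_L2 Cplus_scale z f)
  have lim: "((\<lambda>s. L2_norm c (\<lambda>y. e y * u s y - e y * f y)) \<longlongrightarrow> 0) (at_right 0)"
  proof (rule Lim_null_comparison[OF _ T_ray_0[OF z f]])
    show "\<forall>\<^sub>F s in at_right 0. norm (L2_norm c (\<lambda>y. e y * u s y - e y * f y)) \<le> L2_norm c (\<lambda>y. T (of_real s * z) f y - f y)"
      unfolding eventually_at_filter
    proof (rule always_eventually, intro allI impI)
      fix s :: real assume "s \<in> {0<..}"
      then have d: "(\<lambda>y. T (of_real s * z) f y - f y) \<in> L2 c" by (intro L2_diff T_L2 Cplus_scale z f) auto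
      have "L2_norm c (\<lambda>y. e y * (T (of_real s * z) f y - f y)) \<le> L2_norm c (\<lambda>y. T (of_real s * z) f y - f y)"
        by (rule L2_norm_mono_AE[OF eL[OF d] d], rule AE_weighted_I) (use eb in \<open>auto simp: norm_mult intro: mult_left_le_one_le\<close>)
      then show "norm (L2_norm c (\<lambda>y. e y * u s y - e y * f y)) \<le> L2_norm c (\<lambda>y. T (of_real s * z) f y - f y)"
        by (simp add: u_def right_diff_distrib)
    qed
  qed
  have limc: "((\<lambda>s. L2_norm c (\<lambda>y. cnj (e y * u s y) - cnj (e y * f y))) \<longlongrightarrow> 0) (at_right 0)"
    using lim unfolding complex_cnj_diff[symmetric] L2_norm_cnj .
  have evc: "\<forall>\<^sub>F s in at_right 0. (\<lambda>y. cnj (e y * u s y)) \<in> L2 c"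
    using evL by eventually_elim (rule L2_cnj)
  have "(N \<longlongrightarrow> Re (L2_pair c (\<lambda>y. e y * f y) (\<lambda>y. cnj (e y * f y)))) (at_right 0)"
    unfolding N_def
    by (intro tendsto_Re L2_pair_tendsto2 evL evc lim limc eL f L2_cnj)
  moreover have "Re (L2_pair c (\<lambda>y. e y * f y) (\<lambda>y. cnj (e y * f y))) = (wnorm c \<phi> f)\<^sup>2"
    using L2_pair_cnj[OF eL[OF f]] by (simp add: wnorm_def e_def)
  ultimately have "(N \<longlongrightarrow> (wnorm c \<phi> f)\<^sup>2) (at_right 0)" by simp
  moreover have "((\<lambda>s. exp (- 2 * \<kappa> * s)) \<longlongrightarrow> exp (- 2 * \<kappa> * 0)) (at_right (0::real))" by (intro tendsto_intros)
  ultimately have "((\<lambda>s. N s * exp (- 2 * \<kappa> * s)) \<longlongrightarrow> (wnorm c \<phi> f)\<^sup>2 * exp (- 2 * \<kappa> * 0)) (at_right 0)"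
    by (rule tendsto_mult)
  then have "N 1 * exp (- 2 * \<kappa> * 1) \<le> (wnorm c \<phi> f)\<^sup>2 * exp (- 2 * \<kappa> * 0)"
    by (rule tendsto_lowerbound) (use mono in \<open>auto simp: eventually_at_right_field intro!: exI[of _ 1]\<close>)
  then have "N 1 * exp (- 2 * \<kappa>) * exp (2 * \<kappa>) \<le> (wnorm c \<phi> f)\<^sup>2 * exp (2 * \<kappa>)"
    by (intro mult_right_mono) auto
  moreover have "N 1 * exp (- 2 * \<kappa>) * exp (2 * \<kappa>) = N 1" by (simp add: mult.assoc flip: exp_add)
  moreover have "(wnorm c \<phi> f)\<^sup>2 * exp (2 * \<kappa>) = (exp \<kappa> * wnorm c \<phi> f)\<^sup>2"
    by (simp add: power_mult_distrib exp_double)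
  ultimately have "N 1 \<le> (exp \<kappa> * wnorm c \<phi> f)\<^sup>2" by (simp only:)
  then have "(wnorm c \<phi> (T z f))\<^sup>2 \<le> (exp \<kappa> * wnorm c \<phi> f)\<^sup>2"
    using N[of 1] by (simp add: u_def)
  then show ?thesis unfolding \<kappa>_def by (rule power2_le_imp_le) simp
qed

lemma T_wnorm_psector:
  assumes z: "z \<in> psector \<delta>" and \<delta>: "0 < \<delta>" and wt: "weight \<alpha> \<phi>" and f: "f \<in> L2 c"
  shows "wnorm c \<phi> (T z f) \<le> exp (\<alpha>\<^sup>2 * cmod z / \<delta>) * wnorm c \<phi> f"
proof -
  have p: "0 < Re z" "\<delta> * cmod z \<le> Re z" using z by (auto simp: psector_def)
  have "\<alpha>\<^sup>2 * (cmod z)\<^sup>2 * \<delta> \<le> \<alpha>\<^sup>2 * cmod z * Re z"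
    using mult_left_mono[OF p(2) mult_nonneg_nonneg[OF zero_le_power2[of \<alpha>] norm_ge_zero[of z]]]
    by (simp add: power2_eq_square mult_ac)
  then have "\<alpha>\<^sup>2 * (cmod z)\<^sup>2 / Re z \<le> \<alpha>\<^sup>2 * cmod z / \<delta>" using p \<delta> by (simp add: field_simps)
  then have "exp (\<alpha>\<^sup>2 * (cmod z)\<^sup>2 / Re z) * wnorm c \<phi> f \<le> exp (\<alpha>\<^sup>2 * cmod z / \<delta>) * wnorm c \<phi> f"
    by (intro mult_right_mono) auto
  then show ?thesis using T_wnorm[OF psector_Cplus[OF z] wt f] by linarith
qed

text \<open>Cauchy's inequality for the scalar function that pairs T \<zeta> f with the weighted g,
  followed by duality in g.\<close>

lemma Td_wnorm:
  assumes z: "z \<in> psector \<delta>" and \<delta>: "0 < \<delta>" "\<delta> \<le> 1" and wt: "weight \<alpha> \<phi>" and f: "f \<in> L2 c"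
  shows "wnorm c \<phi> (Td z f) \<le> 2 / (\<delta> * cmod z) * exp (9 / (2 * \<delta>) * (\<alpha>\<^sup>2 * cmod z)) * wnorm c \<phi> f"
    (is "_ \<le> ?B")
proof -
  note zC = psector_Cplus[OF z]
  have p: "0 < Re z" "\<delta> * cmod z \<le> Re z" and n: "0 < cmod z" using z psector_norm_pos by (auto simp: psector_def)
  \<comment> \<open>On this disc Re \<zeta> >= \<delta> |z| / 2 and |\<zeta>| <= 3/2 |z|, hence
    |\<zeta>|^2 / Re \<zeta> <= 9 / (2 \<delta>) |z|. The disc may leave the sector, so
    \<open>T_wnorm\<close> is used on it instead of the sector version.\<close>
  define \<rho> where "\<rho> = \<delta> * cmod z / 2"
  have \<rho>: "0 < \<rho>" using \<delta> n by (simp add: \<rho>_def)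
  define E where "E = exp (9 / (2 * \<delta>) * (\<alpha>\<^sup>2 * cmod z))"
  have near: "\<zeta> \<in> Cplus" "\<alpha>\<^sup>2 * (cmod \<zeta>)\<^sup>2 / Re \<zeta> \<le> 9 / (2 * \<delta>) * (\<alpha>\<^sup>2 * cmod z)" if "cmod (z - \<zeta>) \<le> \<rho>" for \<zeta>
  proof -
    have "Re (z - \<zeta>) \<le> \<rho>" using complex_Re_le_cmod[of "z - \<zeta>"] that by linarith
    then have R: "\<rho> \<le> Re \<zeta>" using p by (simp add: \<rho>_def)
    then show "\<zeta> \<in> Cplus" using \<rho> by (simp add: Cplus_def)
    have "cmod \<zeta> \<le> cmod z + cmod (z - \<zeta>)" using norm_triangle_ineq4[of z "z - \<zeta>"] by simp
    also have "\<dots> \<le> cmod z + \<rho>" using that by simp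
    also have "\<rho> \<le> cmod z / 2" using mult_right_mono[OF \<delta>(2), of "cmod z"] by (simp add: \<rho>_def)
    finally have "cmod \<zeta> \<le> 3 / 2 * cmod z" by simp
    then have "(cmod \<zeta>)\<^sup>2 \<le> (3 / 2 * cmod z)\<^sup>2" by (intro power_mono) auto
    then have "(cmod \<zeta>)\<^sup>2 / Re \<zeta> \<le> (3 / 2 * cmod z)\<^sup>2 / \<rho>" using R \<rho> by (intro frac_le) auto
    also have "\<dots> = 9 / (2 * \<delta>) * cmod z" using n \<delta> by (simp add: \<rho>_def power2_eq_square field_simps)
    finally have "\<alpha>\<^sup>2 * ((cmod \<zeta>)\<^sup>2 / Re \<zeta>) \<le> \<alpha>\<^sup>2 * (9 / (2 * \<delta>) * cmod z)" by (intro mult_left_mono) auto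
    then show "\<alpha>\<^sup>2 * (cmod \<zeta>)\<^sup>2 / Re \<zeta> \<le> 9 / (2 * \<delta>) * (\<alpha>\<^sup>2 * cmod z)" by (simp add: mult_ac)
  qed
  let ?e = "\<lambda>y. complex_of_real (exp (- \<phi> y))"
  have "L2_norm c (\<lambda>y. ?e y * Td z f y) \<le> ?B"
  proof (rule L2_norm_dual)
    show "(\<lambda>y. ?e y * Td z f y) \<in> L2 c" by (rule weight_L2[OF wt Td(2)[OF zC f]])
    show "0 \<le> ?B" using \<delta> n by (simp add: wnorm_def)
    fix g assume g: "g \<in> L2 c"
    define F where "F = (\<lambda>\<zeta>. L2_pair c (T \<zeta> f) (\<lambda>y. ?e y * g y))"
    have eg: "(\<lambda>y. ?e y * g y) \<in> L2 c" by (rule weight_L2[OF wt g])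
    have F_deriv: "(F has_field_derivative L2_pair c (Td \<zeta> f) (\<lambda>y. ?e y * g y)) (at \<zeta>)" if \<zeta>: "\<zeta> \<in> Cplus" for \<zeta>
    proof -
      have "((\<lambda>h. \<zeta> + h) \<longlongrightarrow> \<zeta> + 0) (at 0)" by (intro tendsto_intros)
      then have lim: "filterlim (\<lambda>h. \<zeta> + h) (nhds \<zeta>) (at 0)" by simp
      from eventually_compose_filterlim[OF eventually_nhds_in_open[OF open_Cplus \<zeta>] lim]
      have ev: "\<forall>\<^sub>F h in at 0. \<zeta> + h \<in> Cplus" .
      then have "\<forall>\<^sub>F h in at 0. (\<lambda>y. (T (\<zeta> + h) f y - T \<zeta> f y) / h) \<in> L2 c"
        by eventually_elim (intro L2_divide L2_diff T_L2 \<zeta> f)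
      from L2_pair_tendsto[OF this Td(2)[OF \<zeta> f] eg Td(3)[OF \<zeta> f]]
      have "((\<lambda>h. (F (\<zeta> + h) - F \<zeta>) / h) \<longlongrightarrow> L2_pair c (Td \<zeta> f) (\<lambda>y. ?e y * g y)) (at 0)"
      proof (rule Lim_transform_eventually)
        show "\<forall>\<^sub>F h in at 0. L2_pair c (\<lambda>y. (T (\<zeta> + h) f y - T \<zeta> f y) / h) (\<lambda>y. ?e y * g y) = (F (\<zeta> + h) - F \<zeta>) / h"
          using ev
        proof eventually_elim
          fix h assume h: "\<zeta> + h \<in> Cplus"
          show "L2_pair c (\<lambda>y. (T (\<zeta> + h) f y - T \<zeta> f y) / h) (\<lambda>y. ?e y * g y) = (F (\<zeta> + h) - F \<zeta>) / h"
            using L2_pair_lincomb[OF T_L2[OF h f] T_L2[OF \<zeta> f] eg, of "1 / h" "- 1 / h"]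
            by (simp add: F_def diff_divide_distrib)
        qed
      qed
      then show "(F has_field_derivative L2_pair c (Td \<zeta> f) (\<lambda>y. ?e y * g y)) (at \<zeta>)"
        by (simp add: DERIV_def)
    qed
    have hol: "F holomorphic_on Cplus"
      unfolding holomorphic_on_open[OF open_Cplus] using F_deriv by blast
    have sub: "cball z \<rho> \<subseteq> Cplus" using near(1) by (auto simp: dist_norm)
    have "cmod ((deriv ^^ 1) F z) \<le> fact 1 * (E * wnorm c \<phi> f * L2_norm c g) / \<rho> ^ 1"
    proof (rule Cauchy_inequality[OF _ _ \<rho>])
      show "F holomorphic_on ball z \<rho>" by (rule holomorphic_on_subset[OF hol]) (use sub ball_subset_cball in blast)
      show "continuous_on (cball z \<rho>) F"
        by (rule continuous_on_subset[OF holomorphic_on_imp_continuous_on[OF hol] sub])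
      fix \<zeta> assume "cmod (z - \<zeta>) = \<rho>"
      then have \<zeta>: "\<zeta> \<in> Cplus" "\<alpha>\<^sup>2 * (cmod \<zeta>)\<^sup>2 / Re \<zeta> \<le> 9 / (2 * \<delta>) * (\<alpha>\<^sup>2 * cmod z)" using near[of \<zeta>] by auto
      have "F \<zeta> = L2_pair c (\<lambda>y. ?e y * T \<zeta> f y) g" unfolding F_def L2_pair_def by (simp add: mult_ac)
      then have "cmod (F \<zeta>) \<le> wnorm c \<phi> (T \<zeta> f) * L2_norm c g"
        using L2_pair_bound[OF weight_L2[OF wt T_L2[OF \<zeta>(1) f]] g] by (simp add: wnorm_def)
      also have "wnorm c \<phi> (T \<zeta> f) \<le> exp (\<alpha>\<^sup>2 * (cmod \<zeta>)\<^sup>2 / Re \<zeta>) * wnorm c \<phi> f" by (rule T_wnorm[OF \<zeta>(1) wt f])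
      also have "exp (\<alpha>\<^sup>2 * (cmod \<zeta>)\<^sup>2 / Re \<zeta>) \<le> E" unfolding E_def using \<zeta>(2) by simp
      finally show "cmod (F \<zeta>) \<le> E * wnorm c \<phi> f * L2_norm c g" by (simp add: mult_right_mono)
    qed
    moreover have "deriv F z = L2_pair c (\<lambda>y. ?e y * Td z f y) g"
      using DERIV_imp_deriv[OF F_deriv[OF zC]] by (simp add: L2_pair_def mult_ac)
    ultimately show "cmod (L2_pair c (\<lambda>y. ?e y * Td z f y) g) \<le> ?B * L2_norm c g"
      by (simp add: E_def \<rho>_def mult_ac)
  qed
  then show ?thesis by (simp add: wnorm_def)
qed

text \<open>The scale r is decoupled from z: it only has to satisfy |z| ~ r^2 up to \<Lambda>. Every
  bound is then a power of r times an exponential of \<alpha>^2 r^2, and the same r serves z and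
  z/2.\<close>

lemma energy_T:
  assumes \<delta>: "0 < \<delta>" "\<delta> \<le> 1" and \<Lambda>: "1 \<le> \<Lambda>"
  obtains A where "1 \<le> A"
    "\<And>z r \<alpha> \<phi> f. z \<in> psector \<delta> \<Longrightarrow> 0 < r \<Longrightarrow> cmod z \<le> \<Lambda> * r\<^sup>2 \<Longrightarrow> r\<^sup>2 \<le> \<Lambda> * cmod z \<Longrightarrow> weight \<alpha> \<phi> \<Longrightarrow> f \<in> L2 c \<Longrightarrow>
      wnorm c \<phi> (T z f) \<le> exp (A * (\<alpha>\<^sup>2 * r\<^sup>2)) * wnorm c \<phi> f \<and>
      wnorm c \<phi> (Td z f) \<le> A / r\<^sup>2 * exp (A * (\<alpha>\<^sup>2 * r\<^sup>2)) * wnorm c \<phi> f \<and>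
      wnorm c \<phi> (weak_deriv (T z f)) \<le> A / r * exp (A * (\<alpha>\<^sup>2 * r\<^sup>2)) * wnorm c \<phi> f"
proof -
  \<comment> \<open>a dominates both exponents \<Lambda> / \<delta> and 9 \<Lambda> / (2 \<delta>);
    b / 2 is the factor from Cauchy's inequality after 1 / |z| has been replaced by \<Lambda> /
    r^2.\<close>
  define a where "a = 9 / 2 * (\<Lambda> / \<delta>)"
  define b where "b = 4 * (\<Lambda> / \<delta>)"
  have \<Lambda>\<delta>: "1 \<le> \<Lambda> / \<delta>" using \<delta> \<Lambda> by (simp add: field_simps)
  have ab: "1 \<le> a" "4 \<le> b" using \<Lambda>\<delta> unfolding a_def b_def by linarith+
  define A where "A = a + b + 1"
  show thesis
  proof (rule that[of A])
    show "1 \<le> A" using ab by (simp add: A_def)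
    fix z r \<alpha> \<phi> f
    assume z: "z \<in> psector \<delta>" and r: "0 < r" "cmod z \<le> \<Lambda> * r\<^sup>2" "r\<^sup>2 \<le> \<Lambda> * cmod z"
      and wt: "weight \<alpha> \<phi>" and f: "f \<in> L2 c"
    note zC = psector_Cplus[OF z] and n = psector_norm_pos[OF z]
    define q where "q = \<alpha>\<^sup>2 * r\<^sup>2"
    define F where "F = wnorm c \<phi> f"
    define X where "X = wnorm c \<phi> (weak_deriv (T z f))"
    define Y where "Y = wnorm c \<phi> (T z f)"
    define W where "W = wnorm c \<phi> (Td z f)"
    define G where "G = exp (a * q) * F"
    have nonneg: "0 \<le> q" "0 \<le> F" "0 \<le> X" "0 \<le> Y" "0 \<le> W" "0 \<le> G"
      by (simp_all add: q_def F_def X_def Y_def W_def G_def)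
    have zq: "\<alpha>\<^sup>2 * cmod z \<le> \<Lambda> * q" using mult_left_mono[OF r(2), of "\<alpha>\<^sup>2"] by (simp add: q_def mult_ac)
    have Y: "Y \<le> G"
    proof -
      have "\<alpha>\<^sup>2 * cmod z / \<delta> \<le> \<Lambda> * q / \<delta>" using zq \<delta> by (simp add: divide_right_mono)
      also have "\<dots> \<le> a * q" unfolding a_def using \<delta> \<Lambda> nonneg by (simp add: field_simps)
      finally have "exp (\<alpha>\<^sup>2 * cmod z / \<delta>) * F \<le> exp (a * q) * F" using nonneg by (intro mult_right_mono) auto
      then show ?thesis using T_wnorm_psector[OF z \<delta>(1) wt f] by (simp add: Y_def G_def F_def)
    qed
    have W: "W \<le> b / 2 / r\<^sup>2 * G"
    proof -
      have "9 / (2 * \<delta>) * (\<alpha>\<^sup>2 * cmod z) \<le> 9 / (2 * \<delta>) * (\<Lambda> * q)" using zq \<delta> by (intro mult_left_mono) auto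
      then have e: "exp (9 / (2 * \<delta>) * (\<alpha>\<^sup>2 * cmod z)) * F \<le> G"
        unfolding G_def a_def using nonneg by (intro mult_right_mono) auto
      have "2 / (\<delta> * cmod z) \<le> b / 2 / r\<^sup>2"
        using r(1,3) n \<delta> unfolding b_def by (simp add: field_simps)
      then have "2 / (\<delta> * cmod z) * (exp (9 / (2 * \<delta>) * (\<alpha>\<^sup>2 * cmod z)) * F) \<le> b / 2 / r\<^sup>2 * G"
        using e nonneg ab by (intro mult_mono) auto
      then show ?thesis using Td_wnorm[OF z \<delta> wt f] by (simp add: W_def F_def mult.assoc)
    qed
    have X2: "X\<^sup>2 \<le> (b / r * exp q * G)\<^sup>2"
    proof -
      have "X\<^sup>2 \<le> W * Y + 2 * \<alpha> * X * Y"
        using energy_estimate(1)[OF T_generator[OF zC f] wt V_nonneg V_measurable] by (simp add: X_def Y_def W_def)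
      \<comment> \<open>Half of X^2 is absorbed on the left. The remaining \<alpha>^2 Y^2 has no
        factor 1 / r^2 of its own; it equals q / r^2 times Y^2, and 4 q is swallowed by exp q
        because b >= 4.\<close>
      moreover have "2 * \<alpha> * X * Y \<le> X\<^sup>2 / 2 + 2 * (\<alpha> * Y)\<^sup>2"
        using zero_le_power2[of "X - 2 * \<alpha> * Y"] by (simp add: power2_eq_square algebra_simps)
      ultimately have "X\<^sup>2 \<le> 2 * (W * Y) + 4 * (\<alpha> * Y)\<^sup>2" by simp
      also have "W * Y \<le> (b / 2 / r\<^sup>2 * G) * G" using W Y nonneg ab by (intro mult_mono) auto
      also have "(\<alpha> * Y)\<^sup>2 \<le> \<alpha>\<^sup>2 * G\<^sup>2" unfolding power_mult_distrib using Y nonneg by (intro mult_left_mono power_mono) auto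
      also have "2 * ((b / 2 / r\<^sup>2 * G) * G) + 4 * (\<alpha>\<^sup>2 * G\<^sup>2) = (b + 4 * q) * (G\<^sup>2 / r\<^sup>2)"
        using r(1) by (simp add: q_def field_simps power2_eq_square)
      also have "\<dots> \<le> (b * exp q)\<^sup>2 * (G\<^sup>2 / r\<^sup>2)"
      proof (intro mult_right_mono)
        have "b + 4 * q \<le> b * (1 + q)" using mult_right_mono[OF ab(2) nonneg(1)] by (simp add: algebra_simps)
        also have "\<dots> \<le> b * exp q" using ab exp_ge_add_one_self[of q] by (intro mult_left_mono) auto
        also have "\<dots> \<le> (b * exp q)\<^sup>2"
        proof -
          have "1 * 1 \<le> b * exp q" using ab nonneg(1) by (intro mult_mono) auto
          then show ?thesis by (simp add: self_le_power)
        qed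
        finally show "b + 4 * q \<le> (b * exp q)\<^sup>2" .
      qed simp
      finally show ?thesis by (simp add: power_mult_distrib power_divide mult_ac)
    qed
    have X: "X \<le> b / r * exp q * G" by (rule power2_le_imp_le[OF X2]) (use ab r nonneg in auto)
    have GA: "exp q * G \<le> exp (A * q) * F" "G \<le> exp (A * q) * F"
    proof -
      have q: "q + a * q \<le> A * q" "a * q \<le> A * q" using nonneg(1) ab unfolding A_def by (auto simp: algebra_simps)
      have "exp (q + a * q) * F \<le> exp (A * q) * F" "exp (a * q) * F \<le> exp (A * q) * F"
        using nonneg by (intro mult_right_mono, simp only: exp_le_cancel_iff q, simp)+
      then show "exp q * G \<le> exp (A * q) * F" "G \<le> exp (A * q) * F"
        by (simp_all add: G_def exp_add mult.assoc)
    qed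
    have bA: "b / 2 \<le> A" "b \<le> A" using ab by (auto simp: A_def)
    have "b / 2 / r\<^sup>2 * G \<le> A / r\<^sup>2 * (exp (A * q) * F)"
      by (rule mult_mono[OF divide_right_mono[OF bA(1)] GA(2)]) (use nonneg ab bA in auto)
    moreover have "b / r * (exp q * G) \<le> A / r * (exp (A * q) * F)"
      by (rule mult_mono[OF divide_right_mono[OF bA(2)] GA(1)]) (use nonneg ab r bA in auto)
    ultimately have "Y \<le> exp (A * q) * F" "W \<le> A / r\<^sup>2 * (exp (A * q) * F)" "X \<le> A / r * (exp (A * q) * F)"
      using X Y W GA(2) by (auto simp: mult.assoc)
    then show "wnorm c \<phi> (T z f) \<le> exp (A * (\<alpha>\<^sup>2 * r\<^sup>2)) * wnorm c \<phi> f \<and>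
      wnorm c \<phi> (Td z f) \<le> A / r\<^sup>2 * exp (A * (\<alpha>\<^sup>2 * r\<^sup>2)) * wnorm c \<phi> f \<and>
      wnorm c \<phi> (weak_deriv (T z f)) \<le> A / r * exp (A * (\<alpha>\<^sup>2 * r\<^sup>2)) * wnorm c \<phi> f"
      by (simp add: X_def Y_def W_def F_def q_def mult.assoc)
  qed
qed

end

section \<open>Pointwise bounds for the semigroup\<close>

lemma integral_powr_0:
  fixes p :: real
  assumes "- 1 < p" "0 \<le> r"
  shows "integrable lborel (\<lambda>t. indicator {0..r} t * t powr p)"
    "(\<integral>t. indicator {0..r} t * t powr p \<partial>lborel) = r powr (p + 1) / (p + 1)"
proof -
  note hi = has_integral_powr_from_0[OF assms]
  have "(\<lambda>t. t powr p) absolutely_integrable_on {0..r}"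
    by (rule nonnegative_absolutely_integrable_1) (use hi in auto)
  then have "integrable lebesgue (\<lambda>t. indicator {0..r} t *\<^sub>R t powr p)"
    by (simp add: set_integrable_def)
  moreover have "(\<lambda>t. indicator {0..r} t *\<^sub>R t powr p) \<in> borel_measurable lborel"
    by (intro borel_measurable_scaleR powr_real_measurable) simp_all
  ultimately have i: "integrable lborel (\<lambda>t. indicator {0..r} t *\<^sub>R t powr p)"
    by (simp add: integrable_completion)
  then show "integrable lborel (\<lambda>t. indicator {0..r} t * t powr p)" by simp
  have "(LINT t:{0..r}|lborel. t powr p) = integral {0..r} (\<lambda>t. t powr p)"
    by (rule set_borel_integral_eq_integral(2)) (use i in \<open>simp add: set_integrable_def\<close>)
  also have "\<dots> = r powr (p + 1) / (p + 1)" by (rule integral_unique[OF hi])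
  finally show "(\<integral>t. indicator {0..r} t * t powr p \<partial>lborel) = r powr (p + 1) / (p + 1)"
    by (simp add: set_lebesgue_integral_def)
qed

text \<open>The exponent is shifted by c so that the density leaves t powr p, which is integrable at
  0 for p > -1.\<close>

lemma weighted_integral_powr:
  fixes p :: real
  assumes "- 1 < p" "0 \<le> r"
  shows "integrable (weighted_measure c) (\<lambda>t. indicator {0<..r} t * t powr (p - c))"
    "(LINT t|weighted_measure c. indicator {0<..r} t * t powr (p - c)) = r powr (p + 1) / (p + 1)"
proof -
  have m: "(\<lambda>t. indicator {0<..r} t * t powr (p - c)) \<in> borel_measurable (weighted_measure c)"
    by (intro measurable_weighted_measureI borel_measurable_times powr_real_measurable) simp_all
  have e: "(\<lambda>t. indicator {0<..} t *\<^sub>R (t powr c *\<^sub>R (indicator {0<..r} t * t powr (p - c)))) = (\<lambda>t. indicator {0..r} t * t powr p)"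
  proof
    fix t :: real
    show "indicator {0<..} t *\<^sub>R (t powr c *\<^sub>R (indicator {0<..r} t * t powr (p - c))) = indicator {0..r} t * t powr p"
      by (cases "t \<le> 0") (auto simp: indicator_def powr_diff not_le)
  qed
  show "integrable (weighted_measure c) (\<lambda>t. indicator {0<..r} t * t powr (p - c))"
    unfolding integrable_weighted_iff[OF m] set_integrable_def e by (rule integral_powr_0(1)[OF assms])
  show "(LINT t|weighted_measure c. indicator {0<..r} t * t powr (p - c)) = r powr (p + 1) / (p + 1)"
    unfolding integral_weighted[OF m] set_lebesgue_integral_def e by (rule integral_powr_0(2)[OF assms])
qed

text \<open>Moving by at most r changes 2 \<phi> by at most 2 \<alpha> r <= 1 + \<alpha>^2 r^2, so
  the cost has the shape of the factors already present.\<close>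

lemma exp_weight_shift:
  assumes wt: "weight \<alpha> \<phi>" and st: "\<bar>s - t\<bar> \<le> r" and r: "0 < r"
  shows "exp (- 2 * \<phi> s) \<le> exp (1 + \<alpha>\<^sup>2 * r\<^sup>2) * exp (- 2 * \<phi> t)"
proof -
  have "\<phi> t - \<phi> s \<le> \<alpha> * \<bar>t - s\<bar>" using weight_Lipschitz[OF wt, of t s] by simp
  also have "\<dots> \<le> \<alpha> * r" using st weight_nonneg(1)[OF wt] by (intro mult_left_mono) auto
  finally have "2 * (\<phi> t - \<phi> s) \<le> 2 * (\<alpha> * r)" by simp
  also have "2 * (\<alpha> * r) \<le> 1 + \<alpha>\<^sup>2 * r\<^sup>2"
    using zero_le_power2[of "1 - \<alpha> * r"] by (simp add: power2_eq_square algebra_simps)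
  finally have "- 2 * \<phi> s \<le> (1 + \<alpha>\<^sup>2 * r\<^sup>2) + - 2 * \<phi> t" by simp
  then show ?thesis unfolding exp_add[symmetric] by (simp only: exp_le_cancel_iff)
qed

context schroedinger
begin

text \<open>For s >= r the window of \<open>bulk_bound\<close> may have length r, and the energy
  bounds at scale r give the factor 1 / r. The linear exponent 2 \<alpha> r is merged into the
  quadratic one.\<close>

lemma bulk_T:
  assumes \<delta>: "0 < \<delta>" "\<delta> \<le> 1" and \<Lambda>: "1 \<le> \<Lambda>"
  obtains C where "0 < C"
    "\<And>z r \<alpha> \<phi> f s. z \<in> psector \<delta> \<Longrightarrow> 0 < r \<Longrightarrow> cmod z \<le> \<Lambda> * r\<^sup>2 \<Longrightarrow> r\<^sup>2 \<le> \<Lambda> * cmod z \<Longrightarrow> weight \<alpha> \<phi> \<Longrightarrow> f \<in> L2 c \<Longrightarrow> r \<le> s \<Longrightarrow>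
      (cmod (rep (T z f) s))\<^sup>2 * exp (- 2 * \<phi> s) \<le> C * (s powr (- c) / r) * exp (C * (\<alpha>\<^sup>2 * r\<^sup>2)) * (wnorm c \<phi> f)\<^sup>2"
proof -
  obtain A where A: "1 \<le> A"
    "\<And>z r \<alpha> \<phi> f. z \<in> psector \<delta> \<Longrightarrow> 0 < r \<Longrightarrow> cmod z \<le> \<Lambda> * r\<^sup>2 \<Longrightarrow> r\<^sup>2 \<le> \<Lambda> * cmod z \<Longrightarrow> weight \<alpha> \<phi> \<Longrightarrow> f \<in> L2 c \<Longrightarrow>
      wnorm c \<phi> (T z f) \<le> exp (A * (\<alpha>\<^sup>2 * r\<^sup>2)) * wnorm c \<phi> f \<and>
      wnorm c \<phi> (Td z f) \<le> A / r\<^sup>2 * exp (A * (\<alpha>\<^sup>2 * r\<^sup>2)) * wnorm c \<phi> f \<and>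
      wnorm c \<phi> (weak_deriv (T z f)) \<le> A / r * exp (A * (\<alpha>\<^sup>2 * r\<^sup>2)) * wnorm c \<phi> f"
    using energy_T[OF \<delta> \<Lambda>] by blast
  define K where "K = exp 1 * 2 powr \<bar>c\<bar> * (1 + 2 * A)"
  define C where "C = max K (1 + 2 * A)"
  have K: "0 < K" "0 < C" "K \<le> C" "1 + 2 * A \<le> C" using A(1) by (auto simp: K_def C_def)
  show thesis
  proof (rule that[of C])
    fix z r \<alpha> \<phi> f s
    assume z: "z \<in> psector \<delta>" and r: "0 < r" "cmod z \<le> \<Lambda> * r\<^sup>2" "r\<^sup>2 \<le> \<Lambda> * cmod z"
      and wt: "weight \<alpha> \<phi>" and f: "f \<in> L2 c" and s: "r \<le> s"
    define q where "q = \<alpha>\<^sup>2 * r\<^sup>2"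
    define F where "F = wnorm c \<phi> f"
    define X where "X = wnorm c \<phi> (weak_deriv (T z f))"
    define Y where "Y = wnorm c \<phi> (T z f)"
    define G where "G = exp (A * q) * F"
    have nn: "0 \<le> q" "0 \<le> F" "0 \<le> X" "0 \<le> Y" "0 \<le> G" by (simp_all add: q_def F_def X_def Y_def G_def)
    have XY: "Y \<le> G" "X \<le> A / r * G"
      using A(2)[OF z r wt f] by (simp_all add: X_def Y_def G_def F_def q_def mult.assoc)
    have "Y\<^sup>2 / r + 2 * X * Y \<le> G\<^sup>2 / r + 2 * (A / r * G) * G"
      using XY nn r A(1) by (intro add_mono divide_right_mono power_mono mult_mono) auto
    also have "\<dots> = (1 + 2 * A) * (G\<^sup>2 / r)" using r by (simp add: field_simps power2_eq_square)
    finally have 1: "Y\<^sup>2 / r + 2 * X * Y \<le> (1 + 2 * A) * (G\<^sup>2 / r)" .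
    have "2 * \<alpha> * r \<le> 1 + q"
      using zero_le_power2[of "1 - \<alpha> * r"] by (simp add: q_def power2_eq_square algebra_simps)
    then have 2: "exp (2 * \<alpha> * r) \<le> exp 1 * exp q" by (simp add: exp_add[symmetric])
    have "(cmod (rep (T z f) s))\<^sup>2 * exp (- 2 * \<phi> s) \<le> exp (2 * \<alpha> * r) * 2 powr \<bar>c\<bar> * s powr (- c) * (Y\<^sup>2 / r + 2 * X * Y)"
      using bulk_bound[OF T_form_domain[OF psector_Cplus[OF z] f] wt r(1) s] by (simp add: X_def Y_def)
    also have "\<dots> \<le> (exp 1 * exp q) * 2 powr \<bar>c\<bar> * s powr (- c) * ((1 + 2 * A) * (G\<^sup>2 / r))"
      using 1 2 nn r by (intro mult_mono) auto
    also have "\<dots> = K * (s powr (- c) / r) * (exp q * G\<^sup>2)" by (simp add: K_def field_simps)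
    also have "exp q * G\<^sup>2 = exp ((1 + 2 * A) * q) * F\<^sup>2"
    proof -
      have "exp ((1 + 2 * A) * q) = exp q * (exp (A * q))\<^sup>2"
        by (simp add: exp_double[symmetric] exp_add[symmetric] algebra_simps)
      then show ?thesis by (simp add: G_def power_mult_distrib)
    qed
    also have "K * (s powr (- c) / r) * (exp ((1 + 2 * A) * q) * F\<^sup>2) \<le> C * (s powr (- c) / r) * (exp (C * q) * F\<^sup>2)"
    proof -
      have "exp ((1 + 2 * A) * q) \<le> exp (C * q)" unfolding exp_le_cancel_iff by (rule mult_right_mono[OF K(4) nn(1)])
      then show ?thesis using K nn r by (intro mult_mono mult_right_mono) auto
    qed
    finally show "(cmod (rep (T z f) s))\<^sup>2 * exp (- 2 * \<phi> s) \<le> C * (s powr (- c) / r) * exp (C * (\<alpha>\<^sup>2 * r\<^sup>2)) * (wnorm c \<phi> f)\<^sup>2"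
      by (simp add: F_def q_def mult.assoc)
  qed (rule K)
qed

text \<open>\<gamma> measures the permitted growth of |T z f (s)|^2 towards the origin, relative to
  the size r powr (- c - 1) at s = r. The comparability factor \<Lambda> is quantified inside the
  notion, so halving z is paid by doubling \<Lambda> and the rate can be applied to T (z/2).\<close>

definition inner_rate :: "real \<Rightarrow> real \<Rightarrow> bool" where
  "inner_rate \<delta> \<gamma> \<longleftrightarrow> (\<forall>\<Lambda>\<ge>1. \<exists>C>0. \<forall>z\<in>psector \<delta>. \<forall>r \<alpha> \<phi> f s. 0 < r \<longrightarrow> cmod z \<le> \<Lambda> * r\<^sup>2 \<longrightarrow> r\<^sup>2 \<le> \<Lambda> * cmod z \<longrightarrow>
     weight \<alpha> \<phi> \<longrightarrow> f \<in> L2 c \<longrightarrow> 0 < s \<longrightarrow> s \<le> r \<longrightarrow>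
     (cmod (rep (T z f) s))\<^sup>2 * exp (- 2 * \<phi> s) \<le> C * (r powr (- c - 1) * (s / r) powr (- \<gamma>)) * exp (C * (\<alpha>\<^sup>2 * r\<^sup>2)) * (wnorm c \<phi> f)\<^sup>2)"

text \<open>Shared end of both inner estimates: R stands for the remainder of
  \<open>inner_bound\<close>. The value at r comes from \<open>bulk_T\<close>, and the factor (s /
  r) powr (- \<gamma>), being at least 1, may be inserted freely.\<close>

lemma outer_to_inner:
  assumes \<delta>: "0 < \<delta>" "\<delta> \<le> 1" and \<Lambda>: "1 \<le> \<Lambda>" and \<gamma>: "0 \<le> \<gamma>" and D: "0 < D"
  obtains C where "0 < C"
    "\<And>z r \<alpha> \<phi> f s R. z \<in> psector \<delta> \<Longrightarrow> 0 < r \<Longrightarrow> cmod z \<le> \<Lambda> * r\<^sup>2 \<Longrightarrow> r\<^sup>2 \<le> \<Lambda> * cmod z \<Longrightarrow> weight \<alpha> \<phi> \<Longrightarrow> f \<in> L2 c \<Longrightarrow>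
      0 < s \<Longrightarrow> s \<le> r \<Longrightarrow> (cmod (rep (T z f) s))\<^sup>2 \<le> (cmod (rep (T z f) r))\<^sup>2 + R \<Longrightarrow>
      R * exp (- 2 * \<phi> s) \<le> D * (r powr (- c - 1) * (s / r) powr (- \<gamma>)) * exp (D * (\<alpha>\<^sup>2 * r\<^sup>2)) * (wnorm c \<phi> f)\<^sup>2 \<Longrightarrow>
      (cmod (rep (T z f) s))\<^sup>2 * exp (- 2 * \<phi> s) \<le> C * (r powr (- c - 1) * (s / r) powr (- \<gamma>)) * exp (C * (\<alpha>\<^sup>2 * r\<^sup>2)) * (wnorm c \<phi> f)\<^sup>2"
proof -
  obtain B where B: "0 < B"
    "\<And>z r \<alpha> \<phi> f s. z \<in> psector \<delta> \<Longrightarrow> 0 < r \<Longrightarrow> cmod z \<le> \<Lambda> * r\<^sup>2 \<Longrightarrow> r\<^sup>2 \<le> \<Lambda> * cmod z \<Longrightarrow> weight \<alpha> \<phi> \<Longrightarrow> f \<in> L2 c \<Longrightarrow> r \<le> s \<Longrightarrow>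
      (cmod (rep (T z f) s))\<^sup>2 * exp (- 2 * \<phi> s) \<le> B * (s powr (- c) / r) * exp (B * (\<alpha>\<^sup>2 * r\<^sup>2)) * (wnorm c \<phi> f)\<^sup>2"
    using bulk_T[OF \<delta> \<Lambda>] by metis
  \<comment> \<open>Moving the weight from r to s costs exp (1 + q), which accounts for exp 1 * B in
    front and B + 1 in the exponent; D serves the remainder.\<close>
  define C where "C = exp 1 * B + B + 1 + D"
  show thesis
  proof (rule that[of C])
    show "0 < C" using B D by (simp add: C_def add_pos_pos)
    fix z r \<alpha> \<phi> f s R
    assume z: "z \<in> psector \<delta>" and r: "0 < r" "cmod z \<le> \<Lambda> * r\<^sup>2" "r\<^sup>2 \<le> \<Lambda> * cmod z"
      and wt: "weight \<alpha> \<phi>" and f: "f \<in> L2 c" and s: "0 < s" "s \<le> r"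
      and le: "(cmod (rep (T z f) s))\<^sup>2 \<le> (cmod (rep (T z f) r))\<^sup>2 + R"
      and R: "R * exp (- 2 * \<phi> s) \<le> D * (r powr (- c - 1) * (s / r) powr (- \<gamma>)) * exp (D * (\<alpha>\<^sup>2 * r\<^sup>2)) * (wnorm c \<phi> f)\<^sup>2"
    define q where "q = \<alpha>\<^sup>2 * r\<^sup>2"
    define F where "F = wnorm c \<phi> f"
    define m where "m = r powr (- c - 1)"
    define p where "p = (s / r) powr (- \<gamma>)"
    have nn: "0 \<le> q" "0 \<le> F" "0 \<le> m" by (simp_all add: q_def F_def m_def)
    have p1: "1 \<le> p"
    proof -
      have "1 \<le> (r / s) powr \<gamma>" using s \<gamma> by (intro ge_one_powr_ge_zero) auto
      also have "\<dots> = p" using s r by (simp add: p_def powr_minus powr_divide field_simps)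
      finally show ?thesis .
    qed
    have mr: "r powr (- c) / r = m" using r by (simp add: m_def powr_diff)
    have "(cmod (rep (T z f) r))\<^sup>2 * exp (- 2 * \<phi> s) \<le> (cmod (rep (T z f) r))\<^sup>2 * (exp (1 + q) * exp (- 2 * \<phi> r))"
      unfolding q_def by (intro mult_left_mono exp_weight_shift[OF wt _ r(1)]) (use s in auto)
    also have "\<dots> = exp (1 + q) * ((cmod (rep (T z f) r))\<^sup>2 * exp (- 2 * \<phi> r))" by (simp only: mult_ac)
    also have "\<dots> \<le> exp (1 + q) * (B * m * exp (B * q) * F\<^sup>2)"
      using B(2)[OF z r wt f order_refl] unfolding mr q_def[symmetric] F_def[symmetric] by (intro mult_left_mono) auto
    also have "\<dots> = exp 1 * B * m * exp ((B + 1) * q) * F\<^sup>2"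
      by (simp add: exp_add[symmetric] algebra_simps)
    also have "\<dots> \<le> exp 1 * B * (m * p) * exp (C * q) * F\<^sup>2"
    proof (intro mult_mono mult_right_mono)
      show "m \<le> m * p" using p1 nn by (simp add: mult_le_cancel_left1)
      show "exp ((B + 1) * q) \<le> exp (C * q)"
        using nn B D unfolding exp_le_cancel_iff by (intro mult_right_mono) (auto simp: C_def)
    qed (use nn B p1 in auto)
    finally have 1: "(cmod (rep (T z f) r))\<^sup>2 * exp (- 2 * \<phi> s) \<le> exp 1 * B * (m * p) * exp (C * q) * F\<^sup>2" .
    have "R * exp (- 2 * \<phi> s) \<le> D * (m * p) * exp (D * q) * F\<^sup>2" using R by (simp add: m_def p_def q_def F_def)
    also have "\<dots> \<le> D * (m * p) * exp (C * q) * F\<^sup>2"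
    proof (intro mult_mono mult_right_mono)
      show "exp (D * q) \<le> exp (C * q)"
        using nn B D unfolding exp_le_cancel_iff by (intro mult_right_mono) (auto simp: C_def add_pos_pos)
    qed (use nn D p1 in auto)
    finally have 2: "R * exp (- 2 * \<phi> s) \<le> D * (m * p) * exp (C * q) * F\<^sup>2" .
    have "(cmod (rep (T z f) s))\<^sup>2 * exp (- 2 * \<phi> s) \<le> ((cmod (rep (T z f) r))\<^sup>2 + R) * exp (- 2 * \<phi> s)"
      by (intro mult_right_mono le) auto
    also have "\<dots> \<le> exp 1 * B * (m * p) * exp (C * q) * F\<^sup>2 + D * (m * p) * exp (C * q) * F\<^sup>2"
      using 1 2 by (simp add: distrib_right)
    also have "\<dots> = (exp 1 * B + D) * (m * p) * exp (C * q) * F\<^sup>2" by (simp add: algebra_simps)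
    also have "\<dots> \<le> C * (m * p) * exp (C * q) * F\<^sup>2"
      using nn B D p1 by (intro mult_right_mono) (auto simp: C_def)
    finally show "(cmod (rep (T z f) s))\<^sup>2 * exp (- 2 * \<phi> s) \<le> C * (r powr (- c - 1) * (s / r) powr (- \<gamma>)) * exp (C * (\<alpha>\<^sup>2 * r\<^sup>2)) * (wnorm c \<phi> f)\<^sup>2"
      by (simp add: m_def p_def q_def F_def)
  qed
qed

text \<open>The crude rate: a constant majorant of x powr (- c) on {s..r} is put into
  \<open>inner_bound\<close>, and the integral of |w| |u| is bounded by Cauchy-Schwarz alone. Only
  the case c > 0 leaves any growth.\<close>

lemma inner_rate_base:
  assumes \<delta>: "0 < \<delta>" "\<delta> \<le> 1" shows "inner_rate \<delta> (max c 0)"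
  unfolding inner_rate_def
proof (intro allI impI)
  fix \<Lambda> :: real assume \<Lambda>: "1 \<le> \<Lambda>"
  define \<gamma> where "\<gamma> = max c 0"
  obtain A where A: "1 \<le> A"
    "\<And>z r \<alpha> \<phi> f. z \<in> psector \<delta> \<Longrightarrow> 0 < r \<Longrightarrow> cmod z \<le> \<Lambda> * r\<^sup>2 \<Longrightarrow> r\<^sup>2 \<le> \<Lambda> * cmod z \<Longrightarrow> weight \<alpha> \<phi> \<Longrightarrow> f \<in> L2 c \<Longrightarrow>
      wnorm c \<phi> (T z f) \<le> exp (A * (\<alpha>\<^sup>2 * r\<^sup>2)) * wnorm c \<phi> f \<and>
      wnorm c \<phi> (Td z f) \<le> A / r\<^sup>2 * exp (A * (\<alpha>\<^sup>2 * r\<^sup>2)) * wnorm c \<phi> f \<and>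
      wnorm c \<phi> (weak_deriv (T z f)) \<le> A / r * exp (A * (\<alpha>\<^sup>2 * r\<^sup>2)) * wnorm c \<phi> f"
    using energy_T[OF \<delta> \<Lambda>] by blast
  define D where "D = 2 * exp 1 * A + (2 * A + 1)"
  have D: "0 < D" "2 * exp 1 * A \<le> D" "2 * A + 1 \<le> D" using A(1) by (auto simp: D_def add_pos_pos)
  have \<gamma>: "0 \<le> \<gamma>" by (simp add: \<gamma>_def)
  obtain C where C: "0 < C"
    "\<And>z r \<alpha> \<phi> f s R. z \<in> psector \<delta> \<Longrightarrow> 0 < r \<Longrightarrow> cmod z \<le> \<Lambda> * r\<^sup>2 \<Longrightarrow> r\<^sup>2 \<le> \<Lambda> * cmod z \<Longrightarrow> weight \<alpha> \<phi> \<Longrightarrow> f \<in> L2 c \<Longrightarrow>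
      0 < s \<Longrightarrow> s \<le> r \<Longrightarrow> (cmod (rep (T z f) s))\<^sup>2 \<le> (cmod (rep (T z f) r))\<^sup>2 + R \<Longrightarrow>
      R * exp (- 2 * \<phi> s) \<le> D * (r powr (- c - 1) * (s / r) powr (- \<gamma>)) * exp (D * (\<alpha>\<^sup>2 * r\<^sup>2)) * (wnorm c \<phi> f)\<^sup>2 \<Longrightarrow>
      (cmod (rep (T z f) s))\<^sup>2 * exp (- 2 * \<phi> s) \<le> C * (r powr (- c - 1) * (s / r) powr (- \<gamma>)) * exp (C * (\<alpha>\<^sup>2 * r\<^sup>2)) * (wnorm c \<phi> f)\<^sup>2"
    using outer_to_inner[OF \<delta> \<Lambda> \<gamma> D(1)] by metis
  have "(cmod (rep (T z f) s))\<^sup>2 * exp (- 2 * \<phi> s) \<le> C * (r powr (- c - 1) * (s / r) powr (- \<gamma>)) * exp (C * (\<alpha>\<^sup>2 * r\<^sup>2)) * (wnorm c \<phi> f)\<^sup>2"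
    if z: "z \<in> psector \<delta>" and r: "0 < r" "cmod z \<le> \<Lambda> * r\<^sup>2" "r\<^sup>2 \<le> \<Lambda> * cmod z"
      and wt: "weight \<alpha> \<phi>" and f: "f \<in> L2 c" and s: "0 < s" "s \<le> r" for z r \<alpha> \<phi> f s
  proof -
    let ?M = "weighted_measure c" and ?u = "T z f" and ?w = "Td z f"
    note zC = psector_Cplus[OF z]
    define q where "q = \<alpha>\<^sup>2 * r\<^sup>2"
    define F where "F = wnorm c \<phi> f"
    \<comment> \<open>The maximum of x powr (- c) on {s..r} in both cases: s powr (- c) if c >= 0,
      and r powr (- c) otherwise.\<close>
    define k where "k = r powr (- c) * (s / r) powr (- \<gamma>)"
    have nn: "0 \<le> q" "0 \<le> F" "0 \<le> k" by (simp_all add: q_def F_def k_def)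
    have k: "x powr (- c) \<le> k" if "s \<le> x" "x \<le> r" for x
    proof (cases "0 \<le> c")
      case True
      then have "k = s powr (- c)" using s r by (simp add: k_def \<gamma>_def powr_divide)
      then show ?thesis using that s True by (auto intro: powr_mono2')
    next
      case False
      then have "k = r powr (- c)" using s r by (simp add: k_def \<gamma>_def)
      then show ?thesis using that s False by (auto intro: powr_mono2)
    qed
    define R where "R = 2 * r * (LINT t|?M. indicator {0<..r} t * (k * (cmod (?w t) * cmod (?u t))))"
    have wu: "integrable ?M (\<lambda>t. cmod (?w t) * cmod (?u t))"
      by (intro L2_mult_integrable Td(2) T_L2 zC f)
    have Sr: "{0<..r} \<in> sets ?M" by (auto simp: sets_weighted_measure sets_restrict_space_iff)
    have i: "integrable ?M (\<lambda>t. indicator {0<..r} t * (k * (cmod (?w t) * cmod (?u t))))"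
      using integrable_mult_indicator[OF Sr integrable_mult_right[OF wu, of k]] by simp
    have 1: "(cmod (rep ?u s))\<^sup>2 \<le> (cmod (rep ?u r))\<^sup>2 + R"
      unfolding R_def
      by (rule inner_bound[OF T_generator[OF zC f] V_nonneg V_measurable s, where S="\<lambda>_. k"])
         (use k nn i in auto)
    have ewu: "integrable ?M (\<lambda>t. cmod (of_real (exp (- \<phi> t)) * ?w t) * cmod (of_real (exp (- \<phi> t)) * ?u t))"
      by (intro L2_mult_integrable weight_L2[OF wt] Td(2) T_L2 zC f)
    have "(LINT t|?M. indicator {0<..r} t * (k * (cmod (?w t) * cmod (?u t)))) * exp (- 2 * \<phi> s)
       = (LINT t|?M. exp (- 2 * \<phi> s) * (indicator {0<..r} t * (k * (cmod (?w t) * cmod (?u t)))))"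
      by (simp only: Bochner_Integration.integral_mult_right_zero mult.commute[of _ "exp (- 2 * \<phi> s)"])
    also have "\<dots> \<le> (LINT t|?M. (k * exp (1 + q)) * (cmod (of_real (exp (- \<phi> t)) * ?w t) * cmod (of_real (exp (- \<phi> t)) * ?u t)))"
    proof (rule integral_mono_AE')
      show "integrable ?M (\<lambda>t. (k * exp (1 + q)) * (cmod (of_real (exp (- \<phi> t)) * ?w t) * cmod (of_real (exp (- \<phi> t)) * ?u t)))"
        using ewu by (rule integrable_mult_right)
      show "AE t in ?M. exp (- 2 * \<phi> s) * (indicator {0<..r} t * (k * (cmod (?w t) * cmod (?u t)))) \<le>
          (k * exp (1 + q)) * (cmod (of_real (exp (- \<phi> t)) * ?w t) * cmod (of_real (exp (- \<phi> t)) * ?u t))"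
      proof (rule AE_I2)
        fix t
        show "exp (- 2 * \<phi> s) * (indicator {0<..r} t * (k * (cmod (?w t) * cmod (?u t)))) \<le>
          (k * exp (1 + q)) * (cmod (of_real (exp (- \<phi> t)) * ?w t) * cmod (of_real (exp (- \<phi> t)) * ?u t))"
        proof (cases "t \<in> {0<..r}")
          case True
          have "exp (- 2 * \<phi> s) \<le> exp (1 + q) * exp (- 2 * \<phi> t)"
            unfolding q_def by (rule exp_weight_shift[OF wt _ r(1)]) (use True s in auto)
          then have "exp (- 2 * \<phi> s) * (k * (cmod (?w t) * cmod (?u t))) \<le> (exp (1 + q) * exp (- 2 * \<phi> t)) * (k * (cmod (?w t) * cmod (?u t)))"
            using nn by (intro mult_right_mono) auto
          also have "\<dots> = (k * exp (1 + q)) * (cmod (of_real (exp (- \<phi> t)) * ?w t) * cmod (of_real (exp (- \<phi> t)) * ?u t))"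
            using exp_double[of "- \<phi> t"] by (simp add: norm_mult power2_eq_square mult_ac)
          finally show ?thesis using True by simp
        qed (use nn in simp)
      qed
      show "AE t in ?M. 0 \<le> (k * exp (1 + q)) * (cmod (of_real (exp (- \<phi> t)) * ?w t) * cmod (of_real (exp (- \<phi> t)) * ?u t))"
        using nn by (intro AE_I2 mult_nonneg_nonneg) auto
    qed
    also have "\<dots> \<le> (k * exp (1 + q)) * (wnorm c \<phi> ?w * wnorm c \<phi> ?u)"
      unfolding Bochner_Integration.integral_mult_right_zero wnorm_def
      using nn by (intro mult_left_mono L2_Cauchy_Schwarz weight_L2[OF wt] Td(2) T_L2 zC f) auto
    also have "\<dots> \<le> (k * exp (1 + q)) * ((A / r\<^sup>2 * exp (A * q) * F) * (exp (A * q) * F))"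
      using A(2)[OF z r wt f] nn A(1) by (intro mult_left_mono mult_mono) (auto simp: q_def F_def)
    finally have "R * exp (- 2 * \<phi> s) \<le> 2 * r * ((k * exp (1 + q)) * ((A / r\<^sup>2 * exp (A * q) * F) * (exp (A * q) * F)))"
      using r(1) unfolding R_def by (simp only: mult.assoc) (intro mult_left_mono, auto)
    also have "\<dots> = 2 * exp 1 * A * (k / r) * exp ((2 * A + 1) * q) * F\<^sup>2"
    proof -
      have "exp (1 + q) * (exp (A * q) * exp (A * q)) = exp 1 * exp ((2 * A + 1) * q)"
        by (simp add: exp_add[symmetric] algebra_simps)
      then show ?thesis using r(1) by (simp add: field_simps power2_eq_square)
    qed
    also have "k / r = r powr (- c - 1) * (s / r) powr (- \<gamma>)" using r(1) by (simp add: k_def powr_diff)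
    also have "2 * exp 1 * A * (r powr (- c - 1) * (s / r) powr (- \<gamma>)) * exp ((2 * A + 1) * q) * F\<^sup>2
       \<le> D * (r powr (- c - 1) * (s / r) powr (- \<gamma>)) * exp (D * q) * F\<^sup>2"
      using D nn A(1) by (intro mult_mono mult_right_mono) (auto intro: mult_right_mono)
    finally have 2: "R * exp (- 2 * \<phi> s) \<le> D * (r powr (- c - 1) * (s / r) powr (- \<gamma>)) * exp (D * (\<alpha>\<^sup>2 * r\<^sup>2)) * (wnorm c \<phi> f)\<^sup>2"
      by (simp add: q_def F_def)
    show ?thesis by (rule C(2)[OF z r wt f s 1 2])
  qed
  then show "\<exists>C>0. \<forall>z\<in>psector \<delta>. \<forall>r \<alpha> \<phi> f s. 0 < r \<longrightarrow> cmod z \<le> \<Lambda> * r\<^sup>2 \<longrightarrow> r\<^sup>2 \<le> \<Lambda> * cmod z \<longrightarrow>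
     weight \<alpha> \<phi> \<longrightarrow> f \<in> L2 c \<longrightarrow> 0 < s \<longrightarrow> s \<le> r \<longrightarrow>
     (cmod (rep (T z f) s))\<^sup>2 * exp (- 2 * \<phi> s) \<le> C * (r powr (- c - 1) * (s / r) powr (- max c 0)) * exp (C * (\<alpha>\<^sup>2 * r\<^sup>2)) * (wnorm c \<phi> f)\<^sup>2"
    using C(1) unfolding \<gamma>_def by blast
qed

text \<open>With rate \<gamma> for both factors, |w| |u| grows like t powr (- \<gamma>) instead of
  being merely integrable. Against the majorant t powr (\<theta> - c) and the density this leaves t
  powr (\<theta> - \<gamma>) near 0, which is integrable even for some \<theta> below
  \<gamma>.\<close>

lemma inner_rate_step:
  assumes \<delta>: "0 < \<delta>" "\<delta> \<le> 1" and \<gamma>: "0 \<le> \<gamma>" "\<gamma> \<le> c" and rate: "inner_rate \<delta> \<gamma>"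
  shows "inner_rate \<delta> (max (\<gamma> - 1 / 2) 0)"
  unfolding inner_rate_def
proof (intro allI impI)
  fix \<Lambda> :: real assume \<Lambda>: "1 \<le> \<Lambda>"
  then have \<Lambda>2: "1 \<le> 2 * \<Lambda>" by simp
  \<comment> \<open>Any gain below 1 keeps t powr (\<theta> - \<gamma>) integrable at 0; gaining 1/2
    bounds the constant 1 / (\<theta> - \<gamma> + 1) by 2.\<close>
  define \<theta> where "\<theta> = max (\<gamma> - 1 / 2) 0"
  have \<theta>: "0 \<le> \<theta>" "\<theta> \<le> c" "- 1 / 2 \<le> \<theta> - \<gamma>" using \<gamma> by (auto simp: \<theta>_def)
  obtain A where A: "1 \<le> A"
    "\<And>z r \<alpha> \<phi> f. z \<in> psector \<delta> \<Longrightarrow> 0 < r \<Longrightarrow> cmod z \<le> 2 * \<Lambda> * r\<^sup>2 \<Longrightarrow> r\<^sup>2 \<le> 2 * \<Lambda> * cmod z \<Longrightarrow> weight \<alpha> \<phi> \<Longrightarrow> f \<in> L2 c \<Longrightarrow>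
      wnorm c \<phi> (T z f) \<le> exp (A * (\<alpha>\<^sup>2 * r\<^sup>2)) * wnorm c \<phi> f \<and>
      wnorm c \<phi> (Td z f) \<le> A / r\<^sup>2 * exp (A * (\<alpha>\<^sup>2 * r\<^sup>2)) * wnorm c \<phi> f \<and>
      wnorm c \<phi> (weak_deriv (T z f)) \<le> A / r * exp (A * (\<alpha>\<^sup>2 * r\<^sup>2)) * wnorm c \<phi> f"
    using energy_T[OF \<delta> \<Lambda>2] by blast
  obtain B where B: "0 < B"
    "\<And>z r \<alpha> \<phi> f s. z \<in> psector \<delta> \<Longrightarrow> 0 < r \<Longrightarrow> cmod z \<le> 2 * \<Lambda> * r\<^sup>2 \<Longrightarrow> r\<^sup>2 \<le> 2 * \<Lambda> * cmod z \<Longrightarrow>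
     weight \<alpha> \<phi> \<Longrightarrow> f \<in> L2 c \<Longrightarrow> 0 < s \<Longrightarrow> s \<le> r \<Longrightarrow>
     (cmod (rep (T z f) s))\<^sup>2 * exp (- 2 * \<phi> s) \<le> B * (r powr (- c - 1) * (s / r) powr (- \<gamma>)) * exp (B * (\<alpha>\<^sup>2 * r\<^sup>2)) * (wnorm c \<phi> f)\<^sup>2"
    using rate[unfolded inner_rate_def, rule_format, OF \<Lambda>2] by metis
  define D where "D = 4 * exp 1 * A * B + (1 + B + 2 * A)"
  have D: "0 < D" "4 * exp 1 * A * B \<le> D" "1 + B + 2 * A \<le> D" using A(1) B(1) by (auto simp: D_def add_pos_pos)
  obtain C where C: "0 < C"
    "\<And>z r \<alpha> \<phi> f s R. z \<in> psector \<delta> \<Longrightarrow> 0 < r \<Longrightarrow> cmod z \<le> \<Lambda> * r\<^sup>2 \<Longrightarrow> r\<^sup>2 \<le> \<Lambda> * cmod z \<Longrightarrow> weight \<alpha> \<phi> \<Longrightarrow> f \<in> L2 c \<Longrightarrow>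
      0 < s \<Longrightarrow> s \<le> r \<Longrightarrow> (cmod (rep (T z f) s))\<^sup>2 \<le> (cmod (rep (T z f) r))\<^sup>2 + R \<Longrightarrow>
      R * exp (- 2 * \<phi> s) \<le> D * (r powr (- c - 1) * (s / r) powr (- \<theta>)) * exp (D * (\<alpha>\<^sup>2 * r\<^sup>2)) * (wnorm c \<phi> f)\<^sup>2 \<Longrightarrow>
      (cmod (rep (T z f) s))\<^sup>2 * exp (- 2 * \<phi> s) \<le> C * (r powr (- c - 1) * (s / r) powr (- \<theta>)) * exp (C * (\<alpha>\<^sup>2 * r\<^sup>2)) * (wnorm c \<phi> f)\<^sup>2"
    using outer_to_inner[OF \<delta> \<Lambda> \<theta>(1) D(1)] by metis
  have "(cmod (rep (T z f) s))\<^sup>2 * exp (- 2 * \<phi> s) \<le> C * (r powr (- c - 1) * (s / r) powr (- \<theta>)) * exp (C * (\<alpha>\<^sup>2 * r\<^sup>2)) * (wnorm c \<phi> f)\<^sup>2"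
    if z: "z \<in> psector \<delta>" and r: "0 < r" "cmod z \<le> \<Lambda> * r\<^sup>2" "r\<^sup>2 \<le> \<Lambda> * cmod z"
      and wt: "weight \<alpha> \<phi>" and f: "f \<in> L2 c" and s: "0 < s" "s \<le> r" for z r \<alpha> \<phi> f s
  proof -
    let ?M = "weighted_measure c" and ?u = "T z f" and ?w = "Td z f"
    define z2 where "z2 = z / 2"
    have z2: "z2 \<in> psector \<delta>" unfolding z2_def by (rule psector_half[OF z])
    note zC = psector_Cplus[OF z] and z2C = psector_Cplus[OF z2]
    have n2: "cmod z2 = cmod z / 2" by (simp add: z2_def norm_divide)
    have "0 \<le> \<Lambda> * r\<^sup>2" using \<Lambda> by simp
    then have r2: "cmod z2 \<le> 2 * \<Lambda> * r\<^sup>2" "r\<^sup>2 \<le> 2 * \<Lambda> * cmod z2"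
      unfolding n2 using r by simp_all
    define q where "q = \<alpha>\<^sup>2 * r\<^sup>2"
    define F where "F = wnorm c \<phi> f"
    define G where "G = exp (A * q) * F"
    define H where "H = A / r\<^sup>2 * G"
    define P where "P = (\<lambda>t. B * (r powr (- c - 1) * (t / r) powr (- \<gamma>)) * exp (B * q))"
    have nn: "0 \<le> q" "0 \<le> F" "0 \<le> G" "0 \<le> H" "0 \<le> P t" for t
      using A(1) B(1) by (simp_all add: q_def F_def G_def H_def P_def)
    define g where "g = T z2 f"
    define h where "h = Td z2 f"
    have gL: "g \<in> L2 c" and hL: "h \<in> L2 c" unfolding g_def h_def by (rule T_L2 Td(2), rule z2C, rule f)+
    have gh: "wnorm c \<phi> g \<le> G" "wnorm c \<phi> h \<le> H"
      using A(2)[OF z2 r(1) r2 wt f] by (simp_all add: g_def h_def G_def H_def F_def q_def mult.assoc)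
    \<comment> \<open>The assumed rate for T (z/2), used once with k = T (z/2) f to reach u and once
      with k = Td (z/2) f to reach w.\<close>
    have pt: "cmod (rep (T z2 k) t) * exp (- \<phi> t) \<le> sqrt (P t) * K"
      if k: "k \<in> L2 c" "wnorm c \<phi> k \<le> K" and t: "0 < t" "t \<le> r" for k K t
    proof (rule power2_le_imp_le)
      have "(cmod (rep (T z2 k) t) * exp (- \<phi> t))\<^sup>2 = (cmod (rep (T z2 k) t))\<^sup>2 * exp (- 2 * \<phi> t)"
        using exp_double[of "- \<phi> t"] by (simp add: power_mult_distrib)
      also have "\<dots> \<le> P t * (wnorm c \<phi> k)\<^sup>2"
        using B(2)[OF z2 r(1) r2 wt k(1) t] by (simp add: P_def q_def)
      also have "\<dots> \<le> P t * K\<^sup>2" using k nn by (intro mult_left_mono power_mono) auto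
      also have "\<dots> = (sqrt (P t) * K)\<^sup>2" using nn by (simp add: power_mult_distrib)
      finally show "(cmod (rep (T z2 k) t) * exp (- \<phi> t))\<^sup>2 \<le> (sqrt (P t) * K)\<^sup>2" .
      have "0 \<le> K" using k(2) wnorm_nonneg[of c \<phi> k] by linarith
      then show "0 \<le> sqrt (P t) * K" using nn by simp
    qed
    have uAE: "AE t in ?M. ?u t = rep (T z2 g) t"
      using T_half[OF zC f] rep(2)[OF T_has_rep[OF z2C gL], of c] by eventually_elim (simp add: g_def z2_def)
    have wAE: "AE t in ?M. ?w t = rep (T z2 h) t"
      using Td_half[OF zC f] rep(2)[OF T_has_rep[OF z2C hL], of c] by eventually_elim (simp add: h_def z2_def)
    \<comment> \<open>For x above both s and t, x powr (- c) splits into x powr (- \<theta>),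
      estimated at s, and x powr (\<theta> - c), estimated at t. Both exponents are nonpositive
      because 0 <= \<theta> <= c.\<close>
    define S where "S = (\<lambda>t. s powr (- \<theta>) * t powr (\<theta> - c))"
    define Kc where "Kc = s powr (- \<theta>) * exp (1 + q) * (B * (r powr (- c - 1) * r powr \<gamma>) * exp (B * q)) * (G * H)"
    have Kc: "0 \<le> Kc" using nn B(1) by (simp add: Kc_def)
    define J where "J = (\<lambda>t. indicator {0<..r} t * (S t * (cmod (?w t) * cmod (?u t))))"
    have J0: "0 \<le> J t" for t by (simp add: J_def S_def)
    have dom: "AE t in ?M. J t * exp (- 2 * \<phi> s) \<le> Kc * (indicator {0<..r} t * t powr ((\<theta> - \<gamma>) - c))"
      using uAE wAE AE_space
    proof eventually_elim
      fix t assume eq: "?u t = rep (T z2 g) t" "?w t = rep (T z2 h) t"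
      show "J t * exp (- 2 * \<phi> s) \<le> Kc * (indicator {0<..r} t * t powr ((\<theta> - \<gamma>) - c))"
      proof (cases "t \<in> {0<..r}")
        case True
        then have t: "0 < t" "t \<le> r" by auto
        have e2: "exp (- 2 * \<phi> t) = exp (- \<phi> t) * exp (- \<phi> t)" by (simp add: exp_add[symmetric])
        have "cmod (?w t) * cmod (?u t) * exp (- 2 * \<phi> s) \<le> cmod (?w t) * cmod (?u t) * (exp (1 + q) * exp (- 2 * \<phi> t))"
          unfolding q_def by (intro mult_left_mono exp_weight_shift[OF wt _ r(1)]) (use t s in auto)
        also have "\<dots> = exp (1 + q) * ((cmod (rep (T z2 h) t) * exp (- \<phi> t)) * (cmod (rep (T z2 g) t) * exp (- \<phi> t)))"
          unfolding eq e2 by (simp only: mult_ac)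
        also have "\<dots> \<le> exp (1 + q) * ((sqrt (P t) * H) * (sqrt (P t) * G))"
          using nn by (intro mult_left_mono mult_mono pt gL hL gh t) auto
        also have "\<dots> = exp (1 + q) * ((sqrt (P t) * sqrt (P t)) * (G * H))" by (simp only: mult_ac)
        also have "sqrt (P t) * sqrt (P t) = P t" using nn by simp
        finally have 1: "cmod (?w t) * cmod (?u t) * exp (- 2 * \<phi> s) \<le> exp (1 + q) * (P t * (G * H))" .
        have tg: "(t / r) powr (- \<gamma>) = t powr (- \<gamma>) * r powr \<gamma>"
          using t r(1) by (simp add: powr_divide powr_minus field_simps)
        have tp: "t powr (\<theta> - c) * t powr (- \<gamma>) = t powr ((\<theta> - \<gamma>) - c)"
          unfolding powr_add[symmetric] by (simp add: algebra_simps)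
        have "J t * exp (- 2 * \<phi> s) = S t * (cmod (?w t) * cmod (?u t) * exp (- 2 * \<phi> s))"
          using True by (simp add: J_def mult.assoc)
        also have "\<dots> \<le> S t * (exp (1 + q) * (P t * (G * H)))" using 1 by (intro mult_left_mono) (auto simp: S_def)
        also have "\<dots> = Kc * (t powr (\<theta> - c) * t powr (- \<gamma>))"
          unfolding S_def P_def Kc_def tg by (simp only: mult_ac)
        finally show ?thesis using True unfolding tp by simp
      qed (simp add: J_def)
    qed
    have p1: "- 1 < \<theta> - \<gamma>" using \<theta>(3) by simp
    note wi = weighted_integral_powr[OF p1 less_imp_le[OF r(1)], of c]
    have Jm: "J \<in> borel_measurable ?M"
    proof -
      have mS: "S \<in> borel_measurable ?M" unfolding S_def by (rule measurable_weighted_measureI) measurable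
      have mI: "(indicator {0<..r} :: real \<Rightarrow> real) \<in> borel_measurable ?M"
        by (rule measurable_weighted_measureI) simp
      have mwu: "(\<lambda>t. cmod (?w t) * cmod (?u t)) \<in> borel_measurable ?M"
        by (rule borel_measurable_integrable[OF L2_mult_integrable(2)[OF Td(2)[OF zC f] T_L2[OF zC f]]])
      show ?thesis unfolding J_def by (rule borel_measurable_times[OF mI borel_measurable_times[OF mS mwu]])
    qed
    have Ji: "integrable ?M J"
    \<comment> \<open>The majorant \<open>dom\<close> carries the fixed weight at s; multiplying by
      its inverse frees J from it.\<close>
    proof (rule Bochner_Integration.integrable_bound[OF integrable_mult_right[OF integrable_mult_right[OF wi(1), of Kc], of "exp (2 * \<phi> s)"] Jm])
      show "AE t in ?M. norm (J t) \<le> norm (exp (2 * \<phi> s) * (Kc * (indicator {0<..r} t * t powr ((\<theta> - \<gamma>) - c))))"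
        using dom
      proof eventually_elim
        fix t assume "J t * exp (- 2 * \<phi> s) \<le> Kc * (indicator {0<..r} t * t powr ((\<theta> - \<gamma>) - c))"
        then have "exp (2 * \<phi> s) * (J t * exp (- 2 * \<phi> s)) \<le> exp (2 * \<phi> s) * (Kc * (indicator {0<..r} t * t powr ((\<theta> - \<gamma>) - c)))"
          by (intro mult_left_mono) auto
        moreover have "exp (2 * \<phi> s) * (J t * exp (- 2 * \<phi> s)) = J t"
          by (simp add: exp_minus)
        ultimately have "J t \<le> exp (2 * \<phi> s) * (Kc * (indicator {0<..r} t * t powr ((\<theta> - \<gamma>) - c)))"
          by (simp only:)
        then show "norm (J t) \<le> norm (exp (2 * \<phi> s) * (Kc * (indicator {0<..r} t * t powr ((\<theta> - \<gamma>) - c))))"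
          using J0[of t] unfolding real_norm_def by linarith
      qed
    qed
    define R where "R = 2 * r * (LINT t|?M. J t)"
    have 1: "(cmod (rep ?u s))\<^sup>2 \<le> (cmod (rep ?u r))\<^sup>2 + R"
      unfolding R_def J_def
    proof (rule inner_bound[OF T_generator[OF zC f] V_nonneg V_measurable s])
      show "integrable ?M (\<lambda>t. indicator {0<..r} t * (S t * (cmod (?w t) * cmod (?u t))))"
        using Ji by (simp add: J_def)
      fix t x assume tx: "0 < t" "t \<le> x" "s \<le> x" "x \<le> r"
      have "x powr (- c) = x powr (- \<theta>) * x powr (\<theta> - c)" using tx by (simp add: powr_add[symmetric])
      also have "\<dots> \<le> s powr (- \<theta>) * t powr (\<theta> - c)"
        using tx s \<theta> by (intro mult_mono powr_mono2') auto
      finally show "x powr (- c) \<le> S t" by (simp add: S_def)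
    qed (simp add: S_def)
    have "(LINT t|?M. J t) * exp (- 2 * \<phi> s) = (LINT t|?M. J t * exp (- 2 * \<phi> s))"
      by simp
    also have "\<dots> \<le> (LINT t|?M. Kc * (indicator {0<..r} t * t powr ((\<theta> - \<gamma>) - c)))"
      by (rule integral_mono_AE[OF integrable_mult_left[OF Ji] integrable_mult_right[OF wi(1)] dom])
    also have "\<dots> = Kc * (r powr (\<theta> - \<gamma> + 1) / (\<theta> - \<gamma> + 1))"
      using wi(2) by simp
    also have "\<dots> \<le> Kc * (r powr (\<theta> - \<gamma> + 1) / (1 / 2))"
      using \<theta>(3) Kc by (intro mult_left_mono divide_left_mono) auto
    finally have "R * exp (- 2 * \<phi> s) \<le> 2 * r * (Kc * (r powr (\<theta> - \<gamma> + 1) / (1 / 2)))"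
      using r(1) unfolding R_def by (simp only: mult.assoc) (intro mult_left_mono, auto)
    also have "\<dots> = 4 * exp 1 * A * B * (r powr (- c - 1) * (s / r) powr (- \<theta>)) * exp ((1 + B + 2 * A) * q) * F\<^sup>2"
    proof -
      have e: "exp (1 + q) * exp (B * q) * (exp (A * q) * exp (A * q)) = exp 1 * exp ((1 + B + 2 * A) * q)"
        by (simp add: exp_add[symmetric] algebra_simps)
      have "r * (r powr \<gamma> * r powr (\<theta> - \<gamma> + 1)) = r powr 1 * (r powr \<gamma> * r powr (\<theta> - \<gamma> + 1))" using r(1) by simp
      also have "\<dots> = r powr 2 * r powr \<theta>" unfolding powr_add[symmetric] by simp
      finally have p: "r * (r powr \<gamma> * r powr (\<theta> - \<gamma> + 1)) = r\<^sup>2 * r powr \<theta>" using r(1) by simp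
      have sr: "(s / r) powr (- \<theta>) = s powr (- \<theta>) * r powr \<theta>" using s r(1) by (simp add: powr_divide powr_minus field_simps)
      have GH: "G * H = A / r\<^sup>2 * (exp (A * q) * exp (A * q)) * F\<^sup>2" by (simp add: G_def H_def power2_eq_square)
      have "2 * r * (Kc * (r powr (\<theta> - \<gamma> + 1) / (1 / 2))) =
         4 * (r * (r powr \<gamma> * r powr (\<theta> - \<gamma> + 1))) * (exp (1 + q) * exp (B * q) * (exp (A * q) * exp (A * q)))
           * (A / r\<^sup>2) * B * r powr (- c - 1) * s powr (- \<theta>) * F\<^sup>2"
        unfolding Kc_def GH by simp
      also have "\<dots> = 4 * exp 1 * A * B * (r powr (- c - 1) * (s / r) powr (- \<theta>)) * exp ((1 + B + 2 * A) * q) * F\<^sup>2"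
        unfolding e p sr using r(1) by simp
      finally show ?thesis .
    qed
    also have "\<dots> \<le> D * (r powr (- c - 1) * (s / r) powr (- \<theta>)) * exp (D * q) * F\<^sup>2"
    proof -
      have "exp ((1 + B + 2 * A) * q) \<le> exp (D * q)" unfolding exp_le_cancel_iff by (rule mult_right_mono[OF D(3) nn(1)])
      then show ?thesis using D nn by (intro mult_mono mult_right_mono) auto
    qed
    finally have 2: "R * exp (- 2 * \<phi> s) \<le> D * (r powr (- c - 1) * (s / r) powr (- \<theta>)) * exp (D * (\<alpha>\<^sup>2 * r\<^sup>2)) * (wnorm c \<phi> f)\<^sup>2"
      by (simp add: q_def F_def)
    show ?thesis by (rule C(2)[OF z r wt f s 1 2])
  qed
  then show "\<exists>C>0. \<forall>z\<in>psector \<delta>. \<forall>r \<alpha> \<phi> f s. 0 < r \<longrightarrow> cmod z \<le> \<Lambda> * r\<^sup>2 \<longrightarrow> r\<^sup>2 \<le> \<Lambda> * cmod z \<longrightarrow>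
     weight \<alpha> \<phi> \<longrightarrow> f \<in> L2 c \<longrightarrow> 0 < s \<longrightarrow> s \<le> r \<longrightarrow>
     (cmod (rep (T z f) s))\<^sup>2 * exp (- 2 * \<phi> s) \<le> C * (r powr (- c - 1) * (s / r) powr (- max (\<gamma> - 1 / 2) 0)) * exp (C * (\<alpha>\<^sup>2 * r\<^sup>2)) * (wnorm c \<phi> f)\<^sup>2"
    using C(1) unfolding \<theta>_def by blast
qed

text \<open>For c >= 0 the rate starts at c and drops by 1/2 until it reaches 0, so any n > 2 c
  steps suffice; for c < 0 the crude estimate already has rate 0.\<close>

lemma inner_rate_0:
  assumes \<delta>: "0 < \<delta>" "\<delta> \<le> 1" shows "inner_rate \<delta> 0"
proof (cases "0 \<le> c")
  case True
  have "inner_rate \<delta> (max (c - real n / 2) 0)" for n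
  proof (induction n)
    case 0
    then show ?case using inner_rate_base[OF \<delta>] by simp
  next
    case (Suc n)
    have "inner_rate \<delta> (max (max (c - real n / 2) 0 - 1 / 2) 0)"
      using True by (intro inner_rate_step[OF \<delta>] Suc) auto
    moreover have "max (max (c - real n / 2) 0 - 1 / 2) 0 = max (c - real (Suc n) / 2) 0"
      by (auto simp: max_def field_simps)
    ultimately show ?case by simp
  qed
  moreover obtain n :: nat where "2 * c < real n" using reals_Archimedean2 by blast
  then have "max (c - real n / 2) 0 = 0" by simp
  ultimately show ?thesis by metis
next
  case False
  then show ?thesis using inner_rate_base[OF \<delta>] by simp
qed

text \<open>The bulk and inner bounds coincide in shape once s is replaced by max s r, which encodes
  that the profile is flat below the scale r.\<close>

lemma pointwise_T:
  assumes \<delta>: "0 < \<delta>" "\<delta> \<le> 1" and \<Lambda>: "1 \<le> \<Lambda>"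
  obtains C where "0 < C"
    "\<And>z r \<alpha> \<phi> f (s::real). z \<in> psector \<delta> \<Longrightarrow> 0 < r \<Longrightarrow> cmod z \<le> \<Lambda> * r\<^sup>2 \<Longrightarrow> r\<^sup>2 \<le> \<Lambda> * cmod z \<Longrightarrow> weight \<alpha> \<phi> \<Longrightarrow> f \<in> L2 c \<Longrightarrow> 0 < s \<Longrightarrow>
      (cmod (rep (T z f) s))\<^sup>2 * exp (- 2 * \<phi> s) \<le> C * (max s r powr (- c) / r) * exp (C * (\<alpha>\<^sup>2 * r\<^sup>2)) * (wnorm c \<phi> f)\<^sup>2"
proof -
  obtain B where B: "0 < B"
    "\<And>z r \<alpha> \<phi> f s. z \<in> psector \<delta> \<Longrightarrow> 0 < r \<Longrightarrow> cmod z \<le> \<Lambda> * r\<^sup>2 \<Longrightarrow> r\<^sup>2 \<le> \<Lambda> * cmod z \<Longrightarrow> weight \<alpha> \<phi> \<Longrightarrow> f \<in> L2 c \<Longrightarrow> r \<le> s \<Longrightarrow>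
      (cmod (rep (T z f) s))\<^sup>2 * exp (- 2 * \<phi> s) \<le> B * (s powr (- c) / r) * exp (B * (\<alpha>\<^sup>2 * r\<^sup>2)) * (wnorm c \<phi> f)\<^sup>2"
    using bulk_T[OF \<delta> \<Lambda>] by metis
  obtain A where A: "0 < A"
    "\<And>z r \<alpha> \<phi> f s. z \<in> psector \<delta> \<Longrightarrow> 0 < r \<Longrightarrow> cmod z \<le> \<Lambda> * r\<^sup>2 \<Longrightarrow> r\<^sup>2 \<le> \<Lambda> * cmod z \<Longrightarrow> weight \<alpha> \<phi> \<Longrightarrow> f \<in> L2 c \<Longrightarrow> 0 < s \<Longrightarrow> s \<le> r \<Longrightarrow>
     (cmod (rep (T z f) s))\<^sup>2 * exp (- 2 * \<phi> s) \<le> A * (r powr (- c - 1) * (s / r) powr (- 0)) * exp (A * (\<alpha>\<^sup>2 * r\<^sup>2)) * (wnorm c \<phi> f)\<^sup>2"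
    using inner_rate_0[OF \<delta>, unfolded inner_rate_def, rule_format, OF \<Lambda>] by metis
  show thesis
  proof (rule that[of "max A B"])
    show "0 < max A B" using A by simp
    fix z r \<alpha> \<phi> f and s :: real
    assume z: "z \<in> psector \<delta>" and r: "0 < r" "cmod z \<le> \<Lambda> * r\<^sup>2" "r\<^sup>2 \<le> \<Lambda> * cmod z"
      and wt: "weight \<alpha> \<phi>" and f: "f \<in> L2 c" and s: "0 < s"
    have mono: "K * m * exp (K * q) * F\<^sup>2 \<le> max A B * m * exp (max A B * q) * F\<^sup>2"
      if "K \<le> max A B" "0 < K" "0 \<le> m" "0 \<le> q" for K m q F :: real
    proof -
      have "exp (K * q) \<le> exp (max A B * q)" unfolding exp_le_cancel_iff by (rule mult_right_mono[OF that(1,4)])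
      then show ?thesis using that by (intro mult_mono mult_right_mono) auto
    qed
    show "(cmod (rep (T z f) s))\<^sup>2 * exp (- 2 * \<phi> s) \<le> max A B * (max s r powr (- c) / r) * exp (max A B * (\<alpha>\<^sup>2 * r\<^sup>2)) * (wnorm c \<phi> f)\<^sup>2"
    proof (cases "r \<le> s")
      case True
      then have "(cmod (rep (T z f) s))\<^sup>2 * exp (- 2 * \<phi> s) \<le> B * (max s r powr (- c) / r) * exp (B * (\<alpha>\<^sup>2 * r\<^sup>2)) * (wnorm c \<phi> f)\<^sup>2"
        using B(2)[OF z r wt f True] by (simp add: max_def)
      also have "\<dots> \<le> max A B * (max s r powr (- c) / r) * exp (max A B * (\<alpha>\<^sup>2 * r\<^sup>2)) * (wnorm c \<phi> f)\<^sup>2"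
        using B(1) r(1) by (intro mono) auto
      finally show ?thesis .
    next
      case False
      have "r powr (- c - 1) * (s / r) powr (- 0) = max s r powr (- c) / r"
        using False r(1) s by (simp add: powr_diff max_def)
      then have "(cmod (rep (T z f) s))\<^sup>2 * exp (- 2 * \<phi> s) \<le> A * (max s r powr (- c) / r) * exp (A * (\<alpha>\<^sup>2 * r\<^sup>2)) * (wnorm c \<phi> f)\<^sup>2"
        using A(2)[OF z r wt f s] False by simp
      also have "\<dots> \<le> max A B * (max s r powr (- c) / r) * exp (max A B * (\<alpha>\<^sup>2 * r\<^sup>2)) * (wnorm c \<phi> f)\<^sup>2"
        using A(1) r(1) by (intro mono) auto
      finally show ?thesis .
    qed
  qed
qed

end

section \<open>The integral kernel\<close>

text \<open>An approximate point mass at y, normalised in the weighted measure so that pairing with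
  it averages over the window. The window lies to the right of y and so never leaves the
  half-line.\<close>

definition mollifier :: "real \<Rightarrow> nat \<Rightarrow> real \<Rightarrow> real \<Rightarrow> complex" where
  "mollifier c n y x = of_real (indicator {y..y + 1 / real (Suc n)} x) / of_real (measure (weighted_measure c) {y..y + 1 / real (Suc n)})"

lemma mollifier_L2: "0 < y \<Longrightarrow> mollifier c n y \<in> L2 c"
  unfolding mollifier_def[abs_def] by (intro L2_divide indicator_L2) auto

lemma mollifier_average:
  assumes y: "0 < y" and f: "f \<in> L2 c" "has_rep f"
    and near: "\<And>x. y \<le> x \<Longrightarrow> x \<le> y + 1 / real (Suc n) \<Longrightarrow> cmod (rep f x - k) \<le> e"
  shows "cmod (L2_pair c (mollifier c n y) f - k) \<le> e"
proof -
  let ?M = "weighted_measure c" and ?I = "{y..y + 1 / real (Suc n)}"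
  define m where "m = measure ?M ?I"
  have h: "y < y + 1 / real (Suc n)" by simp
  have m: "0 < m" unfolding m_def by (rule indicator_L2(4)[OF y less_imp_le[OF h] h])
  have ii: "integrable ?M (\<lambda>x. indicator ?I x / m)"
    using indicator_L2(3)[OF y less_imp_le[OF h], of c] by simp
  have int1: "(LINT x|?M. indicator ?I x / m) = 1"
  proof -
    have "?I \<inter> {0<..} = ?I" using y by auto
    then show ?thesis using m Icc_sets_weighted[OF y, of "y + 1 / real (Suc n)" c] by (simp add: m_def)
  qed
  have ci: "integrable ?M (\<lambda>x. of_real (indicator ?I x / m) * k)"
    by (intro integrable_mult_left integrable_of_real ii)
  have fi: "integrable ?M (\<lambda>x. mollifier c n y x * f x)"
    by (rule L2_mult_integrable(1)[OF mollifier_L2[OF y] f(1)])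
  have "(LINT x|?M. of_real (indicator ?I x / m) * k) = of_real (LINT x|?M. indicator ?I x / m) * k"
    by (simp only: Bochner_Integration.integral_mult_left_zero integral_complex_of_real)
  then have k: "(LINT x|?M. of_real (indicator ?I x / m) * k) = k" unfolding int1 by simp
  have eq: "L2_pair c (mollifier c n y) f - k = (LINT x|?M. mollifier c n y x * f x - of_real (indicator ?I x / m) * k)"
    unfolding Bochner_Integration.integral_diff[OF fi ci] k L2_pair_def ..
  have "cmod (L2_pair c (mollifier c n y) f - k) \<le> (LINT x|?M. cmod (mollifier c n y x * f x - of_real (indicator ?I x / m) * k))"
    unfolding eq by (rule integral_norm_bound)
  also have "\<dots> \<le> (LINT x|?M. (indicator ?I x / m) * e)"
  proof (rule integral_mono_AE)
    show "integrable ?M (\<lambda>x. cmod (mollifier c n y x * f x - of_real (indicator ?I x / m) * k))"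
      by (rule integrable_norm[OF Bochner_Integration.integrable_diff[OF fi ci]])
    show "integrable ?M (\<lambda>x. (indicator ?I x / m) * e)" by (rule integrable_mult_left[OF ii])
    show "AE x in ?M. cmod (mollifier c n y x * f x - of_real (indicator ?I x / m) * k) \<le> (indicator ?I x / m) * e"
      using rep(2)[OF f(2), of c]
    proof eventually_elim
      fix x assume x: "f x = rep f x"
      show "cmod (mollifier c n y x * f x - of_real (indicator ?I x / m) * k) \<le> (indicator ?I x / m) * e"
      proof (cases "x \<in> ?I")
        case True
        then have i1: "indicator ?I x = (1::real)" by (rule indicator_simps)
        have "mollifier c n y x = of_real (1 / m)"
          by (simp only: mollifier_def m_def i1 of_real_divide)
        then have e1: "mollifier c n y x * f x - of_real (indicator ?I x / m) * k = of_real (1 / m) * (rep f x - k)"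
          by (simp only: x i1 right_diff_distrib)
        have "cmod (mollifier c n y x * f x - of_real (indicator ?I x / m) * k) = cmod (rep f x - k) / m"
          unfolding e1 norm_mult norm_of_real using m by simp
        also have "\<dots> \<le> e / m" using near[of x] True m by (simp add: divide_right_mono)
        finally show ?thesis using True by simp
      qed (simp add: mollifier_def)
    qed
  qed
  also have "\<dots> = (LINT x|?M. indicator ?I x / m) * e" by (rule Bochner_Integration.integral_mult_left_zero)
  also have "\<dots> = e" unfolding int1 by simp
  finally show ?thesis .
qed

text \<open>Every point of the half-plane lies in its own sector, so statements about a single z can
  use the bounds that are uniform on sectors.\<close>

lemma psector_ratio: "z \<in> Cplus \<Longrightarrow> z \<in> psector (Re z / cmod z)" "z \<in> Cplus \<Longrightarrow> 0 < Re z / cmod z" "z \<in> Cplus \<Longrightarrow> Re z / cmod z \<le> 1"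
proof -
  assume z: "z \<in> Cplus"
  then have n: "0 < cmod z" "0 < Re z" by (auto simp: Cplus_def)
  show "z \<in> psector (Re z / cmod z)" "0 < Re z / cmod z" using n by (auto simp: psector_def)
  show "Re z / cmod z \<le> 1" using n complex_Re_le_cmod[of z] by simp
qed

lemma weight_zero: "weight 0 (\<lambda>_. 0)"
  unfolding weight_def by (auto intro!: exI[of _ "\<lambda>_. 0"])

lemma wnorm_zero: "wnorm c (\<lambda>_. 0) f = L2_norm c f"
  by (simp add: wnorm_def)

context schroedinger
begin

text \<open>The pointwise and Hoelder bounds on a compact interval, at scale r = sqrt |z| and with
  the trivial weight. By duality they say that point evaluations composed with T z are bounded
  functionals depending continuously on the point.\<close>

lemma T_local_bounds:
  assumes z: "z \<in> Cplus" and ab: "0 < a" "a \<le> b"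
  obtains B where "0 < B"
    "\<And>f x. f \<in> L2 c \<Longrightarrow> x \<in> {a..b} \<Longrightarrow> cmod (rep (T z f) x) \<le> B * L2_norm c f"
    "\<And>f x y. f \<in> L2 c \<Longrightarrow> x \<in> {a..b} \<Longrightarrow> y \<in> {a..b} \<Longrightarrow> cmod (rep (T z f) y - rep (T z f) x) \<le> B * sqrt \<bar>y - x\<bar> * L2_norm c f"
proof -
  define \<delta> where "\<delta> = Re z / cmod z"
  define r where "r = sqrt (cmod z)"
  note \<delta> = psector_ratio[OF z, folded \<delta>_def]
  have r: "0 < r" "cmod z \<le> 1 * r\<^sup>2" "r\<^sup>2 \<le> 1 * cmod z"
    using psector_norm_pos[OF \<delta>(1)] by (simp_all add: r_def)
  obtain C where C: "0 < C"
    "\<And>z r \<alpha> \<phi> f (s::real). z \<in> psector \<delta> \<Longrightarrow> 0 < r \<Longrightarrow> cmod z \<le> 1 * r\<^sup>2 \<Longrightarrow> r\<^sup>2 \<le> 1 * cmod z \<Longrightarrow> weight \<alpha> \<phi> \<Longrightarrow> f \<in> L2 c \<Longrightarrow> 0 < s \<Longrightarrow>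
      (cmod (rep (T z f) s))\<^sup>2 * exp (- 2 * \<phi> s) \<le> C * (max s r powr (- c) / r) * exp (C * (\<alpha>\<^sup>2 * r\<^sup>2)) * (wnorm c \<phi> f)\<^sup>2"
    using pointwise_T[OF \<delta>(2,3) order_refl] by metis
  obtain A where A: "1 \<le> A"
    "\<And>z r \<alpha> \<phi> f. z \<in> psector \<delta> \<Longrightarrow> 0 < r \<Longrightarrow> cmod z \<le> 1 * r\<^sup>2 \<Longrightarrow> r\<^sup>2 \<le> 1 * cmod z \<Longrightarrow> weight \<alpha> \<phi> \<Longrightarrow> f \<in> L2 c \<Longrightarrow>
      wnorm c \<phi> (T z f) \<le> exp (A * (\<alpha>\<^sup>2 * r\<^sup>2)) * wnorm c \<phi> f \<and>
      wnorm c \<phi> (Td z f) \<le> A / r\<^sup>2 * exp (A * (\<alpha>\<^sup>2 * r\<^sup>2)) * wnorm c \<phi> f \<and>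
      wnorm c \<phi> (weak_deriv (T z f)) \<le> A / r * exp (A * (\<alpha>\<^sup>2 * r\<^sup>2)) * wnorm c \<phi> f"
    using energy_T[OF \<delta>(2,3) order_refl] by blast
  define B1 where "B1 = sqrt (C * (max (r powr (- c)) (max b r powr (- c)) / r))"
  define B2 where "B2 = max (a powr (- c)) (b powr (- c)) * sqrt (max (a powr c) (b powr c)) * (A / r)"
  have B: "0 \<le> B1" "0 \<le> B2" using C(1) r(1) A(1) ab by (auto simp: B1_def B2_def le_max_iff_disj)
  show thesis
  proof (rule that[of "B1 + B2 + 1"])
    show "0 < B1 + B2 + 1" using B by simp
    fix f assume f: "f \<in> L2 c"
    show "cmod (rep (T z f) x) \<le> (B1 + B2 + 1) * L2_norm c f" if x: "x \<in> {a..b}" for x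
    proof -
      have x0: "0 < x" using x ab by simp
      have "(cmod (rep (T z f) x))\<^sup>2 \<le> C * (max x r powr (- c) / r) * (L2_norm c f)\<^sup>2"
        using C(2)[OF \<delta>(1) r weight_zero f x0] by (simp add: wnorm_zero)
      also have "\<dots> \<le> C * (max (r powr (- c)) (max b r powr (- c)) / r) * (L2_norm c f)\<^sup>2"
        using powr_bound_interval[of r "max x r" "max b r" "- c"] r(1) x C(1)
        by (intro mult_right_mono mult_left_mono divide_right_mono) auto
      also have "\<dots> = (B1 * L2_norm c f)\<^sup>2"
        using C(1) r(1) by (simp add: B1_def power_mult_distrib le_max_iff_disj)
      finally have "cmod (rep (T z f) x) \<le> B1 * L2_norm c f"
        by (rule power2_le_imp_le) (use B in simp)
      also have "\<dots> \<le> (B1 + B2 + 1) * L2_norm c f" using B by (intro mult_right_mono) auto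
      finally show ?thesis .
    qed
    show "cmod (rep (T z f) y - rep (T z f) x) \<le> (B1 + B2 + 1) * sqrt \<bar>y - x\<bar> * L2_norm c f"
      if x: "x \<in> {a..b}" and y: "y \<in> {a..b}" for x y
    proof -
      have w: "L2_norm c (weak_deriv (T z f)) \<le> A / r * L2_norm c f"
        using A(2)[OF \<delta>(1) r weight_zero f] by (simp add: wnorm_zero)
      have "cmod (rep (T z f) y - rep (T z f) x) \<le> max (a powr (- c)) (b powr (- c)) * sqrt (max (a powr c) (b powr c)) * sqrt \<bar>y - x\<bar>
         * L2_norm c (weak_deriv (T z f))"
        by (rule form_domain_Hoelder[OF T_form_domain[OF z f]]) (use x y ab in auto)
      also have "\<dots> \<le> max (a powr (- c)) (b powr (- c)) * sqrt (max (a powr c) (b powr c)) * sqrt \<bar>y - x\<bar> * (A / r * L2_norm c f)"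
        by (intro mult_left_mono w) (auto simp: le_max_iff_disj)
      also have "\<dots> = B2 * (sqrt \<bar>y - x\<bar> * L2_norm c f)" by (simp add: B2_def)
      also have "\<dots> \<le> (B1 + B2 + 1) * (sqrt \<bar>y - x\<bar> * L2_norm c f)" using B by (intro mult_right_mono) auto
      finally show ?thesis by (simp only: mult.assoc)
    qed
  qed
qed

text \<open>The row at y of the kernel of T (2 z), averaged over a short window. The inner T z
  bounds the mollifiers in \<open>L2 c\<close> by duality, and the outer one turns this into
  pointwise bounds; hence \<open>kernel z\<close> is taken from z/2.\<close>

definition pre_kernel :: "complex \<Rightarrow> nat \<Rightarrow> real \<Rightarrow> real \<Rightarrow> complex" where
  "pre_kernel z n y = rep (T z (T z (mollifier c n y)))"

definition kernel :: "complex \<Rightarrow> real \<Rightarrow> real \<Rightarrow> complex" where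
  "kernel z y \<rho> = lim (\<lambda>n. pre_kernel (z / 2) n y \<rho>)"

lemma T_mollifier_L2: "z \<in> Cplus \<Longrightarrow> 0 < y \<Longrightarrow> T z (mollifier c n y) \<in> L2 c"
  by (intro T_L2 mollifier_L2)

text \<open>One joint modulus in the mollification index and in both points. With fixed points it
  gives the Cauchy property in n, and in the limit of large n it gives joint continuity.\<close>

definition kernel_modulus :: "complex \<Rightarrow> real set \<Rightarrow> real \<Rightarrow> bool" where
  "kernel_modulus z K B \<longleftrightarrow> 0 < B \<and>
     (\<forall>y\<in>K. \<forall>y'\<in>K. \<forall>m n. L2_norm c (\<lambda>x. T z (mollifier c n y) x - T z (mollifier c m y') x)
        \<le> B * (sqrt (1 / real (Suc n)) + sqrt (1 / real (Suc m)) + sqrt \<bar>y - y'\<bar>)) \<and>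
     (\<forall>y\<in>K. \<forall>y'\<in>K. \<forall>\<rho>\<in>K. \<forall>\<rho>'\<in>K. \<forall>m n. cmod (pre_kernel z n y \<rho> - pre_kernel z m y' \<rho>')
        \<le> B * (sqrt (1 / real (Suc n)) + sqrt (1 / real (Suc m)) + sqrt \<bar>y - y'\<bar> + sqrt \<bar>\<rho> - \<rho>'\<bar>))"

lemma kernel_modulusD:
  assumes "kernel_modulus z K B"
  shows "0 < B"
    "y \<in> K \<Longrightarrow> y' \<in> K \<Longrightarrow> L2_norm c (\<lambda>x. T z (mollifier c n y) x - T z (mollifier c m y') x)
        \<le> B * (sqrt (1 / real (Suc n)) + sqrt (1 / real (Suc m)) + sqrt \<bar>y - y'\<bar>)"
    "y \<in> K \<Longrightarrow> y' \<in> K \<Longrightarrow> \<rho> \<in> K \<Longrightarrow> \<rho>' \<in> K \<Longrightarrow> cmod (pre_kernel z n y \<rho> - pre_kernel z m y' \<rho>')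
        \<le> B * (sqrt (1 / real (Suc n)) + sqrt (1 / real (Suc m)) + sqrt \<bar>y - y'\<bar> + sqrt \<bar>\<rho> - \<rho>'\<bar>)"
proof -
  note a = assms[unfolded kernel_modulus_def]
  show "0 < B" by (rule a[THEN conjunct1])
  show "y \<in> K \<Longrightarrow> y' \<in> K \<Longrightarrow> L2_norm c (\<lambda>x. T z (mollifier c n y) x - T z (mollifier c m y') x)
        \<le> B * (sqrt (1 / real (Suc n)) + sqrt (1 / real (Suc m)) + sqrt \<bar>y - y'\<bar>)"
    by (rule a[THEN conjunct2, THEN conjunct1, rule_format])
  show "y \<in> K \<Longrightarrow> y' \<in> K \<Longrightarrow> \<rho> \<in> K \<Longrightarrow> \<rho>' \<in> K \<Longrightarrow> cmod (pre_kernel z n y \<rho> - pre_kernel z m y' \<rho>')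
        \<le> B * (sqrt (1 / real (Suc n)) + sqrt (1 / real (Suc m)) + sqrt \<bar>y - y'\<bar> + sqrt \<bar>\<rho> - \<rho>'\<bar>)"
    by (rule a[THEN conjunct2, THEN conjunct2, rule_format])
qed

text \<open>By symmetry, T z of a mollifier tests against g as an average of T z g near y, so the
  Hoelder bound for T z g controls differences of mollified images in norm. A second application of
  T z makes these differences pointwise and adds continuity in \<rho>.\<close>

lemma kernel_modulus_exists:
  assumes z: "z \<in> Cplus" and ab: "0 < a" "a \<le> b"
  shows "\<exists>B. kernel_modulus z {a..b} B"
proof -
  \<comment> \<open>The windows have length at most 1, so the local bounds are taken on {a..b +
    1}.\<close>
  have ab1: "a \<le> b + 1" using ab by simp
  obtain B where B: "0 < B"
    "\<And>f x. f \<in> L2 c \<Longrightarrow> x \<in> {a..b + 1} \<Longrightarrow> cmod (rep (T z f) x) \<le> B * L2_norm c f"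
    "\<And>f x y. f \<in> L2 c \<Longrightarrow> x \<in> {a..b + 1} \<Longrightarrow> y \<in> {a..b + 1} \<Longrightarrow> cmod (rep (T z f) y - rep (T z f) x) \<le> B * sqrt \<bar>y - x\<bar> * L2_norm c f"
    by (rule T_local_bounds[OF z ab(1) ab1]) blast
  have h1: "1 / real (Suc n) \<le> 1" for n by simp
  have K: "L2_norm c (\<lambda>x. T z (mollifier c n y) x - T z (mollifier c m y') x) \<le> B * (sqrt (1 / real (Suc n)) + sqrt (1 / real (Suc m)) + sqrt \<bar>y - y'\<bar>)"
    if y: "y \<in> {a..b}" "y' \<in> {a..b}" for y y' m n
  proof (rule L2_norm_dual)
    have y0: "0 < y" "0 < y'" using y ab by auto
    show "(\<lambda>x. T z (mollifier c n y) x - T z (mollifier c m y') x) \<in> L2 c"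
      by (intro L2_diff T_mollifier_L2 z y0)
    show "0 \<le> B * (sqrt (1 / real (Suc n)) + sqrt (1 / real (Suc m)) + sqrt \<bar>y - y'\<bar>)" using B(1) by simp
    fix g assume g: "g \<in> L2 c"
    have avg: "cmod (L2_pair c (mollifier c n y) (T z g) - rep (T z g) y) \<le> B * sqrt (1 / real (Suc n)) * L2_norm c g"
      if y: "y \<in> {a..b}" for n y
    proof (rule mollifier_average[OF _ T_L2[OF z g] T_has_rep[OF z g]])
      show "0 < y" using y ab by simp
      fix x assume x: "y \<le> x" "x \<le> y + 1 / real (Suc n)"
      then have "x \<le> b + 1" using y h1[of n] unfolding atLeastAtMost_iff by linarith
      then have "cmod (rep (T z g) x - rep (T z g) y) \<le> B * sqrt \<bar>x - y\<bar> * L2_norm c g"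
        using x y by (intro B(3) g) auto
      also have "\<dots> \<le> B * sqrt (1 / real (Suc n)) * L2_norm c g"
        using x B(1) by (intro mult_right_mono mult_left_mono) auto
      finally show "cmod (rep (T z g) x - rep (T z g) y) \<le> B * sqrt (1 / real (Suc n)) * L2_norm c g" .
    qed
    have sym: "L2_pair c (T z (mollifier c n y)) g = L2_pair c (mollifier c n y) (T z g)" if "0 < y" for n y
      by (rule T_symmetric[OF z mollifier_L2[OF that] g])
    have e: "L2_pair c (\<lambda>x. T z (mollifier c n y) x - T z (mollifier c m y') x) g =
       (L2_pair c (mollifier c n y) (T z g) - rep (T z g) y) - (L2_pair c (mollifier c m y') (T z g) - rep (T z g) y') + (rep (T z g) y - rep (T z g) y')"
      unfolding L2_pair_diff[OF T_mollifier_L2[OF z y0(1)] T_mollifier_L2[OF z y0(2)] g] sym[OF y0(1)] sym[OF y0(2)] by simp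
    have tri: "cmod (p - q + w) \<le> cmod p + cmod q + cmod w" for p q w :: complex
      using norm_triangle_ineq[of "p - q" w] norm_triangle_ineq4[of p q] by linarith
    have "cmod (rep (T z g) y - rep (T z g) y') \<le> B * sqrt \<bar>y - y'\<bar> * L2_norm c g"
      using y by (intro B(3) g) auto
    then have "cmod (L2_pair c (\<lambda>x. T z (mollifier c n y) x - T z (mollifier c m y') x) g) \<le>
       B * sqrt (1 / real (Suc n)) * L2_norm c g + B * sqrt (1 / real (Suc m)) * L2_norm c g + B * sqrt \<bar>y - y'\<bar> * L2_norm c g"
      unfolding e using avg[OF y(1), of n] avg[OF y(2), of m]
      by (intro order_trans[OF tri] add_mono)
    then show "cmod (L2_pair c (\<lambda>x. T z (mollifier c n y) x - T z (mollifier c m y') x) g) \<le>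
       B * (sqrt (1 / real (Suc n)) + sqrt (1 / real (Suc m)) + sqrt \<bar>y - y'\<bar>) * L2_norm c g"
      by (simp add: algebra_simps)
  qed
  have KB: "L2_norm c (T z (mollifier c n y)) \<le> B" if y: "y \<in> {a..b}" for n y
  proof (rule L2_norm_dual)
    have y0: "0 < y" using y ab by auto
    show "T z (mollifier c n y) \<in> L2 c" by (rule T_mollifier_L2[OF z y0])
    fix g assume g: "g \<in> L2 c"
    have "cmod (L2_pair c (mollifier c n y) (T z g) - 0) \<le> B * L2_norm c g"
    proof (rule mollifier_average[OF y0 T_L2[OF z g] T_has_rep[OF z g]])
      fix x assume "y \<le> x" "x \<le> y + 1 / real (Suc n)"
      then have "a \<le> x" "x \<le> b + 1" using y h1[of n] unfolding atLeastAtMost_iff by linarith+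
      then have "x \<in> {a..b + 1}" by simp
      then show "cmod (rep (T z g) x - 0) \<le> B * L2_norm c g" using B(2)[OF g, of x] by simp
    qed
    then show "cmod (L2_pair c (T z (mollifier c n y)) g) \<le> B * L2_norm c g"
      using T_symmetric[OF z mollifier_L2[OF y0] g] by simp
  qed (use B in simp)
  have main: "L2_norm c (\<lambda>x. T z (mollifier c n y) x - T z (mollifier c m y') x)
        \<le> (B + B * B) * (sqrt (1 / real (Suc n)) + sqrt (1 / real (Suc m)) + sqrt \<bar>y - y'\<bar>) \<and>
     (\<forall>\<rho>\<in>{a..b}. \<forall>\<rho>'\<in>{a..b}. cmod (pre_kernel z n y \<rho> - pre_kernel z m y' \<rho>')
        \<le> (B + B * B) * (sqrt (1 / real (Suc n)) + sqrt (1 / real (Suc m)) + sqrt \<bar>y - y'\<bar> + sqrt \<bar>\<rho> - \<rho>'\<bar>))"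
    if y: "y \<in> {a..b}" "y' \<in> {a..b}" for y y' m n
  proof (intro conjI ballI)
    have y0: "0 < y" "0 < y'" using y ab by auto
    let ?s = "sqrt (1 / real (Suc n)) + sqrt (1 / real (Suc m)) + sqrt \<bar>y - y'\<bar>"
    have "B * ?s \<le> (B + B * B) * ?s" using B(1) by (intro mult_right_mono) auto
    then show "L2_norm c (\<lambda>x. T z (mollifier c n y) x - T z (mollifier c m y') x) \<le> (B + B * B) * ?s"
      using K[OF y, of n m] by linarith
    fix \<rho> \<rho>' assume \<rho>: "\<rho> \<in> {a..b}" "\<rho>' \<in> {a..b}"
    have \<rho>0: "0 < \<rho>" using \<rho> ab by auto
    let ?u = "T z (mollifier c n y)" and ?v = "T z (mollifier c m y')"
    have L: "?u \<in> L2 c" "?v \<in> L2 c" by (intro T_mollifier_L2 z y0)+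
    have "rep (T z (\<lambda>x. ?u x - ?v x)) \<rho> = rep (T z ?u) \<rho> - rep (T z ?v) \<rho>"
      by (rule rep_diff[OF T_has_rep[OF z L(1)] T_has_rep[OF z L(2)] T_diff[OF z L] \<rho>0])
    then have eq: "pre_kernel z n y \<rho> - pre_kernel z m y' \<rho>' = rep (T z (\<lambda>x. ?u x - ?v x)) \<rho> + (rep (T z ?v) \<rho> - rep (T z ?v) \<rho>')"
      by (simp add: pre_kernel_def)
    have "cmod (pre_kernel z n y \<rho> - pre_kernel z m y' \<rho>') \<le> cmod (rep (T z (\<lambda>x. ?u x - ?v x)) \<rho>) + cmod (rep (T z ?v) \<rho> - rep (T z ?v) \<rho>')"
      unfolding eq by (rule norm_triangle_ineq)
    also have "\<dots> \<le> B * L2_norm c (\<lambda>x. ?u x - ?v x) + B * sqrt \<bar>\<rho> - \<rho>'\<bar> * L2_norm c ?v"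
      using \<rho> by (intro add_mono B L2_diff L) auto
    also have "\<dots> \<le> B * (B * ?s) + B * sqrt \<bar>\<rho> - \<rho>'\<bar> * B"
      by (rule add_mono[OF mult_left_mono[OF K[OF y]] mult_left_mono[OF KB[OF y(2)]]]) (use B(1) in auto)
    also have "\<dots> = B * B * (?s + sqrt \<bar>\<rho> - \<rho>'\<bar>)" by (simp add: algebra_simps)
    also have "\<dots> \<le> (B + B * B) * (?s + sqrt \<bar>\<rho> - \<rho>'\<bar>)"
      using B(1) by (intro mult_right_mono) auto
    finally show "cmod (pre_kernel z n y \<rho> - pre_kernel z m y' \<rho>') \<le> (B + B * B) * (?s + sqrt \<bar>\<rho> - \<rho>'\<bar>)" .
  qed
  have "0 < B + B * B" using B(1) by (simp add: add_pos_pos)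
  then show ?thesis unfolding kernel_modulus_def using main by blast
qed

lemma sqrt_inverse_Suc_tendsto: "(\<lambda>n. sqrt (1 / real (Suc n))) \<longlonglongrightarrow> 0"
  using tendsto_real_sqrt[OF LIMSEQ_inverse_real_of_nat] by (simp add: inverse_eq_divide)

lemma pre_kernel_tendsto:
  assumes z: "z \<in> Cplus" and y: "0 < y" "0 < \<rho>"
  shows "(\<lambda>n. pre_kernel (z / 2) n y \<rho>) \<longlonglongrightarrow> kernel z y \<rho>"
proof -
  have ab: "0 < min y \<rho>" "min y \<rho> \<le> max y \<rho>" using y by auto
  obtain B where "kernel_modulus (z / 2) {min y \<rho>..max y \<rho>} B"
    using kernel_modulus_exists[OF Cplus_half[OF z] ab] by blast
  note B = kernel_modulusD[OF this]
  have "Cauchy (\<lambda>n. pre_kernel (z / 2) n y \<rho>)"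
  proof (rule metric_CauchyI)
    fix e :: real assume e: "0 < e"
    have "(\<lambda>n. 2 * B * sqrt (1 / real (Suc n))) \<longlonglongrightarrow> 2 * B * 0"
      by (intro tendsto_intros sqrt_inverse_Suc_tendsto)
    then have "\<forall>\<^sub>F n in sequentially. 2 * B * sqrt (1 / real (Suc n)) < e"
      using e by (intro order_tendstoD(2)) auto
    then obtain N where N: "2 * B * sqrt (1 / real (Suc n)) < e" if "n \<ge> N" for n
      by (auto simp: eventually_sequentially)
    have "dist (pre_kernel (z / 2) n y \<rho>) (pre_kernel (z / 2) m y \<rho>) < e" if "n \<ge> N" "m \<ge> N" for n m
    proof -
      have "dist (pre_kernel (z / 2) n y \<rho>) (pre_kernel (z / 2) m y \<rho>) \<le> B * (sqrt (1 / real (Suc n)) + sqrt (1 / real (Suc m)))"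
        using B(3)[of y y \<rho> \<rho> n m] by (simp add: dist_norm)
      then show ?thesis using N[OF that(1)] N[OF that(2)] by (simp add: distrib_left)
    qed
    then show "\<exists>N. \<forall>m\<ge>N. \<forall>n\<ge>N. dist (pre_kernel (z / 2) m y \<rho>) (pre_kernel (z / 2) n y \<rho>) < e" by blast
  qed
  then show ?thesis unfolding kernel_def by (simp add: Cauchy_convergent_iff convergent_LIMSEQ_iff)
qed

text \<open>The modulus with equal indices survives the limit in n, in which its mollification terms
  vanish. Joint continuity then supplies measurability with respect to the product measure.\<close>

lemma kernel_continuous:
  assumes z: "z \<in> Cplus" shows "continuous_on ({0<..} \<times> {0<..}) (\<lambda>(y, \<rho>). kernel z y \<rho>)"
proof (rule continuous_at_imp_continuous_on, rule ballI)
  fix p :: "real \<times> real" assume "p \<in> {0<..} \<times> {0<..}"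
  then obtain y \<rho> where p: "p = (y, \<rho>)" "0 < y" "0 < \<rho>" by (cases p) auto
  define a where "a = min y \<rho> / 2"
  define b where "b = 2 * max y \<rho>"
  have ab: "0 < a" "a \<le> b" using p by (auto simp: a_def b_def)
  obtain B where "kernel_modulus (z / 2) {a..b} B"
    using kernel_modulus_exists[OF Cplus_half[OF z] ab] by blast
  note B = kernel_modulusD[OF this]
  have lim: "cmod (kernel z x t - kernel z y \<rho>) \<le> B * (sqrt \<bar>x - y\<bar> + sqrt \<bar>t - \<rho>\<bar>)" if xt: "x \<in> {a..b}" "t \<in> {a..b}" for x t
  proof -
    have "0 < x" "0 < t" using xt ab by auto
    then have "(\<lambda>n. cmod (pre_kernel (z / 2) n x t - pre_kernel (z / 2) n y \<rho>)) \<longlonglongrightarrow> cmod (kernel z x t - kernel z y \<rho>)"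
      by (intro tendsto_norm tendsto_diff pre_kernel_tendsto z p)
    moreover have "(\<lambda>n. B * (sqrt (1 / real (Suc n)) + sqrt (1 / real (Suc n)) + sqrt \<bar>x - y\<bar> + sqrt \<bar>t - \<rho>\<bar>)) \<longlonglongrightarrow>
       B * (0 + 0 + sqrt \<bar>x - y\<bar> + sqrt \<bar>t - \<rho>\<bar>)"
      by (intro tendsto_intros sqrt_inverse_Suc_tendsto)
    ultimately have "cmod (kernel z x t - kernel z y \<rho>) \<le> B * (0 + 0 + sqrt \<bar>x - y\<bar> + sqrt \<bar>t - \<rho>\<bar>)"
    proof (rule LIMSEQ_le)
      have "y \<in> {a..b}" "\<rho> \<in> {a..b}" using p by (auto simp: a_def b_def)
      then show "\<exists>N. \<forall>n\<ge>N. cmod (pre_kernel (z / 2) n x t - pre_kernel (z / 2) n y \<rho>) \<le>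
          B * (sqrt (1 / real (Suc n)) + sqrt (1 / real (Suc n)) + sqrt \<bar>x - y\<bar> + sqrt \<bar>t - \<rho>\<bar>)"
        using B(3)[OF xt(1) _ xt(2)] by blast
    qed
    then show ?thesis by simp
  qed
  have "((\<lambda>q. (case q of (x, t) \<Rightarrow> kernel z x t) - kernel z y \<rho>) \<longlongrightarrow> 0) (at (y, \<rho>))"
  proof (rule Lim_null_comparison)
    have "open ({a<..<b} \<times> {a<..<b})" "(y, \<rho>) \<in> {a<..<b} \<times> {a<..<b}"
      using p by (auto simp: a_def b_def intro: open_Times)
    then have "\<forall>\<^sub>F q in at (y, \<rho>). q \<in> {a<..<b} \<times> {a<..<b}"
      by (intro eventually_at_in_open') auto
    then show "\<forall>\<^sub>F q in at (y, \<rho>). norm ((case q of (x, t) \<Rightarrow> kernel z x t) - kernel z y \<rho>) \<le> B * (sqrt \<bar>fst q - y\<bar> + sqrt \<bar>snd q - \<rho>\<bar>)"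
      by eventually_elim (use lim in auto)
    have "((\<lambda>q. B * (sqrt \<bar>fst q - y\<bar> + sqrt \<bar>snd q - \<rho>\<bar>)) \<longlongrightarrow> B * (sqrt \<bar>fst (y, \<rho>) - y\<bar> + sqrt \<bar>snd (y, \<rho>) - \<rho>\<bar>)) (at (y, \<rho>))"
      by (intro tendsto_intros)
    then show "((\<lambda>q. B * (sqrt \<bar>fst q - y\<bar> + sqrt \<bar>snd q - \<rho>\<bar>)) \<longlongrightarrow> 0) (at (y, \<rho>))" by simp
  qed
  then have "((\<lambda>q. case q of (x, t) \<Rightarrow> kernel z x t) \<longlongrightarrow> kernel z y \<rho>) (at (y, \<rho>))"
    using Lim_null by blast
  then show "isCont (\<lambda>(y, \<rho>). kernel z y \<rho>) p" by (simp add: p(1) isCont_def)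
qed

lemma kernel_measurable:
  assumes z: "z \<in> Cplus"
  shows "(\<lambda>(y, \<rho>). kernel z y \<rho>) \<in> borel_measurable (weighted_measure c \<Otimes>\<^sub>M weighted_measure c)"
proof -
  let ?M = "weighted_measure c" and ?k = "\<lambda>(y, \<rho>). kernel z y \<rho>"
  have "open ({0<..} \<times> {0<..} :: (real \<times> real) set)" by (intro open_Times) auto
  then have "(\<lambda>q. indicator ({0<..} \<times> {0<..}) q *\<^sub>R ?k q) \<in> borel_measurable borel"
    by (intro borel_measurable_continuous_on_indicator kernel_continuous z) auto
  moreover have "(\<lambda>q. q) \<in> ?M \<Otimes>\<^sub>M ?M \<rightarrow>\<^sub>M (borel :: (real \<times> real) measure)"
  proof -
    have id: "(\<lambda>x. x) \<in> borel_measurable ?M" by (rule measurable_weighted_measureI) simp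
    have "(\<lambda>q. (fst q, snd q)) \<in> ?M \<Otimes>\<^sub>M ?M \<rightarrow>\<^sub>M borel \<Otimes>\<^sub>M borel"
      by (intro measurable_Pair measurable_compose[OF measurable_fst id] measurable_compose[OF measurable_snd id])
    then show ?thesis by (simp add: borel_prod)
  qed
  ultimately have "(\<lambda>q. indicator ({0<..} \<times> {0<..}) q *\<^sub>R ?k q) \<in> borel_measurable (?M \<Otimes>\<^sub>M ?M)"
    using measurable_compose by blast
  then show ?thesis
    by (rule measurable_cong[THEN iffD1, rotated]) (auto simp: space_pair_measure)
qed

text \<open>The approximating rows are Cauchy in norm, since T (z/2) is a contraction, and their
  representatives converge pointwise; Fatou's lemma identifies the norm limit with the pointwise
  one.\<close>

lemma kernel_L2:
  assumes z: "z \<in> Cplus" and y: "0 < y"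
  shows "kernel z y \<in> L2 c"
    "((\<lambda>n. L2_norm c (\<lambda>x. T (z / 2) (T (z / 2) (mollifier c n y)) x - kernel z y x)) \<longlongrightarrow> 0) sequentially"
proof -
  let ?M = "weighted_measure c"
  define z2 where "z2 = z / 2"
  have z2: "z2 \<in> Cplus" unfolding z2_def by (rule Cplus_half[OF z])
  define u where "u = (\<lambda>n. T z2 (T z2 (mollifier c n y)))"
  have kL: "T z2 (mollifier c n y) \<in> L2 c" for n by (rule T_mollifier_L2[OF z2 y])
  have uL: "u n \<in> L2 c" for n unfolding u_def by (intro T_L2 z2 kL)
  have ur: "has_rep (u n)" for n unfolding u_def by (intro T_has_rep z2 kL)
  have yy: "y \<in> {y..y}" by simp
  obtain B where "kernel_modulus z2 {y..y} B"
    using kernel_modulus_exists[OF z2 y order_refl] by blast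
  note B = kernel_modulusD[OF this]
  have un: "L2_norm c (\<lambda>x. u n x - u m x) \<le> 2 * B * sqrt (1 / real (Suc n))" if "n \<le> m" for n m
  proof -
    have d: "(\<lambda>x. T z2 (mollifier c n y) x - T z2 (mollifier c m y) x) \<in> L2 c" by (intro L2_diff kL)
    have "L2_norm c (\<lambda>x. u n x - u m x) = L2_norm c (T z2 (\<lambda>x. T z2 (mollifier c n y) x - T z2 (mollifier c m y) x))"
    proof (rule L2_norm_cong_AE)
      show "AE x in ?M. u n x - u m x = T z2 (\<lambda>x. T z2 (mollifier c n y) x - T z2 (mollifier c m y) x) x"
        using T_diff[OF z2 kL kL, of n m] by eventually_elim (simp add: u_def)
    qed (intro L2_diff uL, intro T_L2 z2 d)
    also have "\<dots> \<le> L2_norm c (\<lambda>x. T z2 (mollifier c n y) x - T z2 (mollifier c m y) x)" by (rule T_contr[OF z2 d])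
    also have "\<dots> \<le> B * (sqrt (1 / real (Suc n)) + sqrt (1 / real (Suc m)))" using B(2)[OF yy yy, of n m] by simp
    also have "\<dots> \<le> B * (sqrt (1 / real (Suc n)) + sqrt (1 / real (Suc n)))"
      using that B(1) by (intro mult_left_mono add_left_mono real_sqrt_le_mono divide_left_mono) auto
    finally show ?thesis by simp
  qed
  have conv: "(\<lambda>n. rep (u n) x) \<longlonglongrightarrow> kernel z y x" if "0 < x" for x
    using pre_kernel_tendsto[OF z y that] by (simp add: pre_kernel_def u_def z2_def)
  have km: "kernel z y \<in> borel_measurable ?M"
  proof (rule continuous_on_measurable_weighted)
    have "continuous_on {0<..} (\<lambda>x. (\<lambda>(y, \<rho>). kernel z y \<rho>) (y, x))"
      by (rule continuous_on_compose2[OF kernel_continuous[OF z]]) (use y in \<open>auto intro!: continuous_intros\<close>)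
    then show "continuous_on {0<..} (kernel z y)" by simp
  qed
  have um: "u n \<in> borel_measurable ?M" for n using uL by auto
  have main: "(\<lambda>x. u n x - kernel z y x) \<in> L2 c \<and> L2_norm c (\<lambda>x. u n x - kernel z y x) \<le> 2 * B * sqrt (1 / real (Suc n))" for n
  proof -
    let ?b = "2 * B * sqrt (1 / real (Suc n))"
    have b: "0 \<le> ?b" using B(1) by simp
    have dm: "(\<lambda>x. u n x - kernel z y x) \<in> borel_measurable ?M" by (intro borel_measurable_diff um km)
    have AEall: "AE x in ?M. \<forall>m. u m x = rep (u m) x"
      unfolding AE_all_countable using rep(2)[OF ur] by blast
    \<comment> \<open>Fatou in the second index m, with n fixed: the Cauchy bound for m >= n passes
      to the distance from the limit.\<close>
    have "(\<integral>\<^sup>+x. ennreal ((cmod (u n x - kernel z y x))\<^sup>2) \<partial>?M) \<le> (\<integral>\<^sup>+x. liminf (\<lambda>m. ennreal ((cmod (u n x - u m x))\<^sup>2)) \<partial>?M)"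
    proof (rule nn_integral_mono_AE)
      show "AE x in ?M. ennreal ((cmod (u n x - kernel z y x))\<^sup>2) \<le> liminf (\<lambda>m. ennreal ((cmod (u n x - u m x))\<^sup>2))"
        using AEall AE_space
      proof eventually_elim
        fix x assume x: "\<forall>m. u m x = rep (u m) x" "x \<in> space ?M"
        then have "(\<lambda>m. u m x) \<longlonglongrightarrow> kernel z y x" using conv[of x] by simp
        then have "(\<lambda>m. ennreal ((cmod (u n x - u m x))\<^sup>2)) \<longlonglongrightarrow> ennreal ((cmod (u n x - kernel z y x))\<^sup>2)"
          by (intro tendsto_ennrealI tendsto_power tendsto_norm tendsto_diff tendsto_const)
        then have "liminf (\<lambda>m. ennreal ((cmod (u n x - u m x))\<^sup>2)) = ennreal ((cmod (u n x - kernel z y x))\<^sup>2)"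
          by (rule lim_imp_Liminf[OF trivial_limit_sequentially])
        then show "ennreal ((cmod (u n x - kernel z y x))\<^sup>2) \<le> liminf (\<lambda>m. ennreal ((cmod (u n x - u m x))\<^sup>2))"
          by (simp only: order_refl)
      qed
    qed
    also have "\<dots> \<le> liminf (\<lambda>m. \<integral>\<^sup>+x. ennreal ((cmod (u n x - u m x))\<^sup>2) \<partial>?M)"
    proof (rule nn_integral_liminf)
      fix m
      have "(\<lambda>x. (cmod (u n x - u m x))\<^sup>2) \<in> borel_measurable ?M"
        using borel_measurable_integrable[OF L2_integrable[OF L2_diff[OF uL[of n] uL[of m]]]] .
      then show "(\<lambda>x. ennreal ((cmod (u n x - u m x))\<^sup>2)) \<in> borel_measurable ?M"
        by (rule measurable_compose[OF _ measurable_ennreal])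
    qed
    also have "\<dots> \<le> ennreal (?b\<^sup>2)"
    proof (rule Liminf_le)
      show "\<forall>\<^sub>F m in sequentially. (\<integral>\<^sup>+x. ennreal ((cmod (u n x - u m x))\<^sup>2) \<partial>?M) \<le> ennreal (?b\<^sup>2)"
        using eventually_ge_at_top[of n]
      proof eventually_elim
        fix m assume m: "n \<le> m"
        have d: "(\<lambda>x. u n x - u m x) \<in> L2 c" by (intro L2_diff uL)
        have "(\<integral>\<^sup>+x. ennreal ((cmod (u n x - u m x))\<^sup>2) \<partial>?M) = ennreal ((L2_norm c (\<lambda>x. u n x - u m x))\<^sup>2)"
          unfolding L2_norm_square[OF d] by (rule nn_integral_eq_integral[OF L2_integrable[OF d]]) simp
        also have "\<dots> \<le> ennreal (?b\<^sup>2)" by (intro ennreal_leI power_mono un m) simp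
        finally show "(\<integral>\<^sup>+x. ennreal ((cmod (u n x - u m x))\<^sup>2) \<partial>?M) \<le> ennreal (?b\<^sup>2)" .
      qed
    qed simp
    finally have nb: "(\<integral>\<^sup>+x. ennreal ((cmod (u n x - kernel z y x))\<^sup>2) \<partial>?M) \<le> ennreal (?b\<^sup>2)" .
    have i: "integrable ?M (\<lambda>x. (cmod (u n x - kernel z y x))\<^sup>2)"
    proof (rule integrableI_bounded)
      show "(\<lambda>x. (cmod (u n x - kernel z y x))\<^sup>2) \<in> borel_measurable ?M"
        using measurable_compose[OF dm, of "\<lambda>w. (cmod w)\<^sup>2" borel] by simp
      show "(\<integral>\<^sup>+x. ennreal (norm ((cmod (u n x - kernel z y x))\<^sup>2)) \<partial>?M) < \<infinity>"
        using nb by (simp add: order_le_less_trans[OF _ ennreal_less_top])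
    qed
    then have dL: "(\<lambda>x. u n x - kernel z y x) \<in> L2 c" using dm by (simp add: L2_def)
    have "ennreal ((L2_norm c (\<lambda>x. u n x - kernel z y x))\<^sup>2) \<le> ennreal (?b\<^sup>2)"
      using nb unfolding L2_norm_square[OF dL] nn_integral_eq_integral[OF i AE_I2[OF zero_le_power2]] .
    then have "(L2_norm c (\<lambda>x. u n x - kernel z y x))\<^sup>2 \<le> ?b\<^sup>2" by (simp add: ennreal_le_iff)
    then show ?thesis using dL power2_le_imp_le[OF _ b] by blast
  qed
  show "kernel z y \<in> L2 c"
    using L2_diff[OF uL[of 0] conjunct1[OF main[of 0]]] by simp
  have "(\<lambda>n. 2 * B * sqrt (1 / real (Suc n))) \<longlonglongrightarrow> 2 * B * 0"
    by (intro tendsto_intros sqrt_inverse_Suc_tendsto)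
  then have b0: "(\<lambda>n. 2 * B * sqrt (1 / real (Suc n))) \<longlonglongrightarrow> 0" by simp
  have "((\<lambda>n. L2_norm c (\<lambda>x. u n x - kernel z y x)) \<longlongrightarrow> 0) sequentially"
    by (rule Lim_null_comparison[OF always_eventually b0]) (use main in simp)
  then show "((\<lambda>n. L2_norm c (\<lambda>x. T (z / 2) (T (z / 2) (mollifier c n y)) x - kernel z y x)) \<longlongrightarrow> 0) sequentially"
    by (simp add: u_def z2_def)
qed

text \<open>Two uses of symmetry move both factors T (z/2) from the mollifier to f; the mollifier
  then averages a continuous function and tends to its value at y.\<close>

lemma kernel_represents:
  assumes z: "z \<in> Cplus" and f: "f \<in> L2 c" and y: "0 < y"
  shows "L2_pair c (kernel z y) f = rep (T (z / 2) (T (z / 2) f)) y"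
proof -
  define z2 where "z2 = z / 2"
  have z2: "z2 \<in> Cplus" unfolding z2_def by (rule Cplus_half[OF z])
  define g where "g = T z2 f"
  have g: "g \<in> L2 c" unfolding g_def by (rule T_L2[OF z2 f])
  have 1: "(\<lambda>n. L2_pair c (T z2 (T z2 (mollifier c n y))) f) \<longlonglongrightarrow> L2_pair c (kernel z y) f"
    unfolding z2_def
    by (rule L2_pair_tendsto[OF _ kernel_L2(1)[OF z y] f kernel_L2(2)[OF z y]])
       (intro always_eventually allI T_L2 mollifier_L2 y Cplus_half z)
  have y1: "y \<le> y + 1" by simp
  obtain B where B: "0 < B"
    "\<And>f x. f \<in> L2 c \<Longrightarrow> x \<in> {y..y + 1} \<Longrightarrow> cmod (rep (T z2 f) x) \<le> B * L2_norm c f"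
    "\<And>f x x'. f \<in> L2 c \<Longrightarrow> x \<in> {y..y + 1} \<Longrightarrow> x' \<in> {y..y + 1} \<Longrightarrow> cmod (rep (T z2 f) x' - rep (T z2 f) x) \<le> B * sqrt \<bar>x' - x\<bar> * L2_norm c f"
    by (rule T_local_bounds[OF z2 y y1]) blast
  have e: "L2_pair c (T z2 (T z2 (mollifier c n y))) f = L2_pair c (mollifier c n y) (T z2 g)" for n
    unfolding g_def T_symmetric[OF z2 T_mollifier_L2[OF z2 y] f] by (rule T_symmetric[OF z2 mollifier_L2[OF y] T_L2[OF z2 f]])
  have "(\<lambda>n. L2_pair c (mollifier c n y) (T z2 g) - rep (T z2 g) y) \<longlonglongrightarrow> 0"
  proof (rule Lim_null_comparison[OF always_eventually])
    show "\<forall>n. norm (L2_pair c (mollifier c n y) (T z2 g) - rep (T z2 g) y) \<le> B * sqrt (1 / real (Suc n)) * L2_norm c g"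
    proof
      fix n
      show "norm (L2_pair c (mollifier c n y) (T z2 g) - rep (T z2 g) y) \<le> B * sqrt (1 / real (Suc n)) * L2_norm c g"
      proof (rule mollifier_average[OF y T_L2[OF z2 g] T_has_rep[OF z2 g]])
        fix x assume x: "y \<le> x" "x \<le> y + 1 / real (Suc n)"
        have "1 / real (Suc n) \<le> 1" by simp
        then have "x \<le> y + 1" using x by linarith
        then have "cmod (rep (T z2 g) x - rep (T z2 g) y) \<le> B * sqrt \<bar>x - y\<bar> * L2_norm c g"
          using x by (intro B(3) g) auto
        also have "\<dots> \<le> B * sqrt (1 / real (Suc n)) * L2_norm c g"
          using x B(1) by (intro mult_right_mono mult_left_mono) auto
        finally show "cmod (rep (T z2 g) x - rep (T z2 g) y) \<le> B * sqrt (1 / real (Suc n)) * L2_norm c g" .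
      qed
    qed
    have "(\<lambda>n. B * sqrt (1 / real (Suc n)) * L2_norm c g) \<longlonglongrightarrow> B * 0 * L2_norm c g"
      by (intro tendsto_intros sqrt_inverse_Suc_tendsto)
    then show "(\<lambda>n. B * sqrt (1 / real (Suc n)) * L2_norm c g) \<longlonglongrightarrow> 0" by simp
  qed
  then have "(\<lambda>n. L2_pair c (T z2 (T z2 (mollifier c n y))) f) \<longlonglongrightarrow> rep (T z2 g) y"
    unfolding e using Lim_null by blast
  from LIMSEQ_unique[OF 1 this] show ?thesis by (simp add: g_def z2_def)
qed

lemma kernel_is_integral_kernel:
  assumes z: "z \<in> Cplus" shows "is_integral_kernel c (T z) (kernel z)"
  unfolding is_integral_kernel_def
proof (intro conjI ballI kernel_measurable z)
  fix f assume f: "f \<in> L2 c"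
  note z2 = Cplus_half[OF z]
  show "AE y in weighted_measure c. integrable (weighted_measure c) (\<lambda>\<rho>. kernel z y \<rho> * f \<rho>) \<and>
      T z f y = (LINT \<rho>|weighted_measure c. kernel z y \<rho> * f \<rho>)"
    using T_half[OF z f] rep(2)[OF T_has_rep[OF z2 T_L2[OF z2 f]], of c] AE_space
  proof eventually_elim
    fix y assume y: "T z f y = T (z / 2) (T (z / 2) f) y" "T (z / 2) (T (z / 2) f) y = rep (T (z / 2) (T (z / 2) f)) y"
      "y \<in> space (weighted_measure c)"
    then have "0 < y" by simp
    then show "integrable (weighted_measure c) (\<lambda>\<rho>. kernel z y \<rho> * f \<rho>) \<and>
      T z f y = (LINT \<rho>|weighted_measure c. kernel z y \<rho> * f \<rho>)"
      using L2_mult_integrable(1)[OF kernel_L2(1)[OF z] f] kernel_represents[OF z f] y by (simp add: L2_pair_def)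
  qed
qed

end

section \<open>Gaussian bounds\<close>

lemma hyperbola_has_derivative:
  fixes r y x :: real
  assumes "0 < r"
  shows "((\<lambda>x. sqrt (r\<^sup>2 + (x - y)\<^sup>2)) has_real_derivative (x - y) / sqrt (r\<^sup>2 + (x - y)\<^sup>2)) (at x)"
proof -
  have p: "0 < r\<^sup>2 + (x - y)\<^sup>2" using assms by (simp add: add_pos_nonneg)
  have "((\<lambda>x. r\<^sup>2 + (x - y)\<^sup>2) has_real_derivative 2 * (x - y)) (at x)"
    by (auto intro!: derivative_eq_intros)
  note d = DERIV_chain2[where f = sqrt and g = "\<lambda>x. r\<^sup>2 + (x - y)\<^sup>2", OF DERIV_real_sqrt[OF p] this]
  have "inverse a / 2 * (2 * b) = b / a" for a b :: real by (cases "a = 0") (simp_all add: field_simps)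
  then show ?thesis by (rule DERIV_cong[OF d])
qed

text \<open>A differentiable substitute for \<alpha> |x - y|: it lies above it, has slope at most
  \<alpha>, and at its centre equals only \<alpha> r. With r = sqrt |z| this excess is of the order
  already allowed.\<close>

lemma weight_hyperbolic:
  assumes "0 \<le> \<alpha>" "0 < r" shows "weight \<alpha> (\<lambda>x. \<alpha> * sqrt (r\<^sup>2 + (x - y)\<^sup>2))"
proof -
  define \<phi>' where "\<phi>' = (\<lambda>x. \<alpha> * ((x - y) / sqrt (r\<^sup>2 + (x - y)\<^sup>2)))"
  have p: "0 < r\<^sup>2 + (x - y)\<^sup>2" for x using assms(2) by (simp add: add_pos_nonneg)
  have 1: "0 \<le> \<alpha> * sqrt (r\<^sup>2 + (x - y)\<^sup>2)" for x using assms by simp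
  have 2: "((\<lambda>x. \<alpha> * sqrt (r\<^sup>2 + (x - y)\<^sup>2)) has_real_derivative \<phi>' x) (at x)" for x
    unfolding \<phi>'_def by (rule DERIV_cmult[OF hyperbola_has_derivative[OF assms(2)]])
  have 3: "\<bar>\<phi>' x\<bar> \<le> \<alpha>" for x
  proof -
    have "\<bar>x - y\<bar> \<le> sqrt (r\<^sup>2 + (x - y)\<^sup>2)" by (rule real_le_rsqrt) simp
    \<comment> \<open>The term r^2 keeps the square root away from 0, also at the centre.\<close>
    then have "\<bar>(x - y) / sqrt (r\<^sup>2 + (x - y)\<^sup>2)\<bar> \<le> 1" using p[of x] by simp
    then have "\<alpha> * \<bar>(x - y) / sqrt (r\<^sup>2 + (x - y)\<^sup>2)\<bar> \<le> \<alpha> * 1" using assms(1) by (rule mult_left_mono)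
    then show ?thesis using assms(1) by (simp add: \<phi>'_def abs_mult)
  qed
  have "r\<^sup>2 + (x - y)\<^sup>2 \<noteq> 0" for x using p[of x] by linarith
  then have 4: "continuous_on UNIV \<phi>'"
    unfolding \<phi>'_def by (intro continuous_intros) auto
  show ?thesis unfolding weight_def using assms(1) 1 2 3 4 by blast
qed

lemma wnorm_le:
  assumes f: "f \<in> L2 c" and g: "g \<in> L2 c" and wt: "weight \<alpha> \<phi>" and K: "0 \<le> K"
    and le: "\<And>x. 0 < x \<Longrightarrow> exp (- \<phi> x) * cmod (f x) \<le> K * cmod (g x)"
  shows "wnorm c \<phi> f \<le> K * L2_norm c g"
proof -
  have "wnorm c \<phi> f \<le> L2_norm c (\<lambda>y. of_real K * g y)"
    unfolding wnorm_def
    by (rule L2_norm_mono_AE[OF weight_L2[OF wt f] L2_scale[OF g] AE_weighted_I]) (use le K in \<open>auto simp: norm_mult\<close>)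
  then show ?thesis using K by (simp add: L2_norm_scale)
qed

context schroedinger
begin

text \<open>The row at y is evaluated at \<rho> under the weight centred at \<rho>. Its weighted
  norm is dualised, which leaves T (z/2) of a weighted g evaluated near y under a weight centred
  there. The two weights multiply to at most exp (- \<alpha> |y - \<rho>|) up to the width of the
  mollifier.\<close>

lemma kernel_exponential_bound:
  assumes \<delta>: "0 < \<delta>" "\<delta> \<le> 1"
  obtains C where "0 < C"
    "\<And>z (r::real) (\<alpha>::real) (y::real) (\<rho>::real). z \<in> psector \<delta> \<Longrightarrow> r = sqrt (cmod z) \<Longrightarrow> 0 \<le> \<alpha> \<Longrightarrow> 0 < y \<Longrightarrow> 0 < \<rho> \<Longrightarrow>
      cmod (kernel z y \<rho>) \<le> C * sqrt (max \<rho> r powr (- c) * max y r powr (- c)) / r * exp (C * (\<alpha>\<^sup>2 * r\<^sup>2) - \<alpha> * \<bar>y - \<rho>\<bar>)"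
proof -
  obtain C where C: "0 < C"
    "\<And>z r \<alpha> \<phi> f (s::real). z \<in> psector \<delta> \<Longrightarrow> 0 < r \<Longrightarrow> cmod z \<le> 2 * r\<^sup>2 \<Longrightarrow> r\<^sup>2 \<le> 2 * cmod z \<Longrightarrow> weight \<alpha> \<phi> \<Longrightarrow> f \<in> L2 c \<Longrightarrow> 0 < s \<Longrightarrow>
      (cmod (rep (T z f) s))\<^sup>2 * exp (- 2 * \<phi> s) \<le> C * (max s r powr (- c) / r) * exp (C * (\<alpha>\<^sup>2 * r\<^sup>2)) * (wnorm c \<phi> f)\<^sup>2"
    using pointwise_T[OF \<delta>, of 2] by (metis one_le_numeral)
  \<comment> \<open>The two centre values give exp (2 \<alpha> r), and 2 \<alpha> r <= 1 + q: the
    factor exp 1 goes in front and the extra q into the exponent.\<close>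
  define C' where "C' = C * exp 1 + C + 1"
  show thesis
  proof (rule that[of C'])
    show "0 < C'" using C(1) by (simp add: C'_def add_pos_pos)
    fix z and r \<alpha> y \<rho> :: real
    assume z: "z \<in> psector \<delta>" and r_def: "r = sqrt (cmod z)" and \<alpha>: "0 \<le> \<alpha>" and y: "0 < y" and \<rho>: "0 < \<rho>"
    have zC: "z \<in> Cplus" by (rule psector_Cplus[OF z])
    define z2 where "z2 = z / 2"
    have z2: "z2 \<in> psector \<delta>" unfolding z2_def by (rule psector_half[OF z])
    note z2C = psector_Cplus[OF z2]
    have r: "0 < r" "cmod z2 \<le> 2 * r\<^sup>2" "r\<^sup>2 \<le> 2 * cmod z2"
      using psector_norm_pos[OF z] by (simp_all add: r_def z2_def norm_divide)
    define q where "q = \<alpha>\<^sup>2 * r\<^sup>2"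
    define m where "m = (\<lambda>s. max s r powr (- c) / r)"
    have m0: "0 \<le> m s" for s using r(1) by (simp add: m_def)
    define ph where "ph = (\<lambda>y x. \<alpha> * sqrt (r\<^sup>2 + (x - y)\<^sup>2))"
    have wt: "weight \<alpha> (ph y)" for y unfolding ph_def by (rule weight_hyperbolic[OF \<alpha> r(1)])
    have ph_diag: "ph s s = \<alpha> * r" for s using r(1) by (simp add: ph_def)
    have ph_ge: "\<alpha> * \<bar>x - s\<bar> \<le> ph s x" for s x
      unfolding ph_def by (intro mult_left_mono \<alpha> real_le_rsqrt) simp
    \<comment> \<open>The point of evaluation is the centre of the weight, so undoing the weight
      costs only exp (\<alpha> r).\<close>
    have pt: "cmod (rep (T z2 f) s) \<le> sqrt (C * m s) * exp (C * q / 2 + \<alpha> * r) * wnorm c (ph s) f"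
      if f: "f \<in> L2 c" and s: "0 < s" for f s
    proof (rule power2_le_imp_le)
      have "(cmod (rep (T z2 f) s))\<^sup>2 * exp (- 2 * (\<alpha> * r)) \<le> C * m s * exp (C * q) * (wnorm c (ph s) f)\<^sup>2"
        using C(2)[OF z2 r wt[of s] f s] by (simp add: m_def q_def ph_diag)
      then have "(cmod (rep (T z2 f) s))\<^sup>2 * exp (- 2 * (\<alpha> * r)) * exp (2 * (\<alpha> * r)) \<le> C * m s * exp (C * q) * (wnorm c (ph s) f)\<^sup>2 * exp (2 * (\<alpha> * r))"
        by (rule mult_right_mono) simp
      moreover have "(cmod (rep (T z2 f) s))\<^sup>2 * exp (- 2 * (\<alpha> * r)) * exp (2 * (\<alpha> * r)) = (cmod (rep (T z2 f) s))\<^sup>2"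
        by (simp add: mult.assoc flip: exp_add)
      moreover have "C * m s * exp (C * q) * (wnorm c (ph s) f)\<^sup>2 * exp (2 * (\<alpha> * r)) = (sqrt (C * m s) * exp (C * q / 2 + \<alpha> * r) * wnorm c (ph s) f)\<^sup>2"
      proof -
        have "(exp (C * q / 2 + \<alpha> * r))\<^sup>2 = exp (C * q) * exp (2 * (\<alpha> * r))"
          by (simp add: exp_double[symmetric] exp_add[symmetric] algebra_simps)
        then show ?thesis using m0[of s] C(1) by (simp add: power_mult_distrib)
      qed
      ultimately show "(cmod (rep (T z2 f) s))\<^sup>2 \<le> (sqrt (C * m s) * exp (C * q / 2 + \<alpha> * r) * wnorm c (ph s) f)\<^sup>2"
        by (simp only:)
      show "0 \<le> sqrt (C * m s) * exp (C * q / 2 + \<alpha> * r) * wnorm c (ph s) f" using m0[of s] C(1) by simp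
    qed
    define E where "E = exp (C * q / 2 + \<alpha> * r)"
    have E0: "0 \<le> E" by (simp add: E_def)
    \<comment> \<open>A bound for m on the mollifier window from y to y + h, for either sign of c;
      it tends to m y as h shrinks.\<close>
    define mn where "mn = (\<lambda>h. max (max y r powr (- c)) (max (y + h) r powr (- c)) / r)"
    have mn0: "0 \<le> mn h" for h using r(1) by (simp add: mn_def le_max_iff_disj)
    have kb: "cmod (pre_kernel z2 n y \<rho>) \<le> sqrt (C * m \<rho>) * E * (sqrt (C * mn (1 / real (Suc n))) * E * exp (\<alpha> * (1 / real (Suc n)) - \<alpha> * \<bar>y - \<rho>\<bar>))" for n
    proof -
      let ?h = "1 / real (Suc n)"
      let ?k = "T z2 (mollifier c n y)" and ?e = "\<lambda>x. complex_of_real (exp (- ph \<rho> x))"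
      define D where "D = sqrt (C * mn ?h) * E * exp (\<alpha> * ?h - \<alpha> * \<bar>y - \<rho>\<bar>)"
      have D0: "0 \<le> D" using C(1) mn0 E0 by (simp add: D_def)
      have kL: "?k \<in> L2 c" by (rule T_mollifier_L2[OF z2C y])
      have "L2_norm c (\<lambda>x. ?e x * ?k x) \<le> D"
      proof (rule L2_norm_dual[OF weight_L2[OF wt kL] _ D0])
        fix g assume g: "g \<in> L2 c"
        have eg: "(\<lambda>x. ?e x * g x) \<in> L2 c" by (rule weight_L2[OF wt g])
        have "L2_pair c (\<lambda>x. ?e x * ?k x) g = L2_pair c ?k (\<lambda>x. ?e x * g x)"
          by (simp add: L2_pair_def mult_ac)
        also have "\<dots> = L2_pair c (mollifier c n y) (T z2 (\<lambda>x. ?e x * g x))"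
          by (rule T_symmetric[OF z2C mollifier_L2[OF y] eg])
        finally have eq: "L2_pair c (\<lambda>x. ?e x * ?k x) g = L2_pair c (mollifier c n y) (T z2 (\<lambda>x. ?e x * g x))" .
        have "cmod (L2_pair c (mollifier c n y) (T z2 (\<lambda>x. ?e x * g x)) - 0) \<le> D * L2_norm c g"
        proof (rule mollifier_average[OF y T_L2[OF z2C eg] T_has_rep[OF z2C eg]])
          fix x assume x: "y \<le> x" "x \<le> y + ?h"
          have x0: "0 < x" using x y by simp
          have "wnorm c (ph x) (\<lambda>t. ?e t * g t) \<le> exp (\<alpha> * ?h - \<alpha> * \<bar>y - \<rho>\<bar>) * L2_norm c g"
          proof (rule wnorm_le[OF eg g wt])
            fix t :: real
            \<comment> \<open>Triangle inequality along y, x, t, \<rho>: the arbitrary point t is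
              what allows the two weights to be multiplied inside a norm.\<close>
            have "\<alpha> * \<bar>y - \<rho>\<bar> \<le> \<alpha> * (?h + (\<bar>t - x\<bar> + \<bar>t - \<rho>\<bar>))"
              using x by (intro mult_left_mono \<alpha>) (auto simp: abs_if)
            also have "\<dots> = \<alpha> * ?h + (\<alpha> * \<bar>t - x\<bar> + \<alpha> * \<bar>t - \<rho>\<bar>)" by (simp only: distrib_left)
            also have "\<dots> \<le> \<alpha> * ?h + (ph x t + ph \<rho> t)" by (intro add_mono ph_ge order_refl)
            finally have "- ph x t + - ph \<rho> t \<le> \<alpha> * ?h - \<alpha> * \<bar>y - \<rho>\<bar>" by linarith
            then have "exp (- ph x t) * exp (- ph \<rho> t) \<le> exp (\<alpha> * ?h - \<alpha> * \<bar>y - \<rho>\<bar>)"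
              unfolding exp_add[symmetric] by (simp only: exp_le_cancel_iff)
            then have "exp (- ph x t) * exp (- ph \<rho> t) * cmod (g t) \<le> exp (\<alpha> * ?h - \<alpha> * \<bar>y - \<rho>\<bar>) * cmod (g t)"
              by (rule mult_right_mono) simp
            then show "exp (- ph x t) * cmod (?e t * g t) \<le> exp (\<alpha> * ?h - \<alpha> * \<bar>y - \<rho>\<bar>) * cmod (g t)"
              by (simp add: norm_mult mult.assoc)
          qed simp
          then have "cmod (rep (T z2 (\<lambda>t. ?e t * g t)) x) \<le> sqrt (C * m x) * E * (exp (\<alpha> * ?h - \<alpha> * \<bar>y - \<rho>\<bar>) * L2_norm c g)"
            using pt[OF eg x0] C(1) m0[of x] E0 unfolding E_def[symmetric]
            by (elim order_trans) (intro mult_left_mono, auto)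
          also have "\<dots> \<le> sqrt (C * mn ?h) * E * (exp (\<alpha> * ?h - \<alpha> * \<bar>y - \<rho>\<bar>) * L2_norm c g)"
          proof (intro mult_right_mono real_sqrt_le_mono mult_left_mono E0 less_imp_le[OF C(1)])
            show "m x \<le> mn ?h"
              unfolding m_def mn_def
              by (intro divide_right_mono powr_bound_interval) (use x r(1) y in auto)
          qed simp
          finally show "cmod (rep (T z2 (\<lambda>x. ?e x * g x)) x - 0) \<le> D * L2_norm c g"
            by (simp add: D_def mult.assoc)
        qed
        then show "cmod (L2_pair c (\<lambda>x. ?e x * ?k x) g) \<le> D * L2_norm c g" unfolding eq by simp
      qed
      then have "wnorm c (ph \<rho>) ?k \<le> D" by (simp add: wnorm_def)
      then have "sqrt (C * m \<rho>) * E * wnorm c (ph \<rho>) ?k \<le> sqrt (C * m \<rho>) * E * D"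
        using C(1) m0[of \<rho>] E0 by (intro mult_left_mono) auto
      then show ?thesis using pt[OF kL \<rho>] unfolding pre_kernel_def E_def[symmetric] D_def by linarith
    qed
    have "(\<lambda>n. cmod (pre_kernel z2 n y \<rho>)) \<longlonglongrightarrow> cmod (kernel z y \<rho>)"
      unfolding z2_def by (intro tendsto_norm pre_kernel_tendsto zC y \<rho>)
    moreover have "(\<lambda>n. sqrt (C * m \<rho>) * E * (sqrt (C * mn (1 / real (Suc n))) * E * exp (\<alpha> * (1 / real (Suc n)) - \<alpha> * \<bar>y - \<rho>\<bar>)))
        \<longlonglongrightarrow> sqrt (C * m \<rho>) * E * (sqrt (C * mn 0) * E * exp (\<alpha> * 0 - \<alpha> * \<bar>y - \<rho>\<bar>))"
    proof -
      have h: "(\<lambda>n. 1 / real (Suc n)) \<longlonglongrightarrow> 0" using LIMSEQ_inverse_real_of_nat by (simp add: inverse_eq_divide)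
      have "(\<lambda>n. mn (1 / real (Suc n))) \<longlonglongrightarrow> mn 0"
        unfolding mn_def by (intro tendsto_intros h) (use r(1) in auto)
      then show ?thesis by (intro tendsto_intros h)
    qed
    ultimately have "cmod (kernel z y \<rho>) \<le> sqrt (C * m \<rho>) * E * (sqrt (C * mn 0) * E * exp (\<alpha> * 0 - \<alpha> * \<bar>y - \<rho>\<bar>))"
      by (rule LIMSEQ_le) (use kb in blast)
    also have "mn 0 = m y" by (simp add: mn_def m_def)
    also have "sqrt (C * m \<rho>) * E * (sqrt (C * m y) * E * exp (\<alpha> * 0 - \<alpha> * \<bar>y - \<rho>\<bar>)) =
        C * (sqrt (m \<rho>) * sqrt (m y)) * (E * E * exp (- \<alpha> * \<bar>y - \<rho>\<bar>))"
      using C(1) by (simp add: real_sqrt_mult)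
    also have "sqrt (m \<rho>) * sqrt (m y) = sqrt (max \<rho> r powr (- c) * max y r powr (- c)) / r"
      using r(1) unfolding m_def real_sqrt_mult[symmetric] by (simp add: real_sqrt_divide)
    also have "E * E * exp (- \<alpha> * \<bar>y - \<rho>\<bar>) = exp (C * q + 2 * (\<alpha> * r) - \<alpha> * \<bar>y - \<rho>\<bar>)"
      unfolding E_def exp_add[symmetric] by (simp add: algebra_simps)
    also have "C * (sqrt (max \<rho> r powr (- c) * max y r powr (- c)) / r) * exp (C * q + 2 * (\<alpha> * r) - \<alpha> * \<bar>y - \<rho>\<bar>) \<le>
        C * (sqrt (max \<rho> r powr (- c) * max y r powr (- c)) / r) * (exp 1 * exp (C' * q - \<alpha> * \<bar>y - \<rho>\<bar>))"
    proof (intro mult_left_mono)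
      have "2 * (\<alpha> * r) \<le> 1 + q"
        using zero_le_power2[of "1 - \<alpha> * r"] by (simp add: q_def power2_eq_square algebra_simps)
      moreover have "0 \<le> C * exp 1 * q" using C(1) by (simp add: q_def)
      ultimately have "C * q + 2 * (\<alpha> * r) - \<alpha> * \<bar>y - \<rho>\<bar> \<le> 1 + (C' * q - \<alpha> * \<bar>y - \<rho>\<bar>)"
        unfolding C'_def distrib_right by linarith
      then show "exp (C * q + 2 * (\<alpha> * r) - \<alpha> * \<bar>y - \<rho>\<bar>) \<le> exp 1 * exp (C' * q - \<alpha> * \<bar>y - \<rho>\<bar>)"
        unfolding exp_add[symmetric] by (simp only: exp_le_cancel_iff)
    qed (use C(1) r(1) in auto)
    also have "\<dots> = (C * exp 1) * (sqrt (max \<rho> r powr (- c) * max y r powr (- c)) / r * exp (C' * q - \<alpha> * \<bar>y - \<rho>\<bar>))"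
      by simp
    also have "\<dots> \<le> C' * (sqrt (max \<rho> r powr (- c) * max y r powr (- c)) / r * exp (C' * q - \<alpha> * \<bar>y - \<rho>\<bar>))"
      using C(1) r(1) by (intro mult_right_mono) (auto simp: C'_def)
    finally show "cmod (kernel z y \<rho>) \<le> C' * sqrt (max \<rho> r powr (- c) * max y r powr (- c)) / r * exp (C' * (\<alpha>\<^sup>2 * r\<^sup>2) - \<alpha> * \<bar>y - \<rho>\<bar>)"
      by (simp add: q_def)
  qed
qed

text \<open>The free slope \<alpha> is optimised, and the symmetric geometric mean is traded for the
  profile at \<rho>. The profiles differ by at most a power of 1 + d, where d is the distance in
  units of sqrt |z|, and such a power is beaten by the Gaussian.\<close>

lemma kernel_gaussian_bound:
  assumes \<delta>: "0 < \<delta>" "\<delta> \<le> 1"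
  obtains C \<kappa> where "0 < C" "0 < \<kappa>"
    "\<And>z (y::real) (\<rho>::real). z \<in> psector \<delta> \<Longrightarrow> 0 < y \<Longrightarrow> 0 < \<rho> \<Longrightarrow>
      cmod (kernel z y \<rho>) \<le> C * (max \<rho> (sqrt (cmod z)) powr (- c) / sqrt (cmod z)) * exp (- \<bar>y - \<rho>\<bar>\<^sup>2 / (\<kappa> * cmod z))"
proof (rule kernel_exponential_bound[OF \<delta>])
  fix C
  assume C: "0 < C"
    "\<And>z (r::real) (\<alpha>::real) (y::real) (\<rho>::real). z \<in> psector \<delta> \<Longrightarrow> r = sqrt (cmod z) \<Longrightarrow> 0 \<le> \<alpha> \<Longrightarrow> 0 < y \<Longrightarrow> 0 < \<rho> \<Longrightarrow>
      cmod (kernel z y \<rho>) \<le> C * sqrt (max \<rho> r powr (- c) * max y r powr (- c)) / r * exp (C * (\<alpha>\<^sup>2 * r\<^sup>2) - \<alpha> * \<bar>y - \<rho>\<bar>)"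
  show thesis
  proof (rule that[of "C * exp (C * c\<^sup>2 / 2)" "8 * C"])
    show "0 < C * exp (C * c\<^sup>2 / 2)" "0 < 8 * C" using C(1) by auto
    fix z and y \<rho> :: real assume z: "z \<in> psector \<delta>" and y: "0 < y" and \<rho>: "0 < \<rho>"
    define r where "r = sqrt (cmod z)"
    have r: "0 < r" "cmod z = r\<^sup>2" using psector_norm_pos[OF z] by (simp_all add: r_def)
    define d where "d = \<bar>y - \<rho>\<bar> / r"
    have d: "0 \<le> d" using r(1) by (simp add: d_def)
    \<comment> \<open>The minimiser of C \<alpha>^2 r^2 - \<alpha> |y - \<rho>|, with minimum - d^2
      / (4 C).\<close>
    define \<alpha> where "\<alpha> = d / (2 * C * r)"
    have \<alpha>: "0 \<le> \<alpha>" using d C(1) r(1) by (simp add: \<alpha>_def)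
    have e: "C * (\<alpha>\<^sup>2 * r\<^sup>2) - \<alpha> * \<bar>y - \<rho>\<bar> = - (d\<^sup>2 / (4 * C))"
    proof -
      have a1: "\<bar>y - \<rho>\<bar> = d * r" using r(1) by (simp add: d_def)
      show ?thesis unfolding a1 \<alpha>_def using r(1) C(1) by (simp add: field_simps power2_eq_square)
    qed
    define a where "a = max \<rho> r"
    define b where "b = max y r"
    have ab: "0 < a" "0 < b" using r(1) by (auto simp: a_def b_def)
    have "b \<le> a * (1 + d)"
    proof -
      have "b \<le> a + \<bar>y - \<rho>\<bar>" by (auto simp: a_def b_def)
      also have "\<bar>y - \<rho>\<bar> = r * d" using r(1) by (simp add: d_def)
      also have "\<dots> \<le> a * d" using d by (intro mult_right_mono) (auto simp: a_def)
      finally show ?thesis by (simp add: algebra_simps)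
    qed
    then have ba: "b / a \<le> 1 + d" using ab by (simp add: field_simps)
    have "a \<le> b * (1 + d)"
    proof -
      have "a \<le> b + \<bar>y - \<rho>\<bar>" by (auto simp: a_def b_def)
      also have "\<bar>y - \<rho>\<bar> = r * d" using r(1) by (simp add: d_def)
      also have "\<dots> \<le> b * d" using d by (intro mult_right_mono) (auto simp: b_def)
      finally show ?thesis by (simp add: algebra_simps)
    qed
    then have "a / b \<le> 1 + d" using ab by (simp add: field_simps)
    \<comment> \<open>Both a / b and b / a are at most 1 + d, so the sign of c does not matter; 1 +
      d <= exp d turns the power into an exponential.\<close>
    have ratio: "(b / a) powr (- c) \<le> exp (\<bar>c\<bar> * d)"
    proof -
      have "(b / a) powr (- c) \<le> (1 + d) powr \<bar>c\<bar>"
      proof (cases "0 \<le> c")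
        case True
        have "(b / a) powr (- c) = (a / b) powr c" using ab by (simp add: powr_minus powr_divide)
        also have "\<dots> \<le> (1 + d) powr c" using True ab \<open>a / b \<le> 1 + d\<close> by (intro powr_mono2) auto
        finally show ?thesis using True by simp
      next
        case False
        then show ?thesis using ab ba by (auto intro: powr_mono2)
      qed
      also have "\<dots> \<le> (exp d) powr \<bar>c\<bar>" using d exp_ge_add_one_self[of d] by (intro powr_mono2) auto
      finally show ?thesis by (simp add: exp_powr_real mult.commute)
    qed
    have "sqrt (a powr (- c) * b powr (- c)) = a powr (- c) * sqrt ((b / a) powr (- c))"
    proof -
      have "b powr (- c) = a powr (- c) * (b / a) powr (- c)" using ab by (simp add: powr_mult[symmetric])
      then have "a powr (- c) * b powr (- c) = (a powr (- c))\<^sup>2 * (b / a) powr (- c)" by (simp add: power2_eq_square)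
      then show ?thesis by (simp add: real_sqrt_mult)
    qed
    also have "\<dots> \<le> a powr (- c) * exp (\<bar>c\<bar> * d / 2)"
    proof (intro mult_left_mono real_le_lsqrt)
      show "(b / a) powr (- c) \<le> (exp (\<bar>c\<bar> * d / 2))\<^sup>2" using ratio by (simp add: exp_double[symmetric])
    qed auto
    finally have s: "sqrt (a powr (- c) * b powr (- c)) \<le> a powr (- c) * exp (\<bar>c\<bar> * d / 2)" .
    \<comment> \<open>Half of the Gaussian absorbs the linear term by completing a square; this is
      the origin of \<kappa> = 8 C and of the prefactor exp (C c^2 / 2).\<close>
    have expo: "\<bar>c\<bar> * d / 2 + - (d\<^sup>2 / (4 * C)) \<le> C * c\<^sup>2 / 2 + - (d\<^sup>2 / (8 * C))"
    proof -
      have "C * c\<^sup>2 / 2 + - (d\<^sup>2 / (8 * C)) - (\<bar>c\<bar> * d / 2 + - (d\<^sup>2 / (4 * C))) = (d - 2 * C * \<bar>c\<bar>)\<^sup>2 / (8 * C)"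
        using C(1) by (simp add: field_simps power2_eq_square)
      moreover have "0 \<le> (d - 2 * C * \<bar>c\<bar>)\<^sup>2 / (8 * C)" using C(1) by simp
      ultimately show ?thesis by linarith
    qed
    have "cmod (kernel z y \<rho>) \<le> C * sqrt (a powr (- c) * b powr (- c)) / r * exp (- (d\<^sup>2 / (4 * C)))"
      using C(2)[OF z r_def \<alpha> y \<rho>] unfolding e a_def b_def .
    also have "\<dots> \<le> C * (a powr (- c) * exp (\<bar>c\<bar> * d / 2)) / r * exp (- (d\<^sup>2 / (4 * C)))"
      using s C(1) r(1) by (intro mult_right_mono divide_right_mono mult_left_mono) auto
    also have "\<dots> = C * (a powr (- c) / r) * exp (\<bar>c\<bar> * d / 2 + - (d\<^sup>2 / (4 * C)))"
      unfolding exp_add by simp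
    also have "\<dots> \<le> C * (a powr (- c) / r) * exp (C * c\<^sup>2 / 2 + - (d\<^sup>2 / (8 * C)))"
      using expo C(1) r(1) by (intro mult_left_mono) auto
    also have "\<dots> = C * exp (C * c\<^sup>2 / 2) * (a powr (- c) / r) * exp (- (d\<^sup>2 / (8 * C)))"
      unfolding exp_add by simp
    also have "d\<^sup>2 / (8 * C) = \<bar>y - \<rho>\<bar>\<^sup>2 / (8 * C * cmod z)"
      using r C(1) by (simp add: d_def power_divide)
    finally show "cmod (kernel z y \<rho>) \<le> C * exp (C * c\<^sup>2 / 2) * (max \<rho> (sqrt (cmod z)) powr (- c) / sqrt (cmod z)) * exp (- \<bar>y - \<rho>\<bar>\<^sup>2 / (8 * C * cmod z))"
      by (simp add: a_def r_def)
  qed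
qed

end

text \<open>On the sector cos (Arg z) >= cos (pi / 2 - \<epsilon>) = sin \<epsilon>, and Re z = |z|
  cos (Arg z).\<close>

lemma sector_subset_psector:
  assumes "0 < \<epsilon>" "\<epsilon> < pi / 2" shows "sector (pi / 2 - \<epsilon>) \<subseteq> psector (sin \<epsilon>)"
proof
  fix z assume z: "z \<in> sector (pi / 2 - \<epsilon>)"
  then have z0: "z \<noteq> 0" and A: "\<bar>Arg z\<bar> < pi / 2 - \<epsilon>" by (auto simp: sector_def)
  have "sin \<epsilon> = cos (pi / 2 - \<epsilon>)" by (simp add: cos_sin_eq)
  also have "\<dots> \<le> cos \<bar>Arg z\<bar>" using A assms by (intro cos_monotone_0_pi_le) auto
  also have "\<dots> = cos (Arg z)" by simp
  finally have "sin \<epsilon> * cmod z \<le> cos (Arg z) * cmod z" by (intro mult_right_mono) auto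
  also have "cos (Arg z) * cmod z = Re z"
    using rcis_cmod_Arg[of z] by (metis Re_rcis mult.commute)
  finally have "sin \<epsilon> * cmod z \<le> Re z" .
  moreover have "0 < sin \<epsilon> * cmod z" using z0 assms by (intro mult_pos_pos sin_gt_zero) auto
  ultimately show "z \<in> psector (sin \<epsilon>)" by (simp add: psector_def)
qed

theorem proposition5p3:
  fixes c :: real and V :: "real \<Rightarrow> real"
    and T :: "complex \<Rightarrow> (real \<Rightarrow> complex) \<Rightarrow> (real \<Rightarrow> complex)"
  assumes "c + 1 > 0"
    and "AE y in weighted_measure c. 0 \<le> V y"
    and "L1_loc c V"
    and "generates c (Bn_minus c V) T"
  shows "\<exists>p :: complex \<Rightarrow> real \<Rightarrow> real \<Rightarrow> complex.
     (\<forall>z\<in>Cplus. is_integral_kernel c (T z) (p z)) \<and>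
     (\<forall>\<epsilon>>0. \<exists>\<kappa>>0. \<exists>C>0. \<forall>z\<in>sector (pi / 2 - \<epsilon>).
        AE (y, \<rho>) in weighted_measure c \<Otimes>\<^sub>M weighted_measure c.
          cmod (p z y \<rho>) \<le> C * cmod z powr (- 1 / 2) * \<rho> powr (- c)
            * (min (\<rho> / cmod z powr (1 / 2)) 1) powr c
            * exp (- \<bar>y - \<rho>\<bar>\<^sup>2 / (\<kappa> * cmod z)))"
proof -
  interpret schroedinger c V T by unfold_locales (rule assms)+
  show ?thesis
  proof (intro exI[of _ kernel] conjI ballI allI impI)
    show "is_integral_kernel c (T z) (kernel z)" if "z \<in> Cplus" for z
      by (rule kernel_is_integral_kernel[OF that])
    fix \<epsilon> :: real assume \<epsilon>: "0 < \<epsilon>"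
    show "\<exists>\<kappa>>0. \<exists>C>0. \<forall>z\<in>sector (pi / 2 - \<epsilon>).
        AE (y, \<rho>) in weighted_measure c \<Otimes>\<^sub>M weighted_measure c.
          cmod (kernel z y \<rho>) \<le> C * cmod z powr (- 1 / 2) * \<rho> powr (- c)
            * (min (\<rho> / cmod z powr (1 / 2)) 1) powr c
            * exp (- \<bar>y - \<rho>\<bar>\<^sup>2 / (\<kappa> * cmod z))"
    proof (cases "\<epsilon> < pi / 2")
      case False
      \<comment> \<open>An angle that is not positive leaves no admissible argument, so any
        constants will do.\<close>
      then have "sector (pi / 2 - \<epsilon>) = {}" by (auto simp: sector_def)
      then show ?thesis by (auto intro: exI[of _ "1::real"])
    next
      case True
      have "0 < sin \<epsilon>" "sin \<epsilon> \<le> 1" using True \<epsilon> by (auto intro: sin_gt_zero)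
      then obtain C \<kappa> where C: "0 < C" "0 < \<kappa>"
        "\<And>z (y::real) (\<rho>::real). z \<in> psector (sin \<epsilon>) \<Longrightarrow> 0 < y \<Longrightarrow> 0 < \<rho> \<Longrightarrow>
          cmod (kernel z y \<rho>) \<le> C * (max \<rho> (sqrt (cmod z)) powr (- c) / sqrt (cmod z)) * exp (- \<bar>y - \<rho>\<bar>\<^sup>2 / (\<kappa> * cmod z))"
        by (rule kernel_gaussian_bound) blast
      show ?thesis
      \<comment> \<open>The constructed kernel is continuous, and its bound holds at every point
        with y and \<rho> positive, hence everywhere on the product space.\<close>
      proof (rule exI[of _ \<kappa>], rule conjI[OF C(2)], rule exI[of _ C], rule conjI[OF C(1)], rule ballI, rule AE_I2)
        fix z p assume z: "z \<in> sector (pi / 2 - \<epsilon>)" and p: "p \<in> space (weighted_measure c \<Otimes>\<^sub>M weighted_measure c)"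
        obtain y \<rho> where yp: "p = (y, \<rho>)" "0 < y" "0 < \<rho>" using p by (auto simp: space_pair_measure)
        have zp: "z \<in> psector (sin \<epsilon>)" using sector_subset_psector[OF \<epsilon> True] z by auto
        define r where "r = sqrt (cmod z)"
        have r: "0 < r" using psector_norm_pos[OF zp] by (simp add: r_def)
        have r1: "cmod z powr (1 / 2) = r" using psector_norm_pos[OF zp] by (simp add: r_def powr_half_sqrt)
        have r2: "cmod z powr (- 1 / 2) = 1 / r"
          using psector_norm_pos[OF zp] r1 by (simp add: powr_minus_divide)
        \<comment> \<open>The stated profile is the flat one in disguise: it is r powr (- c) for
          \<rho> below r and \<rho> powr (- c) above.\<close>
        have "max \<rho> r powr (- c) = \<rho> powr (- c) * (min (\<rho> / r) 1) powr c"
        proof (cases "\<rho> \<le> r")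
          case True
          then have "min (\<rho> / r) 1 = \<rho> / r" "max \<rho> r = r" using r by auto
          then show ?thesis using yp(3) r by (simp add: powr_divide powr_minus_divide)
        next
          case False
          then have "min (\<rho> / r) 1 = 1" "max \<rho> r = \<rho>" using r by auto
          then show ?thesis by simp
        qed
        then show "case p of (y, \<rho>) \<Rightarrow> cmod (kernel z y \<rho>) \<le> C * cmod z powr (- 1 / 2) * \<rho> powr (- c)
            * (min (\<rho> / cmod z powr (1 / 2)) 1) powr c
            * exp (- \<bar>y - \<rho>\<bar>\<^sup>2 / (\<kappa> * cmod z))"
          using C(3)[OF zp yp(2,3)] unfolding r1 r2 r_def[symmetric] yp(1) by simp
      qed
    qed
  qed
qed

end
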